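(* Let $\mathcal{A}^\varepsilon$ ($\varepsilon>0$) and $\mathcal{A}^0$ be the global attractors of the dynamical systems $(\mathcal{E},S_\varepsilon(t))$ and $(\mathcal{E},S_0(t))$ corresponding to problems $(P_\varepsilon)$ and $(P_0)$. Assume that $\mathcal{A}^0$ is exponentially attracting: there exist a constant $\sigma>0$ and a non-decreasing function $M_0$ such that for every bounded set $B\subset\mathcal{E}$ $$\operatorname{dist}_{\mathcal{E}}(S_0(t)B,\mathcal{A}^0)\le M_0(\|B\|_{\mathcal{E}})e^{-\sigma t},\quad t\ge0.$$ Then $$\operatorname{dist}_{\mathcal{E}^{-1}}(\mathcal{A}^\varepsilon,\mathcal{A}^0)\le M\,\|A_\varepsilon^{-1}-A_0^{-1}\|^{\varkappa}_{\mathcal{L}(L^2(\Omega))},\qquad \varkappa=\frac{\sigma}{K+\sigma},$$ where $M=M(\|g\|)$ is a non-decreasing function independent of $\varepsilon$, and $K>0$ is the (independent of $\varepsilon$) growth exponent in the trajectory estimate $$\|S_\varepsilon(t)\xi-S_0(t)\xi\|_{\mathcal{E}^{-1}}\le M_1e^{Kt}\|A_\varepsilon^{-1}-A_0^{-1}\|_{\mathcal{L}(L^2(\Omega))},\quad t\ge0,\ \xi\in B_{\mathcal{E}^2_\varepsilon}(0,R),\ \varepsilon>0,$$ with $R$ such that $\mathcal{A}^\varepsilon\subset B_{\mathcal{E}^2_\varepsilon}(0,R)$ for all $\varepsilon>0$.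
   Context: Standing assumptions. $\Omega\subset\mathbb{R}^3$ is a bounded smooth domain, $\gamma>0$, $g\in L^2(\Omega)$. The matrix $a=\{a_{ij}\}_{i,j=1}^3$ satisfies $a_{ij}\in L^\infty(\mathbb{R}^3)$, $a_{ij}=a_{ji}$, $a_{ij}(\cdot+e_k)=a_{ij}(\cdot)$ for $k=1,2,3$ ($e_k$ the standard basis), and $\nu|\eta|^2\le a(y)\eta\cdot\eta\le\nu^{-1}|\eta|^2$ for all $y,\eta\in\mathbb{R}^3$ and some $\nu>0$. The function $f\in C^2(\mathbb{R})$ satisfies $f(s)s\ge-K_1$, $f'(s)\ge-K_2$, $|f''(s)|\le K_3(1+|s|)$ for all $s\in\mathbb{R}$, and $f(0)=0$, with positive constants $K_1,K_2,K_3$. Homogenised matrix. With $Q=[0,1)^3$, let $N_i$ be the $Q$-periodic, zero-mean solution of $-\operatorname{div}_y(a(y)\nabla_yN_i)=\operatorname{div}_y(a(y)e_i)$, and $a^h_{ij}=\int_Q\big(a_{ij}(y)+\sum_{k=1}^3a_{ik}(y)\partial_{y_k}N_j(y)\big)dy$. Operators. $A_\varepsilon u=-\operatorname{div}(a(\tfrac{\cdot}{\varepsilon})\nabla u)$ for $\varepsilon>0$ and $A_0u=-\operatorname{div}(a^h\nabla u)$, with Dirichlet boundary conditions; $A_\varepsilon^{-1},A_0^{-1}$ are bounded on $L^2(\Omega)$. $\|\cdot\|$ is the $L^2(\Omega)$ norm. Problems. $(P_\varepsilon)$, $\varepsilon>0$: $\partial_t^2u^\varepsilon+\gamma\partial_tu^\varepsilon+A_\varepsilon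 u^\varepsilon+f(u^\varepsilon)=g$ in $\Omega$, $t\ge0$, $u^\varepsilon|_{\partial\Omega}=0$, $(u^\varepsilon,\partial_tu^\varepsilon)|_{t=0}=\xi$. $(P_0)$: the same with $A_0$ in place of $A_\varepsilon$ (solution $u^0$). Let $\mathcal{E}=H^1_0(\Omega)\times L^2(\Omega)$ with $\|\xi\|_{\mathcal{E}}^2=\|\nabla\xi^1\|^2+\|\xi^2\|^2$, and $\mathcal{E}^{-1}=L^2(\Omega)\times H^{-1}(\Omega)$ with $\|\xi\|^2_{\mathcal{E}^{-1}}=\|\xi^1\|^2+\|\xi^2\|^2_{H^{-1}(\Omega)}$. For each $\xi\in\mathcal{E}$ there is a unique energy solution with $(u,\partial_tu)\in C(\mathbb{R}_+;\mathcal{E})$; set $S_\varepsilon(t)\xi=(u^\varepsilon(t),\partial_tu^\varepsilon(t))$, $S_0(t)\xi=(u^0(t),\partial_tu^0(t))$. The set $\mathcal{E}^2_\varepsilon=\{\xi=(\xi^1,\xi^2)\in(H^1_0(\Omega))^2: \operatorname{div}(a(\tfrac{\cdot}{\varepsilon})\nabla\xi^1)+g\in H^1_0(\Omega),\ \operatorname{div}(a(\tfrac{\cdot}{\varepsilon})\nabla\xi^2)\in L^2(\Omega)\}$, with $\|\xi\|^2_{\mathcal{E}^2_\varepsilon}=\|\operatorname{div}(a(\tfrac{\cdot}{\varepsilon})\nabla\xi^1)+g\|^2_{H^1_0(\Omega)}+\|\operatorname{div}(a(\tfrac{\cdot}{\varepsilon})\nabla\xi^1)\|^2+\|\operatorname{div}(a(\tfrac{\cdot}{\varepsilon})\nabla\xi^2)\|^2$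 and $B_{\mathcal{E}^2_\varepsilon}(0,R)=\{\xi\in\mathcal{E}^2_\varepsilon:\|\xi\|_{\mathcal{E}^2_\varepsilon}\le R\}$. Global attractor of $(\mathcal{E},S(t))$: a compact set $\mathcal{A}\subset\mathcal{E}$ with $S(t)\mathcal{A}=\mathcal{A}$ for all $t\ge0$ and $\lim_{t\to\infty}\operatorname{dist}_{\mathcal{E}}(S(t)B,\mathcal{A})=0$ for every bounded $B\subset\mathcal{E}$. For $\Omega\subset\mathbb{R}^3$ bounded and smooth, $\gamma>0$, $g\in L^2(\Omega)$, $a$ bounded, symmetric, periodic and uniformly elliptic, and $f\in C^2(\mathbb{R})$ with $f(s)s\ge-K_1$, $f'(s)\ge-K_2$, $|f''(s)|\le K_3(1+|s|)$, $f(0)=0$, the global attractors of $(\mathcal{E},S_\varepsilon(t))$ and $(\mathcal{E},S_0(t))$ exist. $\operatorname{dist}_X(A,B)=\sup_{a\in A}\inf_{b\in B}\|a-b\|_X$; $\|B\|_{\mathcal{E}}=\sup_{b\in B}\|b\|_{\mathcal{E}}$. *)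

theory Defs
  imports "HOL-Analysis.Analysis"
begin

section \<open>The Hilbert spaces \<open>L\<^sup>2\<close>\<close>

definition sq_integrable :: "(real^3 \<Rightarrow> 'b::euclidean_space) \<Rightarrow> bool" where
  "sq_integrable u \<longleftrightarrow>
     u \<in> borel_measurable lebesgue \<and> integrable lebesgue (\<lambda>x. (norm (u x))\<^sup>2)"

definition L2_eq :: "(real^3 \<Rightarrow> 'b::euclidean_space) \<Rightarrow> (real^3 \<Rightarrow> 'b) \<Rightarrow> bool" where
  "L2_eq u v \<longleftrightarrow> sq_integrable u \<and> sq_integrable v \<and> (AE x in lebesgue. u x = v x)"

lemma sq_integrable_0: "sq_integrable (\<lambda>x. 0)"
  by (simp add: sq_integrable_def)

lemma L2_eq_part_equivp: "part_equivp L2_eq"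
proof (rule part_equivpI)
  show "\<exists>u. L2_eq u u"
    using sq_integrable_0 by (auto simp: L2_eq_def)
  show "symp L2_eq"
    by (auto simp: symp_def L2_eq_def elim: eventually_mono)
  show "transp L2_eq"
    by (auto simp: transp_def L2_eq_def elim: eventually_elim2)
qed

quotient_type (overloaded) 'b L2 = "real^3 \<Rightarrow> 'b::euclidean_space" / partial: L2_eq
  by (rule L2_eq_part_equivp)

lemma sq_integrable_cmult: "sq_integrable u \<Longrightarrow> sq_integrable (\<lambda>x. c *\<^sub>R u x)"
  by (auto simp: sq_integrable_def power_mult_distrib intro!: borel_measurable_scaleR)

lemma sq_integrable_add:
  assumes "sq_integrable u" "sq_integrable v"
  shows "sq_integrable (\<lambda>x. u x + v x)"
proof -
  have meas: "u \<in> borel_measurable lebesgue" "v \<in> borel_measurable lebesgue"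
    using assms by (auto simp: sq_integrable_def)
  have "integrable lebesgue (\<lambda>x. 2 * (norm (u x))\<^sup>2 + 2 * (norm (v x))\<^sup>2)"
    using assms by (auto simp: sq_integrable_def)
  moreover have "(norm (u x + v x))\<^sup>2 \<le> 2 * (norm (u x))\<^sup>2 + 2 * (norm (v x))\<^sup>2" for x
  proof -
    have "(norm (u x + v x))\<^sup>2 \<le> (norm (u x) + norm (v x))\<^sup>2"
      by (intro power_mono norm_triangle_ineq) auto
    also have "\<dots> \<le> 2 * (norm (u x))\<^sup>2 + 2 * (norm (v x))\<^sup>2"
      using sum_squares_bound[of "norm (u x)" "norm (v x)"] by (simp add: power2_sum)
    finally show ?thesis .
  qed
  ultimately have "integrable lebesgue (\<lambda>x. (norm (u x + v x))\<^sup>2)"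
    using meas
    by (elim Bochner_Integration.integrable_bound) (auto intro!: borel_measurable_power
        borel_measurable_norm borel_measurable_add)
  with meas show ?thesis by (simp add: sq_integrable_def)
qed

lemma sq_integrable_diff:
  "sq_integrable u \<Longrightarrow> sq_integrable v \<Longrightarrow> sq_integrable (\<lambda>x. u x - v x)"
  using sq_integrable_add[OF _ sq_integrable_cmult[where c = "-1"], of u v] by simp

lemma sq_integrable_inner:
  assumes "sq_integrable u" "sq_integrable v"
  shows "integrable lebesgue (\<lambda>x. u x \<bullet> v x)"
proof -
  have meas: "u \<in> borel_measurable lebesgue" "v \<in> borel_measurable lebesgue"
    using assms by (auto simp: sq_integrable_def)
  have "integrable lebesgue (\<lambda>x. (norm (u x))\<^sup>2 + (norm (v x))\<^sup>2)"
    using assms by (auto simp: sq_integrable_def)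
  moreover have "\<bar>u x \<bullet> v x\<bar> \<le> (norm (u x))\<^sup>2 + (norm (v x))\<^sup>2" for x
  proof -
    have "\<bar>u x \<bullet> v x\<bar> \<le> norm (u x) * norm (v x)"
      by (rule Cauchy_Schwarz_ineq2)
    also have "\<dots> \<le> 2 * norm (u x) * norm (v x)" by simp
    also have "\<dots> \<le> (norm (u x))\<^sup>2 + (norm (v x))\<^sup>2"
      by (rule sum_squares_bound)
    finally show ?thesis .
  qed
  ultimately show ?thesis
    using meas
    by (elim Bochner_Integration.integrable_bound) (auto intro!: borel_measurable_inner)
qed

lemma L2_eq_measurable:
  assumes "L2_eq u v"
  shows "u \<in> borel_measurable lebesgue" "v \<in> borel_measurable lebesgue"
  using assms by (auto simp: L2_eq_def sq_integrable_def)

instantiation L2 :: (euclidean_space) real_inner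
begin

lift_definition zero_L2 :: "'a L2" is "\<lambda>x. 0"
  by (simp add: L2_eq_def sq_integrable_0)

lift_definition plus_L2 :: "'a L2 \<Rightarrow> 'a L2 \<Rightarrow> 'a L2" is "\<lambda>u v x. u x + v x"
  by (auto simp: L2_eq_def sq_integrable_add elim: eventually_elim2)

lift_definition scaleR_L2 :: "real \<Rightarrow> 'a L2 \<Rightarrow> 'a L2" is "\<lambda>c u x. c *\<^sub>R u x"
  by (auto simp: L2_eq_def sq_integrable_cmult elim: eventually_mono)

lift_definition inner_L2 :: "'a L2 \<Rightarrow> 'a L2 \<Rightarrow> real" is "\<lambda>u v. LINT x|lebesgue. u x \<bullet> v x"
proof -
  fix u1 u2 v1 v2 :: "real^3 \<Rightarrow> 'a"
  assume eq: "L2_eq u1 u2" "L2_eq v1 v2"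
  have "AE x in lebesgue. u1 x \<bullet> v1 x = u2 x \<bullet> v2 x"
    using eq by (auto simp: L2_eq_def elim: eventually_elim2)
  then show "(LINT x|lebesgue. u1 x \<bullet> v1 x) = (LINT x|lebesgue. u2 x \<bullet> v2 x)"
    using L2_eq_measurable[OF eq(1)] L2_eq_measurable[OF eq(2)]
    by (intro integral_cong_AE) auto
qed

lift_definition uminus_L2 :: "'a L2 \<Rightarrow> 'a L2" is "\<lambda>u x. - u x"
  using sq_integrable_cmult[where c = "-1"] by (auto simp: L2_eq_def elim: eventually_mono)

lift_definition minus_L2 :: "'a L2 \<Rightarrow> 'a L2 \<Rightarrow> 'a L2" is "\<lambda>u v x. u x - v x"
  using sq_integrable_diff by (auto simp: L2_eq_def elim: eventually_elim2)

definition norm_L2 :: "'a L2 \<Rightarrow> real" where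
  "norm_L2 u = sqrt (inner u u)"

definition sgn_L2 :: "'a L2 \<Rightarrow> 'a L2" where
  "sgn_L2 u = scaleR (inverse (norm u)) u"

definition dist_L2 :: "'a L2 \<Rightarrow> 'a L2 \<Rightarrow> real" where
  "dist_L2 u v = norm (u - v)"

definition uniformity_L2 :: "('a L2 \<times> 'a L2) filter" where
  "uniformity_L2 = (INF e\<in>{0<..}. principal {(u, v). dist u v < e})"

definition open_L2 :: "'a L2 set \<Rightarrow> bool" where
  "open_L2 U \<longleftrightarrow> (\<forall>x\<in>U. eventually (\<lambda>(x', y). x' = x \<longrightarrow> y \<in> U) uniformity)"

instance
proof
  fix u v w :: "'a L2" and c d :: real and U :: "'a L2 set"
  show "u + v + w = u + (v + w)"
    by transfer (auto simp: L2_eq_def algebra_simps intro!: sq_integrable_add)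
  show "u + v = v + u"
    by transfer (auto simp: L2_eq_def algebra_simps intro!: sq_integrable_add)
  show "0 + u = u"
    by transfer (auto simp: L2_eq_def)
  show "- u + u = 0"
    by transfer (auto simp: L2_eq_def sq_integrable_0)
  show "u - v = u + - v"
    by transfer (auto simp: L2_eq_def intro!: sq_integrable_diff)
  show "c *\<^sub>R (u + v) = c *\<^sub>R u + c *\<^sub>R v"
    by transfer (auto simp: L2_eq_def algebra_simps intro!: sq_integrable_add sq_integrable_cmult)
  show "(c + d) *\<^sub>R u = c *\<^sub>R u + d *\<^sub>R u"
    by transfer (auto simp: L2_eq_def algebra_simps intro!: sq_integrable_add sq_integrable_cmult)
  show "c *\<^sub>R d *\<^sub>R u = (c * d) *\<^sub>R u"
    by transfer (auto simp: L2_eq_def sq_integrable_cmult)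
  show "1 *\<^sub>R u = u"
    by transfer (auto simp: L2_eq_def)
  show "dist u v = norm (u - v)" by (rule dist_L2_def)
  show "sgn u = inverse (norm u) *\<^sub>R u" by (rule sgn_L2_def)
  show "uniformity = (INF e\<in>{0<..}. principal {(u::'a L2, v). dist u v < e})"
    by (rule uniformity_L2_def)
  show "open U \<longleftrightarrow> (\<forall>x\<in>U. eventually (\<lambda>(x', y). x' = x \<longrightarrow> y \<in> U) uniformity)"
    by (rule open_L2_def)
  show "u \<bullet> v = v \<bullet> u"
    by transfer (simp add: inner_commute)
  show "(u + v) \<bullet> w = u \<bullet> w + v \<bullet> w"
    by transfer (simp add: L2_eq_def inner_add_left sq_integrable_inner)
  show "(c *\<^sub>R u) \<bullet> v = c * (u \<bullet> v)"
    by transfer simp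
  show "0 \<le> u \<bullet> u"
    by transfer simp
  show "u \<bullet> u = 0 \<longleftrightarrow> u = 0"
  proof transfer
    fix u :: "real^3 \<Rightarrow> 'a"
    assume "L2_eq u u"
    then have u: "sq_integrable u" by (simp add: L2_eq_def)
    have "(LINT x|lebesgue. u x \<bullet> u x) = 0 \<longleftrightarrow> (AE x in lebesgue. u x \<bullet> u x = 0)"
      using u by (intro integral_nonneg_eq_0_iff_AE sq_integrable_inner) auto
    then show "(LINT x|lebesgue. u x \<bullet> u x) = 0 \<longleftrightarrow> L2_eq u (\<lambda>x. 0)"
      using u by (simp add: L2_eq_def sq_integrable_0)
  qed
  show "norm u = sqrt (u \<bullet> u)" by (rule norm_L2_def)
qed

end

(* The class of a square integrable function; 0 is a junk value. *)
definition to_L2 :: "(real^3 \<Rightarrow> 'b::euclidean_space) \<Rightarrow> 'b L2" where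
  "to_L2 u = (if sq_integrable u then abs_L2 u else 0)"

(* L\<^sup>2(\<Omega>) is identified, through extension by zero, with a subspace of L\<^sup>2 of the whole space.
   The spaces H\<^sup>1(\<Omega>), H\<^sup>1_0(\<Omega>) below are realised inside this subspace. *)
definition L2_on :: "(real^3) set \<Rightarrow> ('b::euclidean_space) L2 set" where
  "L2_on \<Omega> = {u. AE x in lebesgue. x \<notin> \<Omega> \<longrightarrow> rep_L2 u x = 0}"


section \<open>Smooth functions and smooth domains\<close>

primrec Ck_on :: "nat \<Rightarrow> ('a::euclidean_space \<Rightarrow> real) \<Rightarrow> 'a set \<Rightarrow> bool" where
  "Ck_on 0 \<phi> U \<longleftrightarrow> continuous_on U \<phi>"
| "Ck_on (Suc k) \<phi> U \<longleftrightarrow>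
     (\<forall>x\<in>U. \<phi> differentiable (at x)) \<and>
     (\<forall>b\<in>Basis. Ck_on k (\<lambda>x. frechet_derivative \<phi> (at x) b) U)"

definition smooth_on :: "('a::euclidean_space \<Rightarrow> real) \<Rightarrow> 'a set \<Rightarrow> bool" where
  "smooth_on \<phi> U \<longleftrightarrow> (\<forall>k. Ck_on k \<phi> U)"

definition cgrad :: "(real^3 \<Rightarrow> real) \<Rightarrow> real^3 \<Rightarrow> real^3" where
  "cgrad \<phi> x = (\<chi> i. frechet_derivative \<phi> (at x) (axis i 1))"

definition test_fun :: "(real^3) set \<Rightarrow> (real^3 \<Rightarrow> real) \<Rightarrow> bool" where
  "test_fun \<Omega> \<phi> \<longleftrightarrow>
     smooth_on \<phi> UNIV \<and> (\<exists>C. compact C \<and> C \<subseteq> \<Omega> \<and> (\<forall>x. x \<notin> C \<longrightarrow> \<phi> x = 0))"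

(* The boundary is smooth, with the domain locally on one side of it: near every boundary point
   the domain is a sublevel set of a smooth function without critical points. *)
definition smooth_domain :: "(real^3) set \<Rightarrow> bool" where
  "smooth_domain \<Omega> \<longleftrightarrow>
     open \<Omega> \<and> connected \<Omega> \<and> \<Omega> \<noteq> {} \<and>
     (\<forall>p\<in>frontier \<Omega>. \<exists>U \<psi>. open U \<and> p \<in> U \<and> smooth_on \<psi> U \<and>
        (\<forall>x\<in>U. cgrad \<psi> x \<noteq> 0) \<and> \<Omega> \<inter> U = {x\<in>U. \<psi> x < 0})"


section \<open>Weak derivatives and Sobolev spaces\<close>

definition has_weak_grad ::
  "(real^3) set \<Rightarrow> (real^3 \<Rightarrow> real) \<Rightarrow> (real^3 \<Rightarrow> real^3) \<Rightarrow> bool" where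
  "has_weak_grad \<Omega> u p \<longleftrightarrow>
     (\<forall>\<phi>. test_fun \<Omega> \<phi> \<longrightarrow>
        (LINT x|lebesgue. u x *\<^sub>R cgrad \<phi> x) = - (LINT x|lebesgue. \<phi> x *\<^sub>R p x))"

definition has_weak_div ::
  "(real^3) set \<Rightarrow> (real^3 \<Rightarrow> real^3) \<Rightarrow> (real^3 \<Rightarrow> real) \<Rightarrow> bool" where
  "has_weak_div \<Omega> p w \<longleftrightarrow>
     (\<forall>\<phi>. test_fun \<Omega> \<phi> \<longrightarrow>
        (LINT x|lebesgue. p x \<bullet> cgrad \<phi> x) = - (LINT x|lebesgue. w x * \<phi> x))"

definition H1 :: "(real^3) set \<Rightarrow> real L2 set" where
  "H1 \<Omega> = {u \<in> L2_on \<Omega>. \<exists>p \<in> L2_on \<Omega>. has_weak_grad \<Omega> (rep_L2 u) (rep_L2 p)}"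

definition grad :: "(real^3) set \<Rightarrow> real L2 \<Rightarrow> (real^3) L2" where
  "grad \<Omega> u = (THE p. p \<in> L2_on \<Omega> \<and> has_weak_grad \<Omega> (rep_L2 u) (rep_L2 p))"

definition H1_norm :: "(real^3) set \<Rightarrow> real L2 \<Rightarrow> real" where
  "H1_norm \<Omega> u = sqrt ((norm u)\<^sup>2 + (norm (grad \<Omega> u))\<^sup>2)"

definition H10 :: "(real^3) set \<Rightarrow> real L2 set" where
  "H10 \<Omega> = {u \<in> H1 \<Omega>. \<forall>e>0. \<exists>\<phi>. test_fun \<Omega> \<phi> \<and> H1_norm \<Omega> (u - to_L2 \<phi>) < e}"

definition H10_norm :: "(real^3) set \<Rightarrow> real L2 \<Rightarrow> real" where
  "H10_norm \<Omega> u = norm (grad \<Omega> u)"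

(* Norm of a functional in the dual H\<^sup>-\<^sup>1(\<Omega>) of H\<^sup>1_0(\<Omega>); a function w in L\<^sup>2(\<Omega>) is embedded as
   the functional \<open>inner w\<close>. *)
definition Hm1_norm :: "(real^3) set \<Rightarrow> (real L2 \<Rightarrow> real) \<Rightarrow> real" where
  "Hm1_norm \<Omega> F = (SUP \<phi>\<in>{\<phi> \<in> H10 \<Omega>. H10_norm \<Omega> \<phi> \<le> 1}. \<bar>F \<phi>\<bar>)"


section \<open>Coefficients and the elliptic operators\<close>

definition periodic :: "(real^3 \<Rightarrow> 'b) \<Rightarrow> bool" where
  "periodic u \<longleftrightarrow> (\<forall>k y. u (y + axis k 1) = u y)"

definition admissible_coeff :: "real \<Rightarrow> (real^3 \<Rightarrow> real^3^3) \<Rightarrow> bool" where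
  "admissible_coeff \<nu> a \<longleftrightarrow>
     0 < \<nu> \<and>
     (\<forall>i j. (\<lambda>y. a y $ i $ j) \<in> borel_measurable lebesgue \<and>
            (\<exists>C. AE y in lebesgue. \<bar>a y $ i $ j\<bar> \<le> C)) \<and>
     (\<forall>y i j. a y $ i $ j = a y $ j $ i) \<and>
     periodic a \<and>
     (\<forall>y \<eta>. \<nu> * (norm \<eta>)\<^sup>2 \<le> (a y *v \<eta>) \<bullet> \<eta> \<and> (a y *v \<eta>) \<bullet> \<eta> \<le> inverse \<nu> * (norm \<eta>)\<^sup>2)"

definition unit_cell :: "(real^3) set" where
  "unit_cell = {y. \<forall>i. 0 \<le> y $ i \<and> y $ i < 1}"

(* N is a periodic H\<^sup>1 function with gradient P.  The derivatives are taken on the whole space, so that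
   N has no jumps across the faces of the cells. *)
definition H1_per :: "(real^3 \<Rightarrow> real) \<Rightarrow> (real^3 \<Rightarrow> real^3) \<Rightarrow> bool" where
  "H1_per N P \<longleftrightarrow>
     periodic N \<and> periodic P \<and>
     N \<in> borel_measurable lebesgue \<and> P \<in> borel_measurable lebesgue \<and>
     set_integrable lebesgue unit_cell (\<lambda>y. (N y)\<^sup>2) \<and>
     set_integrable lebesgue unit_cell (\<lambda>y. (norm (P y))\<^sup>2) \<and>
     has_weak_grad UNIV N P"

(* N, with gradient P, is the corrector in direction e. *)
definition cell_solution ::
  "(real^3 \<Rightarrow> real^3^3) \<Rightarrow> real^3 \<Rightarrow> (real^3 \<Rightarrow> real) \<Rightarrow> (real^3 \<Rightarrow> real^3) \<Rightarrow> bool" where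
  "cell_solution a e N P \<longleftrightarrow>
     H1_per N P \<and> (LINT y:unit_cell|lebesgue. N y) = 0 \<and>
     (\<forall>\<psi> \<Psi>. H1_per \<psi> \<Psi> \<longrightarrow>
        (LINT y:unit_cell|lebesgue. (a y *v P y) \<bullet> \<Psi> y) =
        - (LINT y:unit_cell|lebesgue. (a y *v e) \<bullet> \<Psi> y))"

definition hom_matrix :: "(real^3 \<Rightarrow> real^3^3) \<Rightarrow> real^3^3" where
  "hom_matrix a = (THE A. \<exists>N P. (\<forall>j. cell_solution a (axis j 1) (N j) (P j)) \<and>
     (\<forall>i j. A $ i $ j =
        (LINT y:unit_cell|lebesgue. a y $ i $ j + (\<Sum>k\<in>UNIV. a y $ i $ k * P j y $ k))))"

definition osc_coeff :: "(real^3 \<Rightarrow> real^3^3) \<Rightarrow> real \<Rightarrow> real^3 \<Rightarrow> real^3^3" where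
  "osc_coeff a \<epsilon> x = a (x /\<^sub>R \<epsilon>)"

definition hom_coeff :: "(real^3 \<Rightarrow> real^3^3) \<Rightarrow> real^3 \<Rightarrow> real^3^3" where
  "hom_coeff a x = hom_matrix a"

(* b \<nabla>u *)
definition flux :: "(real^3) set \<Rightarrow> (real^3 \<Rightarrow> real^3^3) \<Rightarrow> real L2 \<Rightarrow> (real^3) L2" where
  "flux \<Omega> b u = to_L2 (\<lambda>x. b x *v rep_L2 (grad \<Omega> u) x)"

(* w = div (b \<nabla>u) in L\<^sup>2(\<Omega>) *)
definition has_div_flux ::
  "(real^3) set \<Rightarrow> (real^3 \<Rightarrow> real^3^3) \<Rightarrow> real L2 \<Rightarrow> real L2 \<Rightarrow> bool" where
  "has_div_flux \<Omega> b u w \<longleftrightarrow> w \<in> L2_on \<Omega> \<and> has_weak_div \<Omega> (rep_L2 (flux \<Omega> b u)) (rep_L2 w)"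

definition div_flux ::
  "(real^3) set \<Rightarrow> (real^3 \<Rightarrow> real^3^3) \<Rightarrow> real L2 \<Rightarrow> real L2" where
  "div_flux \<Omega> b u = (THE w. has_div_flux \<Omega> b u w)"

(* Inverse of the Dirichlet operator u \<mapsto> - div (b \<nabla>u) *)
definition A_inv :: "(real^3) set \<Rightarrow> (real^3 \<Rightarrow> real^3^3) \<Rightarrow> real L2 \<Rightarrow> real L2" where
  "A_inv \<Omega> b w = (THE u. u \<in> H10 \<Omega> \<and> has_div_flux \<Omega> b u (- w))"

definition L2_opnorm :: "(real^3) set \<Rightarrow> (real L2 \<Rightarrow> real L2) \<Rightarrow> real" where
  "L2_opnorm \<Omega> T = (SUP w\<in>{w \<in> L2_on \<Omega>. norm w \<le> 1}. norm (T w))"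


section \<open>Phase spaces\<close>

type_synonym state = "real L2 \<times> real L2"

definition E :: "(real^3) set \<Rightarrow> state set" where
  "E \<Omega> = H10 \<Omega> \<times> L2_on \<Omega>"

definition E_norm :: "(real^3) set \<Rightarrow> state \<Rightarrow> real" where
  "E_norm \<Omega> \<xi> = sqrt ((norm (grad \<Omega> (fst \<xi>)))\<^sup>2 + (norm (snd \<xi>))\<^sup>2)"

definition E_dist :: "(real^3) set \<Rightarrow> state \<Rightarrow> state \<Rightarrow> real" where
  "E_dist \<Omega> \<xi> \<eta> = E_norm \<Omega> (\<xi> - \<eta>)"

abbreviation E_topology :: "(real^3) set \<Rightarrow> state topology" where
  "E_topology \<Omega> \<equiv> Metric_space.mtopology (E \<Omega>) (E_dist \<Omega>)"

abbreviation E_bounded :: "(real^3) set \<Rightarrow> state set \<Rightarrow> bool" where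
  "E_bounded \<Omega> B \<equiv> Metric_space.mbounded (E \<Omega>) (E_dist \<Omega>) B"

definition E_set_norm :: "(real^3) set \<Rightarrow> state set \<Rightarrow> real" where
  "E_set_norm \<Omega> B = (SUP b\<in>B. E_norm \<Omega> b)"

(* The norm of \<E>\<^sup>-\<^sup>1, on the subspace L\<^sup>2(\<Omega>) \<times> L\<^sup>2(\<Omega>) that contains \<E> *)
definition Em1_norm :: "(real^3) set \<Rightarrow> state \<Rightarrow> real" where
  "Em1_norm \<Omega> \<xi> = sqrt ((norm (fst \<xi>))\<^sup>2 + (Hm1_norm \<Omega> (inner (snd \<xi>)))\<^sup>2)"

definition Em1_dist :: "(real^3) set \<Rightarrow> state \<Rightarrow> state \<Rightarrow> real" where
  "Em1_dist \<Omega> \<xi> \<eta> = Em1_norm \<Omega> (\<xi> - \<eta>)"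

definition E2 :: "(real^3) set \<Rightarrow> (real^3 \<Rightarrow> real^3^3) \<Rightarrow> real L2 \<Rightarrow> state set" where
  "E2 \<Omega> b g = {(\<xi>1, \<xi>2). \<xi>1 \<in> H10 \<Omega> \<and> \<xi>2 \<in> H10 \<Omega> \<and>
     (\<exists>w. has_div_flux \<Omega> b \<xi>1 w \<and> w + g \<in> H10 \<Omega>) \<and> (\<exists>w. has_div_flux \<Omega> b \<xi>2 w)}"

definition E2_norm :: "(real^3) set \<Rightarrow> (real^3 \<Rightarrow> real^3^3) \<Rightarrow> real L2 \<Rightarrow> state \<Rightarrow> real" where
  "E2_norm \<Omega> b g \<xi> = sqrt ((H10_norm \<Omega> (div_flux \<Omega> b (fst \<xi>) + g))\<^sup>2
     + (norm (div_flux \<Omega> b (fst \<xi>)))\<^sup>2 + (norm (div_flux \<Omega> b (snd \<xi>)))\<^sup>2)"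

definition E2_ball ::
  "(real^3) set \<Rightarrow> (real^3 \<Rightarrow> real^3^3) \<Rightarrow> real L2 \<Rightarrow> real \<Rightarrow> state set" where
  "E2_ball \<Omega> b g R = {\<xi> \<in> E2 \<Omega> b g. E2_norm \<Omega> b g \<xi> \<le> R}"

(* Non-symmetric Hausdorff distance.  With values in \<open>ennreal\<close>, the distance from a nonempty set
   to the empty set is infinite, and the distance from the empty set is 0. *)
definition semidist :: "('s \<Rightarrow> 's \<Rightarrow> real) \<Rightarrow> 's set \<Rightarrow> 's set \<Rightarrow> ennreal" where
  "semidist d A B = (SUP x\<in>A. INF y\<in>B. ennreal (d x y))"


section \<open>The damped wave equation\<close>

definition admissible_nonlinearity :: "real \<Rightarrow> real \<Rightarrow> real \<Rightarrow> (real \<Rightarrow> real) \<Rightarrow> bool" where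
  "admissible_nonlinearity K1 K2 K3 f \<longleftrightarrow>
     0 < K1 \<and> 0 < K2 \<and> 0 < K3 \<and> Ck_on 2 f UNIV \<and> f 0 = 0 \<and>
     (\<forall>s. f s * s \<ge> - K1 \<and> deriv f s \<ge> - K2 \<and> \<bar>deriv (deriv f) s\<bar> \<le> K3 * (1 + \<bar>s\<bar>))"

(* f(u).  This is in L\<^sup>2 for every u in H\<^sup>1_0(\<Omega>), because f has at most cubic growth and
   H\<^sup>1_0(\<Omega>) embeds into L\<^sup>6. *)
definition superpose :: "(real \<Rightarrow> real) \<Rightarrow> real L2 \<Rightarrow> real L2" where
  "superpose f u = to_L2 (\<lambda>x. f (rep_L2 u x))"

(* U = (u, \<partial>\<^sub>tu) is the energy solution of
     \<partial>\<^sub>t\<^sup>2u + \<gamma> \<partial>\<^sub>tu - div (b \<nabla>u) + f(u) = g,  u = 0 on the boundary,  (u, \<partial>\<^sub>tu) = \<xi> at t = 0;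
   the equation is an equality in H\<^sup>-\<^sup>1(\<Omega>) and is tested with the elements of H\<^sup>1_0(\<Omega>).
   Only the values of U on {0..} matter. *)
definition energy_solution ::
  "(real^3) set \<Rightarrow> (real^3 \<Rightarrow> real^3^3) \<Rightarrow> real \<Rightarrow> (real \<Rightarrow> real) \<Rightarrow> real L2 \<Rightarrow>
   state \<Rightarrow> (real \<Rightarrow> state) \<Rightarrow> bool" where
  "energy_solution \<Omega> b \<gamma> f g \<xi> U \<longleftrightarrow>
     U 0 = \<xi> \<and>
     continuous_map (top_of_set {0..}) (E_topology \<Omega>) U \<and>
     (\<forall>t\<ge>0. ((\<lambda>s. fst (U s)) has_vector_derivative snd (U t)) (at t within {0..})) \<and>
     (\<forall>\<phi>\<in>H10 \<Omega>. \<forall>t\<ge>0.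
        ((\<lambda>s. snd (U s) \<bullet> \<phi>) has_real_derivative
           (g \<bullet> \<phi> - \<gamma> * (snd (U t) \<bullet> \<phi>) - flux \<Omega> b (fst (U t)) \<bullet> grad \<Omega> \<phi>
            - superpose f (fst (U t)) \<bullet> \<phi>)) (at t within {0..}))"

(* S(t) \<xi>.  The description is over the value at time t, as solutions are unique only on {0..}. *)
definition sol_op ::
  "(real^3) set \<Rightarrow> (real^3 \<Rightarrow> real^3^3) \<Rightarrow> real \<Rightarrow> (real \<Rightarrow> real) \<Rightarrow> real L2 \<Rightarrow>
   real \<Rightarrow> state \<Rightarrow> state" where
  "sol_op \<Omega> b \<gamma> f g t \<xi> = (THE \<zeta>. \<exists>U. energy_solution \<Omega> b \<gamma> f g \<xi> U \<and> U t = \<zeta>)"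

definition global_attractor ::
  "(real^3) set \<Rightarrow> (real \<Rightarrow> state \<Rightarrow> state) \<Rightarrow> state set \<Rightarrow> bool" where
  "global_attractor \<Omega> S \<A> \<longleftrightarrow>
     compactin (E_topology \<Omega>) \<A> \<and>
     (\<forall>t\<ge>0. S t ` \<A> = \<A>) \<and>
     (\<forall>B. E_bounded \<Omega> B \<longrightarrow> ((\<lambda>t. semidist (E_dist \<Omega>) (S t ` B) \<A>) \<longlongrightarrow> 0) at_top)"

definition exp_attracting ::
  "(real^3) set \<Rightarrow> (real \<Rightarrow> state \<Rightarrow> state) \<Rightarrow> state set \<Rightarrow> real \<Rightarrow> (real \<Rightarrow> real) \<Rightarrow> bool" where
  "exp_attracting \<Omega> S \<A> \<sigma> M0 \<longleftrightarrow>
     (\<forall>B. E_bounded \<Omega> B \<longrightarrow>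
        (\<forall>t\<ge>0. semidist (E_dist \<Omega>) (S t ` B) \<A> \<le> ennreal (M0 (E_set_norm \<Omega> B) * exp (- \<sigma> * t))))"

end

theory Submission
  imports Defs
begin

text \<open>
  The quantitative core is the balance of two exponentials.  A point \<open>x\<close> of the attractor \<open>A\<close> of the
  oscillating problem is \<open>S t \<xi>\<close> for some \<open>\<xi>\<close> in \<open>A\<close>, for every \<open>t\<close>.  The trajectory estimate
  bounds the distance from \<open>x\<close> to the homogenised trajectory through \<open>\<xi>\<close> by a multiple of
  \<open>exp (K * t) * \<delta>\<close>, where \<open>\<delta>\<close> is the norm of the difference of the inverse operators, and exponential
  attraction bounds the distance from that trajectory to the homogenised attractor by a multiple of
  \<open>exp (- \<sigma> * t)\<close>.  Both are \<open>\<delta> powr (\<sigma> / (K + \<sigma>))\<close> at \<open>t = - ln \<delta> / (K + \<sigma>)\<close>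
  (\<open>attractor_point_distance\<close>).  If \<open>\<delta> = 0\<close>, let \<open>t\<close> tend to infinity; if \<open>\<delta> \<ge> 1\<close>, a uniform
  bound on the distance suffices, which \<open>t = 0\<close> yields.

  Attraction is measured in the energy norm and the conclusion in the weaker norm, which requires
  Poincare's inequality; it is derived from the Sobolev inequality for the exponent six
  (\<open>sobolev_test_fun\<close>), which also controls the cubic nonlinearity.  The elliptic estimate turns the
  bound on the attractor in the regular phase space into a bound in the energy norm
  (\<open>E2_ball_bounded\<close>).

  The remaining work concerns points that have no energy solution of the homogenised equation: there the
  description operator in \<open>sol_op\<close> yields one fixed pair \<open>no_state\<close> at all times.  If the first component
  of \<open>no_state\<close> lies in \<open>H10 \<Omega>\<close>, the argument above applies as it stands.  Otherwise balls of
  \<open>H10 \<Omega>\<close> keep a positive \<open>L\<^sup>2\<close> distance from it (\<open>H10_ball_closed\<close>), so the trajectory estimate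
  at time \<open>0\<close> forces \<open>\<delta>\<close> to be bounded below, and again it suffices that \<open>x\<close> has bounded distance
  from some point of the homogenised attractor.  Such a point is an equilibrium: it minimises the
  Lyapunov function over the attractor (\<open>attractor_contains_equilibrium\<close>), and testing the stationary
  equation with it bounds its norm in terms of \<open>norm g\<close> alone.  This needs the uniqueness of energy
  solutions and the energy identity, and hence that the homogenised matrix is symmetric and positive
  definite (\<open>elliptic_hom_coeff\<close>), which comes from the variational solution of the cell problem.
\<close>

section \<open>The space of square integrable functions\<close>

lemma L2_eq_rep: "L2_eq (rep_L2 u) (rep_L2 u)"
  using Quotient_rep_reflp[OF Quotient_L2] .

lemma sq_integrable_rep [simp]: "sq_integrable (rep_L2 u)"
  using L2_eq_rep by (auto simp: L2_eq_def)

lemma measurable_rep [measurable]: "rep_L2 u \<in> borel_measurable lebesgue"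
  using sq_integrable_rep by (auto simp: sq_integrable_def)

lemma integrable_norm_rep: "integrable lebesgue (\<lambda>x. (norm (rep_L2 u x))\<^sup>2)"
  using sq_integrable_rep by (auto simp: sq_integrable_def)

lemma rep_abs_L2:
  assumes "sq_integrable u"
  shows "AE x in lebesgue. rep_L2 (abs_L2 u) x = u x"
proof -
  have "L2_eq u u" using assms by (simp add: L2_eq_def)
  then have "L2_eq (rep_L2 (abs_L2 u)) u"
    by (rule Quotient_rep_abs[OF Quotient_L2])
  then show ?thesis by (simp add: L2_eq_def)
qed

lemma rep_to_L2:
  assumes "sq_integrable u"
  shows "AE x in lebesgue. rep_L2 (to_L2 u) x = u x"
  using rep_abs_L2[OF assms] assms by (simp add: to_L2_def)

lemma abs_rep_L2: "abs_L2 (rep_L2 u) = u"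
  using Quotient_abs_rep[OF Quotient_L2] .

lemma L2_eqI:
  assumes "AE x in lebesgue. rep_L2 u x = rep_L2 v x"
  shows "u = v"
proof -
  have "L2_eq (rep_L2 u) (rep_L2 v)" using assms by (simp add: L2_eq_def)
  then have "abs_L2 (rep_L2 u) = abs_L2 (rep_L2 v)"
    using Quotient_rel_abs[OF Quotient_L2] by blast
  then show ?thesis by (simp add: abs_rep_L2)
qed

lemma to_L2_rep [simp]: "to_L2 (rep_L2 u) = u"
  by (simp add: to_L2_def abs_rep_L2)

lemma to_L2_cong_AE:
  assumes "sq_integrable u" "sq_integrable v" "AE x in lebesgue. u x = v x"
  shows "to_L2 u = to_L2 v"
  using rep_to_L2[OF assms(1)] rep_to_L2[OF assms(2)] assms(3)
  by (intro L2_eqI) auto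

lemma rep_zero: "AE x in lebesgue. rep_L2 (0 :: 'b::euclidean_space L2) x = 0"
  unfolding zero_L2_def by (rule rep_abs_L2) (simp add: sq_integrable_0)

lemma rep_add: "AE x in lebesgue. rep_L2 (u + v) x = rep_L2 u x + rep_L2 v x"
proof -
  have "u + v = abs_L2 (\<lambda>x. rep_L2 u x + rep_L2 v x)"
    using plus_L2.abs_eq[OF L2_eq_rep[of u] L2_eq_rep[of v]] by (simp add: abs_rep_L2)
  then show ?thesis
    by (simp only:) (rule rep_abs_L2[OF sq_integrable_add[OF sq_integrable_rep sq_integrable_rep]])
qed

lemma rep_diff: "AE x in lebesgue. rep_L2 (u - v) x = rep_L2 u x - rep_L2 v x"
proof -
  have "u - v = abs_L2 (\<lambda>x. rep_L2 u x - rep_L2 v x)"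
    using minus_L2.abs_eq[OF L2_eq_rep[of u] L2_eq_rep[of v]] by (simp add: abs_rep_L2)
  then show ?thesis
    by (simp only:) (rule rep_abs_L2[OF sq_integrable_diff[OF sq_integrable_rep sq_integrable_rep]])
qed

lemma rep_scaleR: "AE x in lebesgue. rep_L2 (c *\<^sub>R u) x = c *\<^sub>R rep_L2 u x"
proof -
  have "c *\<^sub>R u = abs_L2 (\<lambda>x. c *\<^sub>R rep_L2 u x)"
    using scaleR_L2.abs_eq[OF L2_eq_rep[of u], of c] by (simp add: abs_rep_L2)
  then show ?thesis
    by (simp only:) (rule rep_abs_L2[OF sq_integrable_cmult[OF sq_integrable_rep]])
qed

lemma inner_L2_rep: "u \<bullet> v = (LINT x|lebesgue. rep_L2 u x \<bullet> rep_L2 v x)"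
  using inner_L2.abs_eq[OF L2_eq_rep[of u] L2_eq_rep[of v]] by (simp add: abs_rep_L2)

lemma norm_L2_rep: "(norm (u :: 'b::euclidean_space L2))\<^sup>2 = (LINT x|lebesgue. (norm (rep_L2 u x))\<^sup>2)"
  by (simp add: power2_norm_eq_inner inner_L2_rep)

lemma inner_to_L2:
  assumes "sq_integrable u" "sq_integrable v"
  shows "to_L2 u \<bullet> to_L2 v = (LINT x|lebesgue. u x \<bullet> v x)"
  unfolding inner_L2_rep
proof (rule integral_cong_AE)
  show "AE x in lebesgue. rep_L2 (to_L2 u) x \<bullet> rep_L2 (to_L2 v) x = u x \<bullet> v x"
    using rep_to_L2[OF assms(1)] rep_to_L2[OF assms(2)] by eventually_elim simp
qed (use assms in \<open>auto simp: sq_integrable_def intro!: borel_measurable_inner\<close>)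

lemma inner_to_L2_left:
  assumes "sq_integrable u"
  shows "to_L2 u \<bullet> v = (LINT x|lebesgue. u x \<bullet> rep_L2 v x)"
  using inner_to_L2[OF assms sq_integrable_rep[of v]] by simp

lemma inner_to_L2_right:
  assumes "sq_integrable v"
  shows "u \<bullet> to_L2 v = (LINT x|lebesgue. rep_L2 u x \<bullet> v x)"
  using inner_to_L2[OF sq_integrable_rep[of u] assms] by simp

lemma norm_to_L2:
  assumes "sq_integrable u"
  shows "(norm (to_L2 u))\<^sup>2 = (LINT x|lebesgue. (norm (u x))\<^sup>2)"
  using inner_to_L2[OF assms assms] by (simp add: power2_norm_eq_inner)

lemma norm_to_L2_le:
  assumes "sq_integrable u" "AE x in lebesgue. norm (u x) \<le> c * norm (rep_L2 v x)" "c \<ge> 0"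
  shows "norm (to_L2 u) \<le> c * norm v"
proof -
  have "(LINT x|lebesgue. (norm (u x))\<^sup>2) \<le> (LINT x|lebesgue. c\<^sup>2 * (norm (rep_L2 v x))\<^sup>2)"
  proof (rule integral_mono_AE)
    show "AE x in lebesgue. (norm (u x))\<^sup>2 \<le> c\<^sup>2 * (norm (rep_L2 v x))\<^sup>2"
      using assms(2) by eventually_elim (metis norm_ge_zero power_mono power_mult_distrib)
  qed (use assms(1) integrable_norm_rep in \<open>auto simp: sq_integrable_def\<close>)
  then have "(norm (to_L2 u))\<^sup>2 \<le> (c * norm v)\<^sup>2"
    by (simp only: norm_to_L2[OF assms(1)] power_mult_distrib norm_L2_rep[of v] integral_mult_right_zero)
  then show ?thesis using assms(3) by (simp add: power2_le_iff_abs_le)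
qed

lemma to_L2_add:
  assumes "sq_integrable u" "sq_integrable v"
  shows "to_L2 (\<lambda>x. u x + v x) = to_L2 u + to_L2 v"
proof (rule L2_eqI)
  show "AE x in lebesgue. rep_L2 (to_L2 (\<lambda>x. u x + v x)) x = rep_L2 (to_L2 u + to_L2 v) x"
    using rep_to_L2[OF sq_integrable_add[OF assms]] rep_to_L2[OF assms(1)] rep_to_L2[OF assms(2)]
      rep_add[of "to_L2 u" "to_L2 v"] by eventually_elim simp
qed

lemma to_L2_diff:
  assumes "sq_integrable u" "sq_integrable v"
  shows "to_L2 (\<lambda>x. u x - v x) = to_L2 u - to_L2 v"
proof (rule L2_eqI)
  show "AE x in lebesgue. rep_L2 (to_L2 (\<lambda>x. u x - v x)) x = rep_L2 (to_L2 u - to_L2 v) x"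
    using rep_to_L2[OF sq_integrable_diff[OF assms]] rep_to_L2[OF assms(1)] rep_to_L2[OF assms(2)]
      rep_diff[of "to_L2 u" "to_L2 v"] by eventually_elim simp
qed

lemma to_L2_scaleR:
  assumes "sq_integrable u"
  shows "to_L2 (\<lambda>x. c *\<^sub>R u x) = c *\<^sub>R to_L2 u"
proof (rule L2_eqI)
  show "AE x in lebesgue. rep_L2 (to_L2 (\<lambda>x. c *\<^sub>R u x)) x = rep_L2 (c *\<^sub>R to_L2 u) x"
    using rep_to_L2[OF sq_integrable_cmult[OF assms]] rep_to_L2[OF assms(1)]
      rep_scaleR[of c "to_L2 u"] by eventually_elim simp
qed

lemma sq_integrable_bound:
  fixes u :: "real^3 \<Rightarrow> 'b::euclidean_space" and v :: "real^3 \<Rightarrow> 'c::euclidean_space"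
  assumes "sq_integrable v" "u \<in> borel_measurable lebesgue"
    "AE x in lebesgue. norm (u x) \<le> c * norm (v x)"
  shows "sq_integrable u"
  unfolding sq_integrable_def
proof
  have "integrable lebesgue (\<lambda>x. c\<^sup>2 * (norm (v x))\<^sup>2)"
    using assms(1) by (simp add: sq_integrable_def)
  then show "integrable lebesgue (\<lambda>x. (norm (u x))\<^sup>2)"
  proof (rule Bochner_Integration.integrable_bound)
    show "AE x in lebesgue. norm ((norm (u x))\<^sup>2) \<le> norm (c\<^sup>2 * (norm (v x))\<^sup>2)"
      using assms(3)
    proof eventually_elim
      case (elim x)
      have "(norm (u x))\<^sup>2 \<le> (c * norm (v x))\<^sup>2"
        using elim by (intro power_mono) auto
      then show ?case by (simp add: power_mult_distrib)
    qed
  qed (use assms(2) in measurable)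
qed (fact assms(2))

lemma sq_integrable_cong_AE:
  assumes "sq_integrable v" "u \<in> borel_measurable lebesgue" "AE x in lebesgue. u x = v x"
  shows "sq_integrable u"
  by (rule sq_integrable_bound[OF assms(1,2), of 1]) (use assms(3) in auto)

text \<open>A sequence whose successive differences decay geometrically in norm converges almost
  everywhere, since the integral of \<open>\<Sum>k. 2 ^ k * (norm (u (Suc k) x - u k x))\<^sup>2\<close> is finite;
  Fatou's lemma identifies the pointwise limit as the limit in norm.\<close>

lemma L2_rapidly_Cauchy_converges:
  fixes u :: "nat \<Rightarrow> 'b::euclidean_space L2"
  assumes "\<And>k. norm (u (Suc k) - u k) \<le> (1/2) ^ k"
  shows "convergent u"
proof -
  define d where "d k x = rep_L2 (u (Suc k)) x - rep_L2 (u k) x" for k x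
  have [measurable]: "d k \<in> borel_measurable lebesgue" for k
    unfolding d_def[abs_def] by measurable
  have d_eq: "AE x in lebesgue. rep_L2 (u (Suc k) - u k) x = d k x" for k
    unfolding d_def by (rule rep_diff)
  have d_int: "(\<integral>\<^sup>+x. ennreal ((norm (d k x))\<^sup>2) \<partial>lebesgue) \<le> ennreal ((1/4)^k)" for k
  proof -
    have "(\<integral>\<^sup>+x. ennreal ((norm (d k x))\<^sup>2) \<partial>lebesgue) = (\<integral>\<^sup>+x. ennreal ((norm (rep_L2 (u (Suc k) - u k) x))\<^sup>2) \<partial>lebesgue)"
      using d_eq[of k] by (intro nn_integral_cong_AE) (auto elim!: eventually_mono)
    also have "\<dots> = ennreal ((norm (u (Suc k) - u k))\<^sup>2)"
      using integrable_norm_rep by (subst nn_integral_eq_integral) (auto simp: norm_L2_rep)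
    also have "\<dots> \<le> ennreal (((1/2)^k)\<^sup>2)"
      using assms by (intro ennreal_leI power_mono) auto
    also have "((1/2)^k)\<^sup>2 = (1/4::real)^k"
      by (simp add: power_mult[symmetric] power_divide mult.commute[of k]) (simp add: power_mult)
    finally show ?thesis .
  qed
  have "(\<integral>\<^sup>+x. (\<Sum>k. ennreal (2^k * (norm (d k x))\<^sup>2)) \<partial>lebesgue)
      = (\<Sum>k. \<integral>\<^sup>+x. ennreal (2^k * (norm (d k x))\<^sup>2) \<partial>lebesgue)"
    by (rule nn_integral_suminf) measurable
  also have "\<dots> \<le> (\<Sum>k. ennreal ((1/2)^k))"
  proof (rule suminf_le)
    fix k
    have "(\<integral>\<^sup>+x. ennreal (2^k * (norm (d k x))\<^sup>2) \<partial>lebesgue) = ennreal (2^k) * (\<integral>\<^sup>+x. ennreal ((norm (d k x))\<^sup>2) \<partial>lebesgue)"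
      by (subst nn_integral_cmult[symmetric]) (auto simp: ennreal_mult)
    also have "\<dots> \<le> ennreal (2^k) * ennreal ((1/4)^k)"
      using d_int by (intro mult_left_mono) auto
    also have "\<dots> = ennreal ((1/2)^k)"
      by (simp add: ennreal_mult[symmetric] power_mult_distrib[symmetric])
    finally show "(\<integral>\<^sup>+x. ennreal (2^k * (norm (d k x))\<^sup>2) \<partial>lebesgue) \<le> ennreal ((1/2)^k)" .
  qed auto
  also have "\<dots> = ennreal (\<Sum>k. (1/2)^k)"
    by (rule suminf_ennreal2) (auto simp: summable_geometric)
  also have "\<dots> < \<infinity>" by simp
  finally have "(\<integral>\<^sup>+x. (\<Sum>k. ennreal (2^k * (norm (d k x))\<^sup>2)) \<partial>lebesgue) \<noteq> \<infinity>" by simp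
  then have fin: "AE x in lebesgue. (\<Sum>k. ennreal (2^k * (norm (d k x))\<^sup>2)) \<noteq> \<infinity>"
    by (intro nn_integral_PInf_AE) measurable
  have conv: "convergent (\<lambda>k. rep_L2 (u k) x)" if "(\<Sum>k. ennreal (2^k * (norm (d k x))\<^sup>2)) \<noteq> \<infinity>" for x
  proof -
    define S where "S = enn2real (\<Sum>k. ennreal (2^k * (norm (d k x))\<^sup>2))"
    have S: "(\<Sum>k. ennreal (2^k * (norm (d k x))\<^sup>2)) = ennreal S"
      using that by (simp add: S_def less_top)
    have "ennreal (2^k * (norm (d k x))\<^sup>2) \<le> ennreal S" for k
      unfolding S[symmetric] using sum_le_suminf[OF summableI, of "{k}"] by simp
    then have le: "2^k * (norm (d k x))\<^sup>2 \<le> S" for k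
      by (metis S_def enn2real_nonneg ennreal_le_iff)
    have nle: "norm (d k x) \<le> sqrt S * (sqrt (1/2))^k" for k
    proof (rule power2_le_imp_le)
      show "(norm (d k x))\<^sup>2 \<le> (sqrt S * sqrt (1 / 2) ^ k)\<^sup>2"
      proof -
        have "(sqrt S * sqrt (1 / 2) ^ k)\<^sup>2 = (sqrt S)\<^sup>2 * ((sqrt (1/2))\<^sup>2) ^ k"
          by (simp only: power_mult_distrib power_mult[symmetric] mult.commute)
        also have "\<dots> = S * (1/2)^k" by (simp add: S_def)
        finally have eq: "(sqrt S * sqrt (1 / 2) ^ k)\<^sup>2 = S * (1/2)^k" .
        have "(norm (d k x))\<^sup>2 \<le> S * (1/2)^k"
          using le[of k] by (simp add: power_divide field_simps)
        then show ?thesis by (simp only: eq)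
      qed
    qed (auto simp: S_def)
    have "summable (\<lambda>k. d k x)"
    proof (rule summable_comparison_test')
      show "summable (\<lambda>k. sqrt S * (sqrt (1/2))^k)"
        by (intro summable_mult summable_geometric) (simp add: real_sqrt_divide)
    qed (use nle in auto)
    then have "convergent (\<lambda>n. \<Sum>k<n. d k x)"
      by (simp add: summable_iff_convergent)
    moreover have "(\<Sum>k<n. d k x) = rep_L2 (u n) x - rep_L2 (u 0) x" for n
      unfolding d_def by (rule sum_lessThan_telescope)
    ultimately have "convergent (\<lambda>n. (rep_L2 (u n) x - rep_L2 (u 0) x) + rep_L2 (u 0) x)"
      by (intro convergent_add convergent_const) simp
    then show ?thesis by simp
  qed
  define w where "w x = lim (\<lambda>k. rep_L2 (u k) x)" for x
  have [measurable]: "w \<in> borel_measurable lebesgue"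
    unfolding w_def[abs_def] by (rule borel_measurable_lim_metric) measurable
  have lim: "AE x in lebesgue. (\<lambda>k. rep_L2 (u k) x) \<longlonglongrightarrow> w x"
    using fin
  proof eventually_elim
    case (elim x)
    from conv[OF elim] show ?case by (simp add: w_def convergent_LIMSEQ_iff)
  qed
  have tri: "norm (u (k + n) - u k) \<le> 2 * (1/2)^k" for k n
  proof -
    have "norm (u (k + n) - u k) \<le> (2 - 2 * (1/2)^n) * (1/2)^k"
    proof (induction n)
      case (Suc n)
      have "norm (u (k + Suc n) - u k) \<le> norm (u (Suc (k + n)) - u (k + n)) + norm (u (k + n) - u k)"
        using norm_triangle_ineq[of "u (Suc (k + n)) - u (k + n)" "u (k + n) - u k"] by simp
      also have "\<dots> \<le> (1/2)^(k + n) + (2 - 2 * (1/2)^n) * (1/2)^k"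
        using assms[of "k + n"] Suc by linarith
      also have "\<dots> = (2 - 2 * (1/2)^Suc n) * (1/2)^k"
        by (simp add: power_add algebra_simps)
      finally show ?case .
    qed simp
    also have "\<dots> \<le> 2 * (1/2)^k" by (intro mult_right_mono) auto
    finally show ?thesis .
  qed
  have fatou: "(\<integral>\<^sup>+x. ennreal ((norm (w x - rep_L2 (u k) x))\<^sup>2) \<partial>lebesgue) \<le> ennreal ((2 * (1/2)^k)\<^sup>2)" for k
  proof -
    have "(\<integral>\<^sup>+x. ennreal ((norm (w x - rep_L2 (u k) x))\<^sup>2) \<partial>lebesgue)
       = (\<integral>\<^sup>+x. liminf (\<lambda>n. ennreal ((norm (rep_L2 (u (k + n)) x - rep_L2 (u k) x))\<^sup>2)) \<partial>lebesgue)"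
    proof (rule nn_integral_cong_AE, use lim in eventually_elim)
      case (elim x)
      then have "(\<lambda>n. rep_L2 (u (n + k)) x) \<longlonglongrightarrow> w x" by (rule LIMSEQ_ignore_initial_segment)
      then have "(\<lambda>n. ennreal ((norm (rep_L2 (u (k + n)) x - rep_L2 (u k) x))\<^sup>2)) \<longlonglongrightarrow> ennreal ((norm (w x - rep_L2 (u k) x))\<^sup>2)"
        by (intro tendsto_intros) (simp add: add.commute)
      from lim_imp_Liminf[OF sequentially_bot this] show ?case by (rule sym)
    qed
    also have "\<dots> \<le> liminf (\<lambda>n. \<integral>\<^sup>+x. ennreal ((norm (rep_L2 (u (k + n)) x - rep_L2 (u k) x))\<^sup>2) \<partial>lebesgue)"
      by (rule nn_integral_liminf) measurable
    also have "\<dots> \<le> liminf (\<lambda>n::nat. ennreal ((2 * (1/2)^k)\<^sup>2))"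
    proof (intro Liminf_mono always_eventually allI)
      fix n
      have "(\<integral>\<^sup>+x. ennreal ((norm (rep_L2 (u (k + n)) x - rep_L2 (u k) x))\<^sup>2) \<partial>lebesgue)
         = (\<integral>\<^sup>+x. ennreal ((norm (rep_L2 (u (k + n) - u k) x))\<^sup>2) \<partial>lebesgue)"
        using rep_diff[of "u (k+n)" "u k"] by (intro nn_integral_cong_AE) (auto elim!: eventually_mono)
      also have "\<dots> = ennreal ((norm (u (k + n) - u k))\<^sup>2)"
        using integrable_norm_rep by (subst nn_integral_eq_integral) (auto simp: norm_L2_rep)
      also have "\<dots> \<le> ennreal ((2 * (1/2)^k)\<^sup>2)"
        using tri by (intro ennreal_leI power_mono) auto
      finally show "(\<integral>\<^sup>+x. ennreal ((norm (rep_L2 (u (k + n)) x - rep_L2 (u k) x))\<^sup>2) \<partial>lebesgue) \<le> ennreal ((2 * (1/2)^k)\<^sup>2)" .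
    qed
    also have "\<dots> = ennreal ((2 * (1/2)^k)\<^sup>2)" by (simp add: Liminf_const)
    finally show ?thesis .
  qed
  have sq: "sq_integrable (\<lambda>x. w x - rep_L2 (u k) x)" for k
    unfolding sq_integrable_def
  proof
    show "integrable lebesgue (\<lambda>x. (norm (w x - rep_L2 (u k) x))\<^sup>2)"
      using fatou[of k] by (intro integrableI_bounded) (auto intro: le_less_trans)
  qed measurable
  have sqw: "sq_integrable w" using sq_integrable_add[OF sq[of 0] sq_integrable_rep[of "u 0"]] by simp
  have dist: "norm (to_L2 w - u k) \<le> 2 * (1/2)^k" for k
  proof -
    have "to_L2 w - u k = to_L2 (\<lambda>x. w x - rep_L2 (u k) x)"
      using to_L2_diff[OF sqw sq_integrable_rep[of "u k"]] by simp
    then have "ennreal ((norm (to_L2 w - u k))\<^sup>2) \<le> ennreal ((2 * (1/2)^k)\<^sup>2)"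
      using fatou[of k] sq[of k] by (simp add: norm_to_L2 sq_integrable_def nn_integral_eq_integral)
    then have "(norm (to_L2 w - u k))\<^sup>2 \<le> (2 * (1/2)^k)\<^sup>2"
      by (simp add: ennreal_le_iff)
    then show ?thesis by (rule power2_le_imp_le) simp
  qed
  have "u \<longlonglongrightarrow> to_L2 w"
  proof (rule LIM_zero_cancel, rule tendsto_norm_zero_cancel, rule Lim_null_comparison)
    show "\<forall>\<^sub>F k in sequentially. norm (norm (u k - to_L2 w)) \<le> 2 * (1/2)^k"
      using dist by (simp add: norm_minus_commute)
    show "(\<lambda>k. 2 * (1/2::real)^k) \<longlonglongrightarrow> 0"
      by (intro tendsto_mult_right_zero LIMSEQ_power_zero) simp
  qed
  then show ?thesis by (auto simp: convergent_def)
qed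

instance L2 :: (euclidean_space) complete_space
proof
  fix X :: "nat \<Rightarrow> 'a L2"
  assume C: "Cauchy X"
  have "\<exists>M. \<forall>m\<ge>M. \<forall>n\<ge>M. dist (X m) (X n) < (1/2)^k" for k
    using C by (simp add: Cauchy_def)
  then obtain N where N: "\<And>k m n. m \<ge> N k \<Longrightarrow> n \<ge> N k \<Longrightarrow> dist (X m) (X n) < (1/2)^k"
    by metis
  define r where "r k = k + (\<Sum>j\<le>k. N j)" for k
  have rN: "r k \<ge> N k" for k
    using member_le_sum[of k "{..k}" N] by (simp add: r_def)
  have sm: "strict_mono r" by (rule strict_mono_Suc_iff[THEN iffD2]) (simp add: r_def)
  have "convergent (X \<circ> r)"
  proof (rule L2_rapidly_Cauchy_converges)
    fix k
    have "r (Suc k) \<ge> N k" using rN[of k] strict_monoD[OF sm, of k "Suc k"] by simp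
    then show "norm ((X \<circ> r) (Suc k) - (X \<circ> r) k) \<le> (1/2)^k"
      using N[OF _ rN[of k], of "r (Suc k)"] by (simp add: dist_norm less_imp_le)
  qed
  then obtain l where "(X \<circ> r) \<longlonglongrightarrow> l" by (auto simp: convergent_def)
  then show "convergent X"
    using Cauchy_converges_subseq[OF C sm] by (auto simp: convergent_def)
qed

section \<open>Minimisation in a complete subspace\<close>

text \<open>A Cauchy criterion behind every minimisation below: nearly minimal elements of a convex set
  are close to each other, by the parallelogram law.\<close>

lemma parallelogram: "(norm (x - y))\<^sup>2 = 2 * (norm x)\<^sup>2 + 2 * (norm y)\<^sup>2 - (norm (x + y))\<^sup>2"
  for x y :: "'a::real_inner"
  by (simp add: power2_norm_eq_inner inner_add inner_diff inner_commute)

text \<open>The theorem of Lax and Milgram for a symmetric form: the minimum over \<open>x \<in> V\<close> of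
  \<open>A (e + x) \<bullet> (e + x)\<close> is attained, since \<open>V\<close> is complete in the norm of the form, and the
  minimiser solves the variational equation.\<close>

lemma symmetric_Lax_Milgram:
  fixes A :: "'a::real_inner \<Rightarrow> 'a" and V :: "'a set"
  assumes V: "subspace V" "complete V"
    and A: "bounded_linear A"
    and sym: "\<And>x y. A x \<bullet> y = A y \<bullet> x"
    and coercive: "\<And>x. \<nu> * (norm x)\<^sup>2 \<le> A x \<bullet> x" and "\<nu> > 0"
  shows "\<exists>x\<in>V. \<forall>y\<in>V. A (e + x) \<bullet> y = 0"
proof -
  interpret A: bounded_linear A by fact
  define J where "J x = A (e + x) \<bullet> (e + x)" for x
  have q_nonneg: "A x \<bullet> x \<ge> 0" for x
    using coercive[of x] \<open>\<nu> > 0\<close> by (smt (verit) mult_nonneg_nonneg zero_le_power2)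
  define m where "m = (INF x\<in>V. J x)"
  have V0: "0 \<in> V" using V(1) by (rule subspace_0)
  have bdd: "bdd_below (J ` V)" by (rule bdd_belowI[of _ 0]) (auto simp: J_def q_nonneg)
  have m_le: "m \<le> J x" if "x \<in> V" for x
    unfolding m_def using bdd that by (rule cINF_lower)
  have "\<exists>x\<in>V. J x < m + 1 / Suc n" for n
    using cINF_less_iff[of V J "m + 1 / Suc n"] V0 bdd by (auto simp: m_def)
  then obtain X where X: "\<And>n. X n \<in> V" "\<And>n. J (X n) < m + 1 / Suc n" by metis
  have para: "\<nu> * (norm (x - y))\<^sup>2 \<le> 2 * J x + 2 * J y - 4 * m" if "x \<in> V" "y \<in> V" for x y
  proof -
    have "(1/2) *\<^sub>R (x + y) \<in> V"
      using V(1) that by (simp add: subspace_scale subspace_add)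
    then have le: "m \<le> J ((1/2) *\<^sub>R (x + y))" by (rule m_le)
    have "\<nu> * (norm (x - y))\<^sup>2 \<le> A (x - y) \<bullet> (x - y)" by (rule coercive)
    also have "A (x - y) \<bullet> (x - y) = 2 * J x + 2 * J y - 4 * J ((1/2) *\<^sub>R (x + y))"
      by (simp add: J_def A.add A.diff A.scaleR inner_add_left inner_add_right inner_diff_left inner_diff_right sym[of x e] sym[of y e] sym[of y x] field_simps)
    also have "\<dots> \<le> 2 * J x + 2 * J y - 4 * m" using le by simp
    finally show ?thesis .
  qed
  have "Cauchy X"
  proof (rule metric_CauchyI)
    fix \<epsilon> :: real assume "\<epsilon> > 0"
    then obtain N where N': "1 / Suc N < \<nu> * \<epsilon>\<^sup>2 / 4"
      using nat_approx_posE[of "\<nu> * \<epsilon>\<^sup>2 / 4"] \<open>\<nu> > 0\<close> by (metis divide_pos_pos mult_pos_pos zero_less_numeral zero_less_power)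
    define c where "c = 1 / real (Suc N)"
    have N: "c < \<nu> * \<epsilon>\<^sup>2 / 4" using N' by (simp add: c_def)
    have "dist (X i) (X j) < \<epsilon>" if "i \<ge> N" "j \<ge> N" for i j
    proof -
      have "1 / real (Suc i) \<le> c" "1 / real (Suc j) \<le> c"
        using that by (auto simp: c_def intro!: divide_left_mono)
      then have "J (X i) - m < c" "J (X j) - m < c"
        using X(2)[of i] X(2)[of j] by linarith+
      then have "\<nu> * (norm (X i - X j))\<^sup>2 < \<nu> * \<epsilon>\<^sup>2"
        using para[OF X(1)[of i] X(1)[of j]] N by linarith
      then show ?thesis using \<open>\<nu> > 0\<close> \<open>\<epsilon> > 0\<close> by (simp add: dist_norm power_less_imp_less_base)
    qed
    then show "\<exists>M. \<forall>i\<ge>M. \<forall>j\<ge>M. dist (X i) (X j) < \<epsilon>" by blast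
  qed
  then obtain x where x: "x \<in> V" "X \<longlonglongrightarrow> x"
    using V(2) X(1) by (auto simp: complete_def)
  have "(\<lambda>n. J (X n)) \<longlonglongrightarrow> J x"
    unfolding J_def by (intro tendsto_intros A.tendsto x)
  moreover have "(\<lambda>n. m + 1 / Suc n) \<longlonglongrightarrow> m"
    using tendsto_add[OF tendsto_const LIMSEQ_inverse_real_of_nat, of m] by (simp add: inverse_eq_divide)
  ultimately have "J x \<le> m"
    by (rule LIMSEQ_le) (use X(2) in \<open>auto intro: less_imp_le\<close>)
  then have min: "J x \<le> J y" if "y \<in> V" for y using m_le[OF that] by simp
  have "A (e + x) \<bullet> y = 0" if y: "y \<in> V" for y
  proof (rule ccontr)
    let ?b = "A (e + x) \<bullet> y" and ?c = "A y \<bullet> y"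
    assume b: "?b \<noteq> 0"
    have quad: "0 \<le> 2 * t * ?b + t\<^sup>2 * ?c" for t
    proof -
      have "x + t *\<^sub>R y \<in> V" using V(1) x y by (simp add: subspace_scale subspace_add)
      then have "J x \<le> J (x + t *\<^sub>R y)" by (rule min)
      also have "J (x + t *\<^sub>R y) = J x + 2 * t * ?b + t\<^sup>2 * ?c"
        by (simp add: J_def A.add A.scaleR inner_add_left inner_add_right sym[of y e] sym[of y x] power2_eq_square algebra_simps)
      finally show ?thesis by simp
    qed
    have "?c \<ge> 0" by (rule q_nonneg)
    have b2: "?b * ?b > 0" using b by (simp add: zero_less_mult_iff) linarith
    show False
    proof (cases "?c = 0")
      case True
      then have "0 \<le> - (2 * (?b * ?b))" using quad[of "- ?b"] by simp
      then show False using b2 by linarith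
    next
      case False
      with \<open>?c \<ge> 0\<close> have "?c > 0" by simp
      have "2 * (- ?b / ?c) * ?b + (- ?b / ?c)\<^sup>2 * ?c = - (?b * ?b / ?c)"
        using False by (simp add: power2_eq_square)
      moreover have "?b * ?b / ?c > 0" using b2 \<open>?c > 0\<close> by (rule divide_pos_pos)
      ultimately show False using quad[of "- ?b / ?c"] by linarith
    qed
  qed
  with x show ?thesis by blast
qed

section \<open>Test functions\<close>

lemma Ck_on_SucD: "Ck_on (Suc k) \<phi> UNIV \<Longrightarrow> Ck_on k \<phi> UNIV"
proof (induction k arbitrary: \<phi>)
  case 0
  then show ?case by (auto simp: continuous_on_eq_continuous_at intro: differentiable_imp_continuous_within)
qed auto

lemma Ck_on_add:
  assumes "Ck_on k \<phi> UNIV" "Ck_on k \<psi> UNIV"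
  shows "Ck_on k (\<lambda>x. \<phi> x + \<psi> x) UNIV"
  using assms
proof (induction k arbitrary: \<phi> \<psi>)
  case (Suc k)
  have "frechet_derivative (\<lambda>x. \<phi> x + \<psi> x) (at x) = (\<lambda>b. frechet_derivative \<phi> (at x) b + frechet_derivative \<psi> (at x) b)" for x
    by (rule frechet_derivative_at[symmetric]) (use Suc.prems in \<open>auto simp: frechet_derivative_works intro!: has_derivative_add\<close>)
  then show ?case using Suc by auto
qed (auto intro: continuous_on_add)

lemma Ck_on_mult:
  assumes "Ck_on k \<phi> UNIV" "Ck_on k \<psi> UNIV"
  shows "Ck_on k (\<lambda>x. \<phi> x * \<psi> x) UNIV"
  using assms
proof (induction k arbitrary: \<phi> \<psi>)
  case (Suc k)
  have d: "frechet_derivative (\<lambda>x. \<phi> x * \<psi> x) (at x) = (\<lambda>b. \<phi> x * frechet_derivative \<psi> (at x) b + frechet_derivative \<phi> (at x) b * \<psi> x)" for x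
    by (rule frechet_derivative_at[symmetric]) (use Suc.prems in \<open>auto simp: frechet_derivative_works intro!: has_derivative_mult\<close>)
  have "Ck_on k \<phi> UNIV" "Ck_on k \<psi> UNIV" using Suc.prems by (auto intro: Ck_on_SucD simp del: Ck_on.simps)
  then show ?case using Suc by (auto simp: d intro!: Ck_on_add)
qed (auto intro: continuous_on_mult)

lemma Ck_on_const: "Ck_on k (\<lambda>x. c) UNIV"
  by (induction k arbitrary: c) auto

lemma Ck_on_prod: "finite I \<Longrightarrow> (\<And>i. i \<in> I \<Longrightarrow> Ck_on k (\<phi> i) UNIV) \<Longrightarrow> Ck_on k (\<lambda>x. \<Prod>i\<in>I. \<phi> i x) UNIV"
  by (induction I rule: finite_induct) (auto intro: Ck_on_const Ck_on_mult)

lemma Ck_on_shift: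
  assumes "Ck_on k \<phi> UNIV"
  shows "Ck_on k (\<lambda>x. \<phi> (x - h)) UNIV"
  using assms
proof (induction k arbitrary: \<phi>)
  case 0
  then show ?case by (auto intro!: continuous_on_compose2[of UNIV \<phi>] continuous_intros)
next
  case (Suc k)
  have der: "((\<lambda>x. \<phi> (x - h)) has_derivative frechet_derivative \<phi> (at (x - h))) (at x)" for x
  proof -
    have "((\<lambda>x. x - h) has_derivative (\<lambda>y. y)) (at x)" by (auto intro!: derivative_eq_intros)
    moreover have "(\<phi> has_derivative frechet_derivative \<phi> (at (x - h))) (at (x - h))"
      using Suc.prems by (auto simp: frechet_derivative_works)
    ultimately show ?thesis by (rule has_derivative_compose)
  qed
  then have "frechet_derivative (\<lambda>x. \<phi> (x - h)) (at x) = frechet_derivative \<phi> (at (x - h))" for x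
    by (rule frechet_derivative_at[symmetric])
  moreover have "(\<lambda>x. \<phi> (x - h)) differentiable (at x)" for x
    using der by (auto simp: differentiable_def)
  moreover have "Ck_on k (\<lambda>x. frechet_derivative \<phi> (at (x - h)) b) UNIV" if "b \<in> Basis" for b
    using Suc.IH[of "\<lambda>x. frechet_derivative \<phi> (at x) b"] Suc.prems that by auto
  ultimately show ?case by auto
qed

text \<open>A ridge function along \<open>b\<close>, where \<open>D\<close> lists the successive derivatives of its profile.\<close>

lemma Ck_on_ridge:
  fixes b :: "'a::euclidean_space"
  assumes D: "\<And>j t. (D j has_real_derivative D (Suc j) t) (at t)"
  shows "Ck_on k (\<lambda>x. c * D j (x \<bullet> b + d)) UNIV"
proof (induction k arbitrary: c j)
  case 0
  have "continuous_on UNIV (D j)" using D by (auto intro!: DERIV_continuous_on)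
  then show ?case by (auto intro!: continuous_intros continuous_on_compose2[of UNIV "D j"])
next
  case (Suc k)
  have der: "((\<lambda>x. c * D j (x \<bullet> b + d)) has_derivative (\<lambda>e. (c * (e \<bullet> b)) * D (Suc j) (x \<bullet> b + d))) (at x)" for x
  proof -
    have "((\<lambda>x. D j (x \<bullet> b + d)) has_derivative (\<lambda>e. D (Suc j) (x \<bullet> b + d) * (e \<bullet> b))) (at x)"
      by (rule has_derivative_compose[of "\<lambda>x. x \<bullet> b + d" "\<lambda>e. e \<bullet> b", OF _ D[unfolded has_field_derivative_def]])
        (auto intro!: derivative_eq_intros)
    then show ?thesis by (auto intro!: derivative_eq_intros)
  qed
  then have "frechet_derivative (\<lambda>x. c * D j (x \<bullet> b + d)) (at x) = (\<lambda>e. (c * (e \<bullet> b)) * D (Suc j) (x \<bullet> b + d))" for x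
    by (rule frechet_derivative_at[symmetric])
  moreover have "(\<lambda>x. c * D j (x \<bullet> b + d)) differentiable (at x)" for x
    using der by (auto simp: differentiable_def)
  ultimately show ?case using Suc by auto
qed

text \<open>The functions \<open>p (1 / t) * exp (- c / t)\<close>, extended by zero to the left of the origin, are
  closed under differentiation; so \<open>exp (- c / t)\<close> is smooth on the real line.\<close>

definition flat :: "real \<Rightarrow> real poly \<Rightarrow> real \<Rightarrow> real" where
  "flat c p t = (if t \<le> 0 then 0 else poly p (1 / t) * exp (- c / t))"

definition flat_step :: "real \<Rightarrow> real poly \<Rightarrow> real poly" where
  "flat_step c p = [:0, 0, 1:] * (smult c p - pderiv p)"

lemma poly_times_exp_decay:
  fixes c :: real assumes "c > 0"
  shows "((\<lambda>s. poly q s * exp (- c * s)) \<longlongrightarrow> 0) at_top"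
proof -
  have "((\<lambda>s. s ^ i * exp (- c * s)) \<longlongrightarrow> 0) at_top" for i
  proof -
    have "((\<lambda>s. (c * s) ^ i / exp (c * s)) \<longlongrightarrow> 0) at_top"
      using \<open>c > 0\<close> by (intro filterlim_compose[OF tendsto_power_div_exp_0] filterlim_tendsto_pos_mult_at_top[OF tendsto_const] filterlim_ident)
    then have "((\<lambda>s. (1 / c ^ i) * ((c * s) ^ i / exp (c * s))) \<longlongrightarrow> 0) at_top"
      by (rule tendsto_mult_right_zero)
    moreover have "(1 / c ^ i) * ((c * s) ^ i / exp (c * s)) = s ^ i * exp (- c * s)" for s
      using \<open>c > 0\<close> by (simp add: power_mult_distrib exp_minus divide_inverse)
    ultimately show ?thesis by simp
  qed
  then have "((\<lambda>s. \<Sum>i\<le>degree q. coeff q i * (s ^ i * exp (- c * s))) \<longlongrightarrow> 0) at_top"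
    by (intro tendsto_null_sum tendsto_mult_right_zero)
  then show ?thesis by (simp add: poly_altdef sum_distrib_right mult.assoc)
qed

text \<open>At the origin the difference quotient is a polynomial in \<open>1 / t\<close> times \<open>exp (- c / t)\<close>, which
  decays.\<close>

lemma DERIV_flat:
  assumes "c > 0"
  shows "(flat c p has_real_derivative flat c (flat_step c p) t) (at t)"
proof -
  consider "t < 0" | "t > 0" | "t = 0" by linarith
  then show ?thesis
  proof cases
    case 1
    have "((\<lambda>_. 0) has_real_derivative 0) (at t)" by simp
    then have "(flat c p has_real_derivative 0) (at t)"
      by (rule has_field_derivative_transform_within_open[of _ _ _ "{..<0}"]) (use 1 in \<open>auto simp: flat_def\<close>)
    then show ?thesis using 1 by (simp add: flat_def)
  next
    case 2
    have "((\<lambda>t. poly p (1 / t) * exp (- c / t)) has_real_derivative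
        poly (flat_step c p) (1 / t) * exp (- c / t)) (at t)"
      unfolding flat_step_def using 2
      by (auto intro!: derivative_eq_intros DERIV_chain2[OF poly_DERIV] simp: field_simps power2_eq_square)
    then have "(flat c p has_real_derivative poly (flat_step c p) (1 / t) * exp (- c / t)) (at t)"
      by (rule has_field_derivative_transform_within_open[of _ _ _ "{0<..}"]) (use 2 in \<open>auto simp: flat_def\<close>)
    then show ?thesis using 2 by (simp add: flat_def)
  next
    case 3
    have "((\<lambda>y. flat c p y / y) \<longlongrightarrow> 0) (at_left 0)"
      by (rule tendsto_eventually) (auto simp: flat_def eventually_at_filter)
    moreover have "((\<lambda>y. flat c p y / y) \<longlongrightarrow> 0) (at_right 0)"
    proof (rule Lim_transform_eventually)
      show "((\<lambda>y. poly (pCons 0 p) (inverse y) * exp (- c * inverse y)) \<longlongrightarrow> 0) (at_right 0)"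
        using poly_times_exp_decay[OF assms, of "pCons 0 p"] filterlim_inverse_at_top_right
        by (rule filterlim_compose)
      show "\<forall>\<^sub>F y in at_right 0. poly (pCons 0 p) (inverse y) * exp (- c * inverse y) = flat c p y / y"
        by (auto simp: flat_def eventually_at_filter field_simps)
    qed
    ultimately have "((\<lambda>y. flat c p y / y) \<longlongrightarrow> 0) (at 0)"
      by (simp add: filterlim_at_split)
    then show ?thesis using 3 by (simp add: has_field_derivative_iff flat_def)
  qed
qed

lemma Ck_on_flat_ridge:
  fixes b :: "'a::euclidean_space"
  assumes "c > 0" shows "Ck_on k (\<lambda>x. flat c p (x \<bullet> b + d)) UNIV"
proof -
  have "((flat_step c ^^ j) p, (flat_step c ^^ Suc j) p) = ((flat_step c ^^ j) p, flat_step c ((flat_step c ^^ j) p))" for j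
    by simp
  then have "Ck_on k (\<lambda>x. 1 * flat c ((flat_step c ^^ 0) p) (x \<bullet> b + d)) UNIV"
    using Ck_on_ridge[of "\<lambda>j. flat c ((flat_step c ^^ j) p)" k 1 0 b d] DERIV_flat[OF assms] by simp
  then show ?thesis by simp
qed

text \<open>As \<open>\<kappa>\<close> tends to \<open>0\<close>, these functions increase to the indicator of the box.\<close>

definition box_bump :: "real \<Rightarrow> real^3 \<Rightarrow> real^3 \<Rightarrow> real^3 \<Rightarrow> real" where
  "box_bump \<kappa> c d x = (\<Prod>b\<in>Basis. flat \<kappa> [:1:] (x \<bullet> b - c \<bullet> b) * flat \<kappa> [:1:] (d \<bullet> b - x \<bullet> b))"

lemma smooth_box_bump:
  assumes "\<kappa> > 0" shows "smooth_on (box_bump \<kappa> c d) UNIV"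
  unfolding smooth_on_def
proof
  fix k
  have "Ck_on k (\<lambda>x. flat \<kappa> [:1:] (x \<bullet> b + (- (c \<bullet> b))) * flat \<kappa> [:1:] (x \<bullet> (- b) + d \<bullet> b)) UNIV" for b :: "real^3"
    by (intro Ck_on_mult Ck_on_flat_ridge assms)
  then show "Ck_on k (box_bump \<kappa> c d) UNIV"
    unfolding box_bump_def[abs_def] by (intro Ck_on_prod) (auto simp: algebra_simps)
qed

lemma box_bump_outside: "x \<notin> box c d \<Longrightarrow> box_bump \<kappa> c d x = 0"
  unfolding box_bump_def by (rule prod_zero) (force simp: mem_box flat_def)+

lemma box_bump_bounds: "\<kappa> > 0 \<Longrightarrow> 0 \<le> box_bump \<kappa> c d x" "\<kappa> > 0 \<Longrightarrow> box_bump \<kappa> c d x \<le> 1"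
  unfolding box_bump_def by (auto intro!: prod_nonneg prod_le_1 mult_le_one simp: flat_def)

lemma test_fun_box_bump:
  assumes "\<kappa> > 0" "cbox c d \<subseteq> \<Omega>" shows "test_fun \<Omega> (box_bump \<kappa> c d)"
  unfolding test_fun_def
proof (intro conjI exI allI impI)
  show "box_bump \<kappa> c d x = 0" if "x \<notin> cbox c d" for x
    using that box_subset_cbox[of c d] by (intro box_bump_outside) auto
qed (use smooth_box_bump[OF assms(1)] assms(2) in auto)

lemma box_bump_tendsto: "(\<lambda>n. box_bump (1 / real (Suc n)) c d x) \<longlonglongrightarrow> indicator (box c d) x"
proof (cases "x \<in> box c d")
  case True
  have "(\<lambda>n. \<Prod>b\<in>Basis. flat (1 / real (Suc n)) [:1:] (x \<bullet> b - c \<bullet> b) * flat (1 / real (Suc n)) [:1:] (d \<bullet> b - x \<bullet> b))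
     \<longlonglongrightarrow> (\<Prod>b\<in>(Basis::(real^3) set). 1 * 1)"
  proof (intro tendsto_prod tendsto_mult)
    have "(\<lambda>n. flat (1 / real (Suc n)) [:1:] t) \<longlonglongrightarrow> 1" if "t > 0" for t
    proof -
      have "(\<lambda>n. exp (- (1 / real (Suc n)) / t)) \<longlonglongrightarrow> exp (- 0 / t)"
        using that LIMSEQ_inverse_real_of_nat by (intro tendsto_intros) (auto simp: inverse_eq_divide)
      then show ?thesis using that by (simp add: flat_def)
    qed
    then show "(\<lambda>n. flat (1 / real (Suc n)) [:1:] (x \<bullet> b - c \<bullet> b)) \<longlonglongrightarrow> 1"
      "(\<lambda>n. flat (1 / real (Suc n)) [:1:] (d \<bullet> b - x \<bullet> b)) \<longlonglongrightarrow> 1" if "b \<in> Basis" for b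
      using True that by (auto simp: mem_box)
  qed
  then show ?thesis using True by (simp add: box_bump_def)
qed (simp add: box_bump_outside)

section \<open>The fundamental lemma of the calculus of variations\<close>

lemma continuous_imp_lebesgue_measurable:
  "continuous_on UNIV (\<phi> :: 'a::euclidean_space \<Rightarrow> 'b::topological_space) \<Longrightarrow> \<phi> \<in> borel_measurable lebesgue"
  using borel_measurable_continuous_onI measurable_completion measurable_lborel2 by blast

lemma test_fun_continuous: "test_fun \<Omega> \<phi> \<Longrightarrow> continuous_on UNIV \<phi>"
  unfolding test_fun_def smooth_on_def by (metis Ck_on.simps(1))

text \<open>Passing to the limit in the test functions \<open>box_bump\<close>, the integral of \<open>w\<close> over every box
  vanishes, and \<open>w\<close> vanishes at its Lebesgue points.\<close>

lemma fundamental_lemma: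
  fixes w :: "real^3 \<Rightarrow> real"
  assumes "open \<Omega>"
    and int: "\<And>c d. cbox c d \<subseteq> \<Omega> \<Longrightarrow> set_integrable lebesgue (cbox c d) w"
    and test: "\<And>\<phi>. test_fun \<Omega> \<phi> \<Longrightarrow> (LINT x|lebesgue. \<phi> x * w x) = 0"
  shows "AE x in lebesgue. x \<in> \<Omega> \<longrightarrow> w x = 0"
proof -
  have box0: "(LINT x:cbox c d|lebesgue. w x) = 0" if cd: "cbox c d \<subseteq> \<Omega>" for c d
  proof -
    have "(\<lambda>n. LINT x|lebesgue. box_bump (1 / real (Suc n)) c d x * w x) \<longlonglongrightarrow> (LINT x|lebesgue. indicator (box c d) x * w x)"
    proof (rule integral_dominated_convergence)
      have wm: "(\<lambda>x. indicator (cbox c d) x * w x) \<in> borel_measurable lebesgue"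
        using int[OF cd] by (auto simp: set_integrable_def)
      have eq: "indicator (box c d) x * (indicator (cbox c d) x * w x) = indicator (box c d) x * w x" for x
        using box_subset_cbox[of c d] by (auto simp: indicator_def)
      have "(\<lambda>x. indicator (box c d) x * (indicator (cbox c d) x * w x)) \<in> borel_measurable lebesgue"
        by (intro borel_measurable_times[OF _ wm] borel_measurable_indicator) auto
      then show "(\<lambda>x. indicator (box c d) x * w x) \<in> borel_measurable lebesgue" by (simp only: eq)
      show "(\<lambda>x. box_bump (1 / real (Suc n)) c d x * w x) \<in> borel_measurable lebesgue" for n
      proof -
        have m: "box_bump (1 / real (Suc n)) c d \<in> borel_measurable lebesgue"
          using smooth_box_bump[of "1 / real (Suc n)" c d] unfolding smooth_on_def
          by (intro continuous_imp_lebesgue_measurable) (metis Ck_on.simps(1) of_nat_0_less_iff zero_less_Suc zero_less_divide_1_iff)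
        have eq: "box_bump (1 / real (Suc n)) c d x * (indicator (cbox c d) x * w x) = box_bump (1 / real (Suc n)) c d x * w x" for x
          using box_subset_cbox[of c d] box_bump_outside[of x c d] by (auto simp: indicator_def)
        have "(\<lambda>x. box_bump (1 / real (Suc n)) c d x * (indicator (cbox c d) x * w x)) \<in> borel_measurable lebesgue"
          using m wm by (rule borel_measurable_times)
        then show ?thesis by (simp only: eq)
      qed
      show "integrable lebesgue (\<lambda>x. norm (indicator (cbox c d) x * w x))"
        using int[OF cd] by (auto simp: set_integrable_def)
      show "AE x in lebesgue. (\<lambda>n. box_bump (1 / real (Suc n)) c d x * w x) \<longlonglongrightarrow> indicator (box c d) x * w x"
        by (intro AE_I2 tendsto_mult_right box_bump_tendsto)
      show "AE x in lebesgue. norm (box_bump (1 / real (Suc n)) c d x * w x) \<le> norm (indicator (cbox c d) x * w x)" for n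
      proof (rule AE_I2)
        fix x
        show "norm (box_bump (1 / real (Suc n)) c d x * w x) \<le> norm (indicator (cbox c d) x * w x)"
          using box_subset_cbox[of c d] box_bump_outside[of x c d] box_bump_bounds[of "1 / real (Suc n)" c d x]
          by (cases "x \<in> box c d") (auto simp: abs_mult indicator_def intro!: mult_left_le_one_le)
      qed
    qed
    moreover have "(LINT x|lebesgue. box_bump (1 / real (Suc n)) c d x * w x) = 0" for n
      using test test_fun_box_bump[OF _ cd] by simp
    ultimately have "(LINT x|lebesgue. indicator (box c d) x * w x) = 0"
      by (simp add: LIMSEQ_const_iff)
    moreover have "(LINT x|lebesgue. indicator (box c d) x * w x) = (LINT x:cbox c d|lebesgue. w x)"
    proof -
      have "(LINT x:box c d|lebesgue. w x) = (LINT x:cbox c d|lebesgue. w x)"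
      proof -
        have wb: "set_integrable lebesgue (box c d) w"
          by (intro set_integrable_subset[OF int[OF cd]] box_subset_cbox) auto
        have "integral (box c d) w = integral (cbox c d) w"
          by (rule integral_open_interval)
        then show ?thesis using set_lebesgue_integral_eq_integral(2)[OF wb] set_lebesgue_integral_eq_integral(2)[OF int[OF cd]] by simp
      qed
      then show ?thesis by (simp add: set_lebesgue_integral_def)
    qed
    ultimately show ?thesis by simp
  qed
  have local: "AE x in lebesgue. x \<in> box p q \<longrightarrow> w x = 0" if pq: "cbox p q \<subseteq> \<Omega>" for p q
  proof -
    let ?f = "\<lambda>x. if x \<in> cbox p q then w x else 0"
    have "set_integrable lebesgue UNIV ?f"
      using int[OF pq] unfolding set_integrable_def by (rule Bochner_Integration.integrable_cong[THEN iffD1, rotated -1]) (auto simp: indicator_def)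
    then have "set_integrable lebesgue (cbox a b) ?f" for a b
      by (rule set_integrable_subset) auto
    then have "?f integrable_on cbox a b" for a b
      by (rule set_lebesgue_integral_eq_integral(1))
    then obtain N where N: "negligible N" "\<And>x e. \<lbrakk>x \<notin> N; 0 < e\<rbrakk> \<Longrightarrow>
               \<exists>d>0. \<forall>h. 0 < h \<and> h < d \<longrightarrow> norm(integral (cbox x (x + h *\<^sub>R One)) ?f /\<^sub>R h ^ DIM(real^3) - ?f x) < e"
      using integrable_ccontinuous_explicit[of ?f] by blast
    have "w x = 0" if x: "x \<in> box p q" "x \<notin> N" for x
    proof (rule ccontr)
      assume "w x \<noteq> 0"
      then obtain d where d: "d > 0" "\<And>h. 0 < h \<Longrightarrow> h < d \<Longrightarrow> norm(integral (cbox x (x + h *\<^sub>R One)) ?f /\<^sub>R h ^ DIM(real^3) - ?f x) < \<bar>w x\<bar>"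
        using N(2)[OF x(2), of "\<bar>w x\<bar>"] by auto
      have "\<exists>r>0. cball x r \<subseteq> box p q" using open_box x(1) by (rule open_contains_cball[THEN iffD1, rule_format])
      then obtain r where r: "r > 0" "cball x r \<subseteq> box p q" by blast
      define h where "h = min (d / 2) (r / (1 + norm (One::real^3)))"
      have "h > 0" "h < d" using d(1) r(1) by (auto simp: h_def intro!: divide_pos_pos add_pos_nonneg)
      have "norm (h *\<^sub>R One :: real^3) \<le> r"
      proof -
        have "h * norm (One::real^3) \<le> (r / (1 + norm (One::real^3))) * (1 + norm (One::real^3))"
          by (intro mult_mono) (use r in \<open>auto simp: h_def\<close>)
        also have "\<dots> = r"
        proof -
          have "1 + norm (One::real^3) > 0" using norm_ge_zero[of "One::real^3"] by linarith
          then show ?thesis by simp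
        qed
        finally show ?thesis using \<open>h > 0\<close> by simp
      qed
      moreover have "norm (y - x) \<le> norm (h *\<^sub>R One :: real^3)" if "y \<in> cbox x (x + h *\<^sub>R One)" for y
        using that by (intro norm_le_componentwise) (auto simp: mem_box inner_diff_left inner_add_left)
      ultimately have sub: "cbox x (x + h *\<^sub>R One) \<subseteq> cball x r"
        by (force simp: dist_norm norm_minus_commute)
      then have sub': "cbox x (x + h *\<^sub>R One) \<subseteq> cbox p q" using r(2) box_subset_cbox by blast
      then have "integral (cbox x (x + h *\<^sub>R One)) ?f = integral (cbox x (x + h *\<^sub>R One)) w"
        by (intro integral_cong) auto
      also have "\<dots> = (LINT x:cbox x (x + h *\<^sub>R One)|lebesgue. w x)"
        using sub' pq by (intro set_lebesgue_integral_eq_integral(2)[symmetric] int) auto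
      also have "\<dots> = 0" using sub' pq by (intro box0) auto
      finally show False using d(2)[OF \<open>h > 0\<close> \<open>h < d\<close>] x(1) box_subset_cbox[of p q] by auto
    qed
    moreover have "AE x in lebesgue. x \<notin> N"
      using N(1) by (simp add: AE_not_in negligible_iff_null_sets)
    ultimately show ?thesis by (auto elim: eventually_mono)
  qed
  obtain \<D> where D: "countable \<D>" "\<And>X. X \<in> \<D> \<Longrightarrow> \<exists>a b. X = cbox a b" "\<Union>\<D> = \<Omega>" "\<And>X. X \<in> \<D> \<Longrightarrow> X \<subseteq> \<Omega>"
  proof -
    obtain \<D> where "countable \<D>" "\<D> \<subseteq> Pow \<Omega>" "\<And>X. X \<in> \<D> \<Longrightarrow> \<exists>a b. X = cbox a b" "\<Union>\<D> = \<Omega>"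
      using open_countable_Union_open_cbox[OF \<open>open \<Omega>\<close>] by metis
    then show ?thesis by (intro that[of \<D>]) auto
  qed
  have "AE x in lebesgue. \<forall>X\<in>\<D>. x \<in> X \<longrightarrow> w x = 0"
    unfolding AE_ball_countable[OF D(1)]
  proof
    fix X assume X: "X \<in> \<D>"
    then obtain a b where ab: "X = cbox a b" "cbox a b \<subseteq> \<Omega>" using D by blast
    have "AE x in lebesgue. x \<notin> cbox a b - box a b"
      by (rule AE_not_in) (simp add: negligible_iff_null_sets[symmetric] negligible_frontier_interval)
    then show "AE x in lebesgue. x \<in> X \<longrightarrow> w x = 0"
      using local[OF ab(2)] unfolding ab(1) by eventually_elim auto
  qed
  then show ?thesis using D(3) by (auto elim!: eventually_mono)
qed

section \<open>Integration by parts for test functions\<close>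

lemma test_fun_has_derivative:
  assumes "test_fun \<Omega> \<phi>"
  shows "(\<phi> has_derivative (\<lambda>v. cgrad \<phi> x \<bullet> v)) (at x)"
proof -
  have "Ck_on (Suc 0) \<phi> UNIV" using assms unfolding test_fun_def smooth_on_def by blast
  then have der: "(\<phi> has_derivative frechet_derivative \<phi> (at x)) (at x)"
    by (auto simp: frechet_derivative_works)
  interpret bounded_linear "frechet_derivative \<phi> (at x)" using der by (rule has_derivative_bounded_linear)
  have "frechet_derivative \<phi> (at x) = (\<lambda>v. cgrad \<phi> x \<bullet> v)"
  proof
    fix v :: "real^3"
    have "v = (\<Sum>i\<in>UNIV. (v $ i) *\<^sub>R axis i 1)" by (simp add: vec_eq_iff axis_def if_distrib cong: if_cong)
    then have "frechet_derivative \<phi> (at x) v = frechet_derivative \<phi> (at x) (\<Sum>i\<in>UNIV. (v $ i) *\<^sub>R axis i 1)" by simp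
    also have "\<dots> = (\<Sum>i\<in>UNIV. (v $ i) * frechet_derivative \<phi> (at x) (axis i 1))"
      by (simp add: sum scaleR)
    also have "\<dots> = cgrad \<phi> x \<bullet> v" by (simp add: cgrad_def inner_vec_def mult.commute)
    finally show "frechet_derivative \<phi> (at x) v = cgrad \<phi> x \<bullet> v" .
  qed
  then show ?thesis using der by (simp only:)
qed

lemma cgrad_eqI: "(\<phi> has_derivative (\<lambda>v. p \<bullet> v)) (at x) \<Longrightarrow> cgrad \<phi> x = p"
  by (subst vec_eq_iff) (simp add: cgrad_def frechet_derivative_at[symmetric] inner_axis)

lemma test_fun_cgrad_continuous:
  assumes "test_fun \<Omega> \<phi>" shows "continuous_on UNIV (cgrad \<phi>)"
proof -
  have "Ck_on (Suc 0) \<phi> UNIV" using assms unfolding test_fun_def smooth_on_def by blast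
  then show ?thesis unfolding cgrad_def[abs_def]
    by (intro continuous_on_vec_lambda) (auto simp: axis_in_Basis_iff)
qed

lemma test_fun_support:
  assumes "test_fun \<Omega> \<phi>"
  shows "\<exists>C. compact C \<and> C \<subseteq> \<Omega> \<and> (\<forall>x. x \<notin> C \<longrightarrow> \<phi> x = 0 \<and> cgrad \<phi> x = 0)"
proof -
  obtain C where C: "compact C" "C \<subseteq> \<Omega>" "\<And>x. x \<notin> C \<Longrightarrow> \<phi> x = 0"
    using assms unfolding test_fun_def by blast
  have "cgrad \<phi> x = 0" if "x \<notin> C" for x
  proof (rule cgrad_eqI)
    have "((\<lambda>_. 0) has_derivative (\<lambda>v. 0 \<bullet> v)) (at x)" by simp
    then show "(\<phi> has_derivative (\<lambda>v. 0 \<bullet> v)) (at x)"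
      by (rule has_derivative_transform_within_open[of _ _ _ _ "- C"])
        (use that C in \<open>auto simp: compact_imp_closed open_Compl\<close>)
  qed
  then show ?thesis using C by blast
qed

lemma integrable_continuous_compact_support:
  fixes u :: "real^3 \<Rightarrow> 'b::euclidean_space"
  assumes "continuous_on UNIV u" "compact C" "\<And>x. x \<notin> C \<Longrightarrow> u x = 0"
  shows "integrable lebesgue u"
proof -
  have "integrable lborel (\<lambda>x. indicator C x *\<^sub>R u x)"
    using assms(1,2) by (intro borel_integrable_compact) (auto intro: continuous_on_subset)
  then have "integrable lebesgue (\<lambda>x. indicator C x *\<^sub>R u x)"
    by (subst integrable_completion) auto
  moreover have "indicator C x *\<^sub>R u x = u x" for x using assms(3) by (auto simp: indicator_def)
  ultimately show ?thesis by simp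
qed

lemma sq_integrable_continuous_compact_support:
  fixes u :: "real^3 \<Rightarrow> 'b::euclidean_space"
  assumes "continuous_on UNIV u" "compact C" "\<And>x. x \<notin> C \<Longrightarrow> u x = 0"
  shows "sq_integrable u"
  unfolding sq_integrable_def
proof
  show "integrable lebesgue (\<lambda>x. (norm (u x))\<^sup>2)"
    by (rule integrable_continuous_compact_support[of _ C]) (use assms in \<open>auto intro!: continuous_intros\<close>)
qed (use assms(1) in \<open>rule continuous_imp_lebesgue_measurable\<close>)

lemma sq_integrable_test_fun: "test_fun \<Omega> \<phi> \<Longrightarrow> sq_integrable \<phi>"
  by (meson test_fun_support sq_integrable_continuous_compact_support test_fun_continuous)

lemma sq_integrable_cgrad: "test_fun \<Omega> \<phi> \<Longrightarrow> sq_integrable (cgrad \<phi>)"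
  by (meson test_fun_support sq_integrable_continuous_compact_support test_fun_cgrad_continuous)

lemma integral_translate_continuous:
  fixes u :: "real^3 \<Rightarrow> 'b::euclidean_space"
  assumes "continuous_on UNIV u"
  shows "(LINT x|lebesgue. u (x + h)) = (LINT x|lebesgue. u x)"
proof -
  have m: "u \<in> borel_measurable borel" using assms by (rule borel_measurable_continuous_onI)
  have "(LINT x|lebesgue. u (x + h)) = (LINT x|lborel. u (h + x))"
    using m by (subst integral_completion) (auto simp: add.commute)
  also have "\<dots> = (LINT x|distr lborel borel ((+) h). u x)"
    using m by (subst integral_distr) auto
  also have "\<dots> = (LINT x|lebesgue. u x)"
    using m by (simp add: lborel_distr_plus integral_completion)
  finally show ?thesis .
qed

lemma derivative_along_line:
  fixes \<psi> :: "real^3 \<Rightarrow> real"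
  assumes "\<And>x. (\<psi> has_derivative (\<lambda>v. q x \<bullet> v)) (at x)"
  shows "((\<lambda>t. \<psi> (x + t *\<^sub>R e)) has_real_derivative (q (x + t *\<^sub>R e) \<bullet> e)) (at t)"
proof -
  have "((\<lambda>t. x + t *\<^sub>R e) has_derivative (\<lambda>r. r *\<^sub>R e)) (at t)"
    by (auto intro!: derivative_eq_intros)
  then have "((\<lambda>t. \<psi> (x + t *\<^sub>R e)) has_derivative (\<lambda>r. q (x + t *\<^sub>R e) \<bullet> (r *\<^sub>R e))) (at t)"
    using assms by (rule has_derivative_compose)
  moreover have "(\<lambda>r. q (x + t *\<^sub>R e) \<bullet> (r *\<^sub>R e)) = (*) (q (x + t *\<^sub>R e) \<bullet> e)" by (auto simp: mult.commute)
  ultimately show ?thesis by (simp add: has_field_derivative_def)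
qed

text \<open>The difference quotients of \<open>\<psi>\<close> have integral zero by translation invariance, and they are
  dominated, so the integral of the directional derivative vanishes.\<close>

lemma integral_derivative_eq_0:
  fixes \<psi> :: "real^3 \<Rightarrow> real"
  assumes der: "\<And>x. (\<psi> has_derivative (\<lambda>v. q x \<bullet> v)) (at x)"
    and q: "continuous_on UNIV q" and C: "compact C" "\<And>x. x \<notin> C \<Longrightarrow> \<psi> x = 0" "\<And>x. x \<notin> C \<Longrightarrow> q x = 0"
  shows "(LINT x|lebesgue. q x \<bullet> e) = 0"
proof -
  have cont: "continuous_on UNIV \<psi>"
    using der by (meson continuous_at_imp_continuous_on has_derivative_continuous)
  have int: "integrable lebesgue \<psi>" using integrable_continuous_compact_support[OF cont C(1,2)] .
  have qe: "continuous_on UNIV (\<lambda>x. q x \<bullet> e)" using q by (intro continuous_intros)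
  obtain K where K: "\<And>x. \<bar>q x \<bullet> e\<bar> \<le> K" "K \<ge> 0"
  proof -
    have "bounded ((\<lambda>x. q x \<bullet> e) ` C)"
      using C(1) qe by (meson compact_continuous_image compact_imp_bounded continuous_on_subset subset_UNIV)
    then obtain K where "K > 0" "\<And>x. x \<in> C \<Longrightarrow> \<bar>q x \<bullet> e\<bar> \<le> K" by (auto simp: bounded_pos)
    then show ?thesis using C(3) by (intro that[of K]) (metis abs_zero inner_zero_left less_imp_le, simp)
  qed
  obtain R where R: "\<And>x. x \<in> C \<Longrightarrow> norm x \<le> R" using compact_imp_bounded[OF C(1)] by (auto simp: bounded_iff)
  define s where "s n x = (\<psi> (x + (1 / real (Suc n)) *\<^sub>R e) - \<psi> x) * real (Suc n)" for n x
  have s_cont: "continuous_on UNIV (s n)" for n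
    unfolding s_def[abs_def] by (intro continuous_intros continuous_on_compose2[OF cont]) auto
  have "(\<lambda>n. LINT x|lebesgue. s n x) \<longlonglongrightarrow> (LINT x|lebesgue. q x \<bullet> e)"
  proof (rule integral_dominated_convergence)
    show "(\<lambda>x. q x \<bullet> e) \<in> borel_measurable lebesgue" "s n \<in> borel_measurable lebesgue" for n
      using qe s_cont by (auto intro: continuous_imp_lebesgue_measurable)
    show "integrable lebesgue (\<lambda>x::real^3. K * indicator (cball 0 (R + norm e)) x)"
      using emeasure_bounded_finite[of "cball (0::real^3) (R + norm e)"] by (intro integrable_mult_right integrable_real_indicator) auto
    show "AE x in lebesgue. (\<lambda>n. s n x) \<longlonglongrightarrow> q x \<bullet> e"
    proof (rule AE_I2)
      fix x
      have "((\<lambda>t. \<psi> (x + t *\<^sub>R e)) has_real_derivative (q x \<bullet> e)) (at 0)"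
        using derivative_along_line[OF der, of x e 0] by simp
      then have lim: "((\<lambda>t. (\<psi> (x + t *\<^sub>R e) - \<psi> x) / t) \<longlongrightarrow> q x \<bullet> e) (at 0)"
        by (simp add: has_field_derivative_iff)
      have "filterlim (\<lambda>n. 1 / real (Suc n)) (at 0) sequentially"
        using LIMSEQ_inverse_real_of_nat by (auto simp: filterlim_at inverse_eq_divide)
      from filterlim_compose[OF lim this] show "(\<lambda>n. s n x) \<longlonglongrightarrow> q x \<bullet> e"
        by (simp add: s_def)
    qed
    show "AE x in lebesgue. norm (s n x) \<le> K * indicator (cball 0 (R + norm e)) x" for n
    proof (rule AE_I2)
      fix x
      let ?t = "1 / real (Suc n)"
      have t: "0 < ?t" "?t \<le> 1" by auto
      show "norm (s n x) \<le> K * indicator (cball 0 (R + norm e)) x"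
      proof (cases "norm x \<le> R + norm e")
        case True
        have "((\<lambda>t. \<psi> (x + t *\<^sub>R e)) has_real_derivative (q (x + t *\<^sub>R e) \<bullet> e)) (at t)" for t
          by (rule derivative_along_line[OF der])
        then obtain z where z: "\<psi> (x + ?t *\<^sub>R e) - \<psi> (x + 0 *\<^sub>R e) = (?t - 0) * (q (x + z *\<^sub>R e) \<bullet> e)"
          using MVT2[of 0 ?t "\<lambda>t. \<psi> (x + t *\<^sub>R e)" "\<lambda>t. q (x + t *\<^sub>R e) \<bullet> e"] t(1) by blast
        then have "s n x = q (x + z *\<^sub>R e) \<bullet> e" by (simp add: s_def)
        then show ?thesis using K True by (simp add: indicator_def)
      next
        case False
        have "norm (?t *\<^sub>R e) = ?t * norm e" using t by (simp only: norm_scaleR abs_of_pos)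
        then have "norm (?t *\<^sub>R e) \<le> norm e" using mult_right_mono[OF t(2), of "norm e"] by simp
        then have "norm (x + ?t *\<^sub>R e) > R" using False norm_triangle_ineq4[of "x + ?t *\<^sub>R e" "?t *\<^sub>R e"] by simp
        moreover have "norm x > R" using False norm_ge_zero[of e] by linarith
        ultimately have "\<psi> (x + ?t *\<^sub>R e) = 0" "\<psi> x = 0" using R C(2) by (meson leD)+
        then show ?thesis using K(2) by (simp add: s_def)
      qed
    qed
  qed
  moreover have "(LINT x|lebesgue. s n x) = 0" for n
  proof -
    have i: "integrable lebesgue (\<lambda>x. \<psi> (x + (1 / real (Suc n)) *\<^sub>R e))"
    proof (rule integrable_continuous_compact_support[where C = "(\<lambda>y. - ((1 / real (Suc n)) *\<^sub>R e) + y) ` C"])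
      show "continuous_on UNIV (\<lambda>x. \<psi> (x + (1 / real (Suc n)) *\<^sub>R e))"
        by (intro continuous_intros continuous_on_compose2[OF cont]) auto
      show "compact ((\<lambda>y. - ((1 / real (Suc n)) *\<^sub>R e) + y) ` C)" using C(1) by (rule compact_translation)
      show "\<psi> (x + (1 / real (Suc n)) *\<^sub>R e) = 0" if "x \<notin> (\<lambda>y. - ((1 / real (Suc n)) *\<^sub>R e) + y) ` C" for x
        using that by (intro C(2)) (metis (no_types, lifting) add.commute add_diff_cancel_right' image_eqI uminus_add_conv_diff)
    qed
    have "(LINT x|lebesgue. s n x) = ((LINT x|lebesgue. \<psi> (x + (1 / real (Suc n)) *\<^sub>R e)) - (LINT x|lebesgue. \<psi> x)) * real (Suc n)"
      unfolding s_def using int i by (simp del: of_nat_Suc)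
    then show ?thesis using integral_translate_continuous[OF cont] by simp
  qed
  ultimately show ?thesis by (simp add: LIMSEQ_const_iff)
qed

lemma integrable_scaleR_sq:
  fixes p :: "real^3 \<Rightarrow> 'b::euclidean_space"
  assumes "sq_integrable \<phi>" "sq_integrable p"
  shows "integrable lebesgue (\<lambda>x. \<phi> x *\<^sub>R p x)"
proof (rule Bochner_Integration.integrable_bound)
  show "integrable lebesgue (\<lambda>x. (norm (\<phi> x))\<^sup>2 + (norm (p x))\<^sup>2)"
    using assms by (auto simp: sq_integrable_def)
  show "(\<lambda>x. \<phi> x *\<^sub>R p x) \<in> borel_measurable lebesgue" using assms by (auto simp: sq_integrable_def)
  show "AE x in lebesgue. norm (\<phi> x *\<^sub>R p x) \<le> norm ((norm (\<phi> x))\<^sup>2 + (norm (p x))\<^sup>2)"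
  proof (rule AE_I2)
    fix x
    have "2 * (norm (\<phi> x) * norm (p x)) \<le> (norm (\<phi> x))\<^sup>2 + (norm (p x))\<^sup>2"
      using sum_squares_bound[of "norm (\<phi> x)" "norm (p x)"] by simp
    moreover have "0 \<le> norm (\<phi> x) * norm (p x)" by simp
    ultimately have "norm (\<phi> x) * norm (p x) \<le> (norm (\<phi> x))\<^sup>2 + (norm (p x))\<^sup>2" by linarith
    then show "norm (\<phi> x *\<^sub>R p x) \<le> norm ((norm (\<phi> x))\<^sup>2 + (norm (p x))\<^sup>2)" by simp
  qed
qed

text \<open>Integration by parts, as the product \<open>\<phi> * \<psi>\<close> has compact support and its derivative has
  integral zero.\<close>

lemma has_weak_grad_test_fun:
  assumes "test_fun \<Omega>' \<phi>"
  shows "has_weak_grad \<Omega> \<phi> (cgrad \<phi>)"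
  unfolding has_weak_grad_def
proof (intro allI impI)
  fix \<psi> assume psi: "test_fun \<Omega> \<psi>"
  obtain C where C: "compact C" "\<And>x. x \<notin> C \<Longrightarrow> \<phi> x = 0" "\<And>x. x \<notin> C \<Longrightarrow> cgrad \<phi> x = 0"
    using test_fun_support[OF assms] by blast
  let ?q = "\<lambda>x. \<phi> x *\<^sub>R cgrad \<psi> x + \<psi> x *\<^sub>R cgrad \<phi> x"
  have i1: "integrable lebesgue (\<lambda>x. \<phi> x *\<^sub>R cgrad \<psi> x)"
    by (intro integrable_scaleR_sq sq_integrable_cgrad[OF psi] sq_integrable_test_fun[OF assms])
  have i2: "integrable lebesgue (\<lambda>x. \<psi> x *\<^sub>R cgrad \<phi> x)"
    by (intro integrable_scaleR_sq sq_integrable_cgrad[OF assms] sq_integrable_test_fun[OF psi])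
  have "(LINT x|lebesgue. ?q x) \<bullet> e = 0" for e
  proof -
    have "(LINT x|lebesgue. ?q x \<bullet> e) = 0"
    proof (rule integral_derivative_eq_0[of "\<lambda>x. \<phi> x * \<psi> x" _ C])
      show "((\<lambda>x. \<phi> x * \<psi> x) has_derivative (\<lambda>v. ?q x \<bullet> v)) (at x)" for x
        by (auto intro!: derivative_eq_intros test_fun_has_derivative[OF assms] test_fun_has_derivative[OF psi]
            simp: inner_add_left)
      show "continuous_on UNIV ?q"
        by (intro continuous_intros test_fun_continuous[OF assms] test_fun_continuous[OF psi]
            test_fun_cgrad_continuous[OF assms] test_fun_cgrad_continuous[OF psi])
    qed (use C in auto)
    moreover have "(LINT x|lebesgue. ?q x \<bullet> e) = (LINT x|lebesgue. ?q x) \<bullet> e"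
      using Bochner_Integration.integrable_add[OF i1 i2] by (rule integral_inner_left)
    ultimately show ?thesis by simp
  qed
  from this[of "LINT x|lebesgue. ?q x"] have "(LINT x|lebesgue. ?q x) = 0"
    by (simp only: inner_eq_zero_iff)
  then show "(LINT x|lebesgue. \<phi> x *\<^sub>R cgrad \<psi> x) = - (LINT x|lebesgue. \<psi> x *\<^sub>R cgrad \<phi> x)"
    unfolding Bochner_Integration.integral_add[OF i1 i2] by (rule eq_neg_iff_add_eq_0[THEN iffD2])
qed

section \<open>The Sobolev inequality\<close>

text \<open>The coordinates of \<open>real^3\<close> as a nested product, for iterated integration.\<close>

definition coords3 :: "real \<times> real \<times> real \<Rightarrow> real^3" where
  "coords3 p = fst p *\<^sub>R axis 1 1 + fst (snd p) *\<^sub>R axis 2 1 + snd (snd p) *\<^sub>R axis 3 1"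

lemma coords3_nth [simp]:
  "coords3 p $ 1 = fst p" "coords3 p $ 2 = fst (snd p)" "coords3 p $ 3 = snd (snd p)"
  by (simp_all add: coords3_def axis_def)

lemma continuous_coords3: "continuous_on UNIV coords3"
  unfolding coords3_def[abs_def] by (intro continuous_intros)

lemma measurable_coords3 [measurable]: "coords3 \<in> borel \<rightarrow>\<^sub>M borel"
  using continuous_coords3 by (rule borel_measurable_continuous_onI)

text \<open>Both measures agree on boxes, so Tonelli's theorem becomes available for \<open>real^3\<close>.\<close>

lemma lborel_coords3: "distr lborel borel coords3 = lborel"
proof (rule lborel_eqI[symmetric])
  fix l u :: "real^3"
  assume le: "\<And>b. b \<in> Basis \<Longrightarrow> l \<bullet> b \<le> u \<bullet> b"
  have le': "l $ i \<le> u $ i" for i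
    using le[of "axis i 1"] by (simp add: axis_in_Basis_iff inner_axis)
  have "coords3 -` box l u = {l$1<..<u$1} \<times> {l$2<..<u$2} \<times> {l$3<..<u$3}"
    by (auto simp: mem_box_cart forall_3)
  then have "emeasure (distr lborel borel coords3) (box l u)
     = emeasure (lborel \<Otimes>\<^sub>M lborel \<Otimes>\<^sub>M lborel) ({l$1<..<u$1} \<times> ({l$2<..<u$2} \<times> {l$3<..<u$3}))"
    by (subst emeasure_distr) (auto simp: lborel_prod)
  also have "\<dots> = emeasure lborel {l$1<..<u$1} * emeasure (lborel \<Otimes>\<^sub>M lborel) ({l$2<..<u$2} \<times> {l$3<..<u$3})"
  proof (rule sigma_finite_measure.emeasure_pair_measure_Times)
    show "sigma_finite_measure (lborel \<Otimes>\<^sub>M lborel :: (real \<times> real) measure)"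
      by (simp add: lborel_prod sigma_finite_lborel)
  qed auto
  also have "\<dots> = ennreal ((u$1 - l$1) * ((u$2 - l$2) * (u$3 - l$3)))"
    using le' by (subst lborel.emeasure_pair_measure_Times) (auto simp: ennreal_mult)
  also have "(u$1 - l$1) * ((u$2 - l$2) * (u$3 - l$3)) = (\<Prod>b\<in>Basis. (u - l) \<bullet> b)"
  proof -
    have B: "(Basis :: (real^3) set) = range (\<lambda>i. axis i 1)" by (auto simp: Basis_vec_def)
    have "inj (\<lambda>i::3. axis i (1::real))" by (auto simp: inj_def axis_eq_axis)
    then have "(\<Prod>b\<in>Basis. (u - l) \<bullet> b) = (\<Prod>i\<in>UNIV. (u - l) \<bullet> axis i 1)"
      unfolding B by (subst prod.reindex) auto
    then have "(\<Prod>b\<in>Basis. (u - l) \<bullet> b) = (\<Prod>i\<in>UNIV. (u - l) $ i)"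
      by (simp add: inner_axis)
    moreover have "(\<Prod>i\<in>UNIV. (u - l) $ i) = (u$1 - l$1) * ((u$2 - l$2) * (u$3 - l$3))"
      unfolding UNIV_3 by simp
    ultimately show ?thesis by (simp only:)
  qed
  finally show "emeasure (distr lborel borel coords3) (box l u) = ennreal (\<Prod>b\<in>Basis. (u - l) \<bullet> b)" .
qed simp

lemma nn_integral_coords3:
  assumes [measurable]: "w \<in> borel_measurable borel"
  shows "(\<integral>\<^sup>+x. w x \<partial>lborel) = (\<integral>\<^sup>+x. \<integral>\<^sup>+y. \<integral>\<^sup>+z. w (coords3 (x, y, z)) \<partial>lborel \<partial>lborel \<partial>lborel)"
proof -
  have m: "(\<lambda>p. w (coords3 p)) \<in> borel_measurable (lborel \<Otimes>\<^sub>M lborel)" by (simp add: lborel_prod)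
  have m': "(\<lambda>q. w (coords3 (x, q))) \<in> borel_measurable (lborel \<Otimes>\<^sub>M lborel)" for x
  proof -
    have "(\<lambda>q. coords3 (x, q)) \<in> borel \<rightarrow>\<^sub>M borel"
      unfolding coords3_def by (intro borel_measurable_continuous_onI) (auto intro!: continuous_intros)
    then show ?thesis by (simp add: lborel_prod)
  qed
  have "(\<integral>\<^sup>+x. w x \<partial>lborel) = (\<integral>\<^sup>+x. w x \<partial>distr lborel borel coords3)" by (simp add: lborel_coords3)
  also have "\<dots> = (\<integral>\<^sup>+p. w (coords3 p) \<partial>(lborel \<Otimes>\<^sub>M lborel))"
    by (subst nn_integral_distr) (auto simp: lborel_prod)
  also have "\<dots> = (\<integral>\<^sup>+x. \<integral>\<^sup>+q. w (coords3 (x, q)) \<partial>lborel \<partial>lborel)"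
    by (rule lborel.nn_integral_fst[OF m, symmetric])
  also have "\<dots> = (\<integral>\<^sup>+x. \<integral>\<^sup>+y. \<integral>\<^sup>+z. w (coords3 (x, y, z)) \<partial>lborel \<partial>lborel \<partial>lborel)"
  proof (rule nn_integral_cong)
    fix x
    show "(\<integral>\<^sup>+q. w (coords3 (x, q)) \<partial>lborel) = (\<integral>\<^sup>+y. \<integral>\<^sup>+z. w (coords3 (x, y, z)) \<partial>lborel \<partial>lborel)"
      using lborel.nn_integral_fst[OF m'[of x]] by (simp add: lborel_prod)
  qed
  finally show ?thesis .
qed

definition ennsqrt :: "ennreal \<Rightarrow> ennreal" where
  "ennsqrt t = (if t = top then top else ennreal (sqrt (enn2real t)))"

lemma measurable_ennsqrt [measurable]: "ennsqrt \<in> borel_measurable borel"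
  unfolding ennsqrt_def[abs_def] by measurable

lemma ennsqrt_power2 [simp]: "(ennsqrt t)\<^sup>2 = t"
  by (cases t) (auto simp: ennsqrt_def ennreal_power power2_eq_square ennreal_mult[symmetric])

lemma ennreal_power2_le_imp_le:
  fixes x y :: ennreal assumes "x\<^sup>2 \<le> y\<^sup>2" shows "x \<le> y"
  using assms
proof (cases x; cases y)
  fix r s assume "x = ennreal r" "0 \<le> r" "y = ennreal s" "0 \<le> s"
  then show ?thesis using assms by (simp add: ennreal_power)
next
  fix s assume "x = top" "y = ennreal s" "0 \<le> s"
  then show ?thesis using assms by (simp add: power2_eq_square ennreal_mult[symmetric] top_unique)
qed auto

text \<open>The inequality of Loomis and Whitney, in the form with squared functions: each of the
  two applications of the Cauchy-Schwarz inequality separates one more variable.\<close>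

lemma Loomis_Whitney:
  fixes f g h :: "real \<times> real \<Rightarrow> ennreal"
  assumes [measurable]: "f \<in> borel_measurable (lborel \<Otimes>\<^sub>M lborel)" "g \<in> borel_measurable (lborel \<Otimes>\<^sub>M lborel)" "h \<in> borel_measurable (lborel \<Otimes>\<^sub>M lborel)"
  shows "(\<integral>\<^sup>+x. \<integral>\<^sup>+y. \<integral>\<^sup>+z. f (y, z) * (g (x, z) * h (x, y)) \<partial>lborel \<partial>lborel \<partial>lborel)\<^sup>2
    \<le> (\<integral>\<^sup>+y. \<integral>\<^sup>+z. (f (y, z))\<^sup>2 \<partial>lborel \<partial>lborel) *
       ((\<integral>\<^sup>+x. \<integral>\<^sup>+z. (g (x, z))\<^sup>2 \<partial>lborel \<partial>lborel) * (\<integral>\<^sup>+x. \<integral>\<^sup>+y. (h (x, y))\<^sup>2 \<partial>lborel \<partial>lborel))"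
proof -
  have [measurable_cong]: "sets (lborel :: real measure) = sets borel" by simp
  define A where "A = (\<integral>\<^sup>+y. \<integral>\<^sup>+z. (f (y, z))\<^sup>2 \<partial>lborel \<partial>lborel)"
  define G where "G x = (\<integral>\<^sup>+z. (g (x, z))\<^sup>2 \<partial>lborel)" for x
  define H where "H x = (\<integral>\<^sup>+y. (h (x, y))\<^sup>2 \<partial>lborel)" for x
  define I where "I x = (\<integral>\<^sup>+y. \<integral>\<^sup>+z. f (y, z) * (g (x, z) * h (x, y)) \<partial>lborel \<partial>lborel)" for x
  have [measurable]: "G \<in> borel_measurable lborel" "H \<in> borel_measurable lborel"
    unfolding G_def[abs_def] H_def[abs_def] by measurable
  have I2: "(I x)\<^sup>2 \<le> A * (G x * H x)" for x
  proof -
    have [measurable]: "(\<lambda>p. g (x, snd p)) \<in> borel_measurable (lborel \<Otimes>\<^sub>M lborel)"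
      "(\<lambda>p. h (x, fst p)) \<in> borel_measurable (lborel \<Otimes>\<^sub>M lborel)"
      by (rule measurable_compose[OF measurable_Pair assms(2)] measurable_compose[OF measurable_Pair assms(3)]; simp)+
    have gx [measurable]: "(\<lambda>z. g (x, z)) \<in> borel_measurable lborel" "(\<lambda>z. h (x, z)) \<in> borel_measurable lborel"
      by (rule measurable_compose[OF measurable_Pair assms(2)] measurable_compose[OF measurable_Pair assms(3)]; simp)+
    have "I x = (\<integral>\<^sup>+p. f p * (g (x, snd p) * h (x, fst p)) \<partial>(lborel \<Otimes>\<^sub>M lborel))"
      unfolding I_def by (subst lborel.nn_integral_fst[symmetric]) (auto intro!: borel_measurable_times_ennreal)
    also have "\<dots>\<^sup>2 \<le> (\<integral>\<^sup>+p. (f p)\<^sup>2 \<partial>(lborel \<Otimes>\<^sub>M lborel)) * (\<integral>\<^sup>+p. (g (x, snd p) * h (x, fst p))\<^sup>2 \<partial>(lborel \<Otimes>\<^sub>M lborel))"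
      by (rule Cauchy_Schwarz_nn_integral) measurable
    also have "(\<integral>\<^sup>+p. (f p)\<^sup>2 \<partial>(lborel \<Otimes>\<^sub>M lborel)) = A"
      unfolding A_def by (subst lborel.nn_integral_fst[symmetric]) auto
    also have "(\<integral>\<^sup>+p. (g (x, snd p) * h (x, fst p))\<^sup>2 \<partial>(lborel \<Otimes>\<^sub>M lborel)) = (\<integral>\<^sup>+y. \<integral>\<^sup>+z. (h (x, y))\<^sup>2 * (g (x, z))\<^sup>2 \<partial>lborel \<partial>lborel)"
      by (subst lborel.nn_integral_fst[symmetric]) (auto simp: power_mult_distrib mult.commute)
    also have "\<dots> = (\<integral>\<^sup>+y. (h (x, y))\<^sup>2 * G x \<partial>lborel)"
      unfolding G_def by (intro nn_integral_cong nn_integral_cmult) measurable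
    also have "\<dots> = H x * G x"
      unfolding H_def by (intro nn_integral_multc) measurable
    finally show ?thesis by (simp add: mult.commute)
  qed
  have "I x \<le> ennsqrt A * (ennsqrt (G x) * ennsqrt (H x))" for x
    by (rule ennreal_power2_le_imp_le) (simp add: power_mult_distrib I2)
  then have "(\<integral>\<^sup>+x. I x \<partial>lborel) \<le> (\<integral>\<^sup>+x. ennsqrt A * (ennsqrt (G x) * ennsqrt (H x)) \<partial>lborel)"
    by (rule nn_integral_mono)
  also have "\<dots> = ennsqrt A * (\<integral>\<^sup>+x. ennsqrt (G x) * ennsqrt (H x) \<partial>lborel)"
    by (rule nn_integral_cmult) measurable
  finally have "(\<integral>\<^sup>+x. I x \<partial>lborel)\<^sup>2 \<le> (ennsqrt A * (\<integral>\<^sup>+x. ennsqrt (G x) * ennsqrt (H x) \<partial>lborel))\<^sup>2"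
    by (rule power_mono) simp
  also have "\<dots> = A * (\<integral>\<^sup>+x. ennsqrt (G x) * ennsqrt (H x) \<partial>lborel)\<^sup>2"
    by (simp add: power_mult_distrib)
  also have "\<dots> \<le> A * ((\<integral>\<^sup>+x. (ennsqrt (G x))\<^sup>2 \<partial>lborel) * (\<integral>\<^sup>+x. (ennsqrt (H x))\<^sup>2 \<partial>lborel))"
    by (intro mult_left_mono Cauchy_Schwarz_nn_integral) (auto intro!: measurable_compose[OF _ measurable_ennsqrt])
  finally show ?thesis unfolding I_def A_def G_def H_def by simp
qed

lemma abs_le_integral_derivative:
  fixes F :: "real \<Rightarrow> real"
  assumes der: "\<And>t. (F has_real_derivative F' t) (at t)" and cont: "continuous_on UNIV F'"
    and a: "a \<le> t" "F a = 0"
  shows "ennreal \<bar>F t\<bar> \<le> (\<integral>\<^sup>+s. ennreal \<bar>F' s\<bar> \<partial>lborel)"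
proof -
  have c: "isCont F' s" for s using cont by (simp add: continuous_on_eq_continuous_at)
  have "(\<integral>s. F' s * indicator {a..t} s \<partial>lborel) = F t - F a"
    using a(1) der c by (intro integral_FTC_Icc_real) auto
  then have "ennreal \<bar>F t\<bar> = ennreal (norm (\<integral>s. F' s * indicator {a..t} s \<partial>lborel))" using a(2) by simp
  also have "\<dots> \<le> (\<integral>\<^sup>+s. ennreal (norm (F' s * indicator {a..t} s)) \<partial>lborel)"
    using c by (intro integral_norm_bound_ennreal borel_integrable_atLeastAtMost) auto
  also have "\<dots> \<le> (\<integral>\<^sup>+s. ennreal \<bar>F' s\<bar> \<partial>lborel)"
    by (intro nn_integral_mono) (auto simp: indicator_def)
  finally show ?thesis .
qed

text \<open>The fourth power of \<open>\<phi>\<close> at a point is at most the integral of its derivative along each of the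
  three coordinate lines through that point; the inequality of Loomis and Whitney combines
  the three bounds, and a power of the integral of \<open>\<phi> ^ 6\<close> cancels.\<close>

lemma sobolev_test_fun:
  assumes phi: "test_fun \<Omega> \<phi>"
  shows "(LINT x|lebesgue. \<phi> x ^ 6) \<le> 4096 * (LINT x|lebesgue. (norm (cgrad \<phi> x))\<^sup>2) ^ 3"
proof -
  have [measurable_cong]: "sets (lborel :: real measure) = sets borel" by simp
  have cont: "continuous_on UNIV \<phi>" and cont': "continuous_on UNIV (cgrad \<phi>)"
    using test_fun_continuous[OF phi] test_fun_cgrad_continuous[OF phi] .
  have [measurable]: "\<phi> \<in> borel_measurable borel" "cgrad \<phi> \<in> borel_measurable borel"
    using cont cont' by (auto intro: borel_measurable_continuous_onI)
  obtain C where C: "compact C" "\<And>x. x \<notin> C \<Longrightarrow> \<phi> x = 0" "\<And>x. x \<notin> C \<Longrightarrow> cgrad \<phi> x = 0"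
    using test_fun_support[OF phi] by blast
  obtain R where R: "\<And>x. x \<in> C \<Longrightarrow> norm x \<le> R" using compact_imp_bounded[OF C(1)] by (auto simp: bounded_iff)
  define w where "w i x = ennreal (4 * \<bar>\<phi> x\<bar> ^ 3 * \<bar>cgrad \<phi> x $ i\<bar>)" for i :: 3 and x
  have wm [measurable]: "w i \<in> borel_measurable borel" for i
  proof -
    have "(\<lambda>x. 4 * \<bar>\<phi> x\<bar> ^ 3 * \<bar>cgrad \<phi> x $ i\<bar>) \<in> borel_measurable borel"
      by (intro borel_measurable_continuous_onI continuous_intros cont cont')
    then show ?thesis unfolding w_def[abs_def] by measurable
  qed
  have line: "ennreal (\<phi> x ^ 4) \<le> (\<integral>\<^sup>+s. w i (x + (s - x $ i) *\<^sub>R axis i 1) \<partial>lborel)" for x i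
  proof -
    let ?p = "\<lambda>s. (x - (x $ i) *\<^sub>R axis i 1) + s *\<^sub>R axis i 1"
    let ?a = "min (x $ i) (- (\<bar>R\<bar> + 1))"
    have "\<bar>?p ?a $ i\<bar> > R" by (simp add: axis_def)
    then have "norm (?p ?a) > R" using component_le_norm_cart[of "?p ?a" i] by linarith
    then have "\<phi> (?p ?a) = 0" using R C(2) by (meson leD)
    then have "ennreal \<bar>\<phi> (?p (x $ i)) ^ 4\<bar> \<le> (\<integral>\<^sup>+s. ennreal \<bar>4 * \<phi> (?p s) ^ 3 * (cgrad \<phi> (?p s) \<bullet> axis i 1)\<bar> \<partial>lborel)"
    proof (intro abs_le_integral_derivative[of "\<lambda>s. \<phi> (?p s) ^ 4" _ ?a])
      show "((\<lambda>s. \<phi> (?p s) ^ 4) has_real_derivative 4 * \<phi> (?p s) ^ 3 * (cgrad \<phi> (?p s) \<bullet> axis i 1)) (at s)" for s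
        by (auto intro!: derivative_eq_intros derivative_along_line[OF test_fun_has_derivative[OF phi]])
      show "continuous_on UNIV (\<lambda>s. 4 * \<phi> (?p s) ^ 3 * (cgrad \<phi> (?p s) \<bullet> axis i 1))"
        by (intro continuous_intros continuous_on_compose2[OF cont] continuous_on_compose2[OF cont']) auto
    qed auto
    also have "\<dots> = (\<integral>\<^sup>+s. w i (x + (s - x $ i) *\<^sub>R axis i 1) \<partial>lborel)"
      by (intro nn_integral_cong) (simp add: w_def abs_mult power_abs inner_axis algebra_simps)
    finally show ?thesis by simp
  qed
  define F where "F = (\<lambda>p. \<integral>\<^sup>+s. w 1 (coords3 (s, fst p, snd p)) \<partial>lborel)"
  define G where "G = (\<lambda>p. \<integral>\<^sup>+s. w 2 (coords3 (fst p, s, snd p)) \<partial>lborel)"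
  define H where "H = (\<lambda>p. \<integral>\<^sup>+s. w 3 (coords3 (fst p, snd p, s)) \<partial>lborel)"
  have cm: "(\<lambda>p. coords3 (k1 p, k2 p, k3 p)) \<in> borel_measurable M"
    if "k1 \<in> borel_measurable M" "k2 \<in> borel_measurable M" "k3 \<in> borel_measurable M" for k1 k2 k3 and M :: "'m measure"
    using that unfolding coords3_def by (auto intro!: borel_measurable_add borel_measurable_scaleR)
  have [measurable]: "F \<in> borel_measurable (lborel \<Otimes>\<^sub>M lborel)" "G \<in> borel_measurable (lborel \<Otimes>\<^sub>M lborel)" "H \<in> borel_measurable (lborel \<Otimes>\<^sub>M lborel)"
    unfolding F_def G_def H_def
    by (auto simp: split_beta' simp del: prod.collapse intro!: lborel.borel_measurable_nn_integral measurable_compose[OF cm wm])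
  have point: "ennreal (\<phi> (coords3 (x, y, z)) ^ 6) \<le> ennsqrt (F (y, z)) * (ennsqrt (G (x, z)) * ennsqrt (H (x, y)))" for x y z
  proof (rule ennreal_power2_le_imp_le)
    let ?x = "coords3 (x, y, z)"
    have c: "?x + (s - ?x $ 1) *\<^sub>R axis 1 1 = coords3 (s, y, z)" "?x + (s - ?x $ 2) *\<^sub>R axis 2 1 = coords3 (x, s, z)"
      "?x + (s - ?x $ 3) *\<^sub>R axis 3 1 = coords3 (x, y, s)" for s
      by (simp_all add: vec_eq_iff forall_3 axis_def)
    have le: "ennreal (\<phi> ?x ^ 4) \<le> F (y, z)" "ennreal (\<phi> ?x ^ 4) \<le> G (x, z)" "ennreal (\<phi> ?x ^ 4) \<le> H (x, y)"
      using line[of ?x 1] line[of ?x 2] line[of ?x 3] unfolding c F_def G_def H_def by auto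
    have "(ennreal (\<phi> ?x ^ 6))\<^sup>2 = ennreal (\<phi> ?x ^ 4) * (ennreal (\<phi> ?x ^ 4) * ennreal (\<phi> ?x ^ 4))"
      by (simp add: ennreal_power ennreal_mult[symmetric] power_mult[symmetric] power_add[symmetric])
    also have "\<dots> \<le> F (y, z) * (G (x, z) * H (x, y))"
      by (intro mult_mono le) auto
    finally show "(ennreal (\<phi> ?x ^ 6))\<^sup>2 \<le> (ennsqrt (F (y, z)) * (ennsqrt (G (x, z)) * ennsqrt (H (x, y))))\<^sup>2"
      by (simp add: power_mult_distrib)
  qed
  define W where "W i = (\<integral>\<^sup>+x. w i x \<partial>lborel)" for i
  define J where "J = (\<integral>\<^sup>+x. ennreal (\<phi> x ^ 6) \<partial>lborel)"
  define D where "D = (\<integral>\<^sup>+x. ennreal ((norm (cgrad \<phi> x))\<^sup>2) \<partial>lborel)"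
  have W1: "(\<integral>\<^sup>+y. \<integral>\<^sup>+z. F (y, z) \<partial>lborel \<partial>lborel) = W 1"
  proof -
    have "W 1 = (\<integral>\<^sup>+x. \<integral>\<^sup>+y. \<integral>\<^sup>+z. w 1 (coords3 (x, y, z)) \<partial>lborel \<partial>lborel \<partial>lborel)"
      unfolding W_def by (rule nn_integral_coords3) measurable
    also have "\<dots> = (\<integral>\<^sup>+y. \<integral>\<^sup>+x. \<integral>\<^sup>+z. w 1 (coords3 (x, y, z)) \<partial>lborel \<partial>lborel \<partial>lborel)"
      by (rule lborel_pair.Fubini'[symmetric])
        (auto simp: split_beta' intro!: lborel.borel_measurable_nn_integral measurable_compose[OF cm wm])
    also have "\<dots> = (\<integral>\<^sup>+y. \<integral>\<^sup>+z. \<integral>\<^sup>+x. w 1 (coords3 (x, y, z)) \<partial>lborel \<partial>lborel \<partial>lborel)"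
      by (rule nn_integral_cong, rule lborel_pair.Fubini'[symmetric])
        (auto simp: split_beta' simp del: prod.collapse intro!: measurable_compose[OF cm wm])
    finally show ?thesis by (simp add: F_def)
  qed
  have W2: "(\<integral>\<^sup>+x. \<integral>\<^sup>+z. G (x, z) \<partial>lborel \<partial>lborel) = W 2"
  proof -
    have "W 2 = (\<integral>\<^sup>+x. \<integral>\<^sup>+y. \<integral>\<^sup>+z. w 2 (coords3 (x, y, z)) \<partial>lborel \<partial>lborel \<partial>lborel)"
      unfolding W_def by (rule nn_integral_coords3) measurable
    also have "\<dots> = (\<integral>\<^sup>+x. \<integral>\<^sup>+z. \<integral>\<^sup>+y. w 2 (coords3 (x, y, z)) \<partial>lborel \<partial>lborel \<partial>lborel)"
      by (rule nn_integral_cong, rule lborel_pair.Fubini'[symmetric])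
        (auto simp: split_beta' simp del: prod.collapse intro!: measurable_compose[OF cm wm])
    finally show ?thesis by (simp add: G_def)
  qed
  have W3: "(\<integral>\<^sup>+x. \<integral>\<^sup>+y. H (x, y) \<partial>lborel \<partial>lborel) = W 3"
    unfolding W_def H_def by (subst nn_integral_coords3[OF wm]) simp
  have "J = (\<integral>\<^sup>+x. \<integral>\<^sup>+y. \<integral>\<^sup>+z. ennreal (\<phi> (coords3 (x, y, z)) ^ 6) \<partial>lborel \<partial>lborel \<partial>lborel)"
    unfolding J_def by (rule nn_integral_coords3) measurable
  also have "\<dots> \<le> (\<integral>\<^sup>+x. \<integral>\<^sup>+y. \<integral>\<^sup>+z. ennsqrt (F (y, z)) * (ennsqrt (G (x, z)) * ennsqrt (H (x, y))) \<partial>lborel \<partial>lborel \<partial>lborel)"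
    by (intro nn_integral_mono point)
  finally have "J\<^sup>2 \<le> (\<integral>\<^sup>+x. \<integral>\<^sup>+y. \<integral>\<^sup>+z. ennsqrt (F (y, z)) * (ennsqrt (G (x, z)) * ennsqrt (H (x, y))) \<partial>lborel \<partial>lborel \<partial>lborel)\<^sup>2"
    by (rule power_mono) simp
  also have "\<dots> \<le> W 1 * (W 2 * W 3)"
    using Loomis_Whitney[of "\<lambda>p. ennsqrt (F p)" "\<lambda>p. ennsqrt (G p)" "\<lambda>p. ennsqrt (H p)"]
    by (simp add: W1 W2 W3)
  finally have J2: "J\<^sup>2 \<le> W 1 * (W 2 * W 3)" .
  have W2_le: "(W i)\<^sup>2 \<le> 16 * (J * D)" for i
  proof -
    have "W i = (\<integral>\<^sup>+x. ennreal (4 * \<bar>\<phi> x\<bar> ^ 3) * ennreal \<bar>cgrad \<phi> x $ i\<bar> \<partial>lborel)"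
      unfolding W_def w_def by (simp add: ennreal_mult)
    also have "\<dots>\<^sup>2 \<le> (\<integral>\<^sup>+x. (ennreal (4 * \<bar>\<phi> x\<bar> ^ 3))\<^sup>2 \<partial>lborel) * (\<integral>\<^sup>+x. (ennreal \<bar>cgrad \<phi> x $ i\<bar>)\<^sup>2 \<partial>lborel)"
    proof (rule Cauchy_Schwarz_nn_integral)
      have "(\<lambda>x. \<bar>cgrad \<phi> x $ i\<bar>) \<in> borel_measurable borel"
        by (intro borel_measurable_continuous_onI continuous_intros cont')
      then show "(\<lambda>x. ennreal \<bar>cgrad \<phi> x $ i\<bar>) \<in> borel_measurable lborel" by measurable
    qed measurable
    also have "\<dots> \<le> (16 * J) * D"
    proof (rule mult_mono)
      have "(ennreal (4 * \<bar>\<phi> x\<bar> ^ 3))\<^sup>2 = 16 * ennreal (\<phi> x ^ 6)" for x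
      proof -
        have "(4 * \<bar>\<phi> x\<bar> ^ 3)\<^sup>2 = 16 * \<phi> x ^ 6"
          by (simp add: power_mult_distrib power_mult[symmetric])
        then show ?thesis by (simp add: ennreal_power ennreal_mult)
      qed
      then show "(\<integral>\<^sup>+x. (ennreal (4 * \<bar>\<phi> x\<bar> ^ 3))\<^sup>2 \<partial>lborel) \<le> 16 * J"
        by (simp add: J_def nn_integral_cmult)
      show "(\<integral>\<^sup>+x. (ennreal \<bar>cgrad \<phi> x $ i\<bar>)\<^sup>2 \<partial>lborel) \<le> D"
        unfolding D_def
      proof (rule nn_integral_mono)
        fix x
        show "(ennreal \<bar>cgrad \<phi> x $ i\<bar>)\<^sup>2 \<le> ennreal ((norm (cgrad \<phi> x))\<^sup>2)"
          using power_mono[OF component_le_norm_cart[of "cgrad \<phi> x" i], of 2] by (simp add: ennreal_power ennreal_leI)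
      qed
    qed auto
    finally show ?thesis by (simp add: mult.assoc)
  qed
  have intJ: "integrable lebesgue (\<lambda>x. \<phi> x ^ 6)"
    by (rule integrable_continuous_compact_support[of _ C]) (use C cont in \<open>auto intro!: continuous_intros\<close>)
  have intD: "integrable lebesgue (\<lambda>x. (norm (cgrad \<phi> x))\<^sup>2)"
    using sq_integrable_cgrad[OF phi] by (simp add: sq_integrable_def)
  define j where "j = (LINT x|lebesgue. \<phi> x ^ 6)"
  define d where "d = (LINT x|lebesgue. (norm (cgrad \<phi> x))\<^sup>2)"
  have j: "J = ennreal j" "j \<ge> 0"
    using nn_integral_eq_integral[OF intJ] by (auto simp: J_def j_def nn_integral_completion intro!: integral_nonneg)
  have d: "D = ennreal d" "d \<ge> 0"
    using nn_integral_eq_integral[OF intD] by (auto simp: D_def d_def nn_integral_completion intro!: integral_nonneg)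
  have "(J\<^sup>2)\<^sup>2 \<le> (W 1 * (W 2 * W 3))\<^sup>2" using J2 by (rule power_mono) simp
  also have "\<dots> = (W 1)\<^sup>2 * ((W 2)\<^sup>2 * (W 3)\<^sup>2)" by (simp add: power_mult_distrib)
  also have "\<dots> \<le> (16 * (J * D)) * ((16 * (J * D)) * (16 * (J * D)))" by (intro mult_mono W2_le) auto
  finally have "ennreal (j ^ 4) \<le> ennreal ((16 * (j * d)) * ((16 * (j * d)) * (16 * (j * d))))"
  proof -
    assume le: "(J\<^sup>2)\<^sup>2 \<le> (16 * (J * D)) * ((16 * (J * D)) * (16 * (J * D)))"
    have "16 * (J * D) = ennreal (16 * (j * d))" using j d by (simp add: ennreal_mult)
    moreover have "ennreal X * (ennreal X * ennreal X) = ennreal (X * (X * X))" if "X \<ge> 0" for X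
      using that by (simp add: ennreal_mult)
    ultimately have "(16 * (J * D)) * ((16 * (J * D)) * (16 * (J * D))) = ennreal ((16 * (j * d)) * ((16 * (j * d)) * (16 * (j * d))))"
      using j d by (simp only:) simp
    moreover have "(J\<^sup>2)\<^sup>2 = ennreal (j ^ 4)" using j by (simp add: ennreal_power power_mult[symmetric])
    ultimately show ?thesis using le by simp
  qed
  then have "j ^ 4 \<le> (16 * (j * d)) * ((16 * (j * d)) * (16 * (j * d)))"
    using j d by (subst (asm) ennreal_le_iff) auto
  then have "j * j ^ 3 \<le> (4096 * d ^ 3) * j ^ 3"
  proof -
    have "j ^ 4 = j * j ^ 3" "(16 * (j * d)) * ((16 * (j * d)) * (16 * (j * d))) = (4096 * d ^ 3) * j ^ 3"
      by algebra+
    then show "j ^ 4 \<le> (16 * (j * d)) * ((16 * (j * d)) * (16 * (j * d))) \<Longrightarrow> ?thesis" by (simp only:)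
  qed
  then have "j \<le> 4096 * d ^ 3"
    using j(2) d(2) by (cases "j = 0") (auto simp: mult_le_cancel_right)
  then show ?thesis by (simp add: j_def d_def)
qed

section \<open>Weak gradients in the Hilbert space\<close>

lemma sq_integrable_test_fun_scaleR: "test_fun \<Omega> \<phi> \<Longrightarrow> sq_integrable (\<lambda>x. \<phi> x *\<^sub>R e)"
  for e :: "'b::euclidean_space"
  by (rule sq_integrable_bound[OF sq_integrable_test_fun, of \<Omega> \<phi> _ "norm e"])
    (auto intro!: continuous_imp_lebesgue_measurable continuous_intros test_fun_continuous)

lemma sq_integrable_cgrad_inner: "test_fun \<Omega> \<phi> \<Longrightarrow> sq_integrable (\<lambda>x. cgrad \<phi> x \<bullet> e)"
  by (rule sq_integrable_bound[OF sq_integrable_cgrad, of \<Omega> \<phi> _ "norm e"])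
    (auto intro!: continuous_imp_lebesgue_measurable continuous_intros test_fun_cgrad_continuous
      simp: mult.commute[of "norm e"] Cauchy_Schwarz_ineq2)

text \<open>The defining identities of weak gradients and divergences are equations between inner products
  of \<open>L2\<close>, so they are linear and pass to limits.\<close>

lemma has_weak_grad_iff_inner:
  "has_weak_grad \<Omega> (rep_L2 u) (rep_L2 p) \<longleftrightarrow>
    (\<forall>\<phi> e. test_fun \<Omega> \<phi> \<longrightarrow> u \<bullet> to_L2 (\<lambda>x. cgrad \<phi> x \<bullet> e) = - (p \<bullet> to_L2 (\<lambda>x. \<phi> x *\<^sub>R e)))"
proof -
  have l: "(LINT x|lebesgue. rep_L2 u x *\<^sub>R cgrad \<phi> x) \<bullet> e = u \<bullet> to_L2 (\<lambda>x. cgrad \<phi> x \<bullet> e)"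
    and r: "(LINT x|lebesgue. \<phi> x *\<^sub>R rep_L2 p x) \<bullet> e = p \<bullet> to_L2 (\<lambda>x. \<phi> x *\<^sub>R e)"
    if phi: "test_fun \<Omega> \<phi>" for \<phi> e
  proof -
    have "(LINT x|lebesgue. rep_L2 u x *\<^sub>R cgrad \<phi> x) \<bullet> e = (LINT x|lebesgue. (rep_L2 u x *\<^sub>R cgrad \<phi> x) \<bullet> e)"
      by (rule integral_inner_left[symmetric]) (intro integrable_scaleR_sq sq_integrable_rep sq_integrable_cgrad[OF phi])
    then show "(LINT x|lebesgue. rep_L2 u x *\<^sub>R cgrad \<phi> x) \<bullet> e = u \<bullet> to_L2 (\<lambda>x. cgrad \<phi> x \<bullet> e)"
      by (simp add: inner_to_L2_right[OF sq_integrable_cgrad_inner[OF phi]])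
    have "(LINT x|lebesgue. \<phi> x *\<^sub>R rep_L2 p x) \<bullet> e = (LINT x|lebesgue. (\<phi> x *\<^sub>R rep_L2 p x) \<bullet> e)"
      by (rule integral_inner_left[symmetric]) (intro integrable_scaleR_sq sq_integrable_rep sq_integrable_test_fun[OF phi])
    then show "(LINT x|lebesgue. \<phi> x *\<^sub>R rep_L2 p x) \<bullet> e = p \<bullet> to_L2 (\<lambda>x. \<phi> x *\<^sub>R e)"
      by (simp add: inner_to_L2_right[OF sq_integrable_test_fun_scaleR[OF phi]])
  qed
  have vec: "a = - b \<longleftrightarrow> (\<forall>e. a \<bullet> e = - (b \<bullet> e))" for a b :: "real^3"
    using vector_eq_rdot[of a "- b"] by (simp add: inner_minus_left)
  show ?thesis unfolding has_weak_grad_def vec by (auto simp: l r)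
qed

lemma has_weak_div_iff_inner:
  "has_weak_div \<Omega> (rep_L2 P) (rep_L2 w) \<longleftrightarrow>
    (\<forall>\<phi>. test_fun \<Omega> \<phi> \<longrightarrow> P \<bullet> to_L2 (cgrad \<phi>) = - (w \<bullet> to_L2 \<phi>))"
  unfolding has_weak_div_def
  by (auto simp: inner_to_L2_right[OF sq_integrable_cgrad] inner_to_L2_right[OF sq_integrable_test_fun])

lemma subspace_L2_on: "subspace (L2_on \<Omega>)"
  unfolding subspace_def
proof (intro conjI ballI allI)
  show "0 \<in> L2_on \<Omega>" using rep_zero by (auto simp: L2_on_def elim: eventually_mono)
  fix u v :: "'a L2" and c :: real
  assume u: "u \<in> L2_on \<Omega>"
  show "c *\<^sub>R u \<in> L2_on \<Omega>"
    using u rep_scaleR[of c u] by (auto simp: L2_on_def elim: eventually_elim2)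
  assume v: "v \<in> L2_on \<Omega>"
  from u v have "AE x in lebesgue. x \<notin> \<Omega> \<longrightarrow> rep_L2 u x = 0" "AE x in lebesgue. x \<notin> \<Omega> \<longrightarrow> rep_L2 v x = 0"
    by (auto simp: L2_on_def)
  with rep_add[of u v] show "u + v \<in> L2_on \<Omega>"
    unfolding L2_on_def by (auto elim: eventually_elim2)
qed

lemma L2_on_limit:
  fixes u :: "nat \<Rightarrow> 'b::euclidean_space L2"
  assumes "\<Omega> \<in> sets lebesgue" and u: "\<And>n. u n \<in> L2_on \<Omega>" "u \<longlonglongrightarrow> v"
  shows "v \<in> L2_on \<Omega>"
proof -
  let ?w = "\<lambda>x. indicator (- \<Omega>) x *\<^sub>R rep_L2 v x"
  have m: "?w \<in> borel_measurable lebesgue"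
    using assms(1) by (intro borel_measurable_scaleR borel_measurable_indicator measurable_rep) (auto simp: Compl_in_sets_lebesgue)
  have sq: "sq_integrable ?w"
    by (rule sq_integrable_bound[OF sq_integrable_rep[of v] m, of 1]) (auto simp: indicator_def)
  have "norm (to_L2 ?w) \<le> norm (v - u n)" for n
  proof -
    have "AE x in lebesgue. x \<notin> \<Omega> \<longrightarrow> rep_L2 (u n) x = 0" using u(1)[of n] by (simp add: L2_on_def)
    then have "AE x in lebesgue. norm (?w x) \<le> 1 * norm (rep_L2 (v - u n) x)"
      using rep_diff[of v "u n"] by eventually_elim (auto simp: indicator_def)
    then show ?thesis using norm_to_L2_le[OF sq, of 1 "v - u n"] by simp
  qed
  moreover have "(\<lambda>n. norm (v - u n)) \<longlonglongrightarrow> 0"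
    using tendsto_norm[OF tendsto_diff[OF tendsto_const u(2)], of v] by simp
  ultimately have "norm (to_L2 ?w) \<le> 0"
    by (intro LIMSEQ_le_const[of "\<lambda>n. norm (v - u n)"]) auto
  then have "to_L2 ?w = 0" by simp
  then have "AE x in lebesgue. rep_L2 (to_L2 ?w) x = 0" using rep_zero by simp
  with rep_to_L2[OF sq] have "AE x in lebesgue. ?w x = 0" by eventually_elim simp
  then show ?thesis unfolding L2_on_def by (auto simp: indicator_def elim!: eventually_mono)
qed

lemma to_L2_in_L2_on: "sq_integrable w \<Longrightarrow> (\<And>x. x \<notin> \<Omega> \<Longrightarrow> w x = 0) \<Longrightarrow> to_L2 w \<in> L2_on \<Omega>"
  unfolding L2_on_def by (auto dest!: rep_to_L2 elim: eventually_mono)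

lemma to_L2_test_fun: "test_fun \<Omega> \<phi> \<Longrightarrow> to_L2 \<phi> \<in> L2_on \<Omega>"
  using test_fun_support[of \<Omega> \<phi>] by (intro to_L2_in_L2_on sq_integrable_test_fun) auto

lemma to_L2_cgrad: "test_fun \<Omega> \<phi> \<Longrightarrow> to_L2 (cgrad \<phi>) \<in> L2_on \<Omega>"
  using test_fun_support[of \<Omega> \<phi>] by (intro to_L2_in_L2_on sq_integrable_cgrad) auto

text \<open>The fundamental lemma says that the span of the test functions is dense.\<close>

lemma test_fun_total:
  fixes p :: "'b::euclidean_space L2"
  assumes "open \<Omega>" "p \<in> L2_on \<Omega>"
    and orth: "\<And>\<phi> e. test_fun \<Omega> \<phi> \<Longrightarrow> p \<bullet> to_L2 (\<lambda>x. \<phi> x *\<^sub>R e) = 0"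
  shows "p = 0"
proof -
  have "AE x in lebesgue. x \<in> \<Omega> \<longrightarrow> rep_L2 p x \<bullet> b = 0" for b
  proof (rule fundamental_lemma[OF assms(1)])
    fix c d :: "real^3"
    have "sq_integrable (indicator (cbox c d) :: real^3 \<Rightarrow> real)"
      unfolding sq_integrable_def
    proof
      have "integrable lebesgue (indicator (cbox c d) :: real^3 \<Rightarrow> real)" using emeasure_bounded_finite[OF bounded_cbox, of c d] by (intro integrable_real_indicator) auto
      then show "integrable lebesgue (\<lambda>x. (norm (indicator (cbox c d) x :: real))\<^sup>2)"
      proof -
        have eq: "(norm (indicator (cbox c d) x :: real))\<^sup>2 = indicator (cbox c d) x" for x
          by (simp add: indicator_def)
        show "integrable lebesgue (indicator (cbox c d) :: real^3 \<Rightarrow> real) \<Longrightarrow> ?thesis" by (simp only: eq)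
      qed
    qed (auto intro!: borel_measurable_indicator)
    moreover have "sq_integrable (\<lambda>x. rep_L2 p x \<bullet> b)"
      by (rule sq_integrable_bound[OF sq_integrable_rep[of p], of _ "norm b"])
        (auto intro!: borel_measurable_inner simp: mult.commute[of "norm b"] Cauchy_Schwarz_ineq2)
    ultimately show "set_integrable lebesgue (cbox c d) (\<lambda>x. rep_L2 p x \<bullet> b)"
      unfolding set_integrable_def by (rule integrable_scaleR_sq)
  next
    fix \<phi> assume phi: "test_fun \<Omega> \<phi>"
    show "(LINT x|lebesgue. \<phi> x * (rep_L2 p x \<bullet> b)) = 0"
      using orth[OF phi, of b] by (simp add: inner_to_L2_right[OF sq_integrable_test_fun_scaleR[OF phi]])
  qed
  then have "AE x in lebesgue. \<forall>b\<in>Basis. x \<in> \<Omega> \<longrightarrow> rep_L2 p x \<bullet> b = 0"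
    by (subst AE_finite_all) auto
  moreover have "AE x in lebesgue. x \<notin> \<Omega> \<longrightarrow> rep_L2 p x = 0" using assms(2) by (simp add: L2_on_def)
  ultimately have "AE x in lebesgue. rep_L2 p x = rep_L2 0 x"
    using rep_zero by eventually_elim (auto intro: euclidean_eqI)
  then show ?thesis by (rule L2_eqI)
qed

lemma L2_tendsto_AE_subseq:
  fixes u :: "nat \<Rightarrow> 'b::euclidean_space L2"
  assumes "u \<longlonglongrightarrow> v"
  shows "\<exists>r::nat\<Rightarrow>nat. strict_mono r \<and> (AE x in lebesgue. (\<lambda>n. rep_L2 (u (r n)) x) \<longlonglongrightarrow> rep_L2 v x)"
proof -
  have "(\<lambda>n. (norm (u n - v))\<^sup>2) \<longlonglongrightarrow> 0"
    using tendsto_power[OF tendsto_norm[OF tendsto_diff[OF assms tendsto_const]], of v 2] by simp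
  then have "(\<lambda>n. LINT x|lebesgue. norm ((norm (rep_L2 (u n - v) x))\<^sup>2)) \<longlonglongrightarrow> 0"
    by (simp add: norm_L2_rep)
  then obtain r :: "nat \<Rightarrow> nat" where r: "strict_mono r" "AE x in lebesgue. (\<lambda>n. (norm (rep_L2 (u (r n) - v) x))\<^sup>2) \<longlonglongrightarrow> 0"
    using tendsto_L1_AE_subseq[of lebesgue "\<lambda>n x. (norm (rep_L2 (u n - v) x))\<^sup>2"] integrable_norm_rep by blast
  have "AE x in lebesgue. \<forall>n. rep_L2 (u (r n) - v) x = rep_L2 (u (r n)) x - rep_L2 v x"
    by (subst AE_all_countable) (auto intro: rep_diff)
  with r(2) have "AE x in lebesgue. (\<lambda>n. rep_L2 (u (r n)) x) \<longlonglongrightarrow> rep_L2 v x"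
  proof eventually_elim
    case (elim x)
    then have "(\<lambda>n. sqrt ((norm (rep_L2 (u (r n)) x - rep_L2 v x))\<^sup>2)) \<longlonglongrightarrow> sqrt 0"
      by (intro tendsto_real_sqrt) simp
    then have "(\<lambda>n. norm (rep_L2 (u (r n)) x - rep_L2 v x)) \<longlonglongrightarrow> 0" by simp
    then show ?case by (rule LIM_zero_cancel[OF tendsto_norm_zero_cancel])
  qed
  then show ?thesis using r(1) by blast
qed

section \<open>The space of functions with vanishing trace on a bounded open set\<close>

lemma test_fun_add:
  assumes "test_fun \<Omega> \<phi>" "test_fun \<Omega> \<psi>" shows "test_fun \<Omega> (\<lambda>x. \<phi> x + \<psi> x)"
proof -
  obtain C D where CD: "compact C" "compact D" "C \<subseteq> \<Omega>" "D \<subseteq> \<Omega>" "\<And>x. x \<notin> C \<Longrightarrow> \<phi> x = 0" "\<And>x. x \<notin> D \<Longrightarrow> \<psi> x = 0"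
    using assms unfolding test_fun_def by blast
  show ?thesis unfolding test_fun_def smooth_on_def
  proof (intro conjI allI exI[of _ "C \<union> D"])
    show "Ck_on k (\<lambda>x. \<phi> x + \<psi> x) UNIV" for k
      using assms unfolding test_fun_def smooth_on_def by (intro Ck_on_add) auto
  qed (use CD in auto)
qed

lemma test_fun_scale:
  assumes "test_fun \<Omega> \<phi>" shows "test_fun \<Omega> (\<lambda>x. c * \<phi> x)"
  unfolding test_fun_def smooth_on_def
proof (intro conjI allI)
  show "Ck_on k (\<lambda>x. c * \<phi> x) UNIV" for k
    using assms unfolding test_fun_def smooth_on_def by (intro Ck_on_mult Ck_on_const) auto
  show "\<exists>C. compact C \<and> C \<subseteq> \<Omega> \<and> (\<forall>x. x \<notin> C \<longrightarrow> c * \<phi> x = 0)"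
    using assms unfolding test_fun_def by auto
qed

lemma cgrad_add:
  assumes "test_fun \<Omega> \<phi>" "test_fun \<Omega> \<psi>" shows "cgrad (\<lambda>x. \<phi> x + \<psi> x) = (\<lambda>x. cgrad \<phi> x + cgrad \<psi> x)"
  by (rule ext, rule cgrad_eqI)
    (auto intro!: derivative_eq_intros test_fun_has_derivative[OF assms(1)] test_fun_has_derivative[OF assms(2)] simp: inner_add_left)

lemma cgrad_scale:
  assumes "test_fun \<Omega> \<phi>" shows "cgrad (\<lambda>x. c * \<phi> x) = (\<lambda>x. c *\<^sub>R cgrad \<phi> x)"
  by (rule ext, rule cgrad_eqI)
    (auto intro!: derivative_eq_intros test_fun_has_derivative[OF assms(1)])

locale bounded_domain =
  fixes \<Omega> :: "(real^3) set"
  assumes open_domain: "open \<Omega>" and bounded_domain: "bounded \<Omega>"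
begin

lemma domain_sets: "\<Omega> \<in> sets lebesgue"
  using open_domain by (simp add: borel_open)

lemma grad_eqI:
  assumes "p \<in> L2_on \<Omega>" "has_weak_grad \<Omega> (rep_L2 u) (rep_L2 p)"
  shows "grad \<Omega> u = p"
  unfolding grad_def
proof (rule the_equality)
  fix q assume q: "q \<in> L2_on \<Omega> \<and> has_weak_grad \<Omega> (rep_L2 u) (rep_L2 q)"
  have "q - p = 0"
  proof (rule test_fun_total[OF open_domain])
    show "q - p \<in> L2_on \<Omega>" using q assms(1) subspace_L2_on by (blast intro: subspace_diff)
    fix \<phi> e assume "test_fun \<Omega> \<phi>"
    then show "(q - p) \<bullet> to_L2 (\<lambda>x. \<phi> x *\<^sub>R e) = 0"
      using q assms(2) unfolding has_weak_grad_iff_inner by (simp add: inner_diff_left)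
  qed
  then show "q = p" by simp
qed (use assms in blast)

lemma grad_H1:
  assumes "u \<in> H1 \<Omega>"
  shows "grad \<Omega> u \<in> L2_on \<Omega>" "has_weak_grad \<Omega> (rep_L2 u) (rep_L2 (grad \<Omega> u))"
proof -
  obtain p where p: "p \<in> L2_on \<Omega>" "has_weak_grad \<Omega> (rep_L2 u) (rep_L2 p)"
    using assms by (auto simp: H1_def)
  then show "grad \<Omega> u \<in> L2_on \<Omega>" "has_weak_grad \<Omega> (rep_L2 u) (rep_L2 (grad \<Omega> u))"
    by (simp_all add: grad_eqI)
qed

lemma H1_limit:
  assumes u: "\<And>n. u n \<in> H1 \<Omega>" "u \<longlonglongrightarrow> v" "(\<lambda>n. grad \<Omega> (u n)) \<longlonglongrightarrow> p"
  shows "v \<in> H1 \<Omega>" "grad \<Omega> v = p"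
proof -
  have v: "v \<in> L2_on \<Omega>" using L2_on_limit[OF domain_sets _ u(2)] u(1) by (auto simp: H1_def)
  have p: "p \<in> L2_on \<Omega>" using L2_on_limit[OF domain_sets _ u(3)] grad_H1(1)[OF u(1)] by auto
  have w: "has_weak_grad \<Omega> (rep_L2 v) (rep_L2 p)"
    unfolding has_weak_grad_iff_inner
  proof (intro allI impI)
    fix \<phi> e assume phi: "test_fun \<Omega> \<phi>"
    have "(\<lambda>n. u n \<bullet> to_L2 (\<lambda>x. cgrad \<phi> x \<bullet> e)) \<longlonglongrightarrow> v \<bullet> to_L2 (\<lambda>x. cgrad \<phi> x \<bullet> e)"
      by (intro tendsto_intros u)
    moreover have "(\<lambda>n. - (grad \<Omega> (u n) \<bullet> to_L2 (\<lambda>x. \<phi> x *\<^sub>R e))) \<longlonglongrightarrow> - (p \<bullet> to_L2 (\<lambda>x. \<phi> x *\<^sub>R e))"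
      by (intro tendsto_intros u)
    moreover have "u n \<bullet> to_L2 (\<lambda>x. cgrad \<phi> x \<bullet> e) = - (grad \<Omega> (u n) \<bullet> to_L2 (\<lambda>x. \<phi> x *\<^sub>R e))" for n
      using grad_H1(2)[OF u(1)[of n]] phi unfolding has_weak_grad_iff_inner by blast
    ultimately show "v \<bullet> to_L2 (\<lambda>x. cgrad \<phi> x \<bullet> e) = - (p \<bullet> to_L2 (\<lambda>x. \<phi> x *\<^sub>R e))"
      by (simp add: LIMSEQ_unique)
  qed
  show "v \<in> H1 \<Omega>" unfolding H1_def using v p w by blast
  show "grad \<Omega> v = p" using p w by (rule grad_eqI)
qed

lemma H1_add:
  assumes "u \<in> H1 \<Omega>" "v \<in> H1 \<Omega>"
  shows "u + v \<in> H1 \<Omega>" "grad \<Omega> (u + v) = grad \<Omega> u + grad \<Omega> v"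
proof -
  have "has_weak_grad \<Omega> (rep_L2 (u + v)) (rep_L2 (grad \<Omega> u + grad \<Omega> v))"
    using grad_H1(2)[OF assms(1)] grad_H1(2)[OF assms(2)]
    unfolding has_weak_grad_iff_inner by (simp add: inner_add_left)
  moreover have "grad \<Omega> u + grad \<Omega> v \<in> L2_on \<Omega>" "u + v \<in> L2_on \<Omega>"
    using assms grad_H1(1) subspace_L2_on by (auto simp: H1_def intro: subspace_add)
  ultimately show "u + v \<in> H1 \<Omega>" "grad \<Omega> (u + v) = grad \<Omega> u + grad \<Omega> v"
    by (auto simp: H1_def intro: grad_eqI)
qed

lemma H1_scaleR:
  assumes "u \<in> H1 \<Omega>"
  shows "c *\<^sub>R u \<in> H1 \<Omega>" "grad \<Omega> (c *\<^sub>R u) = c *\<^sub>R grad \<Omega> u"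
proof -
  have "has_weak_grad \<Omega> (rep_L2 (c *\<^sub>R u)) (rep_L2 (c *\<^sub>R grad \<Omega> u))"
    using grad_H1(2)[OF assms] unfolding has_weak_grad_iff_inner by simp
  moreover have "c *\<^sub>R grad \<Omega> u \<in> L2_on \<Omega>" "c *\<^sub>R u \<in> L2_on \<Omega>"
    using assms grad_H1(1) subspace_L2_on by (auto simp: H1_def intro: subspace_scale)
  ultimately show "c *\<^sub>R u \<in> H1 \<Omega>" "grad \<Omega> (c *\<^sub>R u) = c *\<^sub>R grad \<Omega> u"
    by (auto simp: H1_def intro: grad_eqI)
qed

lemma H1_diff:
  assumes "u \<in> H1 \<Omega>" "v \<in> H1 \<Omega>"
  shows "u - v \<in> H1 \<Omega>" "grad \<Omega> (u - v) = grad \<Omega> u - grad \<Omega> v"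
  using H1_add[OF assms(1) H1_scaleR(1)[OF assms(2)], of "-1"] H1_scaleR(2)[OF assms(2), of "-1"] by auto

lemma H1_test_fun:
  assumes "test_fun \<Omega> \<phi>"
  shows "to_L2 \<phi> \<in> H1 \<Omega>" "grad \<Omega> (to_L2 \<phi>) = to_L2 (cgrad \<phi>)"
proof -
  have w: "has_weak_grad \<Omega> (rep_L2 (to_L2 \<phi>)) (rep_L2 (to_L2 (cgrad \<phi>)))"
    unfolding has_weak_grad_def
  proof (intro allI impI)
    fix \<psi> assume psi: "test_fun \<Omega> \<psi>"
    have "(LINT x|lebesgue. rep_L2 (to_L2 \<phi>) x *\<^sub>R cgrad \<psi> x) = (LINT x|lebesgue. \<phi> x *\<^sub>R cgrad \<psi> x)"
      using rep_to_L2[OF sq_integrable_test_fun[OF assms]] sq_integrable_test_fun[OF assms] sq_integrable_cgrad[OF psi]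
      by (intro integral_cong_AE) (auto simp: sq_integrable_def intro!: borel_measurable_scaleR elim!: eventually_mono)
    moreover have "(LINT x|lebesgue. \<psi> x *\<^sub>R rep_L2 (to_L2 (cgrad \<phi>)) x) = (LINT x|lebesgue. \<psi> x *\<^sub>R cgrad \<phi> x)"
      using rep_to_L2[OF sq_integrable_cgrad[OF assms]] sq_integrable_test_fun[OF psi] sq_integrable_cgrad[OF assms]
      by (intro integral_cong_AE) (auto simp: sq_integrable_def intro!: borel_measurable_scaleR elim!: eventually_mono)
    ultimately show "(LINT x|lebesgue. rep_L2 (to_L2 \<phi>) x *\<^sub>R cgrad \<psi> x) = - (LINT x|lebesgue. \<psi> x *\<^sub>R rep_L2 (to_L2 (cgrad \<phi>)) x)"
      using has_weak_grad_test_fun[OF assms, of \<Omega>] psi by (simp add: has_weak_grad_def)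
  qed
  show "to_L2 \<phi> \<in> H1 \<Omega>" unfolding H1_def using w to_L2_test_fun[OF assms] to_L2_cgrad[OF assms] by blast
  show "grad \<Omega> (to_L2 \<phi>) = to_L2 (cgrad \<phi>)" using to_L2_cgrad[OF assms] w by (rule grad_eqI)
qed

lemma H10_H1: "u \<in> H10 \<Omega> \<Longrightarrow> u \<in> H1 \<Omega>" by (simp add: H10_def)

lemma H1_norm_le: "H1_norm \<Omega> u \<le> norm u + norm (grad \<Omega> u)"
  unfolding H1_norm_def by (rule sqrt_sum_squares_le_sum) auto

lemma H10_approx:
  assumes "u \<in> H10 \<Omega>"
  shows "\<exists>\<phi>. (\<forall>n. test_fun \<Omega> (\<phi> n)) \<and> (\<lambda>n. to_L2 (\<phi> n)) \<longlonglongrightarrow> u \<and> (\<lambda>n. to_L2 (cgrad (\<phi> n))) \<longlonglongrightarrow> grad \<Omega> u"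
proof -
  have "\<exists>\<phi>. test_fun \<Omega> \<phi> \<and> H1_norm \<Omega> (u - to_L2 \<phi>) < 1 / real (Suc n)" for n
    using assms by (simp add: H10_def)
  then obtain \<phi> where phi: "\<And>n. test_fun \<Omega> (\<phi> n)" "\<And>n. H1_norm \<Omega> (u - to_L2 (\<phi> n)) < 1 / real (Suc n)"
    by metis
  have lim: "(\<lambda>n. 1 / real (Suc n)) \<longlonglongrightarrow> 0"
    using LIMSEQ_inverse_real_of_nat by (simp add: inverse_eq_divide)
  have "norm (to_L2 (\<phi> n) - u) \<le> 1 / real (Suc n)" "norm (to_L2 (cgrad (\<phi> n)) - grad \<Omega> u) \<le> 1 / real (Suc n)" for n
  proof -
    have "norm (u - to_L2 (\<phi> n)) \<le> H1_norm \<Omega> (u - to_L2 (\<phi> n))"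
      "norm (grad \<Omega> (u - to_L2 (\<phi> n))) \<le> H1_norm \<Omega> (u - to_L2 (\<phi> n))"
      unfolding H1_norm_def by (rule real_le_rsqrt, simp)+
    then show "norm (to_L2 (\<phi> n) - u) \<le> 1 / real (Suc n)" "norm (to_L2 (cgrad (\<phi> n)) - grad \<Omega> u) \<le> 1 / real (Suc n)"
      using phi(2)[of n] H1_diff(2)[OF H10_H1[OF assms] H1_test_fun(1)[OF phi(1)[of n]]] H1_test_fun(2)[OF phi(1)[of n]]
      by (simp_all add: norm_minus_commute)
  qed
  then have "(\<lambda>n. to_L2 (\<phi> n) - u) \<longlonglongrightarrow> 0" "(\<lambda>n. to_L2 (cgrad (\<phi> n)) - grad \<Omega> u) \<longlonglongrightarrow> 0"
    by (auto intro!: Lim_null_comparison[OF _ lim] always_eventually simp del: of_nat_Suc)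
  then show ?thesis using phi(1) by (auto intro!: exI[of _ \<phi>] dest: LIM_zero_cancel)
qed

text \<open>The weak gradient is closed, and a test function close to some \<open>u n\<close> close to \<open>v\<close> is close to \<open>v\<close>.\<close>

lemma H10_limit:
  assumes u: "\<And>n. u n \<in> H10 \<Omega>" "u \<longlonglongrightarrow> v" "(\<lambda>n. grad \<Omega> (u n)) \<longlonglongrightarrow> p"
  shows "v \<in> H10 \<Omega>" "grad \<Omega> v = p"
proof -
  have v: "v \<in> H1 \<Omega>" "grad \<Omega> v = p" using H1_limit[OF H10_H1[OF u(1)] u(2,3)] by auto
  show "grad \<Omega> v = p" by fact
  have "\<exists>\<phi>. test_fun \<Omega> \<phi> \<and> H1_norm \<Omega> (v - to_L2 \<phi>) < e" if "e > 0" for e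
  proof -
    have "(\<lambda>n. norm (v - u n)) \<longlonglongrightarrow> norm (v - v)" "(\<lambda>n. norm (grad \<Omega> v - grad \<Omega> (u n))) \<longlonglongrightarrow> norm (grad \<Omega> v - p)"
      by (intro tendsto_intros u)+
    then have "(\<lambda>n. norm (v - u n) + norm (grad \<Omega> v - grad \<Omega> (u n))) \<longlonglongrightarrow> 0"
      using tendsto_add v(2) by fastforce
    then have "\<forall>\<^sub>F n in sequentially. norm (v - u n) + norm (grad \<Omega> v - grad \<Omega> (u n)) < e / 2"
      using \<open>e > 0\<close> by (intro order_tendstoD) auto
    then obtain n where n: "norm (v - u n) + norm (grad \<Omega> v - grad \<Omega> (u n)) < e / 2"
      by (auto simp: eventually_sequentially)
    obtain \<phi> where phi: "\<And>k. test_fun \<Omega> (\<phi> k)" "(\<lambda>k. to_L2 (\<phi> k)) \<longlonglongrightarrow> u n" "(\<lambda>k. to_L2 (cgrad (\<phi> k))) \<longlonglongrightarrow> grad \<Omega> (u n)"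
      using H10_approx[OF u(1)[of n]] by blast
    have "(\<lambda>k. norm (u n - to_L2 (\<phi> k)) + norm (grad \<Omega> (u n) - to_L2 (cgrad (\<phi> k)))) \<longlonglongrightarrow> norm (u n - u n) + norm (grad \<Omega> (u n) - grad \<Omega> (u n))"
      by (intro tendsto_intros phi)
    then have "\<forall>\<^sub>F k in sequentially. norm (u n - to_L2 (\<phi> k)) + norm (grad \<Omega> (u n) - to_L2 (cgrad (\<phi> k))) < e / 2"
      using \<open>e > 0\<close> by (intro order_tendstoD) auto
    then obtain k where k: "norm (u n - to_L2 (\<phi> k)) + norm (grad \<Omega> (u n) - to_L2 (cgrad (\<phi> k))) < e / 2"
      by (auto simp: eventually_sequentially)
    have "H1_norm \<Omega> (v - to_L2 (\<phi> k)) \<le> norm (v - to_L2 (\<phi> k)) + norm (grad \<Omega> v - to_L2 (cgrad (\<phi> k)))"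
      using H1_norm_le[of "v - to_L2 (\<phi> k)"] H1_diff(2)[OF v(1) H1_test_fun(1)[OF phi(1)]] H1_test_fun(2)[OF phi(1)] by simp
    moreover have "norm (v - to_L2 (\<phi> k)) \<le> norm (v - u n) + norm (u n - to_L2 (\<phi> k))"
      using norm_triangle_ineq[of "v - u n" "u n - to_L2 (\<phi> k)"] by simp
    moreover have "norm (grad \<Omega> v - to_L2 (cgrad (\<phi> k))) \<le> norm (grad \<Omega> v - grad \<Omega> (u n)) + norm (grad \<Omega> (u n) - to_L2 (cgrad (\<phi> k)))"
      using norm_triangle_ineq[of "grad \<Omega> v - grad \<Omega> (u n)" "grad \<Omega> (u n) - to_L2 (cgrad (\<phi> k))"] by simp
    ultimately show ?thesis using n k phi(1)[of k] by (intro exI[of _ "\<phi> k"]) auto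
  qed
  then show "v \<in> H10 \<Omega>" using v(1) by (simp add: H10_def)
qed

lemma H10_test_fun: "test_fun \<Omega> \<phi> \<Longrightarrow> to_L2 \<phi> \<in> H10 \<Omega>"
  unfolding H10_def using H1_test_fun[of \<phi>] H1_scaleR[of "to_L2 \<phi>" 0] by (auto intro!: exI[of _ \<phi>] simp: H1_norm_def)

lemma H10_add:
  assumes "u \<in> H10 \<Omega>" "v \<in> H10 \<Omega>" shows "u + v \<in> H10 \<Omega>"
proof -
  obtain \<phi> \<psi> where phi: "\<And>n. test_fun \<Omega> (\<phi> n)" "(\<lambda>n. to_L2 (\<phi> n)) \<longlonglongrightarrow> u" "(\<lambda>n. to_L2 (cgrad (\<phi> n))) \<longlonglongrightarrow> grad \<Omega> u"
    and psi: "\<And>n. test_fun \<Omega> (\<psi> n)" "(\<lambda>n. to_L2 (\<psi> n)) \<longlonglongrightarrow> v" "(\<lambda>n. to_L2 (cgrad (\<psi> n))) \<longlonglongrightarrow> grad \<Omega> v"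
    using H10_approx[OF assms(1)] H10_approx[OF assms(2)] by metis
  have t: "test_fun \<Omega> (\<lambda>x. \<phi> n x + \<psi> n x)" for n using phi(1) psi(1) by (rule test_fun_add)
  have e: "to_L2 (\<lambda>x. \<phi> n x + \<psi> n x) = to_L2 (\<phi> n) + to_L2 (\<psi> n)"
    "grad \<Omega> (to_L2 (\<lambda>x. \<phi> n x + \<psi> n x)) = to_L2 (cgrad (\<phi> n)) + to_L2 (cgrad (\<psi> n))" for n
    using to_L2_add[OF sq_integrable_test_fun[OF phi(1)[of n]] sq_integrable_test_fun[OF psi(1)[of n]]]
      to_L2_add[OF sq_integrable_cgrad[OF phi(1)[of n]] sq_integrable_cgrad[OF psi(1)[of n]]]
      cgrad_add[OF phi(1)[of n] psi(1)[of n]] H1_test_fun(2)[OF t[of n]] by auto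
  show ?thesis
  proof (rule H10_limit(1)[where p = "grad \<Omega> u + grad \<Omega> v"])
    show "to_L2 (\<lambda>x. \<phi> n x + \<psi> n x) \<in> H10 \<Omega>" for n using t by (rule H10_test_fun)
    show "(\<lambda>n. to_L2 (\<lambda>x. \<phi> n x + \<psi> n x)) \<longlonglongrightarrow> u + v" unfolding e(1) by (intro tendsto_add phi psi)
    show "(\<lambda>n. grad \<Omega> (to_L2 (\<lambda>x. \<phi> n x + \<psi> n x))) \<longlonglongrightarrow> grad \<Omega> u + grad \<Omega> v" unfolding e(2) by (intro tendsto_add phi psi)
  qed
qed

lemma H10_scaleR:
  assumes "u \<in> H10 \<Omega>" shows "c *\<^sub>R u \<in> H10 \<Omega>"
proof -
  obtain \<phi> where phi: "\<And>n. test_fun \<Omega> (\<phi> n)" "(\<lambda>n. to_L2 (\<phi> n)) \<longlonglongrightarrow> u" "(\<lambda>n. to_L2 (cgrad (\<phi> n))) \<longlonglongrightarrow> grad \<Omega> u"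
    using H10_approx[OF assms(1)] by metis
  have t: "test_fun \<Omega> (\<lambda>x. c * \<phi> n x)" for n using phi(1) by (rule test_fun_scale)
  have e: "to_L2 (\<lambda>x. c * \<phi> n x) = c *\<^sub>R to_L2 (\<phi> n)"
    "grad \<Omega> (to_L2 (\<lambda>x. c * \<phi> n x)) = c *\<^sub>R to_L2 (cgrad (\<phi> n))" for n
    using to_L2_scaleR[OF sq_integrable_test_fun[OF phi(1)[of n]], of c]
      to_L2_scaleR[OF sq_integrable_cgrad[OF phi(1)[of n]], of c]
      cgrad_scale[OF phi(1)[of n]] H1_test_fun(2)[OF t[of n]] by auto
  show ?thesis
  proof (rule H10_limit(1)[where p = "c *\<^sub>R grad \<Omega> u"])
    show "to_L2 (\<lambda>x. c * \<phi> n x) \<in> H10 \<Omega>" for n using t by (rule H10_test_fun)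
    show "(\<lambda>n. to_L2 (\<lambda>x. c * \<phi> n x)) \<longlonglongrightarrow> c *\<^sub>R u" unfolding e(1) by (intro tendsto_scaleR tendsto_const phi)
    show "(\<lambda>n. grad \<Omega> (to_L2 (\<lambda>x. c * \<phi> n x))) \<longlonglongrightarrow> c *\<^sub>R grad \<Omega> u" unfolding e(2) by (intro tendsto_scaleR tendsto_const phi)
  qed
qed

lemma H10_zero: "0 \<in> H10 \<Omega>"
proof -
  have "test_fun \<Omega> (\<lambda>_. 0)" by (auto simp: test_fun_def smooth_on_def Ck_on_const)
  then show ?thesis using H10_test_fun H10_scaleR[of _ 0] by fastforce
qed

lemma subspace_H10: "subspace (H10 \<Omega>)"
  unfolding subspace_def using H10_zero H10_add H10_scaleR by blast

lemma H10_diff: "u \<in> H10 \<Omega> \<Longrightarrow> v \<in> H10 \<Omega> \<Longrightarrow> u - v \<in> H10 \<Omega>"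
  using subspace_H10 by (rule subspace_diff)

lemma grad_diff: "u \<in> H10 \<Omega> \<Longrightarrow> v \<in> H10 \<Omega> \<Longrightarrow> grad \<Omega> (u - v) = grad \<Omega> u - grad \<Omega> v"
  by (intro H1_diff H10_H1)

lemma grad_add: "u \<in> H10 \<Omega> \<Longrightarrow> v \<in> H10 \<Omega> \<Longrightarrow> grad \<Omega> (u + v) = grad \<Omega> u + grad \<Omega> v"
  by (intro H1_add H10_H1)

lemma grad_scaleR: "u \<in> H10 \<Omega> \<Longrightarrow> grad \<Omega> (c *\<^sub>R u) = c *\<^sub>R grad \<Omega> u"
  by (intro H1_scaleR H10_H1)

lemma grad_zero: "grad \<Omega> 0 = 0"
  using grad_scaleR[OF H10_zero, of 0] by simp

lemma H10_L2_on: "u \<in> H10 \<Omega> \<Longrightarrow> u \<in> L2_on \<Omega>"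
  by (simp add: H10_def H1_def)

text \<open>Fatou's lemma along an almost everywhere convergent sequence of test functions.\<close>

lemma sobolev_nn:
  assumes "u \<in> H10 \<Omega>"
  shows "(\<integral>\<^sup>+x. ennreal (rep_L2 u x ^ 6) \<partial>lebesgue) \<le> ennreal (4096 * norm (grad \<Omega> u) ^ 6)"
proof -
  obtain \<phi> where phi: "\<And>n. test_fun \<Omega> (\<phi> n)" "(\<lambda>n. to_L2 (\<phi> n)) \<longlonglongrightarrow> u" "(\<lambda>n. to_L2 (cgrad (\<phi> n))) \<longlonglongrightarrow> grad \<Omega> u"
    using H10_approx[OF assms(1)] by metis
  obtain r where r: "strict_mono r" "AE x in lebesgue. (\<lambda>n. rep_L2 (to_L2 (\<phi> (r n))) x) \<longlonglongrightarrow> rep_L2 u x"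
    using L2_tendsto_AE_subseq[OF phi(2)] by blast
  have all: "AE x in lebesgue. \<forall>n. rep_L2 (to_L2 (\<phi> (r n))) x = \<phi> (r n) x"
    by (subst AE_all_countable) (auto intro!: rep_to_L2 sq_integrable_test_fun[OF phi(1)])
  have [measurable]: "\<phi> n \<in> borel_measurable lebesgue" for n
    using sq_integrable_test_fun[OF phi(1)[of n]] by (simp add: sq_integrable_def)
  have "(\<integral>\<^sup>+x. ennreal (rep_L2 u x ^ 6) \<partial>lebesgue) = (\<integral>\<^sup>+x. liminf (\<lambda>n. ennreal (\<phi> (r n) x ^ 6)) \<partial>lebesgue)"
  proof (rule nn_integral_cong_AE, use r(2) all in eventually_elim)
    case (elim x)
    then have "(\<lambda>n. ennreal (\<phi> (r n) x ^ 6)) \<longlonglongrightarrow> ennreal (rep_L2 u x ^ 6)"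
      by (intro tendsto_intros) simp
    from lim_imp_Liminf[OF sequentially_bot this] show ?case by (rule sym)
  qed
  also have "\<dots> \<le> liminf (\<lambda>n. \<integral>\<^sup>+x. ennreal (\<phi> (r n) x ^ 6) \<partial>lebesgue)"
    by (rule nn_integral_liminf) measurable
  also have "\<dots> \<le> liminf (\<lambda>n. ennreal (4096 * norm (to_L2 (cgrad (\<phi> (r n)))) ^ 6))"
  proof (intro Liminf_mono always_eventually allI)
    fix n
    obtain C where C: "compact C" "\<And>x. x \<notin> C \<Longrightarrow> \<phi> (r n) x = 0"
      using test_fun_support[OF phi(1)[of "r n"]] by blast
    have "integrable lebesgue (\<lambda>x. \<phi> (r n) x ^ 6)"
      by (rule integrable_continuous_compact_support[of _ C]) (use C test_fun_continuous[OF phi(1)] in \<open>auto intro!: continuous_intros\<close>)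
    then have "(\<integral>\<^sup>+x. ennreal (\<phi> (r n) x ^ 6) \<partial>lebesgue) = ennreal (LINT x|lebesgue. \<phi> (r n) x ^ 6)"
      by (rule nn_integral_eq_integral) auto
    also have "\<dots> \<le> ennreal (4096 * ((norm (to_L2 (cgrad (\<phi> (r n)))))\<^sup>2) ^ 3)"
      using sobolev_test_fun[OF phi(1)] by (intro ennreal_leI) (simp add: norm_to_L2[OF sq_integrable_cgrad[OF phi(1)]])
    finally show "(\<integral>\<^sup>+x. ennreal (\<phi> (r n) x ^ 6) \<partial>lebesgue) \<le> ennreal (4096 * norm (to_L2 (cgrad (\<phi> (r n)))) ^ 6)"
      by (simp add: power_mult[symmetric])
  qed
  also have "\<dots> = ennreal (4096 * norm (grad \<Omega> u) ^ 6)"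
  proof -
    have "(\<lambda>n. to_L2 (cgrad (\<phi> (r n)))) \<longlonglongrightarrow> grad \<Omega> u"
      using LIMSEQ_subseq_LIMSEQ[OF phi(3) r(1)] by (simp add: o_def)
    then have "(\<lambda>n. ennreal (4096 * norm (to_L2 (cgrad (\<phi> (r n)))) ^ 6)) \<longlonglongrightarrow> ennreal (4096 * norm (grad \<Omega> u) ^ 6)"
      by (intro tendsto_intros)
    then show ?thesis using lim_imp_Liminf sequentially_bot by blast
  qed
  finally show ?thesis .
qed

lemma sobolev:
  assumes "u \<in> H10 \<Omega>"
  shows "integrable lebesgue (\<lambda>x. rep_L2 u x ^ 6)"
    and "(LINT x|lebesgue. rep_L2 u x ^ 6) \<le> 4096 * norm (grad \<Omega> u) ^ 6"
proof -
  show i: "integrable lebesgue (\<lambda>x. rep_L2 u x ^ 6)"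
    using sobolev_nn[OF assms] by (intro integrableI_bounded) (auto simp: power_even_abs intro: le_less_trans)
  show "(LINT x|lebesgue. rep_L2 u x ^ 6) \<le> 4096 * norm (grad \<Omega> u) ^ 6"
    using sobolev_nn[OF assms] nn_integral_eq_integral[OF i] by (simp add: ennreal_le_iff)
qed

text \<open>Poincare's inequality follows from the Sobolev inequality, as \<open>t\<^sup>2 \<le> 1 + t ^ 6\<close>
  and \<open>\<Omega>\<close> has finite measure.\<close>

definition "pc = sqrt (measure lebesgue \<Omega> + 4096)"

lemma pc_pos: "pc > 0" unfolding pc_def using measure_nonneg[of lebesgue \<Omega>] by (auto intro: add_nonneg_pos)

lemma square_le_1_plus_power6: "t\<^sup>2 \<le> 1 + t ^ 6" for t :: real
proof (cases "\<bar>t\<bar> \<le> 1")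
  case True
  then have "t\<^sup>2 \<le> 1" by (simp add: abs_square_le_1)
  then show ?thesis by (simp add: add_increasing2)
next
  case False
  then have "\<bar>t\<bar> ^ 2 \<le> \<bar>t\<bar> ^ 6" by (intro power_increasing) auto
  then show ?thesis by simp
qed

lemma emeasure_domain_finite: "emeasure lebesgue \<Omega> < \<infinity>"
  using emeasure_bounded_finite[OF bounded_domain] open_domain by (simp add: borel_open)

lemma poincare:
  assumes u: "u \<in> H10 \<Omega>" shows "norm u \<le> pc * norm (grad \<Omega> u)"
proof (cases "grad \<Omega> u = 0")
  case True
  have "(\<integral>\<^sup>+x. ennreal (rep_L2 u x ^ 6) \<partial>lebesgue) = 0" using sobolev_nn[OF u] True by simp
  then have "AE x in lebesgue. ennreal (rep_L2 u x ^ 6) = 0"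
    by (subst (asm) nn_integral_0_iff_AE) measurable
  then have "AE x in lebesgue. rep_L2 u x = rep_L2 0 x"
    using rep_zero[where 'b = real]
  proof eventually_elim
    case (elim x)
    have "rep_L2 u x ^ 6 \<le> 0" using elim(1) by (simp add: ennreal_eq_0_iff)
    moreover have "rep_L2 u x ^ 6 \<ge> 0" by simp
    ultimately have "rep_L2 u x ^ 6 = 0" by linarith
    then show ?case using elim(2) by simp
  qed
  then have "u = 0" by (rule L2_eqI)
  then show ?thesis by (simp add: pc_pos less_imp_le)
next
  case False
  \<comment> \<open>The pointwise bound is not homogeneous, so \<open>u\<close> is normalised first.\<close>
  define v where "v = (1 / norm (grad \<Omega> u)) *\<^sub>R u"
  have v: "v \<in> H10 \<Omega>" "norm (grad \<Omega> v) = 1"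
    using u False by (auto simp: v_def H10_scaleR grad_scaleR)
  have iO: "integrable lebesgue (indicator \<Omega> :: real^3 \<Rightarrow> real)"
    using emeasure_domain_finite domain_sets by (intro integrable_real_indicator) auto
  have "(norm v)\<^sup>2 = (LINT x|lebesgue. (norm (rep_L2 v x))\<^sup>2)" by (rule norm_L2_rep)
  also have "\<dots> \<le> (LINT x|lebesgue. indicator \<Omega> x + rep_L2 v x ^ 6)"
  proof (rule integral_mono_AE)
    have "AE x in lebesgue. x \<notin> \<Omega> \<longrightarrow> rep_L2 v x = 0" using H10_L2_on[OF v(1)] by (simp add: L2_on_def)
    then show "AE x in lebesgue. (norm (rep_L2 v x))\<^sup>2 \<le> indicator \<Omega> x + rep_L2 v x ^ 6"
    proof eventually_elim
      case (elim x)
      then show ?case using square_le_1_plus_power6[of "rep_L2 v x"] by (cases "x \<in> \<Omega>") auto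
    qed
    show "integrable lebesgue (\<lambda>x. indicator \<Omega> x + rep_L2 v x ^ 6)"
      using iO sobolev(1)[OF v(1)] by (rule Bochner_Integration.integrable_add)
  qed (rule integrable_norm_rep)
  also have "\<dots> = measure lebesgue \<Omega> + (LINT x|lebesgue. rep_L2 v x ^ 6)"
    using iO sobolev(1)[OF v(1)] domain_sets by simp
  also have "\<dots> \<le> measure lebesgue \<Omega> + 4096" using sobolev(2)[OF v(1)] v(2) by simp
  finally have "norm v \<le> pc" unfolding pc_def by (rule real_le_rsqrt)
  then show ?thesis using False by (simp add: v_def field_simps)
qed

text \<open>Elements of nearly minimal gradient among those close to \<open>v\<close> form a Cauchy sequence, by the
  parallelogram law; so \<open>v\<close> keeps a weak gradient.\<close>

lemma H10_ball_closed:
  assumes u: "\<And>n. u n \<in> H10 \<Omega>" "\<And>n. norm (grad \<Omega> (u n)) \<le> \<rho>" and lim: "u \<longlonglongrightarrow> v"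
  shows "v \<in> H10 \<Omega>"
proof -
  \<comment> \<open>The sets \<open>S k\<close> are convex and contain elements of the sequence, so the infimum \<open>m k\<close> of the gradient
    norms over \<open>S k\<close> is at most \<open>\<rho>\<close>; it increases with \<open>k\<close>.\<close>
  define S where "S k = {w \<in> H10 \<Omega>. norm (w - v) \<le> 1 / real (Suc k)}" for k
  define m where "m k = (INF w\<in>S k. norm (grad \<Omega> w))" for k
  have bdd: "bdd_below ((\<lambda>w. norm (grad \<Omega> w)) ` S k)" for k by (rule bdd_belowI[of _ 0]) auto
  have Santi: "S j \<subseteq> S k" if "k \<le> j" for j k
  proof -
    have "1 / real (Suc j) \<le> 1 / real (Suc k)" using that by (intro divide_left_mono) auto
    then show ?thesis by (auto simp: S_def simp del: of_nat_Suc)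
  qed
  have un: "\<exists>n. u n \<in> S k" for k
  proof -
    have "\<forall>\<^sub>F n in sequentially. dist (u n) v < 1 / real (Suc k)"
      using lim by (rule tendstoD) simp
    then obtain n where "dist (u n) v < 1 / real (Suc k)" by (auto simp: eventually_sequentially)
    then show ?thesis using u(1) by (auto simp: S_def dist_norm intro: less_imp_le)
  qed
  then have ne: "S k \<noteq> {}" for k by blast
  have m_le: "m k \<le> norm (grad \<Omega> w)" if "w \<in> S k" for k w
    unfolding m_def using bdd that by (rule cINF_lower)
  have m_rho: "m k \<le> \<rho>" for k using un[of k] m_le u(2) by (meson order_trans)
  have m0: "0 \<le> m k" for k unfolding m_def using ne by (intro cINF_greatest) auto
  have incm: "m k \<le> m j" if "k \<le> j" for k j
    unfolding m_def using Santi[OF that] ne bdd by (intro cINF_superset_mono) auto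
  have "\<exists>w\<in>S k. norm (grad \<Omega> w) < m k + 1 / real (Suc k)" for k
    using cINF_less_iff[OF ne bdd, of k "m k + 1 / real (Suc k)"] by (simp add: m_def)
  then obtain w where w: "\<And>k. w k \<in> S k" "\<And>k. norm (grad \<Omega> (w k)) < m k + 1 / real (Suc k)" by metis
  have wH: "w k \<in> H10 \<Omega>" for k using w(1)[of k] by (simp add: S_def)
  have "incseq m" using incm by (simp add: incseq_def)
  then obtain M where M: "m \<longlonglongrightarrow> M"
    using incseq_convergent[of m \<rho>] m_rho by metis
  have mM: "m k \<le> M" for k using incm by (intro incseq_le[OF _ M]) (auto simp: incseq_def)
  have key: "(norm (grad \<Omega> (w k) - grad \<Omega> (w j)))\<^sup>2 \<le> 4 * (M + 1 / real (Suc k))\<^sup>2 - 4 * (m k)\<^sup>2" if kj: "k \<le> j" for k j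
  proof -
    have wj: "w j \<in> S k" using w(1)[of j] Santi[OF kj] by blast
    have "(1/2) *\<^sub>R (w k + w j) \<in> S k"
    proof -
      have "norm ((1/2) *\<^sub>R (w k + w j) - v) = norm ((1/2) *\<^sub>R ((w k - v) + (w j - v)))"
      proof -
        have "(1/2) *\<^sub>R ((w k - v) + (w j - v)) = (1/2) *\<^sub>R (w k + w j) - (1/2) *\<^sub>R (v + v)"
          by (simp only: scaleR_diff_right[symmetric]) (simp add: algebra_simps)
        also have "(1/2) *\<^sub>R (v + v) = v" by (simp add: scaleR_2[symmetric])
        finally show ?thesis by simp
      qed
      also have "\<dots> \<le> (norm (w k - v) + norm (w j - v)) / 2"
        using norm_triangle_ineq[of "w k - v" "w j - v"] by simp
      also have "\<dots> \<le> 1 / real (Suc k)" using w(1)[of k] wj by (simp add: S_def)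
      finally show ?thesis using wH by (simp add: S_def H10_add H10_scaleR)
    qed
    then have "m k \<le> norm (grad \<Omega> ((1/2) *\<^sub>R (w k + w j)))" by (rule m_le)
    also have "grad \<Omega> ((1/2) *\<^sub>R (w k + w j)) = (1/2) *\<^sub>R (grad \<Omega> (w k) + grad \<Omega> (w j))"
      using wH by (simp add: grad_scaleR grad_add H10_add)
    finally have "2 * m k \<le> norm (grad \<Omega> (w k) + grad \<Omega> (w j))" by simp
    then have "(2 * m k)\<^sup>2 \<le> (norm (grad \<Omega> (w k) + grad \<Omega> (w j)))\<^sup>2" using m0 by (intro power_mono) auto
    moreover have "norm (grad \<Omega> (w k)) \<le> M + 1 / real (Suc k)" using w(2)[of k] mM[of k] by simp
    then have "(norm (grad \<Omega> (w k)))\<^sup>2 \<le> (M + 1 / real (Suc k))\<^sup>2" by (intro power_mono) auto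
    moreover have "norm (grad \<Omega> (w j)) \<le> M + 1 / real (Suc k)"
    proof -
      have "1 / real (Suc j) \<le> 1 / real (Suc k)" using kj by (intro divide_left_mono) auto
      then show ?thesis using w(2)[of j] mM[of j] by linarith
    qed
    then have "(norm (grad \<Omega> (w j)))\<^sup>2 \<le> (M + 1 / real (Suc k))\<^sup>2" by (intro power_mono) auto
    ultimately show ?thesis
      using parallelogram[of "grad \<Omega> (w k)" "grad \<Omega> (w j)"] by (simp add: power_mult_distrib)
  qed
  have "Cauchy (\<lambda>k. grad \<Omega> (w k))"
  proof (rule metric_CauchyI)
    fix e :: real assume "e > 0"
    have inv: "(\<lambda>k. 1 / real (Suc k)) \<longlonglongrightarrow> 0" using LIMSEQ_inverse_real_of_nat by (simp add: inverse_eq_divide)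
    have "(\<lambda>k. 4 * (M + 1 / real (Suc k))\<^sup>2 - 4 * (m k)\<^sup>2) \<longlonglongrightarrow> 4 * (M + 0)\<^sup>2 - 4 * M\<^sup>2"
      by (intro tendsto_intros inv M)
    then have "\<forall>\<^sub>F k in sequentially. 4 * (M + 1 / real (Suc k))\<^sup>2 - 4 * (m k)\<^sup>2 < (e/2)\<^sup>2"
      using \<open>e > 0\<close> by (intro order_tendstoD) auto
    then obtain k where k: "4 * (M + 1 / real (Suc k))\<^sup>2 - 4 * (m k)\<^sup>2 < (e/2)\<^sup>2" by (auto simp: eventually_sequentially)
    have c: "norm (grad \<Omega> (w k) - grad \<Omega> (w j)) < e / 2" if "k \<le> j" for j
      by (rule power_less_imp_less_base[of _ 2]) (use key[OF that] k \<open>e > 0\<close> in auto)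
    have "dist (grad \<Omega> (w i)) (grad \<Omega> (w j)) < e" if "i \<ge> k" "j \<ge> k" for i j
      using c[OF that(1)] c[OF that(2)] norm_triangle_ineq4[of "grad \<Omega> (w k) - grad \<Omega> (w j)" "grad \<Omega> (w k) - grad \<Omega> (w i)"]
      by (simp add: dist_norm)
    then show "\<exists>N. \<forall>i\<ge>N. \<forall>j\<ge>N. dist (grad \<Omega> (w i)) (grad \<Omega> (w j)) < e" by blast
  qed
  then obtain p where p: "(\<lambda>k. grad \<Omega> (w k)) \<longlonglongrightarrow> p" using Cauchy_convergent convergent_def by blast
  have "w \<longlonglongrightarrow> v"
  proof (rule LIM_zero_cancel, rule Lim_null_comparison)
    show "\<forall>\<^sub>F k in sequentially. norm (w k - v) \<le> 1 / real (Suc k)" using w(1) by (simp add: S_def)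
    show "(\<lambda>k. 1 / real (Suc k)) \<longlonglongrightarrow> 0" using LIMSEQ_inverse_real_of_nat by (simp add: inverse_eq_divide)
  qed
  then show ?thesis using H10_limit(1)[OF wH _ p] by blast
qed

end

section \<open>The phase spaces\<close>

context bounded_domain begin

lemma norm_grad_minus: "norm (grad \<Omega> (- u)) = norm (grad \<Omega> u)"
proof -
  have iff: "p \<in> L2_on \<Omega> \<and> has_weak_grad \<Omega> (rep_L2 (- u)) (rep_L2 p) \<longleftrightarrow>
      - p \<in> L2_on \<Omega> \<and> has_weak_grad \<Omega> (rep_L2 u) (rep_L2 (- p))" for p
  proof -
    have "- p \<in> L2_on \<Omega> \<longleftrightarrow> p \<in> L2_on \<Omega>"
      using subspace_neg[OF subspace_L2_on, of "- p" \<Omega>] subspace_neg[OF subspace_L2_on, of p \<Omega>] by auto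
    then show ?thesis unfolding has_weak_grad_iff_inner by (auto simp: minus_equation_iff[of "u \<bullet> _"] eq_commute)
  qed
  show ?thesis
  proof (cases "\<exists>p. p \<in> L2_on \<Omega> \<and> has_weak_grad \<Omega> (rep_L2 u) (rep_L2 p)")
    case True
    then obtain p where p: "p \<in> L2_on \<Omega>" "has_weak_grad \<Omega> (rep_L2 u) (rep_L2 p)" by blast
    then have "- p \<in> L2_on \<Omega>" "has_weak_grad \<Omega> (rep_L2 (- u)) (rep_L2 (- p))"
      using iff[of "- p"] by auto
    then have "grad \<Omega> (- u) = - p" by (rule grad_eqI)
    then show ?thesis using grad_eqI[OF p] by simp
  next
    \<comment> \<open>Neither \<open>u\<close> nor \<open>- u\<close> has a weak gradient, and both description operators have the
      same empty predicate.\<close>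
    case False
    then have "(\<lambda>p. p \<in> L2_on \<Omega> \<and> has_weak_grad \<Omega> (rep_L2 (- u)) (rep_L2 p)) = (\<lambda>_. False)"
      "(\<lambda>p. p \<in> L2_on \<Omega> \<and> has_weak_grad \<Omega> (rep_L2 u) (rep_L2 p)) = (\<lambda>_. False)"
      using iff by blast+
    then show ?thesis by (simp add: grad_def)
  qed
qed

lemma E_dist_eq:
  assumes "\<xi> \<in> E \<Omega>" "\<eta> \<in> E \<Omega>"
  shows "E_dist \<Omega> \<xi> \<eta> = norm ((grad \<Omega> (fst \<xi>), snd \<xi>) - (grad \<Omega> (fst \<eta>), snd \<eta>))"
  using assms by (auto simp: E_dist_def E_norm_def E_def grad_diff norm_Pair)

text \<open>Symmetry is required of arbitrary states, also of those without a weak gradient; definiteness is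
  Poincare's inequality.\<close>

lemma E_metric: "Metric_space (E \<Omega>) (E_dist \<Omega>)"
proof
  fix \<xi> \<eta> \<zeta> :: state
  show "0 \<le> E_dist \<Omega> \<xi> \<eta>" by (simp add: E_dist_def E_norm_def)
  show "E_dist \<Omega> \<xi> \<eta> = E_dist \<Omega> \<eta> \<xi>"
    using norm_grad_minus[of "fst \<xi> - fst \<eta>"] norm_minus_commute[of "snd \<xi>" "snd \<eta>"]
    by (simp add: E_dist_def E_norm_def)
  assume x: "\<xi> \<in> E \<Omega>" and y: "\<eta> \<in> E \<Omega>"
  show "E_dist \<Omega> \<xi> \<eta> = 0 \<longleftrightarrow> \<xi> = \<eta>"
  proof
    assume "E_dist \<Omega> \<xi> \<eta> = 0"
    then have "grad \<Omega> (fst \<xi>) = grad \<Omega> (fst \<eta>)" "snd \<xi> = snd \<eta>" using E_dist_eq[OF x y] by (auto simp: zero_prod_def)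
    moreover have "norm (fst \<xi> - fst \<eta>) \<le> pc * norm (grad \<Omega> (fst \<xi> - fst \<eta>))"
      using x y by (intro poincare H10_diff) (auto simp: E_def)
    ultimately show "\<xi> = \<eta>" using x y by (auto simp: E_def grad_diff prod_eq_iff)
  qed (use E_dist_eq[OF x y] in simp)
  assume z: "\<zeta> \<in> E \<Omega>"
  show "E_dist \<Omega> \<xi> \<zeta> \<le> E_dist \<Omega> \<xi> \<eta> + E_dist \<Omega> \<eta> \<zeta>"
    unfolding E_dist_eq[OF x y] E_dist_eq[OF y z] E_dist_eq[OF x z]
    using norm_triangle_ineq[of "(grad \<Omega> (fst \<xi>), snd \<xi>) - (grad \<Omega> (fst \<eta>), snd \<eta>)" "(grad \<Omega> (fst \<eta>), snd \<eta>) - (grad \<Omega> (fst \<zeta>), snd \<zeta>)"]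
    by (simp add: algebra_simps)
qed

lemma Hm1_bound:
  assumes "\<phi> \<in> {\<phi> \<in> H10 \<Omega>. H10_norm \<Omega> \<phi> \<le> 1}" shows "\<bar>w \<bullet> \<phi>\<bar> \<le> pc * norm w"
proof -
  have "\<bar>w \<bullet> \<phi>\<bar> \<le> norm w * norm \<phi>" by (rule Cauchy_Schwarz_ineq2)
  also have "\<dots> \<le> norm w * (pc * 1)"
  proof (rule mult_left_mono)
    have "norm \<phi> \<le> pc * norm (grad \<Omega> \<phi>)" using assms by (intro poincare) auto
    also have "\<dots> \<le> pc * 1" using assms pc_pos by (intro mult_left_mono) (auto simp: H10_norm_def)
    finally show "norm \<phi> \<le> pc * 1" .
  qed simp
  finally show ?thesis by (simp add: mult.commute)
qed

lemma H10_unit_ball_nonempty: "{\<phi> \<in> H10 \<Omega>. H10_norm \<Omega> \<phi> \<le> 1} \<noteq> {}"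
  using H10_zero grad_zero by (auto simp: H10_norm_def intro!: exI[of _ 0])

lemma Hm1_bdd: "bdd_above ((\<lambda>\<phi>. \<bar>w \<bullet> \<phi>\<bar>) ` {\<phi> \<in> H10 \<Omega>. H10_norm \<Omega> \<phi> \<le> 1})"
  using Hm1_bound[of _ w] by (intro bdd_aboveI[of _ "pc * norm w"]) auto

lemma Hm1_norm_le: "Hm1_norm \<Omega> (inner w) \<le> pc * norm w"
  unfolding Hm1_norm_def using Hm1_bound H10_unit_ball_nonempty by (intro cSUP_least)

lemma Hm1_norm_nonneg: "0 \<le> Hm1_norm \<Omega> (inner w)"
proof -
  have "\<bar>w \<bullet> 0\<bar> \<le> Hm1_norm \<Omega> (inner w)"
    unfolding Hm1_norm_def by (rule cSUP_upper[OF _ Hm1_bdd]) (simp add: H10_zero H10_norm_def grad_zero)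
  then show ?thesis by simp
qed

lemma Hm1_norm_triangle: "Hm1_norm \<Omega> (inner (v + w)) \<le> Hm1_norm \<Omega> (inner v) + Hm1_norm \<Omega> (inner w)"
  unfolding Hm1_norm_def[of \<Omega> "inner (v + w)"]
proof (rule cSUP_least[OF H10_unit_ball_nonempty])
  fix \<phi> assume phi: "\<phi> \<in> {\<phi> \<in> H10 \<Omega>. H10_norm \<Omega> \<phi> \<le> 1}"
  have "\<bar>v \<bullet> \<phi>\<bar> \<le> Hm1_norm \<Omega> (inner v)" "\<bar>w \<bullet> \<phi>\<bar> \<le> Hm1_norm \<Omega> (inner w)"
    unfolding Hm1_norm_def by (rule cSUP_upper[OF phi Hm1_bdd])+
  then show "\<bar>(v + w) \<bullet> \<phi>\<bar> \<le> Hm1_norm \<Omega> (inner v) + Hm1_norm \<Omega> (inner w)"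
    by (simp add: inner_add_left)
qed

lemma Em1_norm_nonneg: "0 \<le> Em1_norm \<Omega> \<xi>"
  by (simp add: Em1_norm_def)

lemma norm_fst_le_Em1: "norm (fst \<xi>) \<le> Em1_norm \<Omega> \<xi>"
  unfolding Em1_norm_def by (rule real_le_rsqrt) simp

lemma Em1_norm_triangle: "Em1_norm \<Omega> (\<xi> + \<eta>) \<le> Em1_norm \<Omega> \<xi> + Em1_norm \<Omega> \<eta>"
proof -
  have "Em1_norm \<Omega> (\<xi> + \<eta>) \<le> sqrt ((norm (fst \<xi>) + norm (fst \<eta>))\<^sup>2 + (Hm1_norm \<Omega> (inner (snd \<xi>)) + Hm1_norm \<Omega> (inner (snd \<eta>)))\<^sup>2)"
    unfolding Em1_norm_def
    by (intro real_sqrt_le_mono add_mono power_mono)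
      (auto simp: norm_triangle_ineq Hm1_norm_triangle Hm1_norm_nonneg)
  also have "\<dots> \<le> Em1_norm \<Omega> \<xi> + Em1_norm \<Omega> \<eta>"
    unfolding Em1_norm_def by (rule real_sqrt_sum_squares_triangle_ineq)
  finally show ?thesis .
qed

lemma Em1_le_E_norm:
  assumes "fst \<xi> \<in> H10 \<Omega>" shows "Em1_norm \<Omega> \<xi> \<le> pc * E_norm \<Omega> \<xi>"
proof -
  have "Em1_norm \<Omega> \<xi> \<le> sqrt ((pc * norm (grad \<Omega> (fst \<xi>)))\<^sup>2 + (pc * norm (snd \<xi>))\<^sup>2)"
    unfolding Em1_norm_def
    by (intro real_sqrt_le_mono add_mono power_mono) (auto simp: poincare[OF assms] Hm1_norm_le Hm1_norm_nonneg)
  also have "\<dots> = sqrt (pc\<^sup>2 * ((norm (grad \<Omega> (fst \<xi>)))\<^sup>2 + (norm (snd \<xi>))\<^sup>2))"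
    by (simp add: power_mult_distrib algebra_simps)
  also have "\<dots> = pc * E_norm \<Omega> \<xi>" using pc_pos by (simp add: E_norm_def real_sqrt_mult)
  finally show ?thesis .
qed

end

section \<open>Elliptic coefficients\<close>

text \<open>The properties that the oscillating and the homogenised coefficients share.\<close>

definition elliptic_coeff :: "real \<Rightarrow> real \<Rightarrow> (real^3 \<Rightarrow> real^3^3) \<Rightarrow> bool" where
  "elliptic_coeff \<nu> \<Lambda> b \<longleftrightarrow> 0 < \<nu> \<and> 0 \<le> \<Lambda> \<and>
     (\<forall>i j. (\<lambda>x. b x $ i $ j) \<in> borel_measurable lebesgue) \<and>
     (\<forall>x i j. b x $ i $ j = b x $ j $ i) \<and>
     (\<forall>x \<eta>. \<nu> * (norm \<eta>)\<^sup>2 \<le> (b x *v \<eta>) \<bullet> \<eta>) \<and>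
     (\<forall>x \<eta>. norm (b x *v \<eta>) \<le> \<Lambda> * norm \<eta>)"

lemma symmetric_matrix_inner:
  fixes A :: "real^3^3"
  assumes "\<And>i j. A $ i $ j = A $ j $ i" shows "(A *v \<eta>) \<bullet> \<zeta> = (A *v \<zeta>) \<bullet> \<eta>"
proof -
  have "transpose A = A" using assms by (simp add: transpose_def vec_eq_iff)
  then have "(A *v \<eta>) \<bullet> \<zeta> = (\<eta> v* A) \<bullet> \<zeta>" by (metis transpose_matrix_vector)
  also have "\<dots> = \<eta> \<bullet> (A *v \<zeta>)" by (rule dot_lmul_matrix)
  finally show ?thesis by (simp add: inner_commute)
qed

text \<open>A bound on the quadratic form bounds a symmetric matrix, by polarisation at two vectors of
  equal length.\<close>

lemma norm_symmetric_matrix_le: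
  fixes A :: "real^3^3"
  assumes sym: "\<And>i j. A $ i $ j = A $ j $ i"
    and lo: "\<And>\<eta>. 0 \<le> (A *v \<eta>) \<bullet> \<eta>" and hi: "\<And>\<eta>. (A *v \<eta>) \<bullet> \<eta> \<le> \<Lambda> * (norm \<eta>)\<^sup>2" and "\<Lambda> \<ge> 0"
  shows "norm (A *v \<eta>) \<le> \<Lambda> * norm \<eta>"
proof (cases "A *v \<eta> = 0")
  case True
  then show ?thesis using \<open>\<Lambda> \<ge> 0\<close> by simp
next
  case False
  define \<zeta> where "\<zeta> = (norm \<eta> / norm (A *v \<eta>)) *\<^sub>R (A *v \<eta>)"
  have nz: "norm \<zeta> = norm \<eta>" using False by (simp add: \<zeta>_def)
  have "\<eta> \<noteq> 0" using False by auto
  have "(A *v \<eta>) \<bullet> \<zeta> = norm \<eta> * norm (A *v \<eta>)"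
    using False by (simp add: \<zeta>_def dot_square_norm power2_eq_square)
  moreover have "4 * ((A *v \<eta>) \<bullet> \<zeta>) = (A *v (\<eta> + \<zeta>)) \<bullet> (\<eta> + \<zeta>) - (A *v (\<eta> - \<zeta>)) \<bullet> (\<eta> - \<zeta>)"
    using symmetric_matrix_inner[OF sym, of \<zeta> \<eta>]
    by (simp add: matrix_vector_right_distrib matrix_vector_mult_diff_distrib inner_add_left inner_add_right inner_diff_left inner_diff_right)
  moreover have "(A *v (\<eta> + \<zeta>)) \<bullet> (\<eta> + \<zeta>) \<le> \<Lambda> * (2 * norm \<eta>)\<^sup>2"
  proof -
    have "norm (\<eta> + \<zeta>) \<le> 2 * norm \<eta>" using norm_triangle_ineq[of \<eta> \<zeta>] nz by simp
    then have "(norm (\<eta> + \<zeta>))\<^sup>2 \<le> (2 * norm \<eta>)\<^sup>2" by (intro power_mono) auto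
    then show ?thesis using hi[of "\<eta> + \<zeta>"] \<open>\<Lambda> \<ge> 0\<close> by (meson mult_left_mono order_trans)
  qed
  ultimately have "4 * (norm \<eta> * norm (A *v \<eta>)) \<le> \<Lambda> * (2 * norm \<eta>)\<^sup>2" using lo[of "\<eta> - \<zeta>"] by linarith
  then have "norm \<eta> * norm (A *v \<eta>) \<le> norm \<eta> * (\<Lambda> * norm \<eta>)" by (simp add: power2_eq_square algebra_simps)
  then show ?thesis using \<open>\<eta> \<noteq> 0\<close> by simp
qed

lemma admissible_coeff_elliptic:
  assumes "admissible_coeff \<nu> a" shows "elliptic_coeff \<nu> (inverse \<nu>) a"
  unfolding elliptic_coeff_def
proof (intro conjI allI)
  have nu: "0 < \<nu>" using assms by (simp add: admissible_coeff_def)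
  show "0 < \<nu>" by fact
  then show "0 \<le> inverse \<nu>" by simp
  show lower: "\<nu> * (norm \<eta>)\<^sup>2 \<le> (a x *v \<eta>) \<bullet> \<eta>" for x \<eta> using assms by (simp add: admissible_coeff_def)
  show "norm (a x *v \<eta>) \<le> inverse \<nu> * norm \<eta>" for x \<eta>
  proof (rule norm_symmetric_matrix_le)
    show "0 \<le> (a x *v \<eta>) \<bullet> \<eta>" for \<eta> using lower[of \<eta> x] nu by (meson less_imp_le mult_nonneg_nonneg order_trans zero_le_power2)
  qed (use assms nu in \<open>auto simp: admissible_coeff_def\<close>)
qed (use assms in \<open>auto simp: admissible_coeff_def\<close>)

lemma elliptic_osc_coeff:
  assumes "elliptic_coeff \<nu> \<Lambda> a" shows "elliptic_coeff \<nu> \<Lambda> (osc_coeff a \<epsilon>)"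
proof -
  have "(\<lambda>x. a (x /\<^sub>R \<epsilon>) $ i $ j) \<in> borel_measurable lebesgue" for i j
    using assms measurable_compose[OF lebesgue_measurable_scaling[of "inverse \<epsilon>"], of "\<lambda>x. a x $ i $ j" borel]
    by (auto simp: elliptic_coeff_def)
  then show ?thesis using assms by (auto simp: elliptic_coeff_def osc_coeff_def)
qed

definition coeff_op :: "(real^3 \<Rightarrow> real^3^3) \<Rightarrow> (real^3) L2 \<Rightarrow> (real^3) L2" where
  "coeff_op b p = to_L2 (\<lambda>x. b x *v rep_L2 p x)"

lemma flux_eq: "flux \<Omega> b u = coeff_op b (grad \<Omega> u)"
  by (simp add: flux_def coeff_op_def)

lemma measurable_coeff_mult:
  assumes b: "elliptic_coeff \<nu> \<Lambda> b" and p: "p \<in> borel_measurable lebesgue"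
  shows "(\<lambda>x. b x *v (p x :: real^3)) \<in> borel_measurable lebesgue"
proof (subst borel_measurable_euclidean_space, intro ballI)
  fix e :: "real^3" assume "e \<in> Basis"
  then obtain i where e: "e = axis i 1" by (auto simp: Basis_vec_def)
  have "(\<lambda>x. b x $ i $ j * p x $ j) \<in> borel_measurable lebesgue" for j
  proof (rule borel_measurable_times)
    show "(\<lambda>x. p x $ j) \<in> borel_measurable lebesgue"
      using borel_measurable_inner[OF p borel_measurable_const[of "axis j 1"]] by (simp add: inner_axis)
  qed (use b in \<open>simp add: elliptic_coeff_def\<close>)
  then show "(\<lambda>x. (b x *v p x) \<bullet> e) \<in> borel_measurable lebesgue"
    by (simp add: e inner_axis matrix_vector_mult_def)
qed

lemma sq_integrable_coeff_mult:
  assumes b: "elliptic_coeff \<nu> \<Lambda> b" and p: "sq_integrable p"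
  shows "sq_integrable (\<lambda>x. b x *v p x)"
  by (rule sq_integrable_bound[OF p, of _ \<Lambda>])
    (use b p in \<open>auto simp: elliptic_coeff_def sq_integrable_def intro!: measurable_coeff_mult[OF b]\<close>)

lemma rep_coeff_op:
  assumes "elliptic_coeff \<nu> \<Lambda> b"
  shows "AE x in lebesgue. rep_L2 (coeff_op b p) x = b x *v rep_L2 p x"
  unfolding coeff_op_def by (intro rep_to_L2 sq_integrable_coeff_mult[OF assms] sq_integrable_rep)

lemma coeff_op_inner:
  assumes "elliptic_coeff \<nu> \<Lambda> b"
  shows "coeff_op b p \<bullet> q = (LINT x|lebesgue. (b x *v rep_L2 p x) \<bullet> rep_L2 q x)"
  unfolding coeff_op_def by (intro inner_to_L2_left sq_integrable_coeff_mult[OF assms] sq_integrable_rep)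

lemma coeff_op_sym:
  assumes "elliptic_coeff \<nu> \<Lambda> b" shows "coeff_op b p \<bullet> q = coeff_op b q \<bullet> p"
proof -
  have "(b x *v \<eta>) \<bullet> \<zeta> = (b x *v \<zeta>) \<bullet> \<eta>" for x \<eta> \<zeta>
    using assms by (intro symmetric_matrix_inner) (simp add: elliptic_coeff_def)
  then show ?thesis unfolding coeff_op_inner[OF assms] by metis
qed

lemma coeff_op_coercive:
  assumes b: "elliptic_coeff \<nu> \<Lambda> b" shows "\<nu> * (norm p)\<^sup>2 \<le> coeff_op b p \<bullet> p"
proof -
  have "\<nu> * (norm p)\<^sup>2 = (LINT x|lebesgue. \<nu> * (norm (rep_L2 p x))\<^sup>2)" by (simp add: norm_L2_rep)
  also have "\<dots> \<le> (LINT x|lebesgue. (b x *v rep_L2 p x) \<bullet> rep_L2 p x)"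
  proof (rule integral_mono)
    show "integrable lebesgue (\<lambda>x. (b x *v rep_L2 p x) \<bullet> rep_L2 p x)"
      by (intro sq_integrable_inner sq_integrable_coeff_mult[OF b] sq_integrable_rep)
    show "integrable lebesgue (\<lambda>x. \<nu> * (norm (rep_L2 p x))\<^sup>2)" by (intro integrable_mult_right integrable_norm_rep)
  qed (use b in \<open>simp add: elliptic_coeff_def\<close>)
  finally show ?thesis by (simp add: coeff_op_inner[OF b])
qed

lemma coeff_op_bounded_linear:
  assumes b: "elliptic_coeff \<nu> \<Lambda> b" shows "bounded_linear (coeff_op b)"
proof (rule bounded_linear_intro[where K = \<Lambda>])
  fix p q :: "(real^3) L2" and c :: real
  show "coeff_op b (p + q) = coeff_op b p + coeff_op b q"
  proof (rule L2_eqI)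
    show "AE x in lebesgue. rep_L2 (coeff_op b (p + q)) x = rep_L2 (coeff_op b p + coeff_op b q) x"
      using rep_coeff_op[OF b, of "p + q"] rep_coeff_op[OF b, of p] rep_coeff_op[OF b, of q] rep_add[of p q] rep_add[of "coeff_op b p" "coeff_op b q"]
      by eventually_elim (simp add: matrix_vector_right_distrib)
  qed
  show "coeff_op b (c *\<^sub>R p) = c *\<^sub>R coeff_op b p"
  proof (rule L2_eqI)
    show "AE x in lebesgue. rep_L2 (coeff_op b (c *\<^sub>R p)) x = rep_L2 (c *\<^sub>R coeff_op b p) x"
      using rep_coeff_op[OF b, of "c *\<^sub>R p"] rep_coeff_op[OF b, of p] rep_scaleR[of c p] rep_scaleR[of c "coeff_op b p"]
      by eventually_elim (simp add: scaleR_matrix_vector_assoc[symmetric] matrix_vector_mult_scaleR)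
  qed
  show "norm (coeff_op b p) \<le> norm p * \<Lambda>"
    unfolding coeff_op_def mult.commute[of _ \<Lambda>]
    by (rule norm_to_L2_le) (use b in \<open>auto simp: elliptic_coeff_def intro!: sq_integrable_coeff_mult[OF b]\<close>)
qed

context bounded_domain begin

lemma div_flux_eqI:
  assumes "has_div_flux \<Omega> b u w" shows "div_flux \<Omega> b u = w"
  unfolding div_flux_def
proof (rule the_equality)
  fix v assume v: "has_div_flux \<Omega> b u v"
  have "v - w = 0"
  proof (rule test_fun_total[OF open_domain])
    show "v - w \<in> L2_on \<Omega>" using assms v subspace_L2_on by (auto simp: has_div_flux_def intro: subspace_diff)
    fix \<phi> and e :: real assume phi: "test_fun \<Omega> \<phi>"
    have "(v - w) \<bullet> to_L2 \<phi> = 0"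
      using assms v phi unfolding has_div_flux_def has_weak_div_iff_inner by (simp add: inner_diff_left)
    moreover have "to_L2 (\<lambda>x. \<phi> x *\<^sub>R e) = e *\<^sub>R to_L2 \<phi>"
      using to_L2_scaleR[OF sq_integrable_test_fun[OF phi], of e] by (simp add: mult.commute)
    ultimately show "(v - w) \<bullet> to_L2 (\<lambda>x. \<phi> x *\<^sub>R e) = 0" by simp
  qed
  then show "v = w" by simp
qed (fact assms)

lemma weak_form_H10:
  assumes "has_div_flux \<Omega> b u w" "v \<in> H10 \<Omega>" shows "flux \<Omega> b u \<bullet> grad \<Omega> v = - (w \<bullet> v)"
proof -
  obtain \<phi> where phi: "\<And>n. test_fun \<Omega> (\<phi> n)" "(\<lambda>n. to_L2 (\<phi> n)) \<longlonglongrightarrow> v" "(\<lambda>n. to_L2 (cgrad (\<phi> n))) \<longlonglongrightarrow> grad \<Omega> v"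
    using H10_approx[OF assms(2)] by metis
  have "(\<lambda>n. flux \<Omega> b u \<bullet> to_L2 (cgrad (\<phi> n))) \<longlonglongrightarrow> flux \<Omega> b u \<bullet> grad \<Omega> v" by (intro tendsto_intros phi)
  moreover have "(\<lambda>n. - (w \<bullet> to_L2 (\<phi> n))) \<longlonglongrightarrow> - (w \<bullet> v)" by (intro tendsto_intros phi)
  moreover have "flux \<Omega> b u \<bullet> to_L2 (cgrad (\<phi> n)) = - (w \<bullet> to_L2 (\<phi> n))" for n
    using assms(1) phi(1) unfolding has_div_flux_def has_weak_div_iff_inner by blast
  ultimately show ?thesis by (simp add: LIMSEQ_unique)
qed

text \<open>Test the equation with its solution and apply Poincare's inequality to the right hand side.\<close>

lemma elliptic_estimate:
  assumes b: "elliptic_coeff \<nu> \<Lambda> b" and u: "u \<in> H10 \<Omega>" "has_div_flux \<Omega> b u w"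
  shows "norm (grad \<Omega> u) \<le> pc / \<nu> * norm w"
proof -
  have nu: "\<nu> > 0" using b by (simp add: elliptic_coeff_def)
  have "\<nu> * (norm (grad \<Omega> u))\<^sup>2 \<le> - (w \<bullet> u)"
    using coeff_op_coercive[OF b, of "grad \<Omega> u"] weak_form_H10[OF u(2,1)] by (simp add: flux_eq)
  also have "\<dots> \<le> norm w * norm u" using norm_cauchy_schwarz[of "- w" u] by simp
  also have "\<dots> \<le> norm w * (pc * norm (grad \<Omega> u))" using poincare[OF u(1)] by (intro mult_left_mono) auto
  finally have "(\<nu> * norm (grad \<Omega> u)) * norm (grad \<Omega> u) \<le> (pc * norm w) * norm (grad \<Omega> u)"
    by (simp add: power2_eq_square mult_ac)
  then have "\<nu> * norm (grad \<Omega> u) \<le> pc * norm w"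
    using pc_pos by (cases "grad \<Omega> u = 0") (auto simp: mult_le_cancel_right)
  then show ?thesis using nu by (simp add: field_simps)
qed

definition "E2_const \<nu> = (pc + pc\<^sup>2) / \<nu>"

text \<open>Both components solve a Dirichlet problem whose right hand side is bounded by the norm of the
  regular phase space; Poincare's inequality bounds the second component by its gradient.\<close>

lemma E2_ball_bounded:
  assumes b: "elliptic_coeff \<nu> \<Lambda> b" and xi: "\<xi> \<in> E2_ball \<Omega> b g R"
  shows "\<xi> \<in> E \<Omega>" "0 \<le> R" "norm (grad \<Omega> (fst \<xi>)) \<le> E2_const \<nu> * R" "E_norm \<Omega> \<xi> \<le> E2_const \<nu> * R"
proof -
  have nu: "\<nu> > 0" using b by (simp add: elliptic_coeff_def)
  obtain w1 w2 where w: "fst \<xi> \<in> H10 \<Omega>" "snd \<xi> \<in> H10 \<Omega>" "has_div_flux \<Omega> b (fst \<xi>) w1" "has_div_flux \<Omega> b (snd \<xi>) w2"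
    using xi by (auto simp: E2_ball_def E2_def)
  show "\<xi> \<in> E \<Omega>" using w by (cases \<xi>) (auto simp: E_def H10_L2_on)
  have R: "sqrt ((H10_norm \<Omega> (w1 + g))\<^sup>2 + (norm w1)\<^sup>2 + (norm w2)\<^sup>2) \<le> R"
    using xi div_flux_eqI[OF w(3)] div_flux_eqI[OF w(4)] by (simp add: E2_ball_def E2_norm_def)
  then show R0: "0 \<le> R" by (meson order_trans real_sqrt_ge_zero add_nonneg_nonneg zero_le_power2)
  have "norm w1 \<le> sqrt ((H10_norm \<Omega> (w1 + g))\<^sup>2 + (norm w1)\<^sup>2 + (norm w2)\<^sup>2)"
    "norm w2 \<le> sqrt ((H10_norm \<Omega> (w1 + g))\<^sup>2 + (norm w1)\<^sup>2 + (norm w2)\<^sup>2)"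
    by (rule real_le_rsqrt, simp)+
  then have n: "norm w1 \<le> R" "norm w2 \<le> R" using R by linarith+
  have g1: "norm (grad \<Omega> (fst \<xi>)) \<le> pc / \<nu> * R"
    using elliptic_estimate[OF b w(1,3)] n(1) nu pc_pos by (meson divide_nonneg_pos less_imp_le mult_left_mono order_trans)
  have "norm (grad \<Omega> (snd \<xi>)) \<le> pc / \<nu> * R"
    using elliptic_estimate[OF b w(2,4)] n(2) nu pc_pos by (meson divide_nonneg_pos less_imp_le mult_left_mono order_trans)
  then have "norm (snd \<xi>) \<le> pc * (pc / \<nu> * R)"
    using poincare[OF w(2)] pc_pos by (meson less_imp_le mult_left_mono order_trans)
  then have g2: "norm (snd \<xi>) \<le> pc\<^sup>2 / \<nu> * R" by (simp add: power2_eq_square)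
  have "0 \<le> pc\<^sup>2 / \<nu> * R" using nu R0 by simp
  then show "norm (grad \<Omega> (fst \<xi>)) \<le> E2_const \<nu> * R"
    using g1 by (simp add: E2_const_def add_divide_distrib distrib_right)
  have "E_norm \<Omega> \<xi> \<le> norm (grad \<Omega> (fst \<xi>)) + norm (snd \<xi>)"
    unfolding E_norm_def by (rule sqrt_sum_squares_le_sum) auto
  then show "E_norm \<Omega> \<xi> \<le> E2_const \<nu> * R"
    using g1 g2 by (simp add: E2_const_def add_divide_distrib distrib_right)
qed

text \<open>Where the Dirichlet problem has no solution, \<open>A_inv\<close> takes one fixed value.  So uniqueness of
  the solution and the elliptic estimate suffice to bound it on the unit ball.\<close>

lemma A_inv_bounded:
  assumes b: "elliptic_coeff \<nu> \<Lambda> b"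
  shows "\<exists>C. \<forall>w. norm w \<le> 1 \<longrightarrow> norm (A_inv \<Omega> b w) \<le> C"
proof (intro exI allI impI)
  fix w :: "real L2" assume w1: "norm w \<le> 1"
  have nu: "\<nu> > 0" using b by (simp add: elliptic_coeff_def)
  let ?P = "\<lambda>u. u \<in> H10 \<Omega> \<and> has_div_flux \<Omega> b u (- w)"
  let ?d = "norm (THE u::real L2. False)"
  show "norm (A_inv \<Omega> b w) \<le> max ?d (pc * (pc / \<nu>))"
  proof (cases "\<exists>u. ?P u")
    case True
    then obtain u where u: "?P u" by blast
    have "A_inv \<Omega> b w = u"
      unfolding A_inv_def
    proof (rule the_equality)
      fix v assume v: "?P v"
      interpret A: bounded_linear "coeff_op b" by (rule coeff_op_bounded_linear[OF b])
      have "has_div_flux \<Omega> b (v - u) 0"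
      proof -
        have "flux \<Omega> b (v - u) = flux \<Omega> b v - flux \<Omega> b u"
          using u v by (simp add: flux_eq grad_diff A.diff)
        then show ?thesis
          using u v subspace_0[OF subspace_L2_on] unfolding has_div_flux_def has_weak_div_iff_inner by (simp add: inner_diff_left)
      qed
      then have "norm (grad \<Omega> (v - u)) \<le> pc / \<nu> * norm (0 :: real L2)"
        using u v by (intro elliptic_estimate[OF b]) (auto intro: H10_diff)
      then have "norm (v - u) \<le> 0" using poincare[of "v - u"] u v H10_diff by auto
      then show "v = u" by simp
    qed (fact u)
    moreover have "norm u \<le> pc * (pc / \<nu>)"
    proof -
      have "norm (grad \<Omega> u) \<le> pc / \<nu> * norm (- w)" using elliptic_estimate[OF b] u by blast
      also have "\<dots> \<le> pc / \<nu> * 1" using w1 nu pc_pos by (intro mult_left_mono) auto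
      finally have "norm (grad \<Omega> u) \<le> pc / \<nu>" by simp
      then have "pc * norm (grad \<Omega> u) \<le> pc * (pc / \<nu>)" using pc_pos by (intro mult_left_mono) auto
      then show ?thesis using poincare[of u] u by linarith
    qed
    ultimately show ?thesis by simp
  next
    case False
    then have "?P = (\<lambda>_. False)" by blast
    then have "A_inv \<Omega> b w = (THE u. False)" unfolding A_inv_def by (rule arg_cong[of _ _ The])
    then show ?thesis by simp
  qed
qed

lemma L2_opnorm_diff_nonneg:
  assumes "elliptic_coeff \<nu> \<Lambda> b" "elliptic_coeff \<nu>' \<Lambda>' b'"
  shows "0 \<le> L2_opnorm \<Omega> (\<lambda>w. A_inv \<Omega> b w - A_inv \<Omega> b' w)"
proof -
  obtain C C' where C: "\<And>w. norm w \<le> 1 \<Longrightarrow> norm (A_inv \<Omega> b w) \<le> C" "\<And>w. norm w \<le> 1 \<Longrightarrow> norm (A_inv \<Omega> b' w) \<le> C'"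
    using A_inv_bounded[OF assms(1)] A_inv_bounded[OF assms(2)] by blast
  have bdd: "bdd_above ((\<lambda>w. norm (A_inv \<Omega> b w - A_inv \<Omega> b' w)) ` {w \<in> L2_on \<Omega>. norm w \<le> 1})"
  proof (rule bdd_aboveI[of _ "C + C'"], clarify)
    fix w :: "real L2" assume "norm w \<le> 1"
    then show "norm (A_inv \<Omega> b w - A_inv \<Omega> b' w) \<le> C + C'"
      using C[of w] norm_triangle_ineq4[of "A_inv \<Omega> b w" "A_inv \<Omega> b' w"] by linarith
  qed
  have "(0 :: real L2) \<in> {w \<in> L2_on \<Omega>. norm w \<le> 1}" using subspace_0[OF subspace_L2_on] by simp
  from cSUP_upper[OF this bdd] show ?thesis
    unfolding L2_opnorm_def using norm_ge_zero order_trans by blast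
qed

end

section \<open>Periodic functions\<close>

lemma distr_lebesgue_translate: "distr lebesgue lebesgue (\<lambda>x. h + x) = (lebesgue :: (real^3) measure)"
  and measurable_lebesgue_translate: "(\<lambda>x. h + x) \<in> (lebesgue :: (real^3) measure) \<rightarrow>\<^sub>M lebesgue"
proof -
  have T: "(\<lambda>x. h + (\<Sum>j\<in>Basis. (1 * (x \<bullet> j)) *\<^sub>R j)) = (\<lambda>x. h + x)"
    by (simp add: euclidean_representation)
  have "lebesgue = density (distr lebesgue lebesgue (\<lambda>x. h + x)) (\<lambda>_. 1)"
    using lebesgue_affine_euclidean[of "\<lambda>_::real^3. 1" h] unfolding T by simp
  then show "distr lebesgue lebesgue (\<lambda>x. h + x) = (lebesgue :: (real^3) measure)" by (simp add: density_1)
  show "(\<lambda>x. h + x) \<in> (lebesgue :: (real^3) measure) \<rightarrow>\<^sub>M lebesgue"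
    using lebesgue_affine_measurable[of "\<lambda>_::real^3. 1" h] unfolding T by simp
qed

lemma measurable_translate:
  assumes "f \<in> borel_measurable lebesgue" shows "(\<lambda>x. f (x + h :: real^3)) \<in> borel_measurable lebesgue"
  using measurable_compose[OF measurable_lebesgue_translate[of h] assms] by (simp add: add.commute)

lemma nn_integral_translate:
  assumes "f \<in> borel_measurable lebesgue"
  shows "(\<integral>\<^sup>+x. f (x + h :: real^3) \<partial>lebesgue) = (\<integral>\<^sup>+x. f x \<partial>lebesgue)"
proof -
  have "(\<integral>\<^sup>+x. f x \<partial>lebesgue) = (\<integral>\<^sup>+x. f x \<partial>distr lebesgue lebesgue (\<lambda>x. h + x))"
    by (simp add: distr_lebesgue_translate)
  also have "\<dots> = (\<integral>\<^sup>+x. f (h + x) \<partial>lebesgue)"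
    using measurable_lebesgue_translate[of h] assms by (subst nn_integral_distr) simp_all
  finally show ?thesis by (simp add: add.commute)
qed

lemma integral_translate:
  fixes f :: "real^3 \<Rightarrow> real"
  assumes "f \<in> borel_measurable lebesgue"
  shows "(LINT x|lebesgue. f (x + h)) = (LINT x|lebesgue. f x)"
proof -
  have "(LINT x|lebesgue. f x) = (LINT x|distr lebesgue lebesgue (\<lambda>x. h + x). f x)"
    by (simp add: distr_lebesgue_translate)
  also have "\<dots> = (LINT x|lebesgue. f (h + x))"
    using measurable_lebesgue_translate[of h] assms by (rule integral_distr)
  finally show ?thesis by (simp add: add.commute)
qed

lemma unit_cell_borel: "unit_cell \<in> sets borel"
proof -
  have eq: "unit_cell = (\<Inter>i. {y :: real^3. 0 \<le> y $ i} \<inter> {y. y $ i < 1})"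
    by (auto simp: unit_cell_def)
  have "{y :: real^3. 0 \<le> y $ i} \<inter> {y. y $ i < 1} \<in> sets borel" for i
    by (intro sets.Int borel_closed borel_open closed_Collect_le open_Collect_less continuous_intros)
  then show ?thesis unfolding eq by (intro sets.finite_INT) auto
qed

lemma unit_cell_sets [simp]: "unit_cell \<in> sets lebesgue"
  using unit_cell_borel by simp

lemma One_nth: "(One :: real^3) $ i = 1"
proof -
  have "(One :: real^3) \<bullet> axis i 1 = 1" by (simp add: axis_in_Basis_iff)
  then show ?thesis by (simp add: inner_axis)
qed

lemma box_unit_cell: "box 0 One \<subseteq> unit_cell" "unit_cell \<subseteq> cbox 0 One"
proof -
  show "box 0 One \<subseteq> unit_cell"
    by (auto simp: unit_cell_def mem_box_cart One_nth simp del: sum_component intro: less_imp_le)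
  have "0 \<le> x $ i \<and> x $ i \<le> 1" if "x \<in> unit_cell" for x i
    using that by (auto simp: unit_cell_def intro: less_imp_le)
  then show "unit_cell \<subseteq> cbox 0 One"
    by (auto simp: mem_box_cart One_nth simp del: sum_component)
qed

lemma bounded_unit_cell: "bounded unit_cell"
  using box_unit_cell(2) bounded_cbox bounded_subset by blast

lemma emeasure_unit_cell_finite: "emeasure lebesgue unit_cell < \<infinity>"
  using emeasure_bounded_finite[OF bounded_unit_cell] unit_cell_borel by simp

lemma AE_unit_cell_interior: "AE x in lebesgue. x \<in> unit_cell \<longrightarrow> x \<in> box 0 (One :: real^3)"
proof -
  have "AE x in lebesgue. x \<notin> cbox 0 (One :: real^3) - box 0 One"
    by (rule AE_not_in) (simp add: negligible_iff_null_sets[symmetric] negligible_frontier_interval)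
  then show ?thesis using box_unit_cell(2) by (auto elim!: eventually_mono)
qed

lemma periodic_nat:
  assumes "periodic u" shows "u (y + real m *\<^sub>R axis k 1) = u y"
proof (induction m)
  case (Suc m)
  have "y + real (Suc m) *\<^sub>R axis k 1 = (y + real m *\<^sub>R axis k 1) + axis k 1" by (simp add: algebra_simps)
  then show ?case using assms Suc by (simp only: periodic_def)
qed simp

lemma periodic_int:
  assumes "periodic u" shows "u (y + of_int m *\<^sub>R axis k 1) = u y"
proof (cases "m \<ge> 0")
  case True
  then show ?thesis using periodic_nat[OF assms, of y "nat m" k] by simp
next
  case False
  then show ?thesis using periodic_nat[OF assms, of "y + of_int m *\<^sub>R axis k 1" "nat (- m)" k] by simp
qed

lemma periodic_lattice:
  assumes "periodic u" shows "u (y + (\<chi> i. of_int (\<kappa> i))) = u y"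
proof -
  have "(\<chi> i. of_int (\<kappa> i)) = of_int (\<kappa> 1) *\<^sub>R axis 1 1 + of_int (\<kappa> 2) *\<^sub>R axis 2 1 + of_int (\<kappa> 3) *\<^sub>R axis 3 (1::real)"
    by (simp add: vec_eq_iff forall_3 axis_def)
  then show ?thesis
    using periodic_int[OF assms, of "y + of_int (\<kappa> 1) *\<^sub>R axis 1 1 + of_int (\<kappa> 2) *\<^sub>R axis 2 1" "\<kappa> 3" 3]
      periodic_int[OF assms, of "y + of_int (\<kappa> 1) *\<^sub>R axis 1 1" "\<kappa> 2" 2] periodic_int[OF assms, of y "\<kappa> 1" 1]
    by (simp add: add.assoc)
qed

lemma periodic_shift: "periodic u \<Longrightarrow> periodic (\<lambda>x. u (x + h))"
  unfolding periodic_def by (metis add.assoc add.commute)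

lemma periodic_compose: "periodic u \<Longrightarrow> periodic (\<lambda>x. F (u x))"
  by (simp add: periodic_def)

text \<open>A ball is covered by finitely many translates of the unit cell.\<close>

lemma nn_integral_periodic_ball:
  "\<exists>c. \<forall>F :: real^3 \<Rightarrow> ennreal. periodic F \<longrightarrow> F \<in> borel_measurable lebesgue \<longrightarrow>
    (\<integral>\<^sup>+x. F x * indicator (cball 0 r) x \<partial>lebesgue) \<le> of_nat c * (\<integral>\<^sup>+x. F x * indicator unit_cell x \<partial>lebesgue)"
proof -
  define m where "m = \<lceil>\<bar>r\<bar>\<rceil> + 1"
  define K where "K = (UNIV :: 3 set) \<rightarrow>\<^sub>E {- m..m}"
  have finK: "finite K" unfolding K_def by (intro finite_PiE) auto
  define z :: "(3 \<Rightarrow> int) \<Rightarrow> real^3" where "z \<kappa> = (\<chi> i. of_int (\<kappa> i))" for \<kappa>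
  show ?thesis
  proof (intro exI[of _ "card K"] allI impI)
    fix F :: "real^3 \<Rightarrow> ennreal" assume F: "periodic F" and [measurable]: "F \<in> borel_measurable lebesgue"
    have im [measurable]: "(\<lambda>x. indicator unit_cell (x + h) :: ennreal) \<in> borel_measurable lebesgue" for h :: "real^3"
      by (intro measurable_translate borel_measurable_indicator unit_cell_sets)
    have "(\<integral>\<^sup>+x. F x * indicator (cball 0 r) x \<partial>lebesgue) \<le> (\<integral>\<^sup>+x. (\<Sum>\<kappa>\<in>K. F x * indicator unit_cell (x + - z \<kappa>)) \<partial>lebesgue)"
    proof (rule nn_integral_mono)
      fix x :: "real^3"
      show "F x * indicator (cball 0 r) x \<le> (\<Sum>\<kappa>\<in>K. F x * indicator unit_cell (x + - z \<kappa>))"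
      proof (cases "x \<in> cball 0 r")
        case True
        define \<kappa> where "\<kappa> i = \<lfloor>x $ i\<rfloor>" for i
        have xr: "\<bar>x $ i\<bar> \<le> \<bar>r\<bar>" for i using component_le_norm_cart[of x i] True by simp
        have "real_of_int (\<kappa> i) \<le> real_of_int m" "real_of_int (- m) \<le> real_of_int (\<kappa> i)" for i
          using xr[of i] of_int_floor_le[of "x $ i"] real_of_int_floor_add_one_gt[of "x $ i"] le_of_int_ceiling[of "\<bar>r\<bar>"]
          unfolding \<kappa>_def m_def of_int_minus of_int_add of_int_1 abs_le_iff by linarith+
        then have "\<kappa> i \<in> {- m..m}" for i by (simp only: of_int_le_iff atLeastAtMost_iff simp_thms)
        then have kK: "\<kappa> \<in> K" by (auto simp: K_def)
        have "x + - z \<kappa> \<in> unit_cell" unfolding unit_cell_def z_def \<kappa>_def by (auto; linarith)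
        then have "F x * indicator (cball 0 r) x = F x * indicator unit_cell (x + - z \<kappa>)" using True by (simp add: indicator_def)
        also have "\<dots> \<le> (\<Sum>\<kappa>\<in>K. F x * indicator unit_cell (x + - z \<kappa>))"
          using kK finK by (intro member_le_sum[of \<kappa> K "\<lambda>\<kappa>. F x * indicator unit_cell (x + - z \<kappa>)"]) auto
        finally show ?thesis .
      qed (simp add: indicator_def)
    qed
    also have "\<dots> = (\<Sum>\<kappa>\<in>K. \<integral>\<^sup>+x. F x * indicator unit_cell (x + - z \<kappa>) \<partial>lebesgue)"
      by (rule nn_integral_sum) measurable
    also have "\<dots> = (\<Sum>\<kappa>\<in>K. \<integral>\<^sup>+x. F x * indicator unit_cell x \<partial>lebesgue)"
    proof (rule sum.cong)
      fix \<kappa> assume "\<kappa> \<in> K"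
      have "(\<integral>\<^sup>+x. F x * indicator unit_cell (x + - z \<kappa>) \<partial>lebesgue) = (\<integral>\<^sup>+x. F (x + z \<kappa>) * indicator unit_cell ((x + z \<kappa>) + - z \<kappa>) \<partial>lebesgue)"
        by (rule nn_integral_translate[symmetric]) measurable
      then show "(\<integral>\<^sup>+x. F x * indicator unit_cell (x + - z \<kappa>) \<partial>lebesgue) = (\<integral>\<^sup>+x. F x * indicator unit_cell x \<partial>lebesgue)"
        by (simp add: z_def periodic_lattice[OF F])
    qed simp
    also have "\<dots> = of_nat (card K) * (\<integral>\<^sup>+x. F x * indicator unit_cell x \<partial>lebesgue)" by simp
    finally show "(\<integral>\<^sup>+x. F x * indicator (cball 0 r) x \<partial>lebesgue) \<le> of_nat (card K) * (\<integral>\<^sup>+x. F x * indicator unit_cell x \<partial>lebesgue)" .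
  qed
qed

text \<open>The part of the cell that a translation along one axis moves out comes back by periodicity.\<close>

lemma nn_integral_cell_shift_axis:
  fixes F :: "real^3 \<Rightarrow> ennreal"
  assumes F: "periodic F" and [measurable]: "F \<in> borel_measurable lebesgue" and t: "0 \<le> t" "t \<le> 1"
  shows "(\<integral>\<^sup>+x. F (x + t *\<^sub>R axis k 1) * indicator unit_cell x \<partial>lebesgue) = (\<integral>\<^sup>+x. F x * indicator unit_cell x \<partial>lebesgue)"
proof -
  define lo where "lo = unit_cell \<inter> {y :: real^3. y $ k < t}"
  define hi where "hi = unit_cell \<inter> {y :: real^3. t \<le> y $ k}"
  have "{y :: real^3. y $ k < t} \<in> sets borel" "{y :: real^3. t \<le> y $ k} \<in> sets borel"
    by (intro borel_open borel_closed open_Collect_less closed_Collect_le continuous_intros)+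
  then have sets [measurable]: "lo \<in> sets lebesgue" "hi \<in> sets lebesgue"
    unfolding lo_def hi_def using unit_cell_borel by (auto intro!: sets.Int)
  have im [measurable]: "(\<lambda>x. indicator S (x + h) :: ennreal) \<in> borel_measurable lebesgue" if "S \<in> sets lebesgue" for h :: "real^3" and S
    by (intro measurable_translate borel_measurable_indicator that)
  let ?e = "axis k (1::real)"
  have split: "indicator unit_cell (x + - (t *\<^sub>R ?e)) = (indicator hi x + indicator lo (x + - ?e) :: ennreal)" for x
  proof -
    have c: "y \<in> unit_cell \<longleftrightarrow> (0 \<le> y $ k \<and> y $ k < 1) \<and> (\<forall>i. i \<noteq> k \<longrightarrow> 0 \<le> y $ i \<and> y $ i < 1)" for y
      by (auto simp: unit_cell_def)
    have ax: "axis k (1::real) $ k = 1" "\<And>i. i \<noteq> k \<Longrightarrow> axis k (1::real) $ i = 0" by (simp_all add: axis_def)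
    let ?P = "\<forall>i. i \<noteq> k \<longrightarrow> 0 \<le> x $ i \<and> x $ i < 1"
    have 1: "x + - (t *\<^sub>R ?e) \<in> unit_cell \<longleftrightarrow> (t \<le> x $ k \<and> x $ k < 1 + t) \<and> ?P"
      unfolding c by (auto simp: ax)
    have 2: "x \<in> hi \<longleftrightarrow> (t \<le> x $ k \<and> x $ k < 1) \<and> ?P" unfolding hi_def using t by (auto simp: c)
    have 3: "x + - ?e \<in> lo \<longleftrightarrow> (1 \<le> x $ k \<and> x $ k < 1 + t) \<and> ?P"
      using t unfolding lo_def by (auto simp: c ax)
    show ?thesis unfolding indicator_def 1 2 3 using t by auto
  qed
  have "(\<integral>\<^sup>+x. F (x + t *\<^sub>R ?e) * indicator unit_cell x \<partial>lebesgue)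
      = (\<integral>\<^sup>+x. F (x + t *\<^sub>R ?e) * indicator unit_cell ((x + t *\<^sub>R ?e) + - (t *\<^sub>R ?e)) \<partial>lebesgue)" by simp
  also have "\<dots> = (\<integral>\<^sup>+x. F x * indicator unit_cell (x + - (t *\<^sub>R ?e)) \<partial>lebesgue)"
    by (rule nn_integral_translate) (intro borel_measurable_times_ennreal im unit_cell_sets assms)
  also have "\<dots> = (\<integral>\<^sup>+x. F x * indicator hi x + F x * indicator lo (x + - ?e) \<partial>lebesgue)"
    by (simp only: split distrib_left)
  also have "\<dots> = (\<integral>\<^sup>+x. F x * indicator hi x \<partial>lebesgue) + (\<integral>\<^sup>+x. F x * indicator lo (x + - ?e) \<partial>lebesgue)"
    by (rule nn_integral_add) (intro borel_measurable_times_ennreal im borel_measurable_indicator sets assms)+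
  also have "(\<integral>\<^sup>+x. F x * indicator lo (x + - ?e) \<partial>lebesgue) = (\<integral>\<^sup>+x. F (x + ?e) * indicator lo ((x + ?e) + - ?e) \<partial>lebesgue)"
    by (rule nn_integral_translate[symmetric]) (intro borel_measurable_times_ennreal im sets assms)
  also have "\<dots> = (\<integral>\<^sup>+x. F x * indicator lo x \<partial>lebesgue)" using F by (simp add: periodic_def)
  also have "(\<integral>\<^sup>+x. F x * indicator hi x \<partial>lebesgue) + (\<integral>\<^sup>+x. F x * indicator lo x \<partial>lebesgue) = (\<integral>\<^sup>+x. F x * indicator hi x + F x * indicator lo x \<partial>lebesgue)"
    by (rule nn_integral_add[symmetric]) (intro borel_measurable_times_ennreal borel_measurable_indicator sets assms)+
  also have "\<dots> = (\<integral>\<^sup>+x. F x * indicator unit_cell x \<partial>lebesgue)"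
    by (intro nn_integral_cong) (auto simp: indicator_def hi_def lo_def)
  finally show ?thesis .
qed

lemma nn_integral_cell_shift:
  fixes F :: "real^3 \<Rightarrow> ennreal"
  assumes F: "periodic F" "F \<in> borel_measurable lebesgue" and h: "\<And>i. 0 \<le> h $ i" "\<And>i. h $ i \<le> 1"
  shows "(\<integral>\<^sup>+x. F (x + h) * indicator unit_cell x \<partial>lebesgue) = (\<integral>\<^sup>+x. F x * indicator unit_cell x \<partial>lebesgue)"
proof -
  have h_eq: "h = (h $ 1) *\<^sub>R axis 1 1 + (h $ 2) *\<^sub>R axis 2 1 + (h $ 3) *\<^sub>R axis 3 1"
    by (simp add: vec_eq_iff forall_3 axis_def)
  let ?F1 = "\<lambda>x. F (x + (h $ 3) *\<^sub>R axis 3 1)"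
  let ?F2 = "\<lambda>x. ?F1 (x + (h $ 2) *\<^sub>R axis 2 1)"
  have p: "periodic ?F1" "periodic ?F2" using F(1) by (auto intro!: periodic_shift)
  have m: "?F1 \<in> borel_measurable lebesgue" "?F2 \<in> borel_measurable lebesgue"
    using F(2) by (auto intro!: measurable_translate measurable_translate[of ?F1])
  have "(\<integral>\<^sup>+x. F (x + h) * indicator unit_cell x \<partial>lebesgue) = (\<integral>\<^sup>+x. ?F2 (x + (h $ 1) *\<^sub>R axis 1 1) * indicator unit_cell x \<partial>lebesgue)"
    by (subst h_eq) (simp add: add.assoc)
  also have "\<dots> = (\<integral>\<^sup>+x. ?F2 x * indicator unit_cell x \<partial>lebesgue)"
    by (rule nn_integral_cell_shift_axis[OF p(2) m(2) h])
  also have "\<dots> = (\<integral>\<^sup>+x. ?F1 x * indicator unit_cell x \<partial>lebesgue)"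
    by (rule nn_integral_cell_shift_axis[OF p(1) m(1) h])
  also have "\<dots> = (\<integral>\<^sup>+x. F x * indicator unit_cell x \<partial>lebesgue)"
    by (rule nn_integral_cell_shift_axis[OF F h])
  finally show ?thesis .
qed

lemma ennreal_norm_to_L2:
  assumes "sq_integrable u" shows "ennreal ((norm (to_L2 u))\<^sup>2) = (\<integral>\<^sup>+x. ennreal ((norm (u x))\<^sup>2) \<partial>lebesgue)"
  using assms by (subst nn_integral_eq_integral) (auto simp: norm_to_L2 sq_integrable_def)

definition per_L2 :: "(real^3 \<Rightarrow> 'b::euclidean_space) \<Rightarrow> bool" where
  "per_L2 w \<longleftrightarrow> periodic w \<and> w \<in> borel_measurable lebesgue \<and> sq_integrable (\<lambda>x. indicator unit_cell x *\<^sub>R w x)"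

definition cell_L2 :: "(real^3 \<Rightarrow> 'b::euclidean_space) \<Rightarrow> 'b L2" where
  "cell_L2 w = to_L2 (\<lambda>x. indicator unit_cell x *\<^sub>R w x)"

lemma sq_integrable_indicator_iff:
  assumes "S \<in> sets lebesgue" "w \<in> borel_measurable lebesgue"
  shows "sq_integrable (\<lambda>x. indicator S x *\<^sub>R w x) \<longleftrightarrow> set_integrable lebesgue S (\<lambda>x. (norm (w x))\<^sup>2)"
proof -
  have "(norm (indicator S x *\<^sub>R w x))\<^sup>2 = indicator S x *\<^sub>R (norm (w x))\<^sup>2" for x
    by (simp add: indicator_def)
  moreover have "(\<lambda>x. indicator S x *\<^sub>R w x) \<in> borel_measurable lebesgue"
    using assms by (intro borel_measurable_scaleR borel_measurable_indicator)
  ultimately show ?thesis by (simp add: sq_integrable_def set_integrable_def)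
qed

lemma H1_per_iff: "H1_per N P \<longleftrightarrow> per_L2 N \<and> per_L2 P \<and> has_weak_grad UNIV N P"
  unfolding H1_per_def per_L2_def using sq_integrable_indicator_iff[of unit_cell N] sq_integrable_indicator_iff[of unit_cell P]
  by auto

lemma nn_integral_indicator_sq:
  fixes w :: "real^3 \<Rightarrow> 'b::euclidean_space"
  shows "(\<integral>\<^sup>+x. ennreal ((norm (indicator S x *\<^sub>R w x))\<^sup>2) \<partial>lebesgue) = (\<integral>\<^sup>+x. ennreal ((norm (w x))\<^sup>2) * indicator S x \<partial>lebesgue)"
  by (intro nn_integral_cong) (simp add: indicator_def)

text \<open>A bound over one cell becomes a bound over a ball with a constant that does not depend on the
  function, so convergence over one cell implies local convergence.\<close>

lemma per_L2_ball:
  "\<exists>c\<ge>0. \<forall>w :: real^3 \<Rightarrow> 'b::euclidean_space. per_L2 w \<longrightarrow> sq_integrable (\<lambda>x. indicator (cball 0 r) x *\<^sub>R w x) \<and>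
     norm (to_L2 (\<lambda>x. indicator (cball 0 r) x *\<^sub>R w x)) \<le> c * norm (cell_L2 w)"
proof -
  obtain c where c: "\<And>F :: real^3 \<Rightarrow> ennreal. periodic F \<Longrightarrow> F \<in> borel_measurable lebesgue \<Longrightarrow>
    (\<integral>\<^sup>+x. F x * indicator (cball 0 r) x \<partial>lebesgue) \<le> of_nat c * (\<integral>\<^sup>+x. F x * indicator unit_cell x \<partial>lebesgue)"
    using nn_integral_periodic_ball[of r] by blast
  show ?thesis
  proof (intro exI[of _ "sqrt (real c)"] conjI allI impI)
    fix w :: "real^3 \<Rightarrow> 'b" assume w: "per_L2 w"
    have sqw: "sq_integrable (\<lambda>x. indicator unit_cell x *\<^sub>R w x)" using w by (simp add: per_L2_def)
    have [measurable]: "w \<in> borel_measurable lebesgue" using w by (simp add: per_L2_def)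
    have m: "(\<lambda>x. indicator (cball 0 r) x *\<^sub>R w x) \<in> borel_measurable lebesgue"
      by (intro borel_measurable_scaleR borel_measurable_indicator) auto
    have "(\<integral>\<^sup>+x. ennreal ((norm (indicator (cball 0 r) x *\<^sub>R w x))\<^sup>2) \<partial>lebesgue) = (\<integral>\<^sup>+x. ennreal ((norm (w x))\<^sup>2) * indicator (cball 0 r) x \<partial>lebesgue)"
      by (rule nn_integral_indicator_sq)
    also have "\<dots> \<le> of_nat c * (\<integral>\<^sup>+x. ennreal ((norm (w x))\<^sup>2) * indicator unit_cell x \<partial>lebesgue)"
    proof (rule c)
      show "periodic (\<lambda>x. ennreal ((norm (w x))\<^sup>2))" using w by (auto simp: per_L2_def intro: periodic_compose)
    qed measurable
    also have "\<dots> = of_nat c * ennreal ((norm (cell_L2 w))\<^sup>2)"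
      unfolding cell_L2_def by (simp only: ennreal_norm_to_L2[OF sqw] nn_integral_indicator_sq)
    also have "\<dots> = ennreal ((sqrt (real c) * norm (cell_L2 w))\<^sup>2)"
      by (simp add: power_mult_distrib ennreal_mult ennreal_of_nat_eq_real_of_nat)
    finally have le: "(\<integral>\<^sup>+x. ennreal ((norm (indicator (cball 0 r) x *\<^sub>R w x))\<^sup>2) \<partial>lebesgue) \<le> ennreal ((sqrt (real c) * norm (cell_L2 w))\<^sup>2)" .
    show sq: "sq_integrable (\<lambda>x. indicator (cball 0 r) x *\<^sub>R w x)"
      unfolding sq_integrable_def
    proof (rule conjI[OF m], rule integrableI_bounded)
      show "(\<lambda>x. (norm (indicator (cball 0 r) x *\<^sub>R w x))\<^sup>2) \<in> borel_measurable lebesgue" using m by measurable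
      show "(\<integral>\<^sup>+x. ennreal (norm ((norm (indicator (cball 0 r) x *\<^sub>R w x))\<^sup>2)) \<partial>lebesgue) < \<infinity>"
        using le_less_trans[OF le] by (simp del: norm_scaleR)
    qed
    have "ennreal ((norm (to_L2 (\<lambda>x. indicator (cball 0 r) x *\<^sub>R w x)))\<^sup>2) \<le> ennreal ((sqrt (real c) * norm (cell_L2 w))\<^sup>2)"
      unfolding ennreal_norm_to_L2[OF sq] by (rule le)
    then have "(norm (to_L2 (\<lambda>x. indicator (cball 0 r) x *\<^sub>R w x)))\<^sup>2 \<le> (sqrt (real c) * norm (cell_L2 w))\<^sup>2"
      by (subst (asm) ennreal_le_iff) auto
    then show "norm (to_L2 (\<lambda>x. indicator (cball 0 r) x *\<^sub>R w x)) \<le> sqrt (real c) * norm (cell_L2 w)"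
      by (rule power2_le_imp_le) simp
  qed simp
qed

lemma per_L2_shift:
  fixes w :: "real^3 \<Rightarrow> 'b::euclidean_space"
  assumes w: "per_L2 w" and h: "\<And>i. 0 \<le> h $ i" "\<And>i. h $ i \<le> 1"
  shows "per_L2 (\<lambda>x. w (x + h))" "norm (cell_L2 (\<lambda>x. w (x + h))) = norm (cell_L2 w)"
proof -
  have wm: "w \<in> borel_measurable lebesgue" using w by (simp add: per_L2_def)
  have sqw: "sq_integrable (\<lambda>x. indicator unit_cell x *\<^sub>R w x)" using w by (simp add: per_L2_def)
  have m: "(\<lambda>x. w (x + h)) \<in> borel_measurable lebesgue" using wm by (rule measurable_translate)
  have m2: "(\<lambda>x. indicator unit_cell x *\<^sub>R w (x + h)) \<in> borel_measurable lebesgue"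
    by (intro borel_measurable_scaleR borel_measurable_indicator m) auto
  have "(\<integral>\<^sup>+x. ennreal ((norm (indicator unit_cell x *\<^sub>R w (x + h)))\<^sup>2) \<partial>lebesgue) = (\<integral>\<^sup>+x. ennreal ((norm (w (x + h)))\<^sup>2) * indicator unit_cell x \<partial>lebesgue)"
    by (rule nn_integral_indicator_sq)
  also have "\<dots> = (\<integral>\<^sup>+x. ennreal ((norm (w x))\<^sup>2) * indicator unit_cell x \<partial>lebesgue)"
  proof (rule nn_integral_cell_shift[OF _ _ h])
    show "periodic (\<lambda>x. ennreal ((norm (w x))\<^sup>2))" using w by (auto simp: per_L2_def intro: periodic_compose)
    show "(\<lambda>x. ennreal ((norm (w x))\<^sup>2)) \<in> borel_measurable lebesgue" using wm by measurable
  qed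
  also have "\<dots> = ennreal ((norm (cell_L2 w))\<^sup>2)"
    unfolding cell_L2_def by (simp only: ennreal_norm_to_L2[OF sqw] nn_integral_indicator_sq)
  finally have eq: "(\<integral>\<^sup>+x. ennreal ((norm (indicator unit_cell x *\<^sub>R w (x + h)))\<^sup>2) \<partial>lebesgue) = ennreal ((norm (cell_L2 w))\<^sup>2)" .
  have sq: "sq_integrable (\<lambda>x. indicator unit_cell x *\<^sub>R w (x + h))"
    unfolding sq_integrable_def
  proof (rule conjI[OF m2], rule integrableI_bounded)
    show "(\<lambda>x. (norm (indicator unit_cell x *\<^sub>R w (x + h)))\<^sup>2) \<in> borel_measurable lebesgue" using m2 by measurable
    show "(\<integral>\<^sup>+x. ennreal (norm ((norm (indicator unit_cell x *\<^sub>R w (x + h)))\<^sup>2)) \<partial>lebesgue) < \<infinity>"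
      using eq by (simp del: norm_scaleR)
  qed
  then show "per_L2 (\<lambda>x. w (x + h))" using w m by (simp add: per_L2_def periodic_shift)
  have "ennreal ((norm (cell_L2 (\<lambda>x. w (x + h))))\<^sup>2) = ennreal ((norm (cell_L2 w))\<^sup>2)"
    unfolding cell_L2_def[of "\<lambda>x. w (x + h)"] ennreal_norm_to_L2[OF sq] by (rule eq)
  then have "(norm (cell_L2 (\<lambda>x. w (x + h))))\<^sup>2 = (norm (cell_L2 w))\<^sup>2" by (subst (asm) ennreal_inj) auto
  then show "norm (cell_L2 (\<lambda>x. w (x + h))) = norm (cell_L2 w)" by simp
qed

lemma per_L2_add:
  fixes v w :: "real^3 \<Rightarrow> 'b::euclidean_space"
  assumes "per_L2 v" "per_L2 w"
  shows "per_L2 (\<lambda>x. v x + w x)" "cell_L2 (\<lambda>x. v x + w x) = cell_L2 v + cell_L2 w"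
  using assms sq_integrable_add[of "\<lambda>x. indicator unit_cell x *\<^sub>R v x" "\<lambda>x. indicator unit_cell x *\<^sub>R w x"]
    to_L2_add[of "\<lambda>x. indicator unit_cell x *\<^sub>R v x" "\<lambda>x. indicator unit_cell x *\<^sub>R w x"]
  by (auto simp: per_L2_def cell_L2_def periodic_def scaleR_right_distrib)

lemma per_L2_scaleR:
  fixes w :: "real^3 \<Rightarrow> 'b::euclidean_space"
  assumes "per_L2 w"
  shows "per_L2 (\<lambda>x. c *\<^sub>R w x)" "cell_L2 (\<lambda>x. c *\<^sub>R w x) = c *\<^sub>R cell_L2 w"
  using assms sq_integrable_cmult[of "\<lambda>x. indicator unit_cell x *\<^sub>R w x" c] to_L2_scaleR[of "\<lambda>x. indicator unit_cell x *\<^sub>R w x" c]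
  by (auto simp: per_L2_def cell_L2_def periodic_def mult.commute)

lemma per_L2_diff:
  fixes v w :: "real^3 \<Rightarrow> 'b::euclidean_space"
  assumes "per_L2 v" "per_L2 w"
  shows "per_L2 (\<lambda>x. v x - w x)" "cell_L2 (\<lambda>x. v x - w x) = cell_L2 v - cell_L2 w"
  using per_L2_add[OF assms(1) per_L2_scaleR(1)[OF assms(2)], of "-1"] per_L2_scaleR(2)[OF assms(2), of "-1"] by auto

lemma per_L2_const: "per_L2 (\<lambda>x. c :: 'b::euclidean_space)"
proof -
  have "set_integrable lebesgue unit_cell (\<lambda>x. (norm c)\<^sup>2)"
    unfolding set_integrable_def
    using emeasure_unit_cell_finite by (intro integrable_scaleR_left integrable_real_indicator) auto
  then show ?thesis using sq_integrable_indicator_iff[of unit_cell "\<lambda>x. c"] by (simp add: per_L2_def periodic_def)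
qed

lemma inner_cell_L2:
  assumes "per_L2 v" "per_L2 w"
  shows "cell_L2 v \<bullet> cell_L2 w = (LINT y:unit_cell|lebesgue. v y \<bullet> w y)"
proof -
  have "(LINT x|lebesgue. (indicator unit_cell x *\<^sub>R v x) \<bullet> (indicator unit_cell x *\<^sub>R w x)) = (LINT y:unit_cell|lebesgue. v y \<bullet> w y)"
    unfolding set_lebesgue_integral_def by (intro Bochner_Integration.integral_cong) (auto simp: indicator_def)
  then show ?thesis using assms unfolding cell_L2_def by (subst inner_to_L2) (auto simp: per_L2_def)
qed

lemma cell_L2_on: "per_L2 w \<Longrightarrow> cell_L2 w \<in> L2_on (box 0 One)"
proof -
  assume w: "per_L2 w"
  have "AE x in lebesgue. rep_L2 (cell_L2 w) x = indicator unit_cell x *\<^sub>R w x"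
    unfolding cell_L2_def using w by (intro rep_to_L2) (simp add: per_L2_def)
  then show ?thesis using AE_unit_cell_interior unfolding L2_on_def mem_Collect_eq
    by eventually_elim (auto simp: indicator_def)
qed

section \<open>The inequality of Poincare and Wirtinger on the cell\<close>

lemma test_fun_shift:
  assumes "test_fun UNIV \<psi>" shows "test_fun UNIV (\<lambda>x. \<psi> (x - h))" "cgrad (\<lambda>x. \<psi> (x - h)) x = cgrad \<psi> (x - h)"
proof -
  obtain C where C: "compact C" "\<And>x. x \<notin> C \<Longrightarrow> \<psi> x = 0" using assms unfolding test_fun_def by blast
  show "test_fun UNIV (\<lambda>x. \<psi> (x - h))"
    unfolding test_fun_def smooth_on_def
  proof (intro conjI allI exI[of _ "(+) h ` C"] impI)
    show "Ck_on k (\<lambda>x. \<psi> (x - h)) UNIV" for k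
      using assms unfolding test_fun_def smooth_on_def by (intro Ck_on_shift) auto
    show "compact ((+) h ` C)" using C(1) by (rule compact_translation)
    show "\<psi> (x - h) = 0" if "x \<notin> (+) h ` C" for x
    proof (rule C(2))
      show "x - h \<notin> C" using that by (metis add_diff_cancel_left' diff_add_cancel add.commute image_eqI)
    qed
  qed auto
  have "((\<lambda>x. x - h) has_derivative (\<lambda>y. y)) (at x)" by (auto intro!: derivative_eq_intros)
  from has_derivative_compose[OF this test_fun_has_derivative[OF assms]]
  show "cgrad (\<lambda>x. \<psi> (x - h)) x = cgrad \<psi> (x - h)" by (rule cgrad_eqI)
qed

lemma test_fun_mono: "test_fun \<Omega> \<psi> \<Longrightarrow> \<Omega> \<subseteq> \<Omega>' \<Longrightarrow> test_fun \<Omega>' \<psi>"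
  unfolding test_fun_def by blast

text \<open>Moving a test function in the direction \<open>h\<close>: the derivative falls on \<open>N\<close> by the definition
  of the weak gradient.\<close>

lemma DERIV_integral_shifted_test_fun:
  assumes NP: "H1_per N P" and psi: "test_fun UNIV \<psi>"
  shows "((\<lambda>s. LINT x|lebesgue. N x * \<psi> (x - s *\<^sub>R h)) has_real_derivative
      (LINT x|lebesgue. \<psi> (x - s *\<^sub>R h) * (P x \<bullet> h))) (at s)"
proof -
  have N: "per_L2 N" and P: "per_L2 P" and wg: "has_weak_grad UNIV N P" using NP by (auto simp: H1_per_iff)
  have Nm: "N \<in> borel_measurable lebesgue" using N by (simp add: per_L2_def)
  have cont: "continuous_on UNIV \<psi>" and cont': "continuous_on UNIV (cgrad \<psi>)"
    using test_fun_continuous[OF psi] test_fun_cgrad_continuous[OF psi] .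
  obtain C where C: "compact C" "\<And>x. x \<notin> C \<Longrightarrow> \<psi> x = 0" "\<And>x. x \<notin> C \<Longrightarrow> cgrad \<psi> x = 0"
    using test_fun_support[OF psi] by blast
  obtain r where r: "\<And>x. x \<in> C \<Longrightarrow> norm x \<le> r" using compact_imp_bounded[OF C(1)] by (auto simp: bounded_iff)
  have "bounded ((\<lambda>x. cgrad \<psi> x \<bullet> h) ` C)"
    using C(1) cont' by (intro compact_imp_bounded compact_continuous_image continuous_intros) (auto intro: continuous_on_subset)
  then obtain K0 where K0: "\<And>x. x \<in> C \<Longrightarrow> \<bar>cgrad \<psi> x \<bullet> h\<bar> \<le> K0" by (auto simp: bounded_iff)
  define K where "K = max 0 K0"
  have K: "\<bar>cgrad \<psi> x \<bullet> h\<bar> \<le> K" for x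
    using K0[of x] C(3)[of x] unfolding K_def by (cases "x \<in> C") auto
  have line: "((\<lambda>s. \<psi> (x - s *\<^sub>R h)) has_real_derivative - (cgrad \<psi> (x - s *\<^sub>R h) \<bullet> h)) (at s)" for x s
    using derivative_along_line[OF test_fun_has_derivative[OF psi], of x "- h" s] by simp
  have psi_s: "(\<lambda>x. \<psi> (x - s *\<^sub>R h)) \<in> borel_measurable lebesgue" for s
    by (intro continuous_imp_lebesgue_measurable continuous_on_compose2[OF cont] continuous_intros) auto
  have outside: "\<psi> (x - s *\<^sub>R h) = 0" "cgrad \<psi> (x - s *\<^sub>R h) = 0" if "norm x > r + \<bar>s\<bar> * norm h" for x s
  proof -
    have "norm (x - s *\<^sub>R h) > r" using that norm_triangle_ineq2[of x "s *\<^sub>R h"] by simp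
    then have "x - s *\<^sub>R h \<notin> C" using r by (meson leD)
    then show "\<psi> (x - s *\<^sub>R h) = 0" "cgrad \<psi> (x - s *\<^sub>R h) = 0" using C by auto
  qed
  have locint: "integrable lebesgue (\<lambda>x. \<bar>N x\<bar> * indicator (cball 0 \<rho>) x)" for \<rho>
  proof -
    have sq: "sq_integrable (\<lambda>x. indicator (cball 0 \<rho>) x *\<^sub>R N x)" using per_L2_ball[of \<rho>] N by blast
    have "sq_integrable (\<lambda>x::real^3. indicator (cball 0 \<rho>) x :: real)"
    proof -
      have "set_integrable lebesgue (cball (0::real^3) \<rho>) (\<lambda>x. (norm (1::real))\<^sup>2)"
        unfolding set_integrable_def using emeasure_bounded_finite[OF bounded_cball, of "0::real^3" \<rho>]
        by (intro integrable_scaleR_left integrable_real_indicator) auto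
      then show ?thesis using sq_integrable_indicator_iff[of "cball 0 \<rho>" "\<lambda>_. 1::real"] by simp
    qed
    from integrable_norm[OF integrable_scaleR_sq[OF this sq]] show ?thesis
      by (rule Bochner_Integration.integrable_cong[THEN iffD1, rotated -1]) (auto simp: indicator_def)
  qed
  have intq: "integrable lebesgue (\<lambda>x. N x * \<psi> (x - s *\<^sub>R h))" for s
  proof -
    obtain B where B: "\<And>x. \<bar>\<psi> x\<bar> \<le> B"
    proof -
      have "bounded (\<psi> ` C)" using C(1) cont by (intro compact_imp_bounded compact_continuous_image) (auto intro: continuous_on_subset)
      then obtain B where "\<And>x. x \<in> C \<Longrightarrow> \<bar>\<psi> x\<bar> \<le> B" by (auto simp: bounded_iff)
      then have "\<bar>\<psi> x\<bar> \<le> max 0 B" for x using C(2)[of x] by (cases "x \<in> C") (auto intro: max.coboundedI2)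
      then show ?thesis by (rule that)
    qed
    show ?thesis
    proof (rule Bochner_Integration.integrable_bound)
      show "integrable lebesgue (\<lambda>x. B * (\<bar>N x\<bar> * indicator (cball 0 (r + \<bar>s\<bar> * norm h)) x))"
        by (intro integrable_mult_right locint)
      show "(\<lambda>x. N x * \<psi> (x - s *\<^sub>R h)) \<in> borel_measurable lebesgue" using Nm psi_s by (rule borel_measurable_times)
      show "AE x in lebesgue. norm (N x * \<psi> (x - s *\<^sub>R h)) \<le> norm (B * (\<bar>N x\<bar> * indicator (cball 0 (r + \<bar>s\<bar> * norm h)) x))"
      proof (rule AE_I2)
        fix x
        have "B \<ge> 0" using B[of 0] by simp
        show "norm (N x * \<psi> (x - s *\<^sub>R h)) \<le> norm (B * (\<bar>N x\<bar> * indicator (cball 0 (r + \<bar>s\<bar> * norm h)) x))"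
        proof (cases "norm x \<le> r + \<bar>s\<bar> * norm h")
          case True
          then show ?thesis using mult_left_mono[OF B[of "x - s *\<^sub>R h"], of "\<bar>N x\<bar>"] \<open>B \<ge> 0\<close> by (simp add: abs_mult mult.commute)
        qed (use outside[of s x] in simp)
      qed
    qed
  qed
  let ?G = "\<lambda>s. LINT x|lebesgue. N x * \<psi> (x - s *\<^sub>R h)"
  have lim: "((\<lambda>t. (?G t - ?G s) / (t - s)) \<longlongrightarrow> (LINT x|lebesgue. N x * - (cgrad \<psi> (x - s *\<^sub>R h) \<bullet> h))) (at s)"
    unfolding tendsto_at_iff_sequentially
  proof (intro allI impI)
    fix X assume X: "\<forall>n. X n \<in> UNIV - {s}" "X \<longlonglongrightarrow> s"
    have "bounded (range X)" using X(2) by (rule convergent_imp_bounded)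
    then obtain \<rho>1 where r1: "\<And>n. \<bar>X n\<bar> \<le> \<rho>1" by (auto simp: bounded_iff)
    define \<rho> where "\<rho> = r + max \<rho>1 \<bar>s\<bar> * norm h"
    have A: "(\<lambda>n. LINT x|lebesgue. N x * ((\<psi> (x - X n *\<^sub>R h) - \<psi> (x - s *\<^sub>R h)) / (X n - s))) \<longlonglongrightarrow> (LINT x|lebesgue. N x * - (cgrad \<psi> (x - s *\<^sub>R h) \<bullet> h))"
    proof (rule integral_dominated_convergence)
      show "(\<lambda>x. N x * - (cgrad \<psi> (x - s *\<^sub>R h) \<bullet> h)) \<in> borel_measurable lebesgue"
        by (intro borel_measurable_times[OF Nm] continuous_imp_lebesgue_measurable continuous_intros continuous_on_compose2[OF cont']) auto
      show "(\<lambda>x. N x * ((\<psi> (x - X n *\<^sub>R h) - \<psi> (x - s *\<^sub>R h)) / (X n - s))) \<in> borel_measurable lebesgue" for n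
        by (intro borel_measurable_times[OF Nm] borel_measurable_divide borel_measurable_diff psi_s borel_measurable_const)
      show "integrable lebesgue (\<lambda>x. K * (\<bar>N x\<bar> * indicator (cball 0 \<rho>) x))" by (intro integrable_mult_right locint)
      show "AE x in lebesgue. (\<lambda>n. N x * ((\<psi> (x - X n *\<^sub>R h) - \<psi> (x - s *\<^sub>R h)) / (X n - s))) \<longlonglongrightarrow> N x * - (cgrad \<psi> (x - s *\<^sub>R h) \<bullet> h)"
      proof (intro AE_I2 tendsto_mult_left)
        fix x
        have "((\<lambda>t. (\<psi> (x - t *\<^sub>R h) - \<psi> (x - s *\<^sub>R h)) / (t - s)) \<longlongrightarrow> - (cgrad \<psi> (x - s *\<^sub>R h) \<bullet> h)) (at s)"
          using line[of x s] by (simp add: has_field_derivative_iff)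
        then show "(\<lambda>n. (\<psi> (x - X n *\<^sub>R h) - \<psi> (x - s *\<^sub>R h)) / (X n - s)) \<longlonglongrightarrow> - (cgrad \<psi> (x - s *\<^sub>R h) \<bullet> h)"
          unfolding tendsto_at_iff_sequentially using X by (auto simp: o_def)
      qed
      show "AE x in lebesgue. norm (N x * ((\<psi> (x - X n *\<^sub>R h) - \<psi> (x - s *\<^sub>R h)) / (X n - s))) \<le> K * (\<bar>N x\<bar> * indicator (cball 0 \<rho>) x)" for n
      proof (rule AE_I2)
        fix x
        show "norm (N x * ((\<psi> (x - X n *\<^sub>R h) - \<psi> (x - s *\<^sub>R h)) / (X n - s))) \<le> K * (\<bar>N x\<bar> * indicator (cball 0 \<rho>) x)"
        proof (cases "norm x \<le> \<rho>")
          case True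
          have "norm (\<psi> (x - X n *\<^sub>R h) - \<psi> (x - s *\<^sub>R h)) \<le> K * norm (X n - s)"
            by (rule field_differentiable_bound[of UNIV "\<lambda>s. \<psi> (x - s *\<^sub>R h)" "\<lambda>s. - (cgrad \<psi> (x - s *\<^sub>R h) \<bullet> h)"]) (use line K in auto)
          then have "\<bar>(\<psi> (x - X n *\<^sub>R h) - \<psi> (x - s *\<^sub>R h)) / (X n - s)\<bar> \<le> K" using X(1) by (simp add: divide_le_eq)
          from mult_left_mono[OF this, of "\<bar>N x\<bar>"] show ?thesis using True by (simp add: abs_mult mult.commute)
        next
          case False
          have "\<bar>X n\<bar> * norm h \<le> max \<rho>1 \<bar>s\<bar> * norm h" "\<bar>s\<bar> * norm h \<le> max \<rho>1 \<bar>s\<bar> * norm h"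
            using r1[of n] by (auto intro!: mult_right_mono)
          then have "norm x > r + \<bar>X n\<bar> * norm h" "norm x > r + \<bar>s\<bar> * norm h" using False by (auto simp: \<rho>_def)
          then show ?thesis using outside(1)[of "X n" x] outside(1)[of s x] by (simp add: K_def)
        qed
      qed
    qed
    have B: "(LINT x|lebesgue. N x * ((\<psi> (x - X n *\<^sub>R h) - \<psi> (x - s *\<^sub>R h)) / (X n - s))) = (?G (X n) - ?G s) / (X n - s)" for n
    proof -
      have "(\<lambda>x. N x * ((\<psi> (x - X n *\<^sub>R h) - \<psi> (x - s *\<^sub>R h)) / (X n - s))) = (\<lambda>x. (N x * \<psi> (x - X n *\<^sub>R h) - N x * \<psi> (x - s *\<^sub>R h)) / (X n - s))"
        by (auto simp: right_diff_distrib)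
      then show ?thesis using intq by simp
    qed
    show "((\<lambda>t. (?G t - ?G s) / (t - s)) \<circ> X) \<longlonglongrightarrow> (LINT x|lebesgue. N x * - (cgrad \<psi> (x - s *\<^sub>R h) \<bullet> h))"
      using A unfolding B o_def .
  qed
  have "(LINT x|lebesgue. N x * - (cgrad \<psi> (x - s *\<^sub>R h) \<bullet> h)) = (LINT x|lebesgue. \<psi> (x - s *\<^sub>R h) * (P x \<bullet> h))"
  proof -
    let ?\<rho> = "r + \<bar>s\<bar> * norm h"
    let ?\<psi> = "\<lambda>x. \<psi> (x - s *\<^sub>R h)"
    have t: "test_fun UNIV ?\<psi>" and g: "cgrad ?\<psi> x = cgrad \<psi> (x - s *\<^sub>R h)" for x using test_fun_shift[OF psi] by auto
    have sqN: "sq_integrable (\<lambda>x. indicator (cball 0 ?\<rho>) x *\<^sub>R N x)" using per_L2_ball[of ?\<rho>] N by blast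
    have sqP: "sq_integrable (\<lambda>x. indicator (cball 0 ?\<rho>) x *\<^sub>R P x)"
    proof -
      have "\<exists>c\<ge>0. \<forall>w :: real^3 \<Rightarrow> real^3. per_L2 w \<longrightarrow> sq_integrable (\<lambda>x. indicator (cball 0 ?\<rho>) x *\<^sub>R w x) \<and>
        norm (to_L2 (\<lambda>x. indicator (cball 0 ?\<rho>) x *\<^sub>R w x)) \<le> c * norm (cell_L2 w)" by (rule per_L2_ball)
      then show ?thesis using P by blast
    qed
    have e1: "(\<lambda>x. (indicator (cball 0 ?\<rho>) x *\<^sub>R N x) *\<^sub>R cgrad ?\<psi> x) = (\<lambda>x. N x *\<^sub>R cgrad ?\<psi> x)"
    proof
      fix x show "(indicator (cball 0 ?\<rho>) x *\<^sub>R N x) *\<^sub>R cgrad ?\<psi> x = N x *\<^sub>R cgrad ?\<psi> x"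
        using outside(2)[of s x] by (cases "norm x \<le> ?\<rho>") (auto simp: g)
    qed
    have e2: "(\<lambda>x. ?\<psi> x *\<^sub>R (indicator (cball 0 ?\<rho>) x *\<^sub>R P x)) = (\<lambda>x. ?\<psi> x *\<^sub>R P x)"
    proof
      fix x show "?\<psi> x *\<^sub>R (indicator (cball 0 ?\<rho>) x *\<^sub>R P x) = ?\<psi> x *\<^sub>R P x"
        using outside(1)[of s x] by (cases "norm x \<le> ?\<rho>") auto
    qed
    have i1: "integrable lebesgue (\<lambda>x. N x *\<^sub>R cgrad ?\<psi> x)"
      using integrable_scaleR_sq[OF sqN sq_integrable_cgrad[OF t]] unfolding e1 .
    have i2: "integrable lebesgue (\<lambda>x. ?\<psi> x *\<^sub>R P x)"
      using integrable_scaleR_sq[OF sq_integrable_test_fun[OF t] sqP] unfolding e2 .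
    have "(LINT x|lebesgue. N x *\<^sub>R cgrad ?\<psi> x) = - (LINT x|lebesgue. ?\<psi> x *\<^sub>R P x)"
      using wg t by (simp add: has_weak_grad_def)
    then have "(LINT x|lebesgue. N x *\<^sub>R cgrad ?\<psi> x) \<bullet> h = - ((LINT x|lebesgue. ?\<psi> x *\<^sub>R P x) \<bullet> h)" by simp
    then have "(LINT x|lebesgue. (N x *\<^sub>R cgrad ?\<psi> x) \<bullet> h) = - (LINT x|lebesgue. (?\<psi> x *\<^sub>R P x) \<bullet> h)"
      using integral_inner_left[OF i1, of h] integral_inner_left[OF i2, of h] by simp
    then show ?thesis by (simp add: g)
  qed
  with lim show ?thesis by (simp add: has_field_derivative_iff)
qed

lemma subspace_test_funs: "subspace (to_L2 ` {\<psi>. test_fun \<Omega> \<psi>})"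
  unfolding subspace_def
proof (intro conjI ballI allI)
  have "test_fun \<Omega> (\<lambda>_. 0)" by (auto simp: test_fun_def smooth_on_def Ck_on_const)
  moreover have "to_L2 (\<lambda>_. 0 :: real) = 0"
    using to_L2_scaleR[OF sq_integrable_0, of 0] by simp
  ultimately show "0 \<in> to_L2 ` {\<psi>. test_fun \<Omega> \<psi>}" by (metis (mono_tags) image_eqI mem_Collect_eq)
next
  fix x y assume "x \<in> to_L2 ` {\<psi>. test_fun \<Omega> \<psi>}" "y \<in> to_L2 ` {\<psi>. test_fun \<Omega> \<psi>}"
  then obtain \<phi> \<psi> where p: "test_fun \<Omega> \<phi>" "test_fun \<Omega> \<psi>" "x = to_L2 \<phi>" "y = to_L2 \<psi>" by auto
  then have "x + y = to_L2 (\<lambda>x. \<phi> x + \<psi> x)" by (simp add: to_L2_add sq_integrable_test_fun)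
  then show "x + y \<in> to_L2 ` {\<psi>. test_fun \<Omega> \<psi>}" using test_fun_add[OF p(1,2)] by blast
next
  fix c :: real and x assume "x \<in> to_L2 ` {\<psi>. test_fun \<Omega> \<psi>}"
  then obtain \<phi> where p: "test_fun \<Omega> \<phi>" "x = to_L2 \<phi>" by auto
  then have "c *\<^sub>R x = to_L2 (\<lambda>x. c * \<phi> x)" using to_L2_scaleR[OF sq_integrable_test_fun[OF p(1)], of c] by simp
  then show "c *\<^sub>R x \<in> to_L2 ` {\<psi>. test_fun \<Omega> \<psi>}" using test_fun_scale[OF p(1)] by blast
qed

lemma subspace_closure:
  fixes S :: "'a::real_normed_vector set"
  assumes "subspace S" shows "subspace (closure S)"
  unfolding subspace_def
proof (intro conjI ballI allI)
  show "0 \<in> closure S" using subspace_0[OF assms] closure_subset by blast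
next
  fix x y assume "x \<in> closure S" "y \<in> closure S"
  then obtain a b where "\<forall>n. a n \<in> S" "a \<longlonglongrightarrow> x" "\<forall>n. b n \<in> S" "b \<longlonglongrightarrow> y" by (auto simp: closure_sequential)
  then show "x + y \<in> closure S"
    unfolding closure_sequential using subspace_add[OF assms] by (intro exI[of _ "\<lambda>n. a n + b n"]) (auto intro: tendsto_add)
next
  fix c :: real and x assume "x \<in> closure S"
  then obtain a where "\<forall>n. a n \<in> S" "a \<longlonglongrightarrow> x" by (auto simp: closure_sequential)
  then show "c *\<^sub>R x \<in> closure S"
    unfolding closure_sequential using subspace_scale[OF assms] by (intro exI[of _ "\<lambda>n. c *\<^sub>R a n"]) (auto intro: tendsto_intros)
qed

text \<open>The element is a limit of test functions: its projection to their closure, given by the theorem of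
  Lax and Milgram for the inner product itself, leaves a remainder that vanishes by the fundamental
  lemma.\<close>

lemma norm_le_by_test_funs:
  fixes D :: "real L2"
  assumes "open \<Omega>" "D \<in> L2_on \<Omega>" and le: "\<And>\<psi>. test_fun \<Omega> \<psi> \<Longrightarrow> \<bar>D \<bullet> to_L2 \<psi>\<bar> \<le> c * norm (to_L2 \<psi>)" and "c \<ge> 0"
  shows "norm D \<le> c"
proof -
  let ?T = "to_L2 ` {\<psi>. test_fun \<Omega> \<psi>}"
  have cl: "subspace (closure ?T)" "complete (closure ?T)"
    using subspace_test_funs by (auto intro: subspace_closure simp: complete_eq_closed)
  have "\<exists>x\<in>closure ?T. \<forall>y\<in>closure ?T. (- D + x) \<bullet> y = 0"
    using symmetric_Lax_Milgram[OF cl bounded_linear_ident, of 1 "- D"] by (simp add: power2_norm_eq_inner inner_commute)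
  then obtain x where x: "x \<in> closure ?T" "\<And>y. y \<in> closure ?T \<Longrightarrow> (- D + x) \<bullet> y = 0" by blast
  obtain t where t: "\<And>n. t n \<in> ?T" "t \<longlonglongrightarrow> x" using x(1) by (auto simp: closure_sequential)
  have tO: "t n \<in> L2_on \<Omega>" for n using t(1)[of n] to_L2_test_fun by auto
  have "x \<in> L2_on \<Omega>" by (rule L2_on_limit[OF _ tO t(2)]) (use assms(1) in \<open>simp add: borel_open\<close>)
  then have "- D + x \<in> L2_on \<Omega>" using assms(2) subspace_diff[OF subspace_L2_on, of x \<Omega> D] by simp
  then have "- D + x = 0"
  proof (rule test_fun_total[OF assms(1)])
    fix \<phi> and e :: real assume phi: "test_fun \<Omega> \<phi>"
    have "to_L2 (\<lambda>x. \<phi> x *\<^sub>R e) = e *\<^sub>R to_L2 \<phi>"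
      using to_L2_scaleR[OF sq_integrable_test_fun[OF phi], of e] by (simp add: mult.commute)
    moreover have "to_L2 \<phi> \<in> closure ?T" by (rule subsetD[OF closure_subset]) (use phi in simp)
    then have "(- D + x) \<bullet> to_L2 \<phi> = 0" by (rule x(2))
    ultimately show "(- D + x) \<bullet> to_L2 (\<lambda>x. \<phi> x *\<^sub>R e) = 0" by simp
  qed
  then have "x = D" by simp
  then have lim: "t \<longlonglongrightarrow> D" using t(2) by simp
  have "D \<bullet> D \<le> c * norm D"
  proof (rule LIMSEQ_le)
    show "(\<lambda>n. D \<bullet> t n) \<longlonglongrightarrow> D \<bullet> D" "(\<lambda>n. c * norm (t n)) \<longlonglongrightarrow> c * norm D" by (intro tendsto_intros lim)+
    have "D \<bullet> t n \<le> c * norm (t n)" for n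
    proof -
      obtain \<psi> where "test_fun \<Omega> \<psi>" "t n = to_L2 \<psi>" using t(1)[of n] by auto
      then show ?thesis using le[of \<psi>] by simp
    qed
    then show "\<exists>N. \<forall>n\<ge>N. D \<bullet> t n \<le> c * norm (t n)" by blast
  qed
  then have "norm D * norm D \<le> c * norm D" by (simp add: dot_square_norm power2_eq_square)
  then show ?thesis using \<open>c \<ge> 0\<close> by (cases "D = 0") auto
qed


lemma cell_L2_inner_test_fun:
  assumes "per_L2 w" "test_fun (box 0 One) \<psi>"
  shows "cell_L2 w \<bullet> to_L2 (\<lambda>x. \<psi> x *\<^sub>R e) = (LINT x|lebesgue. \<psi> x * (w x \<bullet> e))"
proof -
  have out: "\<psi> x = 0" if "x \<notin> unit_cell" for x
    using assms(2) that box_unit_cell(1) unfolding test_fun_def by blast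
  have "cell_L2 w \<bullet> to_L2 (\<lambda>x. \<psi> x *\<^sub>R e) = (LINT x|lebesgue. (indicator unit_cell x *\<^sub>R w x) \<bullet> (\<psi> x *\<^sub>R e))"
    unfolding cell_L2_def using assms(1) by (intro inner_to_L2 sq_integrable_test_fun_scaleR[OF assms(2)]) (simp add: per_L2_def)
  also have "\<dots> = (LINT x|lebesgue. \<psi> x * (w x \<bullet> e))"
    by (intro Bochner_Integration.integral_cong) (auto simp: indicator_def out)
  finally show ?thesis .
qed

text \<open>By duality with test functions supported in the cell.  The mean value theorem for the pairing with the
  translates by \<open>s *\<^sub>R h\<close> involves one translate of \<open>P\<close>, and all of them have the same norm.\<close>

lemma translation_estimate:
  assumes NP: "H1_per N P" and h: "\<And>i. 0 \<le> h $ i" "\<And>i. h $ i \<le> 1"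
  shows "norm (cell_L2 (\<lambda>x. N (x + h)) - cell_L2 N) \<le> norm h * norm (cell_L2 P)"
proof (rule norm_le_by_test_funs)
  have N: "per_L2 N" and P: "per_L2 P" using NP by (auto simp: H1_per_iff)
  have Nh: "per_L2 (\<lambda>x. N (x + h))" using per_L2_shift(1)[OF N h] .
  show "cell_L2 (\<lambda>x. N (x + h)) - cell_L2 N \<in> L2_on (box 0 One)"
    using cell_L2_on[OF N] cell_L2_on[OF Nh] subspace_L2_on by (blast intro: subspace_diff)
  fix \<psi> assume psi: "test_fun (box 0 (One :: real^3)) \<psi>"
  then have psi': "test_fun UNIV \<psi>" by (rule test_fun_mono) simp
  let ?G = "\<lambda>s. LINT x|lebesgue. N x * \<psi> (x - s *\<^sub>R h)"
  obtain z where z: "0 < z" "z < 1" "?G 1 - ?G 0 = (1 - 0) * (LINT x|lebesgue. \<psi> (x - z *\<^sub>R h) * (P x \<bullet> h))"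
    using MVT2[of 0 1 ?G "\<lambda>s. LINT x|lebesgue. \<psi> (x - s *\<^sub>R h) * (P x \<bullet> h)"] DERIV_integral_shifted_test_fun[OF NP psi'] by auto
  have c1: "cell_L2 w \<bullet> to_L2 \<psi> = (LINT x|lebesgue. w x * \<psi> x)" if "per_L2 w" for w :: "real^3 \<Rightarrow> real"
    using cell_L2_inner_test_fun[OF that psi, of 1] by (simp add: mult.commute)
  have zh: "0 \<le> (z *\<^sub>R h) $ i" "(z *\<^sub>R h) $ i \<le> 1" for i using z h[of i] by (auto intro: mult_le_one)
  have Pz: "per_L2 (\<lambda>x. P (x + z *\<^sub>R h))" using per_L2_shift(1)[OF P zh] .
  have psim: "\<psi> \<in> borel_measurable lebesgue" using sq_integrable_test_fun[OF psi] by (simp add: sq_integrable_def)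
  have "(cell_L2 (\<lambda>x. N (x + h)) - cell_L2 N) \<bullet> to_L2 \<psi> = (LINT x|lebesgue. N (x + h) * \<psi> x) - ?G 0"
    by (simp add: inner_diff_left c1[OF N] c1[OF Nh])
  also have "(LINT x|lebesgue. N (x + h) * \<psi> x) = ?G 1"
  proof -
    have "(\<lambda>x. N x * \<psi> (x + - h)) \<in> borel_measurable lebesgue"
      using N by (intro borel_measurable_times measurable_translate[OF psim]) (simp add: per_L2_def)
    from integral_translate[OF this, of h] show ?thesis by simp
  qed
  also have "?G 1 - ?G 0 = (LINT x|lebesgue. \<psi> (x - z *\<^sub>R h) * (P x \<bullet> h))" using z(3) by simp
  also have "\<dots> = (LINT x|lebesgue. \<psi> x * (P (x + z *\<^sub>R h) \<bullet> h))"
  proof -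
    have "(\<lambda>x. \<psi> (x + - (z *\<^sub>R h)) * (P x \<bullet> h)) \<in> borel_measurable lebesgue"
      using P by (intro borel_measurable_times measurable_translate[OF psim] borel_measurable_inner borel_measurable_const) (simp add: per_L2_def)
    from integral_translate[OF this, of "z *\<^sub>R h"] show ?thesis by simp
  qed
  also have "\<dots> = cell_L2 (\<lambda>x. P (x + z *\<^sub>R h)) \<bullet> to_L2 (\<lambda>x. \<psi> x *\<^sub>R h)"
    by (rule cell_L2_inner_test_fun[OF Pz psi, symmetric])
  finally have "\<bar>(cell_L2 (\<lambda>x. N (x + h)) - cell_L2 N) \<bullet> to_L2 \<psi>\<bar> \<le> norm (cell_L2 (\<lambda>x. P (x + z *\<^sub>R h))) * norm (to_L2 (\<lambda>x. \<psi> x *\<^sub>R h))"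
    by (simp add: Cauchy_Schwarz_ineq2)
  also have "norm (cell_L2 (\<lambda>x. P (x + z *\<^sub>R h))) = norm (cell_L2 P)" using per_L2_shift(2)[OF P zh] .
  also have "norm (cell_L2 P) * norm (to_L2 (\<lambda>x. \<psi> x *\<^sub>R h)) \<le> norm (cell_L2 P) * (norm h * norm (to_L2 \<psi>))"
  proof (rule mult_left_mono, rule norm_to_L2_le[OF sq_integrable_test_fun_scaleR[OF psi]])
    show "AE x in lebesgue. norm (\<psi> x *\<^sub>R h) \<le> norm h * norm (rep_L2 (to_L2 \<psi>) x)"
      using rep_to_L2[OF sq_integrable_test_fun[OF psi]] by eventually_elim simp
  qed auto
  finally show "\<bar>(cell_L2 (\<lambda>x. N (x + h)) - cell_L2 N) \<bullet> to_L2 \<psi>\<bar> \<le> norm h * norm (cell_L2 P) * norm (to_L2 \<psi>)"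
    by (simp add: mult_ac)
qed auto

lemma measure_unit_cell_pos: "measure lborel unit_cell > 0"
proof -
  have "measure lborel (box 0 (One :: real^3)) \<le> measure lborel unit_cell"
    using box_unit_cell(1) emeasure_bounded_finite[OF bounded_unit_cell] unit_cell_borel by (intro measure_mono_fmeasurable) (auto simp: fmeasurable_def)
  moreover have "measure lborel (box 0 (One :: real^3)) = 1" by (subst measure_lborel_box) auto
  ultimately show ?thesis by simp
qed

text \<open>The mean is an inner product with the constant function, hence by polarisation it is invariant like
  the norm.\<close>

lemma cell_mean_shift:
  assumes N: "per_L2 (N :: real^3 \<Rightarrow> real)" and h: "\<And>i. 0 \<le> h $ i" "\<And>i. h $ i \<le> 1"
  shows "(LINT y:unit_cell|lebesgue. N (y + h)) = (LINT y:unit_cell|lebesgue. N y)"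
proof -
  have one: "per_L2 (\<lambda>x. 1 :: real)" by (rule per_L2_const)
  have Nh: "per_L2 (\<lambda>x. N (x + h))" using per_L2_shift(1)[OF N h] .
  let ?n = "cell_L2 N" and ?nh = "cell_L2 (\<lambda>x. N (x + h))" and ?o = "cell_L2 (\<lambda>x. 1 :: real)"
  have "norm (?nh + ?o) = norm (?n + ?o)"
    using per_L2_shift(2)[OF per_L2_add(1)[OF N one] h] per_L2_add(2)[OF N one] per_L2_add(2)[OF Nh one] by simp
  moreover have "norm ?nh = norm ?n" using per_L2_shift(2)[OF N h] .
  ultimately have "?nh \<bullet> ?o = ?n \<bullet> ?o" by (simp add: norm_eq inner_add inner_commute)
  then show ?thesis by (simp add: inner_cell_L2[OF Nh one] inner_cell_L2[OF N one])
qed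

text \<open>For a function of mean zero the average over \<open>h\<close> in the cell of the squared distance between
  \<open>N\<close> and its translate by \<open>h\<close> is twice the squared norm of \<open>N\<close>.\<close>

lemma poincare_wirtinger:
  assumes NP: "H1_per N P" and mean: "(LINT y:unit_cell|lebesgue. N y) = 0"
  shows "norm (cell_L2 N) \<le> 2 * norm (cell_L2 P)"
proof -
  have N: "per_L2 N" and P: "per_L2 P" using NP by (auto simp: H1_per_iff)
  have Nm: "N \<in> borel_measurable lebesgue" using N by (simp add: per_L2_def)
  \<comment> \<open>A Borel representative makes the function \<open>N' (h + x)\<close> of two variables measurable.\<close>
  obtain N' where N'm [measurable]: "N' \<in> borel_measurable borel" and N': "AE x in lborel. N x = N' x"
    using completion_ex_borel_measurable_real[OF Nm] by auto
  have N'': "AE x in lebesgue. N x = N' x" using N' by (rule AE_completion)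
  have N'h: "AE x in lebesgue. N (h + x) = N' (h + x)" for h
  proof -
    have "AE x in distr lebesgue lebesgue (\<lambda>x. h + x). N x = N' x"
      unfolding distr_lebesgue_translate by (rule N'')
    then show ?thesis by (rule AE_distrD[OF measurable_lebesgue_translate])
  qed
  let ?n = "cell_L2 N" and ?A = "norm (cell_L2 P)"
  let ?I = "\<lambda>h. cell_L2 (\<lambda>x. N (x + h)) \<bullet> ?n"
  define \<Phi> where "\<Phi> = (\<lambda>(h, x). indicator unit_cell h * (indicator unit_cell x * (N' (h + x) * N' x)))"
  have Qm [measurable]: "unit_cell \<in> sets borel" by (rule unit_cell_borel)
  have cell: "0 \<le> h $ i" "h $ i \<le> 1" if "h \<in> unit_cell" for h i using that by (auto simp: unit_cell_def intro: less_imp_le)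
  have Phi_m [measurable]: "\<Phi> \<in> borel_measurable (borel \<Otimes>\<^sub>M borel)" unfolding \<Phi>_def by measurable
  then have Phi_m' : "\<Phi> \<in> borel_measurable (lborel \<Otimes>\<^sub>M lborel)" by (simp cong: measurable_cong_sets)
  have Phi_hx: "(\<lambda>x. \<Phi> (h, x)) \<in> borel_measurable borel" for h unfolding \<Phi>_def prod.case by measurable
  have inner_eq: "(LINT x|lborel. \<Phi> (h, x)) = indicator unit_cell h * ?I h" for h
  proof (cases "h \<in> unit_cell")
    case True
    have "?I h = (LINT y:unit_cell|lebesgue. N (y + h) \<bullet> N y)"
      by (rule inner_cell_L2[OF per_L2_shift(1)[OF N cell[OF True]] N])
    also have "\<dots> = (LINT x|lebesgue. \<Phi> (h, x))"
      unfolding set_lebesgue_integral_def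
    proof (rule integral_cong_AE)
      show "AE x in lebesgue. indicator unit_cell x *\<^sub>R (N (x + h) \<bullet> N x) = \<Phi> (h, x)"
        using N'' N'h[of h] by eventually_elim (use True in \<open>simp add: \<Phi>_def add.commute\<close>)
      show "(\<lambda>x. indicator unit_cell x *\<^sub>R (N (x + h) \<bullet> N x)) \<in> borel_measurable lebesgue"
        by (intro borel_measurable_scaleR borel_measurable_indicator borel_measurable_inner measurable_translate[OF Nm] Nm) auto
      show "(\<lambda>x. \<Phi> (h, x)) \<in> borel_measurable lebesgue" using Phi_hx[of h] by (intro measurable_completion) simp
    qed
    also have "\<dots> = (LINT x|lborel. \<Phi> (h, x))" using Phi_hx[of h] by (intro integral_completion) simp
    finally show ?thesis using True by simp
  qed (simp add: \<Phi>_def)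
  have "(\<integral>\<^sup>+p. ennreal (norm (\<Phi> p)) \<partial>(lborel \<Otimes>\<^sub>M lborel)) = (\<integral>\<^sup>+h. \<integral>\<^sup>+x. ennreal (norm (\<Phi> (h, x))) \<partial>lborel \<partial>lborel)"
    by (rule lborel.nn_integral_fst[symmetric]) (use Phi_m' in measurable)
  also have "\<dots> \<le> (\<integral>\<^sup>+h. ennreal ((norm ?n)\<^sup>2) * indicator unit_cell h \<partial>lborel)"
  proof (rule nn_integral_mono)
    fix h :: "real^3"
    show "(\<integral>\<^sup>+x. ennreal (norm (\<Phi> (h, x))) \<partial>lborel) \<le> ennreal ((norm ?n)\<^sup>2) * indicator unit_cell h"
    proof (cases "h \<in> unit_cell")
      case True
      have Nh: "per_L2 (\<lambda>x. N (x + h))" and nh: "norm (cell_L2 (\<lambda>x. N (x + h))) = norm ?n" using per_L2_shift[OF N cell[OF True]] by auto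
      have sq: "sq_integrable (\<lambda>x. indicator unit_cell x *\<^sub>R N x)" "sq_integrable (\<lambda>x. indicator unit_cell x *\<^sub>R N (x + h))"
        using N Nh by (auto simp: per_L2_def)
      have half: "(\<integral>\<^sup>+x. ennreal (1/2) * ennreal ((norm (w x))\<^sup>2) \<partial>lebesgue) = ennreal ((norm (to_L2 w))\<^sup>2 / 2)" if "sq_integrable w" for w :: "real^3 \<Rightarrow> real"
      proof -
        have "(\<lambda>x. ennreal ((norm (w x))\<^sup>2)) \<in> borel_measurable lebesgue" using that by (auto simp: sq_integrable_def)
        then have "(\<integral>\<^sup>+x. ennreal (1/2) * ennreal ((norm (w x))\<^sup>2) \<partial>lebesgue) = ennreal (1/2) * (\<integral>\<^sup>+x. ennreal ((norm (w x))\<^sup>2) \<partial>lebesgue)"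
          by (rule nn_integral_cmult)
        also have "\<dots> = ennreal (1/2) * ennreal ((norm (to_L2 w))\<^sup>2)" unfolding ennreal_norm_to_L2[OF that] ..
        also have "\<dots> = ennreal ((norm (to_L2 w))\<^sup>2 / 2)" by (subst ennreal_mult[symmetric]) auto
        finally show ?thesis .
      qed
      have "(\<integral>\<^sup>+x. ennreal (norm (\<Phi> (h, x))) \<partial>lborel) = (\<integral>\<^sup>+x. ennreal (norm (\<Phi> (h, x))) \<partial>lebesgue)"
        by (rule nn_integral_completion[symmetric])
      also have "\<dots> \<le> (\<integral>\<^sup>+x. ennreal (1/2) * ennreal ((norm (indicator unit_cell x *\<^sub>R N x))\<^sup>2) + ennreal (1/2) * ennreal ((norm (indicator unit_cell x *\<^sub>R N (x + h)))\<^sup>2) \<partial>lebesgue)"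
      proof (rule nn_integral_mono_AE)
        show "AE x in lebesgue. ennreal (norm (\<Phi> (h, x))) \<le> ennreal (1/2) * ennreal ((norm (indicator unit_cell x *\<^sub>R N x))\<^sup>2) + ennreal (1/2) * ennreal ((norm (indicator unit_cell x *\<^sub>R N (x + h)))\<^sup>2)"
          using N'' N'h[of h]
        proof eventually_elim
          case (elim x)
          have "norm (\<Phi> (h, x)) \<le> 1/2 * (norm (indicator unit_cell x *\<^sub>R N x))\<^sup>2 + 1/2 * (norm (indicator unit_cell x *\<^sub>R N (x + h)))\<^sup>2"
          proof (cases "x \<in> unit_cell")
            case True
            have "norm (\<Phi> (h, x)) = \<bar>N (x + h)\<bar> * \<bar>N x\<bar>"
              using True \<open>h \<in> unit_cell\<close> elim by (simp add: \<Phi>_def abs_mult add.commute)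
            moreover have "2 * (\<bar>N (x + h)\<bar> * \<bar>N x\<bar>) \<le> (N (x + h))\<^sup>2 + (N x)\<^sup>2"
              using sum_squares_bound[of "\<bar>N (x + h)\<bar>" "\<bar>N x\<bar>"] by (simp add: mult.assoc)
            ultimately show ?thesis using True by simp
          qed (simp add: \<Phi>_def)
          then have "ennreal (norm (\<Phi> (h, x))) \<le> ennreal (1/2 * (norm (indicator unit_cell x *\<^sub>R N x))\<^sup>2 + 1/2 * (norm (indicator unit_cell x *\<^sub>R N (x + h)))\<^sup>2)"
            by (rule ennreal_leI)
          also have "\<dots> = ennreal (1/2) * ennreal ((norm (indicator unit_cell x *\<^sub>R N x))\<^sup>2) + ennreal (1/2) * ennreal ((norm (indicator unit_cell x *\<^sub>R N (x + h)))\<^sup>2)"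
            by (simp only: ennreal_plus[symmetric] ennreal_mult[symmetric] zero_le_power2 mult_nonneg_nonneg zero_le_divide_1_iff zero_le_numeral)
          finally show ?case .
        qed
      qed
      also have "\<dots> = ennreal ((norm ?n)\<^sup>2 / 2) + ennreal ((norm (cell_L2 (\<lambda>x. N (x + h))))\<^sup>2 / 2)"
        unfolding cell_L2_def half[OF sq(1), symmetric] half[OF sq(2), symmetric]
        by (rule nn_integral_add) (use sq in \<open>auto simp: sq_integrable_def\<close>)
      also have "\<dots> = ennreal ((norm ?n)\<^sup>2)" unfolding nh by (subst ennreal_plus[symmetric]) auto
      finally show ?thesis using True by simp
    qed (simp add: \<Phi>_def)
  qed
  also have "\<dots> = ennreal ((norm ?n)\<^sup>2) * emeasure lborel unit_cell" by (rule nn_integral_cmult_indicator) simp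
  also have "\<dots> < \<infinity>" using emeasure_bounded_finite[OF bounded_unit_cell] by (simp add: ennreal_mult_less_top)
  finally have Phi_int: "integrable (lborel \<Otimes>\<^sub>M lborel) \<Phi>" using Phi_m' by (intro integrableI_bounded)
  have "(LINT h|lborel. LINT x|lborel. \<Phi> (h, x)) = (LINT x|lborel. LINT h|lborel. \<Phi> (h, x))"
    using lborel_pair.Fubini_integral[of "\<lambda>h x. \<Phi> (h, x)"] Phi_int by simp
  also have "\<dots> = (LINT x|(lborel :: (real^3) measure). 0)"
  proof (rule Bochner_Integration.integral_cong)
    fix x :: "real^3"
    show "(LINT h|lborel. \<Phi> (h, x)) = 0"
    proof (cases "x \<in> unit_cell")
      case True
      have "(LINT h|lborel. \<Phi> (h, x)) = (LINT h|lborel. indicator unit_cell h * N' (h + x)) * N' x"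
        using True by (simp add: \<Phi>_def mult.assoc[symmetric])
      also have "(LINT h|lborel. indicator unit_cell h * N' (h + x)) = (LINT h|lebesgue. indicator unit_cell h * N' (h + x))"
        by (rule integral_completion[symmetric]) measurable
      also have "\<dots> = (LINT h:unit_cell|lebesgue. N (h + x))"
        unfolding set_lebesgue_integral_def
      proof (rule integral_cong_AE)
        show "AE h in lebesgue. indicator unit_cell h * N' (h + x) = indicator unit_cell h *\<^sub>R N (h + x)"
          using N'h[of x] by eventually_elim (simp add: add.commute)
        show "(\<lambda>h. indicator unit_cell h *\<^sub>R N (h + x)) \<in> borel_measurable lebesgue"
          by (intro borel_measurable_scaleR borel_measurable_indicator measurable_translate[OF Nm] Nm) auto
        have "(\<lambda>h. indicator unit_cell h * N' (h + x)) \<in> borel_measurable lborel" by measurable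
        then show "(\<lambda>h. indicator unit_cell h * N' (h + x)) \<in> borel_measurable lebesgue" by (rule measurable_completion)
      qed
      also have "\<dots> = 0" using cell_mean_shift[OF N cell[OF True]] mean by simp
      finally show ?thesis by simp
    qed (simp add: \<Phi>_def)
  qed simp
  \<comment> \<open>The correlation of \<open>N\<close> with its translates has mean zero.\<close>
  finally have zero: "(LINT h|lborel. indicator unit_cell h * ?I h) = 0" by (simp add: inner_eq)
  have intI: "integrable lborel (\<lambda>h. indicator unit_cell h * ?I h)"
    using lborel_pair.integrable_fst'[OF Phi_int] by (simp add: inner_eq)
  \<comment> \<open>The factor \<open>3\<close> is the squared diameter of the cell.\<close>
  let ?c = "2 * (norm ?n)\<^sup>2 - 3 * ?A\<^sup>2"
  have "(LINT h|lborel. indicator unit_cell h * ?c) \<le> (LINT h|lborel. 2 * (indicator unit_cell h * ?I h))"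
  proof (rule integral_mono)
    show "integrable lborel (\<lambda>h. indicator unit_cell h * ?c)"
      using emeasure_bounded_finite[OF bounded_unit_cell] by (intro integrable_mult_left integrable_real_indicator) auto
    show "integrable lborel (\<lambda>h. 2 * (indicator unit_cell h * ?I h))" using intI by simp
    fix h :: "real^3"
    show "indicator unit_cell h * ?c \<le> 2 * (indicator unit_cell h * ?I h)"
    proof (cases "h \<in> unit_cell")
      case True
      note c = cell[OF True]
      have "(norm h)\<^sup>2 = h \<bullet> h" by (rule power2_norm_eq_inner)
      also have "\<dots> = (\<Sum>i\<in>UNIV. (h $ i)\<^sup>2)" by (simp add: inner_vec_def power2_eq_square)
      also have "\<dots> \<le> (\<Sum>i\<in>(UNIV :: 3 set). 1)" using c by (intro sum_mono) (simp add: power_le_one)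
      finally have h3: "(norm h)\<^sup>2 \<le> 3" by simp
      let ?nh = "cell_L2 (\<lambda>x. N (x + h))"
      have "(norm (?nh - ?n))\<^sup>2 \<le> (norm h * ?A)\<^sup>2" using translation_estimate[OF NP c] by (intro power_mono) auto
      also have "\<dots> \<le> 3 * ?A\<^sup>2" using h3 by (simp add: power_mult_distrib mult_right_mono)
      finally have "(norm (?nh - ?n))\<^sup>2 \<le> 3 * ?A\<^sup>2" .
      moreover have "(norm (?nh - ?n))\<^sup>2 = (norm ?nh)\<^sup>2 + (norm ?n)\<^sup>2 - 2 * ?I h"
        by (simp add: power2_norm_eq_inner inner_diff inner_commute)
      moreover have "norm ?nh = norm ?n" using per_L2_shift(2)[OF N c] .
      ultimately show ?thesis using True by simp
    qed simp
  qed
  then have "measure lborel unit_cell * ?c \<le> 0" using zero by simp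
  moreover have "measure lborel unit_cell > 0" by (rule measure_unit_cell_pos)
  ultimately have "?c \<le> 0" by (simp add: mult_le_0_iff)
  moreover have "0 \<le> ?A\<^sup>2" by simp
  ultimately have "(norm ?n)\<^sup>2 \<le> 4 * ?A\<^sup>2" by linarith
  then have "(norm ?n)\<^sup>2 \<le> (2 * ?A)\<^sup>2" by (simp add: power_mult_distrib)
  then show ?thesis by (rule power2_le_imp_le) simp
qed

section \<open>The cell problem and the homogenised matrix\<close>

definition loc_L2 :: "real \<Rightarrow> (real^3 \<Rightarrow> 'b::euclidean_space) \<Rightarrow> 'b L2" where
  "loc_L2 r w = to_L2 (\<lambda>x. indicator (cball 0 r) x *\<^sub>R w x)"

lemma sq_integrable_loc: "per_L2 w \<Longrightarrow> sq_integrable (\<lambda>x. indicator (cball 0 r) x *\<^sub>R w x)"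
  for w :: "real^3 \<Rightarrow> 'b::euclidean_space"
proof -
  assume w: "per_L2 w"
  have "\<exists>c\<ge>0. \<forall>w :: real^3 \<Rightarrow> 'b. per_L2 w \<longrightarrow> sq_integrable (\<lambda>x. indicator (cball 0 r) x *\<^sub>R w x) \<and>
     norm (to_L2 (\<lambda>x. indicator (cball 0 r) x *\<^sub>R w x)) \<le> c * norm (cell_L2 w)" by (rule per_L2_ball)
  then show ?thesis using w by blast
qed

lemma loc_L2_add:
  fixes v w :: "real^3 \<Rightarrow> 'b::euclidean_space"
  assumes "per_L2 v" "per_L2 w" shows "loc_L2 r (\<lambda>x. v x + w x) = loc_L2 r v + loc_L2 r w"
  using to_L2_add[OF sq_integrable_loc[OF assms(1), of r] sq_integrable_loc[OF assms(2), of r]]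
  by (simp add: loc_L2_def scaleR_right_distrib)

lemma loc_L2_scaleR:
  fixes w :: "real^3 \<Rightarrow> 'b::euclidean_space"
  assumes "per_L2 w" shows "loc_L2 r (\<lambda>x. c *\<^sub>R w x) = c *\<^sub>R loc_L2 r w"
  using to_L2_scaleR[OF sq_integrable_loc[OF assms, of r], of c] by (simp add: loc_L2_def mult.commute)

lemma loc_L2_tendsto:
  fixes w :: "real^3 \<Rightarrow> 'b::euclidean_space"
  assumes "\<And>n. per_L2 (u n)" "per_L2 w" "(\<lambda>n. cell_L2 (u n)) \<longlonglongrightarrow> cell_L2 w"
  shows "(\<lambda>n. loc_L2 r (u n)) \<longlonglongrightarrow> loc_L2 r w"
proof -
  have "\<exists>c\<ge>0. \<forall>w :: real^3 \<Rightarrow> 'b. per_L2 w \<longrightarrow> sq_integrable (\<lambda>x. indicator (cball 0 r) x *\<^sub>R w x) \<and>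
     norm (to_L2 (\<lambda>x. indicator (cball 0 r) x *\<^sub>R w x)) \<le> c * norm (cell_L2 w)" by (rule per_L2_ball)
  then obtain c where c: "\<And>w :: real^3 \<Rightarrow> 'b. per_L2 w \<Longrightarrow> norm (loc_L2 r w) \<le> c * norm (cell_L2 w)"
    unfolding loc_L2_def by blast
  have le: "norm (loc_L2 r (u n) - loc_L2 r w) \<le> c * norm (cell_L2 (u n) - cell_L2 w)" for n
  proof -
    have "loc_L2 r (\<lambda>x. u n x - w x) = loc_L2 r (u n) - loc_L2 r w"
      using loc_L2_add[OF assms(1)[of n] per_L2_scaleR(1)[OF assms(2)], of r "-1"] loc_L2_scaleR[OF assms(2), of r "-1"] by simp
    then show ?thesis using c[OF per_L2_diff(1)[OF assms(1)[of n] assms(2)]] per_L2_diff(2)[OF assms(1)[of n] assms(2)] by simp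
  qed
  have "(\<lambda>n. c * norm (cell_L2 (u n) - cell_L2 w)) \<longlonglongrightarrow> c * norm (cell_L2 w - cell_L2 w)"
    by (intro tendsto_intros assms(3))
  then have lim: "(\<lambda>n. c * norm (cell_L2 (u n) - cell_L2 w)) \<longlonglongrightarrow> 0" by simp
  have "\<forall>\<^sub>F n in sequentially. norm (loc_L2 r (u n) - loc_L2 r w) \<le> c * norm (cell_L2 (u n) - cell_L2 w)"
    by (rule always_eventually) (use le in blast)
  from Lim_null_comparison[OF this lim] have "(\<lambda>n. loc_L2 r (u n) - loc_L2 r w) \<longlonglongrightarrow> 0" .
  then show ?thesis by (rule LIM_zero_cancel)
qed

text \<open>Tested with functions supported in a ball, the weak gradient of a periodic function only
  involves its restriction to that ball.\<close>

lemma weak_grad_loc_iff: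
  assumes N: "per_L2 N" and P: "per_L2 P"
  shows "has_weak_grad UNIV N P \<longleftrightarrow> (\<forall>r \<phi> e. test_fun UNIV \<phi> \<and> (\<forall>x. x \<notin> cball 0 r \<longrightarrow> \<phi> x = 0 \<and> cgrad \<phi> x = 0) \<longrightarrow>
     loc_L2 r N \<bullet> to_L2 (\<lambda>x. cgrad \<phi> x \<bullet> e) = - (loc_L2 r P \<bullet> to_L2 (\<lambda>x. \<phi> x *\<^sub>R e)))"
proof -
  have l: "(LINT x|lebesgue. N x *\<^sub>R cgrad \<phi> x) \<bullet> e = loc_L2 r N \<bullet> to_L2 (\<lambda>x. cgrad \<phi> x \<bullet> e)"
    and p: "(LINT x|lebesgue. \<phi> x *\<^sub>R P x) \<bullet> e = loc_L2 r P \<bullet> to_L2 (\<lambda>x. \<phi> x *\<^sub>R e)"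
    if phi: "test_fun UNIV \<phi>" and out: "\<forall>x. x \<notin> cball 0 r \<longrightarrow> \<phi> x = 0 \<and> cgrad \<phi> x = 0" for r \<phi> e
  proof -
    have e1: "(\<lambda>x. N x *\<^sub>R cgrad \<phi> x) = (\<lambda>x. (indicator (cball 0 r) x *\<^sub>R N x) *\<^sub>R cgrad \<phi> x)"
      using out by (auto simp: fun_eq_iff indicator_def)
    have e2: "(\<lambda>x. \<phi> x *\<^sub>R P x) = (\<lambda>x. \<phi> x *\<^sub>R (indicator (cball 0 r) x *\<^sub>R P x))"
      using out by (auto simp: fun_eq_iff indicator_def)
    have "(LINT x|lebesgue. N x *\<^sub>R cgrad \<phi> x) \<bullet> e = (LINT x|lebesgue. ((indicator (cball 0 r) x *\<^sub>R N x) *\<^sub>R cgrad \<phi> x) \<bullet> e)"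
      unfolding e1 by (rule integral_inner_left[symmetric]) (intro integrable_scaleR_sq sq_integrable_loc N sq_integrable_cgrad[OF phi])
    also have "\<dots> = loc_L2 r N \<bullet> to_L2 (\<lambda>x. cgrad \<phi> x \<bullet> e)"
      unfolding loc_L2_def by (subst inner_to_L2[OF sq_integrable_loc[OF N] sq_integrable_cgrad_inner[OF phi]]) simp
    finally show "(LINT x|lebesgue. N x *\<^sub>R cgrad \<phi> x) \<bullet> e = loc_L2 r N \<bullet> to_L2 (\<lambda>x. cgrad \<phi> x \<bullet> e)" .
    have "(LINT x|lebesgue. \<phi> x *\<^sub>R P x) \<bullet> e = (LINT x|lebesgue. (\<phi> x *\<^sub>R (indicator (cball 0 r) x *\<^sub>R P x)) \<bullet> e)"
      unfolding e2 by (rule integral_inner_left[symmetric]) (intro integrable_scaleR_sq sq_integrable_loc P sq_integrable_test_fun[OF phi])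
    also have "\<dots> = loc_L2 r P \<bullet> to_L2 (\<lambda>x. \<phi> x *\<^sub>R e)"
      unfolding loc_L2_def by (subst inner_to_L2[OF sq_integrable_loc[OF P] sq_integrable_test_fun_scaleR[OF phi]]) (simp add: mult_ac)
    finally show "(LINT x|lebesgue. \<phi> x *\<^sub>R P x) \<bullet> e = loc_L2 r P \<bullet> to_L2 (\<lambda>x. \<phi> x *\<^sub>R e)" .
  qed
  have vec: "a = - b \<longleftrightarrow> (\<forall>e. a \<bullet> e = - (b \<bullet> e))" for a b :: "real^3"
    using vector_eq_rdot[of a "- b"] by (simp add: inner_minus_left)
  show ?thesis
  proof
    assume wg: "has_weak_grad UNIV N P"
    show "\<forall>r \<phi> e. test_fun UNIV \<phi> \<and> (\<forall>x. x \<notin> cball 0 r \<longrightarrow> \<phi> x = 0 \<and> cgrad \<phi> x = 0) \<longrightarrow>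
       loc_L2 r N \<bullet> to_L2 (\<lambda>x. cgrad \<phi> x \<bullet> e) = - (loc_L2 r P \<bullet> to_L2 (\<lambda>x. \<phi> x *\<^sub>R e))"
    proof (intro allI impI, elim conjE)
      fix r \<phi> e assume t: "test_fun UNIV \<phi>" "\<forall>x. x \<notin> cball 0 r \<longrightarrow> \<phi> x = 0 \<and> cgrad \<phi> x = 0"
      have "(LINT x|lebesgue. N x *\<^sub>R cgrad \<phi> x) = - (LINT x|lebesgue. \<phi> x *\<^sub>R P x)"
        using wg t(1) by (simp add: has_weak_grad_def)
      then show "loc_L2 r N \<bullet> to_L2 (\<lambda>x. cgrad \<phi> x \<bullet> e) = - (loc_L2 r P \<bullet> to_L2 (\<lambda>x. \<phi> x *\<^sub>R e))"
        unfolding l[OF t, symmetric] p[OF t, symmetric] vec by blast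
    qed
  next
    assume R: "\<forall>r \<phi> e. test_fun UNIV \<phi> \<and> (\<forall>x. x \<notin> cball 0 r \<longrightarrow> \<phi> x = 0 \<and> cgrad \<phi> x = 0) \<longrightarrow>
       loc_L2 r N \<bullet> to_L2 (\<lambda>x. cgrad \<phi> x \<bullet> e) = - (loc_L2 r P \<bullet> to_L2 (\<lambda>x. \<phi> x *\<^sub>R e))"
    show "has_weak_grad UNIV N P"
      unfolding has_weak_grad_def vec
    proof (intro allI impI)
      fix \<phi> e assume t: "test_fun UNIV \<phi>"
      obtain C where C: "compact C" "\<And>x. x \<notin> C \<Longrightarrow> \<phi> x = 0" "\<And>x. x \<notin> C \<Longrightarrow> cgrad \<phi> x = 0"
        using test_fun_support[OF t] by blast
      obtain r where "\<And>x. x \<in> C \<Longrightarrow> norm x \<le> r" using compact_imp_bounded[OF C(1)] by (auto simp: bounded_iff)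
      then have o: "\<forall>x. x \<notin> cball 0 r \<longrightarrow> \<phi> x = 0 \<and> cgrad \<phi> x = 0" using C by auto
      show "(LINT x|lebesgue. N x *\<^sub>R cgrad \<phi> x) \<bullet> e = - ((LINT x|lebesgue. \<phi> x *\<^sub>R P x) \<bullet> e)"
        unfolding l[OF t o] p[OF t o] using R t o by blast
    qed
  qed
qed

lemma H1_per_add:
  assumes "H1_per N P" "H1_per N' P'" shows "H1_per (\<lambda>x. N x + N' x) (\<lambda>x. P x + P' x)"
proof -
  have n: "per_L2 N" "per_L2 N'" "per_L2 P" "per_L2 P'" using assms by (auto simp: H1_per_iff)
  have s: "per_L2 (\<lambda>x. N x + N' x)" "per_L2 (\<lambda>x. P x + P' x)" using n by (auto intro: per_L2_add)
  show ?thesis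
    using assms s unfolding H1_per_iff weak_grad_loc_iff[OF n(1,3)] weak_grad_loc_iff[OF n(2,4)] weak_grad_loc_iff[OF s]
    by (simp add: loc_L2_add n inner_add_left)
qed

lemma H1_per_scale:
  assumes "H1_per N P" shows "H1_per (\<lambda>x. c * N x) (\<lambda>x. c *\<^sub>R P x)"
proof -
  have n: "per_L2 N" "per_L2 P" using assms by (auto simp: H1_per_iff)
  have s: "per_L2 (\<lambda>x. c * N x)" "per_L2 (\<lambda>x. c *\<^sub>R P x)" using per_L2_scaleR(1)[OF n(1), of c] per_L2_scaleR(1)[OF n(2)] by auto
  have "loc_L2 r (\<lambda>x. c * N x) = c *\<^sub>R loc_L2 r N" for r using loc_L2_scaleR[OF n(1), of r c] by simp
  then show ?thesis
    using assms s unfolding H1_per_iff weak_grad_loc_iff[OF n] weak_grad_loc_iff[OF s]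
    by (simp add: loc_L2_scaleR n)
qed

lemma H1_per_const: "H1_per (\<lambda>_. c) (\<lambda>_. 0)"
  unfolding H1_per_iff
proof (intro conjI per_L2_const)
  show "has_weak_grad UNIV (\<lambda>_. c) (\<lambda>_. 0)"
    unfolding has_weak_grad_def
  proof (intro allI impI)
    fix \<phi> assume t: "test_fun (UNIV :: (real^3) set) \<phi>"
    obtain C where C: "compact C" "\<And>x. x \<notin> C \<Longrightarrow> \<phi> x = 0" "\<And>x. x \<notin> C \<Longrightarrow> cgrad \<phi> x = 0"
      using test_fun_support[OF t] by blast
    have i: "integrable lebesgue (cgrad \<phi>)"
      using integrable_continuous_compact_support[OF test_fun_cgrad_continuous[OF t] C(1) C(3)] .
    have "(LINT x|lebesgue. cgrad \<phi> x) \<bullet> e = 0" for e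
      using integral_derivative_eq_0[OF test_fun_has_derivative[OF t] test_fun_cgrad_continuous[OF t] C, of e]
        integral_inner_left[OF i, of e] by simp
    from this[of "LINT x|lebesgue. cgrad \<phi> x"] have "(LINT x|lebesgue. cgrad \<phi> x) = 0" by (simp only: inner_eq_zero_iff)
    then show "(LINT x|lebesgue. c *\<^sub>R cgrad \<phi> x) = - (LINT x|lebesgue. \<phi> x *\<^sub>R (0 :: real^3))" by simp
  qed
qed

lemma H1_per_diff:
  assumes "H1_per N P" "H1_per N' P'" shows "H1_per (\<lambda>x. N x - N' x) (\<lambda>x. P x - P' x)"
  using H1_per_add[OF assms(1) H1_per_scale[OF assms(2), of "-1"]] by simp

lemma cell_mean_eq: "per_L2 N \<Longrightarrow> (LINT y:unit_cell|lebesgue. N y) = cell_L2 N \<bullet> cell_L2 (\<lambda>_. 1 :: real)"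
  using inner_cell_L2[OF _ per_L2_const[of "1 :: real"], of N] by simp

lemma inner_cell_L2_const: "cell_L2 (\<lambda>_. c) \<bullet> cell_L2 (\<lambda>_. d) = measure lborel unit_cell * (c \<bullet> d)"
  for c d :: "'b::euclidean_space"
proof -
  have "(LINT y:unit_cell|lebesgue. c \<bullet> d) = measure lebesgue unit_cell * (c \<bullet> d)"
    using emeasure_unit_cell_finite unfolding set_lebesgue_integral_def by simp
  then show ?thesis using inner_cell_L2[OF per_L2_const per_L2_const, of c d] unit_cell_borel by simp
qed

lemma H1_per_zero_mean:
  assumes "H1_per N P" shows "\<exists>N'. H1_per N' P \<and> (LINT y:unit_cell|lebesgue. N' y) = 0"
proof -
  have N: "per_L2 N" using assms by (auto simp: H1_per_iff)
  define c where "c = (LINT y:unit_cell|lebesgue. N y) / measure lborel unit_cell"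
  have h: "H1_per (\<lambda>x. N x - c) P" using H1_per_diff[OF assms H1_per_const[of c]] by simp
  have "(LINT y:unit_cell|lebesgue. N y - c) = cell_L2 (\<lambda>x. N x - c) \<bullet> cell_L2 (\<lambda>_. 1 :: real)"
    using h by (intro cell_mean_eq) (simp add: H1_per_iff)
  also have "\<dots> = (LINT y:unit_cell|lebesgue. N y) - measure lborel unit_cell * c"
    using per_L2_diff(2)[OF N per_L2_const[of c]] by (simp add: inner_diff_left cell_mean_eq[OF N] inner_cell_L2_const)
  also have "\<dots> = 0" using measure_unit_cell_pos by (simp add: c_def)
  finally show ?thesis using h by blast
qed

definition cell_gradients :: "(real^3) L2 set" where
  "cell_gradients = {p. \<exists>N P. H1_per N P \<and> p = cell_L2 P}"

lemma subspace_cell_gradients: "subspace cell_gradients"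
  unfolding subspace_def cell_gradients_def mem_Collect_eq
proof (intro conjI ballI allI)
  have "cell_L2 (\<lambda>_. 0 :: real^3) = 0" using to_L2_scaleR[OF sq_integrable_0, of 0] by (simp add: cell_L2_def)
  then show "\<exists>N P. H1_per N P \<and> 0 = cell_L2 P" using H1_per_const[of 0] by metis
next
  fix p q assume "p \<in> {p. \<exists>N P. H1_per N P \<and> p = cell_L2 P}" "q \<in> {p. \<exists>N P. H1_per N P \<and> p = cell_L2 P}"
  then obtain N P N' P' where h: "H1_per N P" "p = cell_L2 P" "H1_per N' P'" "q = cell_L2 P'" by auto
  then have "p + q = cell_L2 (\<lambda>x. P x + P' x)" by (simp add: H1_per_iff per_L2_add(2))
  then show "\<exists>N P. H1_per N P \<and> p + q = cell_L2 P" using H1_per_add[OF h(1,3)] by blast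
next
  fix c :: real and p assume "p \<in> {p. \<exists>N P. H1_per N P \<and> p = cell_L2 P}"
  then obtain N P where h: "H1_per N P" "p = cell_L2 P" by auto
  then have "c *\<^sub>R p = cell_L2 (\<lambda>x. c *\<^sub>R P x)" by (simp add: H1_per_iff per_L2_scaleR(2))
  then show "\<exists>N P. H1_per N P \<and> c *\<^sub>R p = cell_L2 P" using H1_per_scale[OF h(1)] by blast
qed

text \<open>The limit must be periodic everywhere, not only on one cell, so it is taken pointwise along an almost
  everywhere convergent subsequence.\<close>

lemma cell_L2_pointwise_limit:
  fixes w :: "nat \<Rightarrow> real^3 \<Rightarrow> 'b::euclidean_space"
  assumes w: "\<And>n. per_L2 (w n)" and lim: "(\<lambda>n. cell_L2 (w n)) \<longlonglongrightarrow> l"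
  shows "\<exists>v. per_L2 v \<and> cell_L2 v = l"
proof -
  obtain r :: "nat \<Rightarrow> nat" where r: "strict_mono r" "AE x in lebesgue. (\<lambda>n. rep_L2 (cell_L2 (w (r n))) x) \<longlonglongrightarrow> rep_L2 l x"
    using L2_tendsto_AE_subseq[OF lim] by blast
  have sq: "sq_integrable (\<lambda>x. indicator unit_cell x *\<^sub>R w n x)" for n using w[of n] by (simp add: per_L2_def)
  have all: "AE x in lebesgue. \<forall>n. rep_L2 (cell_L2 (w (r n))) x = indicator unit_cell x *\<^sub>R w (r n) x"
    unfolding cell_L2_def by (subst AE_all_countable) (auto intro!: rep_to_L2 sq)
  define v where "v x = lim (\<lambda>n. w (r n) x)" for x
  have vm: "v \<in> borel_measurable lebesgue"
    unfolding v_def[abs_def] by (rule borel_measurable_lim_metric) (use w in \<open>auto simp: per_L2_def\<close>)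
  have per: "periodic v"
    using w unfolding v_def per_L2_def periodic_def by simp
  have eq: "AE x in lebesgue. indicator unit_cell x *\<^sub>R v x = rep_L2 l x"
    using r(2) all
  proof eventually_elim
    case (elim x)
    then have lim: "(\<lambda>n. indicator unit_cell x *\<^sub>R w (r n) x) \<longlonglongrightarrow> rep_L2 l x" by simp
    show ?case
    proof (cases "x \<in> unit_cell")
      case True
      then have "v x = rep_L2 l x" unfolding v_def using lim by (intro limI) simp
      then show ?thesis using True by simp
    next
      case False
      then show ?thesis using lim by (simp add: LIMSEQ_const_iff)
    qed
  qed
  have vm2: "(\<lambda>x. indicator unit_cell x *\<^sub>R v x) \<in> borel_measurable lebesgue"
    by (intro borel_measurable_scaleR borel_measurable_indicator vm) auto
  have sqv: "sq_integrable (\<lambda>x. indicator unit_cell x *\<^sub>R v x)"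
    by (rule sq_integrable_cong_AE[OF sq_integrable_rep[of l] vm2 eq])
  then have "per_L2 v" using vm per by (simp add: per_L2_def)
  moreover have "cell_L2 v = l"
  proof (rule L2_eqI)
    show "AE x in lebesgue. rep_L2 (cell_L2 v) x = rep_L2 l x"
      using rep_to_L2[OF sqv] eq unfolding cell_L2_def by eventually_elim simp
  qed
  ultimately show ?thesis by blast
qed

text \<open>The gradients of periodic functions are closed, since the inequality of Poincare and Wirtinger makes
  the functions themselves converge.\<close>

lemma complete_cell_gradients: "complete cell_gradients"
  unfolding complete_eq_closed closed_sequential_limits
proof (intro allI impI, elim conjE)
  fix p l assume p: "\<forall>n. p n \<in> cell_gradients" and lim: "p \<longlonglongrightarrow> l"
  have "\<exists>N P. H1_per N P \<and> (LINT y:unit_cell|lebesgue. N y) = 0 \<and> p n = cell_L2 P" for n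
  proof -
    have "p n \<in> cell_gradients" using p by blast
    then obtain N P where NP: "H1_per N P" "p n = cell_L2 P" unfolding cell_gradients_def by blast
    then show ?thesis using H1_per_zero_mean[OF NP(1)] by blast
  qed
  then obtain N P where NP: "\<And>n. H1_per (N n) (P n)" "\<And>n. (LINT y:unit_cell|lebesgue. N n y) = 0" "\<And>n. p n = cell_L2 (P n)" by metis
  have N: "per_L2 (N n)" and P: "per_L2 (P n)" for n using NP(1)[of n] by (auto simp: H1_per_iff)
  have d: "norm (cell_L2 (N i) - cell_L2 (N j)) \<le> 2 * norm (p i - p j)" for i j
  proof -
    have "(LINT y:unit_cell|lebesgue. N i y - N j y) = 0"
    proof -
      have "(LINT y:unit_cell|lebesgue. N i y - N j y) = cell_L2 (\<lambda>y. N i y - N j y) \<bullet> cell_L2 (\<lambda>_. 1 :: real)"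
        by (rule cell_mean_eq[OF per_L2_diff(1)[OF N N]])
      then show ?thesis using NP(2)[of i] NP(2)[of j] by (simp add: per_L2_diff(2)[OF N N] inner_diff_left cell_mean_eq[OF N, symmetric])
    qed
    from poincare_wirtinger[OF H1_per_diff[OF NP(1)[of i] NP(1)[of j]] this] show ?thesis
      by (simp add: per_L2_diff(2)[OF N N] per_L2_diff(2)[OF P P] NP(3))
  qed
  have "Cauchy (\<lambda>n. cell_L2 (N n))"
  proof (rule metric_CauchyI)
    fix e :: real assume "e > 0"
    have "Cauchy p" using lim by (rule LIMSEQ_imp_Cauchy)
    then obtain M where M: "\<And>i j. i \<ge> M \<Longrightarrow> j \<ge> M \<Longrightarrow> dist (p i) (p j) < e / 2"
      using \<open>e > 0\<close> unfolding Cauchy_def by (meson half_gt_zero)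
    have "dist (cell_L2 (N i)) (cell_L2 (N j)) < e" if "i \<ge> M" "j \<ge> M" for i j
      using M[OF that] d[of i j] by (simp add: dist_norm)
    then show "\<exists>M. \<forall>i\<ge>M. \<forall>j\<ge>M. dist (cell_L2 (N i)) (cell_L2 (N j)) < e" by blast
  qed
  then obtain n where n: "(\<lambda>k. cell_L2 (N k)) \<longlonglongrightarrow> n" using Cauchy_convergent convergent_def by blast
  have pl: "(\<lambda>k. cell_L2 (P k)) \<longlonglongrightarrow> l" using lim by (simp add: NP(3)[symmetric])
  obtain N' where N': "per_L2 N'" "cell_L2 N' = n" using cell_L2_pointwise_limit[OF N n] by blast
  obtain P' where P': "per_L2 P'" "cell_L2 P' = l" using cell_L2_pointwise_limit[OF P pl] by blast
  have "has_weak_grad UNIV N' P'"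
    unfolding weak_grad_loc_iff[OF N'(1) P'(1)]
  proof (intro allI impI)
    fix r \<phi> e assume t: "test_fun UNIV \<phi> \<and> (\<forall>x. x \<notin> cball 0 r \<longrightarrow> \<phi> x = 0 \<and> cgrad \<phi> x = 0)"
    have "(\<lambda>k. loc_L2 r (N k) \<bullet> to_L2 (\<lambda>x. cgrad \<phi> x \<bullet> e)) \<longlonglongrightarrow> loc_L2 r N' \<bullet> to_L2 (\<lambda>x. cgrad \<phi> x \<bullet> e)"
      by (intro tendsto_intros loc_L2_tendsto[OF N N'(1)]) (simp add: N'(2) n)
    moreover have "(\<lambda>k. - (loc_L2 r (P k) \<bullet> to_L2 (\<lambda>x. \<phi> x *\<^sub>R e))) \<longlonglongrightarrow> - (loc_L2 r P' \<bullet> to_L2 (\<lambda>x. \<phi> x *\<^sub>R e))"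
      by (intro tendsto_intros loc_L2_tendsto[OF P P'(1)]) (simp add: P'(2) pl)
    moreover have "loc_L2 r (N k) \<bullet> to_L2 (\<lambda>x. cgrad \<phi> x \<bullet> e) = - (loc_L2 r (P k) \<bullet> to_L2 (\<lambda>x. \<phi> x *\<^sub>R e))" for k
      using NP(1)[of k] t unfolding H1_per_iff weak_grad_loc_iff[OF N P] by blast
    ultimately show "loc_L2 r N' \<bullet> to_L2 (\<lambda>x. cgrad \<phi> x \<bullet> e) = - (loc_L2 r P' \<bullet> to_L2 (\<lambda>x. \<phi> x *\<^sub>R e))"
      by (simp add: LIMSEQ_unique)
  qed
  then show "l \<in> cell_gradients" using N' P' by (auto simp: cell_gradients_def H1_per_iff)
qed

lemma coeff_op_cell:
  assumes a: "elliptic_coeff \<nu> \<Lambda> a" and P: "per_L2 P" "per_L2 \<Psi>"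
  shows "coeff_op a (cell_L2 P) \<bullet> cell_L2 \<Psi> = (LINT y:unit_cell|lebesgue. (a y *v P y) \<bullet> \<Psi> y)"
proof -
  let ?p = "\<lambda>x. indicator unit_cell x *\<^sub>R P x"
  have sq: "sq_integrable ?p" "sq_integrable (\<lambda>x. indicator unit_cell x *\<^sub>R \<Psi> x)" using P by (auto simp: per_L2_def)
  have "coeff_op a (cell_L2 P) = to_L2 (\<lambda>x. a x *v ?p x)"
    unfolding coeff_op_def
  proof (rule to_L2_cong_AE[OF sq_integrable_coeff_mult[OF a sq_integrable_rep] sq_integrable_coeff_mult[OF a sq(1)]])
    show "AE x in lebesgue. a x *v rep_L2 (cell_L2 P) x = a x *v ?p x"
      using rep_to_L2[OF sq(1)] unfolding cell_L2_def by eventually_elim simp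
  qed
  then have "coeff_op a (cell_L2 P) \<bullet> cell_L2 \<Psi> = (LINT x|lebesgue. (a x *v ?p x) \<bullet> (indicator unit_cell x *\<^sub>R \<Psi> x))"
    unfolding cell_L2_def[of \<Psi>] using inner_to_L2[OF sq_integrable_coeff_mult[OF a sq(1)] sq(2)] by simp
  also have "\<dots> = (LINT y:unit_cell|lebesgue. (a y *v P y) \<bullet> \<Psi> y)"
    unfolding set_lebesgue_integral_def by (intro Bochner_Integration.integral_cong) (auto simp: indicator_def)
  finally show ?thesis .
qed

text \<open>The cell problem says that \<open>e + P\<close> is orthogonal, in the energy product, to all gradients of
  periodic functions.\<close>

lemma cell_solution_iff:
  assumes a: "elliptic_coeff \<nu> \<Lambda> a"
  shows "cell_solution a e N P \<longleftrightarrow> H1_per N P \<and> (LINT y:unit_cell|lebesgue. N y) = 0 \<and>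
     (\<forall>q\<in>cell_gradients. coeff_op a (cell_L2 (\<lambda>_. e) + cell_L2 P) \<bullet> q = 0)"
proof -
  interpret A: bounded_linear "coeff_op a" by (rule coeff_op_bounded_linear[OF a])
  have "(\<forall>\<psi> \<Psi>. H1_per \<psi> \<Psi> \<longrightarrow> (LINT y:unit_cell|lebesgue. (a y *v P y) \<bullet> \<Psi> y) = - (LINT y:unit_cell|lebesgue. (a y *v e) \<bullet> \<Psi> y))
    \<longleftrightarrow> (\<forall>q\<in>cell_gradients. coeff_op a (cell_L2 (\<lambda>_. e) + cell_L2 P) \<bullet> q = 0)" if "H1_per N P"
  proof -
    have "(LINT y:unit_cell|lebesgue. (a y *v P y) \<bullet> \<Psi> y) = - (LINT y:unit_cell|lebesgue. (a y *v e) \<bullet> \<Psi> y)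
      \<longleftrightarrow> coeff_op a (cell_L2 (\<lambda>_. e) + cell_L2 P) \<bullet> cell_L2 \<Psi> = 0" if "H1_per \<psi> \<Psi>" for \<psi> \<Psi>
    proof -
      have P: "per_L2 P" "per_L2 \<Psi>" using that \<open>H1_per N P\<close> by (auto simp: H1_per_iff)
      show ?thesis
        using coeff_op_cell[OF a P] coeff_op_cell[OF a per_L2_const[of e] P(2)] by (auto simp: A.add inner_add_left)
    qed
    then show ?thesis unfolding cell_gradients_def by blast
  qed
  then show ?thesis unfolding cell_solution_def by blast
qed

lemma cell_solution_exists:
  assumes a: "elliptic_coeff \<nu> \<Lambda> a" shows "\<exists>N P. cell_solution a e N P"
proof -
  have "\<exists>p\<in>cell_gradients. \<forall>q\<in>cell_gradients. coeff_op a (cell_L2 (\<lambda>_. e) + p) \<bullet> q = 0"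
    using a by (intro symmetric_Lax_Milgram[OF subspace_cell_gradients complete_cell_gradients coeff_op_bounded_linear[OF a] coeff_op_sym[OF a] coeff_op_coercive[OF a]])
      (simp add: elliptic_coeff_def)
  then obtain N P where NP: "H1_per N P" "\<forall>q\<in>cell_gradients. coeff_op a (cell_L2 (\<lambda>_. e) + cell_L2 P) \<bullet> q = 0"
    by (auto simp: cell_gradients_def)
  obtain N' where "H1_per N' P" "(LINT y:unit_cell|lebesgue. N' y) = 0" using H1_per_zero_mean[OF NP(1)] by blast
  then show ?thesis using NP(2) unfolding cell_solution_iff[OF a] by blast
qed

lemma cell_solution_unique:
  assumes a: "elliptic_coeff \<nu> \<Lambda> a" and "cell_solution a e N P" "cell_solution a e N' P'"
  shows "cell_L2 P = cell_L2 P'"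
proof -
  interpret A: bounded_linear "coeff_op a" by (rule coeff_op_bounded_linear[OF a])
  have mem: "cell_L2 P \<in> cell_gradients" "cell_L2 P' \<in> cell_gradients"
    using assms(2,3) unfolding cell_solution_iff[OF a] cell_gradients_def by blast+
  let ?q = "cell_L2 P - cell_L2 P'"
  have q: "?q \<in> cell_gradients" using mem by (intro subspace_diff subspace_cell_gradients)
  have "coeff_op a (cell_L2 (\<lambda>_. e) + cell_L2 P) \<bullet> ?q = 0" "coeff_op a (cell_L2 (\<lambda>_. e) + cell_L2 P') \<bullet> ?q = 0"
    using assms(2,3) q unfolding cell_solution_iff[OF a] by blast+
  then have "coeff_op a ?q \<bullet> ?q = 0" by (simp add: A.add A.diff inner_add_left inner_diff_left)
  then have "\<nu> * (norm ?q)\<^sup>2 \<le> 0" using coeff_op_coercive[OF a, of ?q] by simp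
  moreover have "\<nu> > 0" using a by (simp add: elliptic_coeff_def)
  ultimately have "(norm ?q)\<^sup>2 \<le> 0" by (simp add: mult_le_0_iff)
  then show ?thesis by simp
qed

text \<open>The entries of the homogenised matrix are the energy products of the fields \<open>e\<^sub>j + \<nabla>N\<^sub>j\<close>.\<close>

lemma hom_matrix_entries:
  assumes a: "elliptic_coeff \<nu> \<Lambda> a"
  shows "\<exists>N P. (\<forall>j. H1_per (N j) (P j)) \<and>
    (\<forall>i j. hom_matrix a $ i $ j = coeff_op a (cell_L2 (\<lambda>_. axis j 1) + cell_L2 (P j)) \<bullet> (cell_L2 (\<lambda>_. axis i 1) + cell_L2 (P i)))"
proof -
  let ?E = "\<lambda>j::3. cell_L2 (\<lambda>_. axis j 1 :: real^3)"
  have entry: "(LINT y:unit_cell|lebesgue. a y $ i $ j + (\<Sum>k\<in>UNIV. a y $ i $ k * P y $ k)) = coeff_op a (?E j + cell_L2 P) \<bullet> ?E i"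
    if "per_L2 P" for P i j
  proof -
    have "coeff_op a (?E j + cell_L2 P) \<bullet> ?E i = coeff_op a (cell_L2 (\<lambda>y. axis j 1 + P y)) \<bullet> ?E i"
      by (simp add: per_L2_add(2)[OF per_L2_const that])
    also have "\<dots> = (LINT y:unit_cell|lebesgue. (a y *v (axis j 1 + P y)) \<bullet> axis i 1)"
      by (intro coeff_op_cell[OF a] per_L2_add(1)[OF per_L2_const that] per_L2_const)
    also have "\<dots> = (LINT y:unit_cell|lebesgue. a y $ i $ j + (\<Sum>k\<in>UNIV. a y $ i $ k * P y $ k))"
    proof -
      have "(a y *v (axis j 1 + P y)) \<bullet> axis i 1 = a y $ i $ j + (\<Sum>k\<in>UNIV. a y $ i $ k * P y $ k)" for y
        by (simp add: matrix_vector_right_distrib inner_axis matrix_vector_mult_basis column_def) (simp add: matrix_vector_mult_def)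
      then show ?thesis by simp
    qed
    finally show ?thesis by simp
  qed
  have "\<forall>j. \<exists>N P. cell_solution a (axis j 1) N P" using cell_solution_exists[OF a] by blast
  then obtain N P where NP: "\<And>j. cell_solution a (axis j 1) (N j) (P j)" by metis
  have h: "H1_per (N j) (P j)" for j using NP[of j] by (simp add: cell_solution_def)
  then have P: "per_L2 (P j)" for j by (simp add: H1_per_iff)
  define B where "B = (\<chi> i j. coeff_op a (?E j + cell_L2 (P j)) \<bullet> ?E i)"
  have "hom_matrix a = B"
    unfolding hom_matrix_def
  proof (rule the_equality)
    show "\<exists>N P. (\<forall>j. cell_solution a (axis j 1) (N j) (P j)) \<and> (\<forall>i j. B $ i $ j =
        (LINT y:unit_cell|lebesgue. a y $ i $ j + (\<Sum>k\<in>UNIV. a y $ i $ k * P j y $ k)))"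
      using NP by (intro exI[of _ N] exI[of _ P]) (simp add: B_def entry[OF P])
  next
    fix A assume "\<exists>N P. (\<forall>j. cell_solution a (axis j 1) (N j) (P j)) \<and> (\<forall>i j. A $ i $ j =
        (LINT y:unit_cell|lebesgue. a y $ i $ j + (\<Sum>k\<in>UNIV. a y $ i $ k * P j y $ k)))"
    then obtain N' P' where NP': "\<And>j. cell_solution a (axis j 1) (N' j) (P' j)"
      and A: "\<And>i j. A $ i $ j = (LINT y:unit_cell|lebesgue. a y $ i $ j + (\<Sum>k\<in>UNIV. a y $ i $ k * P' j y $ k))" by blast
    have P': "per_L2 (P' j)" for j using NP'[of j] by (simp add: cell_solution_def H1_per_iff)
    show "A = B"
      by (simp add: vec_eq_iff A B_def entry[OF P'] cell_solution_unique[OF a NP' NP])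
  qed
  moreover have "coeff_op a (?E j + cell_L2 (P j)) \<bullet> cell_L2 (P i) = 0" for i j
    using NP[of j] h[of i] unfolding cell_solution_iff[OF a] cell_gradients_def by blast
  ultimately have "hom_matrix a $ i $ j = coeff_op a (?E j + cell_L2 (P j)) \<bullet> (?E i + cell_L2 (P i))" for i j
    by (simp add: B_def inner_add_right)
  then show ?thesis using h by blast
qed

text \<open>If \<open>\<eta> + \<nabla>N\<close> vanishes, then \<open>N\<close> is affine with slope \<open>- \<eta>\<close>; being periodic, it has slope zero.\<close>

lemma periodic_gradient_not_constant:
  assumes NP: "H1_per N P" and z: "cell_L2 (\<lambda>_. \<eta>) + cell_L2 P = 0" shows "\<eta> = 0"
proof -
  have N: "per_L2 N" and P: "per_L2 P" using NP by (auto simp: H1_per_iff)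
  have eP: "per_L2 (\<lambda>x. \<eta> + P x)" "cell_L2 (\<lambda>x. \<eta> + P x) = 0"
    using per_L2_add[OF per_L2_const P, of \<eta>] z by auto
  have comp: "(LINT x|lebesgue. \<psi> x) * \<eta> $ i = 0" if psi: "test_fun (box 0 One) \<psi>" for \<psi> i
  proof -
    let ?h = "axis i 1 :: real^3"
    have psi': "test_fun UNIV \<psi>" using psi by (rule test_fun_mono) simp
    have psim: "\<psi> \<in> borel_measurable lebesgue" using sq_integrable_test_fun[OF psi] by (simp add: sq_integrable_def)
    let ?G = "\<lambda>s. LINT x|lebesgue. N x * \<psi> (x - s *\<^sub>R ?h)"
    obtain s where s: "0 < s" "s < 1" "?G 1 - ?G 0 = (1 - 0) * (LINT x|lebesgue. \<psi> (x - s *\<^sub>R ?h) * (P x \<bullet> ?h))"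
      using MVT2[of 0 1 ?G "\<lambda>s. LINT x|lebesgue. \<psi> (x - s *\<^sub>R ?h) * (P x \<bullet> ?h)"] DERIV_integral_shifted_test_fun[OF NP psi'] by auto
    have sh: "0 \<le> (s *\<^sub>R ?h) $ j" "(s *\<^sub>R ?h) $ j \<le> 1" for j using s by (auto simp: axis_def)
    have "?G 1 = ?G 0"
    proof -
      have "(\<lambda>x. N x * \<psi> (x + - ?h)) \<in> borel_measurable lebesgue"
        using N by (intro borel_measurable_times measurable_translate[OF psim]) (simp add: per_L2_def)
      from integral_translate[OF this, of ?h] show ?thesis using N by (simp add: per_L2_def periodic_def)
    qed
    then have "0 = (LINT x|lebesgue. \<psi> (x - s *\<^sub>R ?h) * (P x \<bullet> ?h))" using s(3) by simp
    also have "\<dots> = (LINT x|lebesgue. \<psi> x * (P (x + s *\<^sub>R ?h) \<bullet> ?h))"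
    proof -
      have "(\<lambda>x. \<psi> (x + - (s *\<^sub>R ?h)) * (P x \<bullet> ?h)) \<in> borel_measurable lebesgue"
        using P by (intro borel_measurable_times measurable_translate[OF psim] borel_measurable_inner borel_measurable_const) (simp add: per_L2_def)
      from integral_translate[OF this, of "s *\<^sub>R ?h"] show ?thesis by simp
    qed
    also have "\<dots> = cell_L2 (\<lambda>x. P (x + s *\<^sub>R ?h)) \<bullet> to_L2 (\<lambda>x. \<psi> x *\<^sub>R ?h)"
      by (rule cell_L2_inner_test_fun[OF per_L2_shift(1)[OF P sh] psi, symmetric])
    also have "cell_L2 (\<lambda>x. P (x + s *\<^sub>R ?h)) = - cell_L2 (\<lambda>_. \<eta>)"
    proof -
      have "norm (cell_L2 (\<lambda>x. \<eta> + P (x + s *\<^sub>R ?h))) = 0" using per_L2_shift(2)[OF eP(1) sh] eP(2) by simp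
      then have "cell_L2 (\<lambda>_. \<eta>) + cell_L2 (\<lambda>x. P (x + s *\<^sub>R ?h)) = 0"
        using per_L2_add(2)[OF per_L2_const per_L2_shift(1)[OF P sh], of \<eta>] by simp
      then show ?thesis by (simp add: add_eq_0_iff)
    qed
    also have "- cell_L2 (\<lambda>_. \<eta>) \<bullet> to_L2 (\<lambda>x. \<psi> x *\<^sub>R ?h) = - ((LINT x|lebesgue. \<psi> x) * \<eta> $ i)"
      using cell_L2_inner_test_fun[OF per_L2_const psi, of \<eta> ?h] by (simp add: inner_axis)
    finally show ?thesis by simp
  qed
  have "cell_L2 (\<lambda>_. \<eta>) = 0"
  proof (rule test_fun_total[OF open_box cell_L2_on[OF per_L2_const]])
    fix \<psi> e assume psi: "test_fun (box 0 (One :: real^3)) \<psi>"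
    have "cell_L2 (\<lambda>_. \<eta>) \<bullet> to_L2 (\<lambda>x. \<psi> x *\<^sub>R e) = (LINT x|lebesgue. \<psi> x) * (\<eta> \<bullet> e)"
      using cell_L2_inner_test_fun[OF per_L2_const psi, of \<eta> e] by simp
    also have "\<dots> = (\<Sum>i\<in>UNIV. ((LINT x|lebesgue. \<psi> x) * \<eta> $ i) * e $ i)"
      by (simp add: inner_vec_def sum_distrib_left mult.assoc)
    also have "\<dots> = 0" by (simp add: comp[OF psi])
    finally show "cell_L2 (\<lambda>_. \<eta>) \<bullet> to_L2 (\<lambda>x. \<psi> x *\<^sub>R e) = 0" .
  qed
  then have "measure lborel unit_cell * (\<eta> \<bullet> \<eta>) = 0" using inner_cell_L2_const[of \<eta> \<eta>] by simp
  then show ?thesis using measure_unit_cell_pos by simp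
qed

text \<open>Positive definiteness: the quadratic form at \<open>\<eta>\<close> is the energy of \<open>\<eta> + \<nabla>N\<close> for a periodic \<open>N\<close>, which
  does not vanish if \<open>\<eta> \<noteq> 0\<close>; the lower bound follows by compactness of the unit sphere.\<close>

lemma elliptic_hom_coeff:
  assumes a: "elliptic_coeff \<nu> \<Lambda> a" shows "\<exists>\<nu>' \<Lambda>'. elliptic_coeff \<nu>' \<Lambda>' (hom_coeff a)"
proof -
  interpret A: bounded_linear "coeff_op a" by (rule coeff_op_bounded_linear[OF a])
  obtain N P where h: "\<And>j::3. H1_per (N j) (P j)"
    and B: "\<And>i j. hom_matrix a $ i $ j = coeff_op a (cell_L2 (\<lambda>_. axis j 1) + cell_L2 (P j)) \<bullet> (cell_L2 (\<lambda>_. axis i 1) + cell_L2 (P i))"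
    using hom_matrix_entries[OF a] by blast
  define z where "z j = cell_L2 (\<lambda>_. axis j 1) + cell_L2 (P j)" for j
  have nu: "\<nu> > 0" using a by (simp add: elliptic_coeff_def)
  have sym: "hom_matrix a $ i $ j = hom_matrix a $ j $ i" for i j
    unfolding B by (rule coeff_op_sym[OF a])
  let ?q = "\<lambda>\<eta>. (hom_matrix a *v \<eta>) \<bullet> \<eta>"
  have q: "?q \<eta> = coeff_op a (\<Sum>j\<in>UNIV. (\<eta> $ j) *\<^sub>R z j) \<bullet> (\<Sum>j\<in>UNIV. (\<eta> $ j) *\<^sub>R z j)" for \<eta>
    by (simp add: A.sum A.scaleR inner_sum_left inner_sum_right inner_vec_def matrix_vector_mult_def sum_distrib_left sum_distrib_right B z_def[symmetric] mult_ac)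
  have pos: "?q \<eta> > 0" if "\<eta> \<noteq> 0" for \<eta>
  proof -
    define N' where "N' x = \<eta> $ 1 * N 1 x + (\<eta> $ 2 * N 2 x + \<eta> $ 3 * N 3 x)" for x
    define P' where "P' x = (\<eta> $ 1) *\<^sub>R P 1 x + ((\<eta> $ 2) *\<^sub>R P 2 x + (\<eta> $ 3) *\<^sub>R P 3 x)" for x
    have NP': "H1_per N' P'" unfolding N'_def[abs_def] P'_def[abs_def] by (intro H1_per_add H1_per_scale h)
    have p: "per_L2 (P j)" for j using h[of j] by (simp add: H1_per_iff)
    have ps: "per_L2 (\<lambda>x. c *\<^sub>R P j x)" for c j using p by (rule per_L2_scaleR)
    have cP: "cell_L2 P' = (\<Sum>j\<in>UNIV. (\<eta> $ j) *\<^sub>R cell_L2 (P j))"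
      unfolding P'_def[abs_def] sum_3
      by (simp add: per_L2_add(2)[OF ps per_L2_add(1)[OF ps ps]] per_L2_add(2)[OF ps ps] per_L2_scaleR(2)[OF p])
    have cE: "cell_L2 (\<lambda>_. \<eta>) = (\<Sum>j\<in>UNIV. (\<eta> $ j) *\<^sub>R cell_L2 (\<lambda>_. axis j 1))"
    proof -
      have "\<eta> = (\<eta> $ 1) *\<^sub>R axis 1 1 + ((\<eta> $ 2) *\<^sub>R axis 2 1 + (\<eta> $ 3) *\<^sub>R axis 3 1)"
        by (simp add: vec_eq_iff forall_3 axis_def)
      then have "cell_L2 (\<lambda>_. \<eta>) = cell_L2 (\<lambda>_::real^3. (\<eta> $ 1) *\<^sub>R axis 1 1 + ((\<eta> $ 2) *\<^sub>R axis 2 1 + (\<eta> $ 3) *\<^sub>R axis 3 (1::real)))" by simp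
      then show ?thesis
        unfolding sum_3 by (simp only: per_L2_add(2)[OF per_L2_const per_L2_const] per_L2_scaleR(2)[OF per_L2_const] add.assoc)
    qed
    have "(\<Sum>j\<in>UNIV. (\<eta> $ j) *\<^sub>R z j) = cell_L2 (\<lambda>_. \<eta>) + cell_L2 P'"
      unfolding cE cP z_def by (simp add: scaleR_right_distrib sum.distrib)
    moreover have "cell_L2 (\<lambda>_. \<eta>) + cell_L2 P' \<noteq> 0" using periodic_gradient_not_constant[OF NP'] that by blast
    ultimately have "0 < \<nu> * (norm (\<Sum>j\<in>UNIV. (\<eta> $ j) *\<^sub>R z j))\<^sup>2" using nu by simp
    also have "\<dots> \<le> ?q \<eta>" unfolding q by (rule coeff_op_coercive[OF a])
    finally show ?thesis .
  qed
  have "compact (sphere (0::real^3) 1)" by (rule compact_sphere)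
  moreover have "(axis 1 1 :: real^3) \<in> sphere 0 1" by (simp add: norm_axis_1)
  moreover have "continuous_on (sphere 0 1) ?q"
    by (intro continuous_on_inner continuous_on_id linear_continuous_on bounded_linear.linear matrix_vector_mul_bounded_linear)
  ultimately obtain \<eta>0 where e0: "\<eta>0 \<in> sphere 0 1" "\<And>\<eta>. \<eta> \<in> sphere 0 1 \<Longrightarrow> ?q \<eta>0 \<le> ?q \<eta>"
    using continuous_attains_inf[of "sphere 0 1" ?q] by blast
  have m: "?q \<eta>0 > 0" using e0(1) by (intro pos) auto
  have lower: "?q \<eta>0 * (norm \<eta>)\<^sup>2 \<le> ?q \<eta>" for \<eta>
  proof (cases "\<eta> = 0")
    case False
    let ?u = "(1 / norm \<eta>) *\<^sub>R \<eta>"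
    have "?u \<in> sphere 0 1" using False by simp
    then have "?q \<eta>0 \<le> ?q ?u" by (rule e0(2))
    also have "?q ?u = ?q \<eta> / (norm \<eta>)\<^sup>2" by (simp add: matrix_vector_mult_scaleR power2_eq_square)
    finally show ?thesis using False by (simp add: field_simps)
  qed simp
  obtain L where L: "\<And>\<eta>. norm (hom_matrix a *v \<eta>) \<le> norm \<eta> * L"
    using bounded_linear.bounded[OF matrix_vector_mul_bounded_linear[of "hom_matrix a"]] by blast
  have "norm (hom_matrix a *v \<eta>) \<le> max 0 L * norm \<eta>" for \<eta>
    using L[of \<eta>] mult_right_mono[of L "max 0 L" "norm \<eta>"] by (simp add: mult.commute)
  then have "elliptic_coeff (?q \<eta>0) (max 0 L) (hom_coeff a)"
    unfolding elliptic_coeff_def hom_coeff_def using m lower sym by simp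
  then show ?thesis by blast
qed

section \<open>The nonlinearity\<close>

lemma nonlinearity_derivs:
  assumes "admissible_nonlinearity K1 K2 K3 f"
  shows "(f has_real_derivative deriv f s) (at s)" "(deriv f has_real_derivative deriv (deriv f) s) (at s)"
proof -
  have C2: "Ck_on (Suc (Suc 0)) f UNIV" using assms by (simp add: admissible_nonlinearity_def numeral_2_eq_2)
  have D: "(\<phi> has_real_derivative deriv \<phi> x) (at x)" if "\<phi> differentiable (at x)" for \<phi> :: "real \<Rightarrow> real" and x
    using that by (simp add: DERIV_deriv_iff_real_differentiable)
  have fr: "frechet_derivative \<phi> (at x) 1 = deriv \<phi> x" if "\<phi> differentiable (at x)" for \<phi> :: "real \<Rightarrow> real" and x
    using frechet_derivative_at[OF D[OF that, unfolded has_field_derivative_def]] by (metis mult.right_neutral)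
  have d1: "f differentiable (at x)" for x using C2 by simp
  show "(f has_real_derivative deriv f s) (at s)" by (rule D[OF d1])
  have "(\<lambda>x. frechet_derivative f (at x) 1) = deriv f" using fr[OF d1] by auto
  then have "deriv f differentiable (at x)" for x using C2 by simp
  then show "(deriv f has_real_derivative deriv (deriv f) s) (at s)" by (rule D)
qed

lemma abs_le_1_plus_square: "\<bar>s\<bar> \<le> 1 + s\<^sup>2" for s :: real
  using sum_squares_bound[of 1 "\<bar>s\<bar>"] by simp

text \<open>The mean value inequality for \<open>deriv f\<close>; the bound is put in the form that matches the Sobolev exponent.\<close>

lemma nonlinearity_derivative_growth:
  assumes adm: "admissible_nonlinearity K1 K2 K3 f"
  shows "\<bar>deriv f s\<bar> \<le> (\<bar>deriv f 0\<bar> + 2 * K3) * (1 + s\<^sup>2)"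
proof -
  have K3: "0 < K3" and d2: "\<And>t. \<bar>deriv (deriv f) t\<bar> \<le> K3 * (1 + \<bar>t\<bar>)" using adm by (auto simp: admissible_nonlinearity_def)
  have "norm (deriv f s - deriv f 0) \<le> K3 * (1 + \<bar>s\<bar>) * norm (s - 0)"
  proof (rule field_differentiable_bound[of "{-\<bar>s\<bar>..\<bar>s\<bar>}" "deriv f" "deriv (deriv f)"])
    fix z assume z: "z \<in> {-\<bar>s\<bar>..\<bar>s\<bar>}"
    show "(deriv f has_field_derivative deriv (deriv f) z) (at z within {-\<bar>s\<bar>..\<bar>s\<bar>})"
      using nonlinearity_derivs(2)[OF adm] by (rule has_field_derivative_at_within)
    have "\<bar>z\<bar> \<le> \<bar>s\<bar>" using z by (auto simp: abs_le_iff)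
    then have "K3 * (1 + \<bar>z\<bar>) \<le> K3 * (1 + \<bar>s\<bar>)" using K3 by simp
    then show "norm (deriv (deriv f) z) \<le> K3 * (1 + \<bar>s\<bar>)" using d2[of z] by simp
  qed auto
  then have "\<bar>deriv f s\<bar> \<le> \<bar>deriv f 0\<bar> + K3 * ((1 + \<bar>s\<bar>) * \<bar>s\<bar>)" by (simp add: mult.assoc)
  also have "K3 * ((1 + \<bar>s\<bar>) * \<bar>s\<bar>) \<le> K3 * (2 * (1 + s\<^sup>2))"
  proof (rule mult_left_mono)
    have "(1 + \<bar>s\<bar>) * \<bar>s\<bar> = \<bar>s\<bar> + s\<^sup>2" by (simp add: distrib_right power2_eq_square)
    then show "(1 + \<bar>s\<bar>) * \<bar>s\<bar> \<le> 2 * (1 + s\<^sup>2)" using abs_le_1_plus_square[of s] by simp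
  qed (use K3 in simp)
  also have "\<bar>deriv f 0\<bar> + K3 * (2 * (1 + s\<^sup>2)) \<le> (\<bar>deriv f 0\<bar> + 2 * K3) * (1 + s\<^sup>2)"
    by (simp add: algebra_simps)
  finally show ?thesis by simp
qed

lemma nonlinearity_Lipschitz:
  assumes adm: "admissible_nonlinearity K1 K2 K3 f"
  shows "\<bar>f s - f r\<bar> \<le> (\<bar>deriv f 0\<bar> + 2 * K3) * (1 + s\<^sup>2 + r\<^sup>2) * \<bar>s - r\<bar>"
proof -
  define M where "M = max \<bar>s\<bar> \<bar>r\<bar>"
  have K3: "0 < K3" using adm by (simp add: admissible_nonlinearity_def)
  have "norm (f s - f r) \<le> (\<bar>deriv f 0\<bar> + 2 * K3) * (1 + s\<^sup>2 + r\<^sup>2) * norm (s - r)"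
  proof (rule field_differentiable_bound[of "{-M..M}" f "deriv f"])
    fix z assume z: "z \<in> {-M..M}"
    show "(f has_field_derivative deriv f z) (at z within {-M..M})"
      using nonlinearity_derivs(1)[OF adm] by (rule has_field_derivative_at_within)
    have "\<bar>z\<bar> \<le> M" using z by (auto simp: abs_le_iff)
    then have "\<bar>z\<bar> \<le> \<bar>s\<bar> \<or> \<bar>z\<bar> \<le> \<bar>r\<bar>" by (auto simp: M_def)
    then have "z\<^sup>2 \<le> s\<^sup>2 \<or> z\<^sup>2 \<le> r\<^sup>2" by (simp add: abs_le_square_iff)
    then have "1 + z\<^sup>2 \<le> 1 + s\<^sup>2 + r\<^sup>2" using zero_le_power2[of s] zero_le_power2[of r] by linarith
    then have "(\<bar>deriv f 0\<bar> + 2 * K3) * (1 + z\<^sup>2) \<le> (\<bar>deriv f 0\<bar> + 2 * K3) * (1 + s\<^sup>2 + r\<^sup>2)"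
      using K3 by (intro mult_left_mono) auto
    then show "norm (deriv f z) \<le> (\<bar>deriv f 0\<bar> + 2 * K3) * (1 + s\<^sup>2 + r\<^sup>2)"
      using nonlinearity_derivative_growth[OF adm, of z] by simp
  qed (auto simp: M_def abs_le_iff)
  then show ?thesis by simp
qed

text \<open>The bound on the remainder of the first order expansion holds because the derivative of
  \<open>F t - f r * t\<close> is \<open>f t - f r\<close>.\<close>

lemma nonlinearity_primitive:
  assumes adm: "admissible_nonlinearity K1 K2 K3 f"
  shows "\<exists>F. F 0 = 0 \<and> (\<forall>s. (F has_real_derivative f s) (at s)) \<and>
    (\<forall>s r. \<bar>F s - F r - f r * (s - r)\<bar> \<le> 2 * (\<bar>deriv f 0\<bar> + 2 * K3) * (1 + s\<^sup>2 + r\<^sup>2) * (s - r)\<^sup>2)"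
proof -
  let ?C = "\<bar>deriv f 0\<bar> + 2 * K3"
  have C: "0 \<le> ?C" using adm by (simp add: admissible_nonlinearity_def)
  have "isCont f x" for x using nonlinearity_derivs(1)[OF adm] by (rule DERIV_isCont)
  then have "\<exists>F. \<forall>x::real. -\<infinity> < ereal x \<longrightarrow> ereal x < \<infinity> \<longrightarrow> (F has_vector_derivative f x) (at x)"
    by (intro einterval_antiderivative) auto
  then obtain G where G: "\<And>x. (G has_real_derivative f x) (at x)" by (auto simp: has_real_derivative_iff_has_vector_derivative)
  define F where "F x = G x - G 0" for x
  have F: "(F has_real_derivative f x) (at x)" for x
    unfolding F_def[abs_def] using DERIV_diff[OF G DERIV_const] by simp
  have "\<bar>F s - F r - f r * (s - r)\<bar> \<le> 2 * ?C * (1 + s\<^sup>2 + r\<^sup>2) * (s - r)\<^sup>2" for s r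
  proof -
    have "norm ((F s - f r * s) - (F r - f r * r)) \<le> 2 * ?C * (1 + s\<^sup>2 + r\<^sup>2) * \<bar>s - r\<bar> * norm (s - r)"
    proof (rule field_differentiable_bound[of "closed_segment r s" "\<lambda>t. F t - f r * t" "\<lambda>t. f t - f r"])
      fix t assume t: "t \<in> closed_segment r s"
      show "((\<lambda>t. F t - f r * t) has_field_derivative f t - f r) (at t within closed_segment r s)"
        by (rule has_field_derivative_at_within) (auto intro!: derivative_eq_intros F)
      have tr: "\<bar>t - r\<bar> \<le> \<bar>s - r\<bar>" "\<bar>t\<bar> \<le> \<bar>s\<bar> \<or> \<bar>t\<bar> \<le> \<bar>r\<bar>"
        using t by (auto simp: closed_segment_eq_real_ivl split: if_splits)
      then have "t\<^sup>2 \<le> s\<^sup>2 \<or> t\<^sup>2 \<le> r\<^sup>2" by (simp add: abs_le_square_iff)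
      then have "1 + t\<^sup>2 + r\<^sup>2 \<le> 2 * (1 + s\<^sup>2 + r\<^sup>2)" using zero_le_power2[of s] zero_le_power2[of r] unfolding distrib_left by linarith
      then have "?C * (1 + t\<^sup>2 + r\<^sup>2) * \<bar>t - r\<bar> \<le> ?C * (2 * (1 + s\<^sup>2 + r\<^sup>2)) * \<bar>s - r\<bar>"
        using C tr(1) by (intro mult_mono mult_left_mono) auto
      moreover have "?C * (2 * (1 + s\<^sup>2 + r\<^sup>2)) = 2 * ?C * (1 + s\<^sup>2 + r\<^sup>2)" by (simp only: mult.assoc mult.left_commute)
      ultimately have "?C * (1 + t\<^sup>2 + r\<^sup>2) * \<bar>t - r\<bar> \<le> 2 * ?C * (1 + s\<^sup>2 + r\<^sup>2) * \<bar>s - r\<bar>" by (simp only:)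
      from order_trans[OF nonlinearity_Lipschitz[OF adm, of t r] this]
      show "norm (f t - f r) \<le> 2 * ?C * (1 + s\<^sup>2 + r\<^sup>2) * \<bar>s - r\<bar>" by (simp only: real_norm_def)
    qed auto
    moreover have "norm ((F s - f r * s) - (F r - f r * r)) = \<bar>F s - F r - f r * (s - r)\<bar>"
      unfolding real_norm_def right_diff_distrib by (rule arg_cong[where f = abs]) linarith
    moreover have "\<bar>s - r\<bar> * norm (s - r) = (s - r)\<^sup>2" by (simp add: power2_eq_square)
    ultimately show ?thesis by (simp only: mult.assoc)
  qed
  then show ?thesis using F by (intro exI[of _ F]) (auto simp: F_def)
qed

text \<open>The bound \<open>a\<^sup>4 b\<^sup>2 \<le> a\<^sup>6 + b\<^sup>6\<close> reduces products to the sixth powers that the Sobolev inequality controls.\<close>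

lemma cubic_pointwise: "((1 + u\<^sup>2 + w\<^sup>2) * e)\<^sup>2 \<le> 3 * (e\<^sup>2 + u ^ 6 + w ^ 6 + 2 * e ^ 6)" for u w e :: real
proof -
  have AB: "A\<^sup>2 * B \<le> A ^ 3 + B ^ 3" if "A \<ge> 0" "B \<ge> 0" for A B :: real
  proof (cases "B \<le> A")
    case True
    then have "A\<^sup>2 * B \<le> A\<^sup>2 * A" by (intro mult_left_mono) auto
    then show ?thesis using that by (simp add: power2_eq_square power3_eq_cube add_increasing2)
  next
    case False
    then have "A\<^sup>2 * B \<le> B\<^sup>2 * B" using that by (intro mult_right_mono power_mono) auto
    then show ?thesis using that by (simp add: power2_eq_square power3_eq_cube add_increasing)
  qed
  have "(1 + u\<^sup>2 + w\<^sup>2)\<^sup>2 \<le> 3 * (1 + (u\<^sup>2)\<^sup>2 + (w\<^sup>2)\<^sup>2)"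
  proof -
    have "0 \<le> (1 - u\<^sup>2)\<^sup>2 + (1 - w\<^sup>2)\<^sup>2 + (u\<^sup>2 - w\<^sup>2)\<^sup>2" by simp
    then show ?thesis by (simp add: power2_eq_square algebra_simps)
  qed
  then have "((1 + u\<^sup>2 + w\<^sup>2) * e)\<^sup>2 \<le> 3 * (1 + (u\<^sup>2)\<^sup>2 + (w\<^sup>2)\<^sup>2) * e\<^sup>2"
    unfolding power_mult_distrib by (rule mult_right_mono) simp
  also have "\<dots> = 3 * (e\<^sup>2 + (u\<^sup>2)\<^sup>2 * e\<^sup>2 + (w\<^sup>2)\<^sup>2 * e\<^sup>2)" by (simp add: algebra_simps)
  also have "\<dots> \<le> 3 * (e\<^sup>2 + ((u\<^sup>2) ^ 3 + (e\<^sup>2) ^ 3) + ((w\<^sup>2) ^ 3 + (e\<^sup>2) ^ 3))"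
    using AB[of "u\<^sup>2" "e\<^sup>2"] AB[of "w\<^sup>2" "e\<^sup>2"] by simp
  finally show ?thesis by (simp add: power_mult[symmetric])
qed

context bounded_domain begin

text \<open>The Lipschitz constant, up to the factor \<open>growth\<close>, of a nonlinearity of cubic growth from the ball of
  radius \<open>r\<close> in \<open>H\<^sup>1\<^sub>0\<close> to \<open>L\<^sup>2\<close>; \<open>4096\<close> is the constant of the Sobolev inequality.\<close>

definition "cubic_const r = sqrt (3 * (pc\<^sup>2 + 4096 * (2 * r ^ 6 + 2)))"

definition cubic_mult :: "real L2 \<Rightarrow> real L2 \<Rightarrow> real L2 \<Rightarrow> real^3 \<Rightarrow> real" where
  "cubic_mult u w d x = (1 + (rep_L2 u x)\<^sup>2 + (rep_L2 w x)\<^sup>2) * rep_L2 d x"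

text \<open>The bound is homogeneous in \<open>d\<close>, so \<open>d\<close> may be normalised; then \<open>cubic_pointwise\<close> integrates to the
  constant.\<close>

lemma cubic_mult_bound:
  assumes u: "u \<in> H10 \<Omega>" "norm (grad \<Omega> u) \<le> r" and w: "w \<in> H10 \<Omega>" "norm (grad \<Omega> w) \<le> r" and d: "d \<in> H10 \<Omega>"
  shows "sq_integrable (cubic_mult u w d)" "norm (to_L2 (cubic_mult u w d)) \<le> cubic_const r * norm (grad \<Omega> d)"
proof -
  have m [measurable]: "cubic_mult u w d \<in> borel_measurable lebesgue" unfolding cubic_mult_def[abs_def] by measurable
  have c0: "0 \<le> 3 * (pc\<^sup>2 + 4096 * (2 * r ^ 6 + 2))" by simp
  have "integrable lebesgue (\<lambda>x. (cubic_mult u w d x)\<^sup>2) \<and> (LINT x|lebesgue. (cubic_mult u w d x)\<^sup>2) \<le> (cubic_const r * norm (grad \<Omega> d))\<^sup>2"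
  proof (cases "grad \<Omega> d = 0")
    case True
    then have "d = 0" using poincare[OF d] by simp
    then have "AE x in lebesgue. (cubic_mult u w d x)\<^sup>2 = 0"
      using rep_zero[where 'b = real] by (auto simp: cubic_mult_def elim!: eventually_mono)
    moreover have "(\<lambda>x. (cubic_mult u w d x)\<^sup>2) \<in> borel_measurable lebesgue" by measurable
    ultimately show ?thesis
      using integrable_cong_AE[of "\<lambda>x. (cubic_mult u w d x)\<^sup>2" lebesgue "\<lambda>_. 0"] integral_cong_AE[of "\<lambda>x. (cubic_mult u w d x)\<^sup>2" lebesgue "\<lambda>_. 0"] by simp
  next
    case False
    define \<theta> where "\<theta> = norm (grad \<Omega> d)"
    have th: "\<theta> > 0" using False by (simp add: \<theta>_def)
    define e where "e = (1 / \<theta>) *\<^sub>R d"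
    have e: "e \<in> H10 \<Omega>" "norm (grad \<Omega> e) = 1" using d th by (auto simp: e_def H10_scaleR grad_scaleR \<theta>_def)
    define g where "g x = 3 * ((rep_L2 e x)\<^sup>2 + rep_L2 u x ^ 6 + rep_L2 w x ^ 6 + 2 * rep_L2 e x ^ 6)" for x
    have ie: "integrable lebesgue (\<lambda>x. (rep_L2 e x)\<^sup>2)" using integrable_norm_rep[of e] by simp
    note i6 = sobolev(1)[OF u(1)] sobolev(1)[OF w(1)] sobolev(1)[OF e(1)]
    have ig: "integrable lebesgue g" unfolding g_def[abs_def] using ie i6 by simp
    have le: "AE x in lebesgue. (cubic_mult u w d x)\<^sup>2 \<le> \<theta>\<^sup>2 * g x"
      using rep_scaleR[of "1 / \<theta>" d]
    proof eventually_elim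
      case (elim x)
      have "rep_L2 d x = \<theta> * rep_L2 e x" using elim th by (simp add: e_def)
      then have "(cubic_mult u w d x)\<^sup>2 = \<theta>\<^sup>2 * ((1 + (rep_L2 u x)\<^sup>2 + (rep_L2 w x)\<^sup>2) * rep_L2 e x)\<^sup>2"
        by (simp add: cubic_mult_def power_mult_distrib)
      also have "\<dots> \<le> \<theta>\<^sup>2 * g x" unfolding g_def by (intro mult_left_mono cubic_pointwise) simp
      finally show ?case .
    qed
    have int: "integrable lebesgue (\<lambda>x. (cubic_mult u w d x)\<^sup>2)"
    proof (rule Bochner_Integration.integrable_bound)
      show "integrable lebesgue (\<lambda>x. \<theta>\<^sup>2 * g x)" using ig by simp
      show "AE x in lebesgue. norm ((cubic_mult u w d x)\<^sup>2) \<le> norm (\<theta>\<^sup>2 * g x)"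
        using le by eventually_elim simp
    qed measurable
    have "(LINT x|lebesgue. (cubic_mult u w d x)\<^sup>2) \<le> (LINT x|lebesgue. \<theta>\<^sup>2 * g x)"
      using int ig le by (intro integral_mono_AE) auto
    also have "\<dots> = \<theta>\<^sup>2 * (3 * ((LINT x|lebesgue. (rep_L2 e x)\<^sup>2) + (LINT x|lebesgue. rep_L2 u x ^ 6) + (LINT x|lebesgue. rep_L2 w x ^ 6) + 2 * (LINT x|lebesgue. rep_L2 e x ^ 6)))"
      unfolding g_def using ie i6 by simp
    also have "\<dots> \<le> \<theta>\<^sup>2 * (3 * (pc\<^sup>2 + 4096 * r ^ 6 + 4096 * r ^ 6 + 2 * 4096))"
    proof (intro mult_left_mono add_mono)
      have "norm e \<le> pc" using poincare[OF e(1)] e(2) by simp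
      then have "(norm e)\<^sup>2 \<le> pc\<^sup>2" by (intro power_mono) auto
      then show "(LINT x|lebesgue. (rep_L2 e x)\<^sup>2) \<le> pc\<^sup>2" using norm_L2_rep[of e] by simp
      have "norm (grad \<Omega> u) ^ 6 \<le> r ^ 6" "norm (grad \<Omega> w) ^ 6 \<le> r ^ 6" using u(2) w(2) by (auto intro!: power_mono)
      then show "(LINT x|lebesgue. rep_L2 u x ^ 6) \<le> 4096 * r ^ 6" "(LINT x|lebesgue. rep_L2 w x ^ 6) \<le> 4096 * r ^ 6"
        using sobolev(2)[OF u(1)] sobolev(2)[OF w(1)] by linarith+
      show "(LINT x|lebesgue. rep_L2 e x ^ 6) \<le> 4096" using sobolev(2)[OF e(1)] e(2) by simp
    qed auto
    also have "\<dots> = (cubic_const r * \<theta>)\<^sup>2"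
      using c0 by (simp add: cubic_const_def power_mult_distrib algebra_simps)
    finally show ?thesis using int by (simp add: \<theta>_def)
  qed
  then have int: "integrable lebesgue (\<lambda>x. (cubic_mult u w d x)\<^sup>2)"
    and le: "(LINT x|lebesgue. (cubic_mult u w d x)\<^sup>2) \<le> (cubic_const r * norm (grad \<Omega> d))\<^sup>2" by auto
  show sq: "sq_integrable (cubic_mult u w d)" using int m by (simp add: sq_integrable_def)
  have "(norm (to_L2 (cubic_mult u w d)))\<^sup>2 \<le> (cubic_const r * norm (grad \<Omega> d))\<^sup>2"
    using le by (simp add: norm_to_L2[OF sq])
  then show "norm (to_L2 (cubic_mult u w d)) \<le> cubic_const r * norm (grad \<Omega> d)"
    by (rule power2_le_imp_le) (use c0 in \<open>simp add: cubic_const_def\<close>)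
qed

end

locale damped_wave = bounded_domain +
  fixes f :: "real \<Rightarrow> real" and K1 K2 K3 :: real
    and b :: "real^3 \<Rightarrow> real^3^3" and \<nu> \<Lambda> \<gamma> :: real
  assumes nonlinearity: "admissible_nonlinearity K1 K2 K3 f"
    and elliptic: "elliptic_coeff \<nu> \<Lambda> b" and damping: "\<gamma> > 0"
begin

definition "growth = \<bar>deriv f 0\<bar> + 2 * K3"

lemma growth_nonneg: "0 \<le> growth"
  using nonlinearity by (simp add: growth_def admissible_nonlinearity_def)

lemma f_zero: "f 0 = 0" using nonlinearity by (simp add: admissible_nonlinearity_def)

lemma f_borel: "(\<lambda>x. f (rep_L2 u x)) \<in> borel_measurable lebesgue"
proof -
  have "continuous_on UNIV f"
    using nonlinearity_derivs(1)[OF nonlinearity] by (intro continuous_at_imp_continuous_on) (auto intro: DERIV_isCont)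
  then have "f \<in> borel_measurable borel" by (rule borel_measurable_continuous_onI)
  from measurable_compose[OF measurable_rep this] show ?thesis .
qed

lemma sq_integrable_f:
  assumes u: "u \<in> H10 \<Omega>" shows "sq_integrable (\<lambda>x. f (rep_L2 u x))"
proof (rule sq_integrable_bound[OF cubic_mult_bound(1)[OF u order_refl H10_zero _ u] f_borel])
  show "norm (grad \<Omega> 0) \<le> norm (grad \<Omega> u)" by (simp add: grad_zero)
  show "AE x in lebesgue. norm (f (rep_L2 u x)) \<le> growth * norm (cubic_mult u 0 u x)"
    using rep_zero[where 'b = real]
  proof eventually_elim
    case (elim x)
    then show ?case using nonlinearity_Lipschitz[OF nonlinearity, of "rep_L2 u x" 0]
      by (simp add: f_zero cubic_mult_def growth_def abs_mult mult.assoc)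
  qed
qed

lemma superpose_Lipschitz:
  assumes u: "u \<in> H10 \<Omega>" "norm (grad \<Omega> u) \<le> r" and w: "w \<in> H10 \<Omega>" "norm (grad \<Omega> w) \<le> r"
  shows "norm (superpose f u - superpose f w) \<le> growth * (cubic_const r * norm (grad \<Omega> (u - w)))"
proof -
  have d: "u - w \<in> H10 \<Omega>" using u w by (intro H10_diff)
  note c = cubic_mult_bound[OF u w d]
  have "superpose f u - superpose f w = to_L2 (\<lambda>x. f (rep_L2 u x) - f (rep_L2 w x))"
    unfolding superpose_def by (rule to_L2_diff[symmetric]) (intro sq_integrable_f u w)+
  also have "norm \<dots> \<le> growth * norm (to_L2 (cubic_mult u w (u - w)))"
  proof (rule norm_to_L2_le[OF sq_integrable_diff[OF sq_integrable_f[OF u(1)] sq_integrable_f[OF w(1)]] _ growth_nonneg])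
    show "AE x in lebesgue. norm (f (rep_L2 u x) - f (rep_L2 w x)) \<le> growth * norm (rep_L2 (to_L2 (cubic_mult u w (u - w))) x)"
      using rep_to_L2[OF c(1)] rep_diff[of u w]
    proof eventually_elim
      case (elim x)
      then show ?case using nonlinearity_Lipschitz[OF nonlinearity, of "rep_L2 u x" "rep_L2 w x"]
        by (simp add: cubic_mult_def growth_def abs_mult mult.assoc)
    qed
  qed
  also have "\<dots> \<le> growth * (cubic_const r * norm (grad \<Omega> (u - w)))" using c(2) growth_nonneg by (intro mult_left_mono)
  finally show ?thesis .
qed

definition F :: "real \<Rightarrow> real" where
  "F = (SOME F. F 0 = 0 \<and> (\<forall>s. (F has_real_derivative f s) (at s)) \<and>
    (\<forall>s r. \<bar>F s - F r - f r * (s - r)\<bar> \<le> 2 * growth * (1 + s\<^sup>2 + r\<^sup>2) * (s - r)\<^sup>2))"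

lemma F: "F 0 = 0" "(F has_real_derivative f s) (at s)"
  "\<bar>F s - F r - f r * (s - r)\<bar> \<le> 2 * growth * (1 + s\<^sup>2 + r\<^sup>2) * (s - r)\<^sup>2"
  using someI_ex[OF nonlinearity_primitive[OF nonlinearity]] unfolding F_def growth_def by blast+

definition potential :: "real L2 \<Rightarrow> real" where "potential u = (LINT x|lebesgue. F (rep_L2 u x))"

lemma integrable_F:
  assumes u: "u \<in> H10 \<Omega>" shows "integrable lebesgue (\<lambda>x. F (rep_L2 u x))"
proof (rule Bochner_Integration.integrable_bound)
  have g: "norm (grad \<Omega> 0) \<le> norm (grad \<Omega> u)" by (simp add: grad_zero)
  show "integrable lebesgue (\<lambda>x. 2 * growth * (cubic_mult u 0 u x *\<^sub>R rep_L2 u x))"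
    by (intro integrable_mult_right integrable_scaleR_sq cubic_mult_bound(1)[OF u order_refl H10_zero g u] sq_integrable_rep)
  have "continuous_on UNIV F" using F(2) by (intro continuous_at_imp_continuous_on) (auto intro: DERIV_isCont)
  then have "F \<in> borel_measurable borel" by (rule borel_measurable_continuous_onI)
  from measurable_compose[OF measurable_rep this] show "(\<lambda>x. F (rep_L2 u x)) \<in> borel_measurable lebesgue" .
  show "AE x in lebesgue. norm (F (rep_L2 u x)) \<le> norm (2 * growth * (cubic_mult u 0 u x *\<^sub>R rep_L2 u x))"
    using rep_zero[where 'b = real]
  proof eventually_elim
    case (elim x)
    then show ?case using F(3)[of "rep_L2 u x" 0] growth_nonneg
      by (simp add: F(1) f_zero cubic_mult_def abs_mult mult.assoc power2_eq_square)
  qed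
qed

text \<open>The pointwise remainder is a cubic multiplier times \<open>u - w\<close>; the Cauchy-Schwarz inequality keeps one
  factor in \<open>H\<^sup>1\<^sub>0\<close> and leaves the other in \<open>L\<^sup>2\<close>.\<close>

lemma potential_expansion:
  assumes u: "u \<in> H10 \<Omega>" "norm (grad \<Omega> u) \<le> r" and w: "w \<in> H10 \<Omega>" "norm (grad \<Omega> w) \<le> r"
  shows "\<bar>potential u - potential w - superpose f w \<bullet> (u - w)\<bar> \<le> 2 * growth * (cubic_const r * norm (grad \<Omega> (u - w))) * norm (u - w)"
proof -
  have d: "u - w \<in> H10 \<Omega>" using u w by (intro H10_diff)
  note c = cubic_mult_bound[OF u w d]
  have i: "integrable lebesgue (\<lambda>x. F (rep_L2 u x))" "integrable lebesgue (\<lambda>x. F (rep_L2 w x))"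
    "integrable lebesgue (\<lambda>x. f (rep_L2 w x) * rep_L2 (u - w) x)"
    using integrable_F[OF u(1)] integrable_F[OF w(1)] integrable_scaleR_sq[OF sq_integrable_f[OF w(1)] sq_integrable_rep[of "u - w"]] by auto
  have s: "superpose f w \<bullet> (u - w) = (LINT x|lebesgue. f (rep_L2 w x) * rep_L2 (u - w) x)"
    unfolding superpose_def by (subst inner_to_L2_left[OF sq_integrable_f[OF w(1)]]) simp
  have "\<bar>potential u - potential w - superpose f w \<bullet> (u - w)\<bar>
      = norm (LINT x|lebesgue. F (rep_L2 u x) - F (rep_L2 w x) - f (rep_L2 w x) * rep_L2 (u - w) x)"
    unfolding potential_def s using i by simp
  also have "\<dots> \<le> (LINT x|lebesgue. norm (F (rep_L2 u x) - F (rep_L2 w x) - f (rep_L2 w x) * rep_L2 (u - w) x))"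
    by (rule integral_norm_bound)
  also have "\<dots> \<le> (LINT x|lebesgue. 2 * growth * (norm (cubic_mult u w (u - w) x) * norm (rep_L2 (u - w) x)))"
  proof (rule integral_mono_AE)
    show "integrable lebesgue (\<lambda>x. norm (F (rep_L2 u x) - F (rep_L2 w x) - f (rep_L2 w x) * rep_L2 (u - w) x))"
      using i by (intro integrable_norm Bochner_Integration.integrable_diff)
    have "integrable lebesgue (\<lambda>x. norm (cubic_mult u w (u - w) x *\<^sub>R rep_L2 (u - w) x))"
      by (intro integrable_norm integrable_scaleR_sq c(1) sq_integrable_rep)
    then show "integrable lebesgue (\<lambda>x. 2 * growth * (norm (cubic_mult u w (u - w) x) * norm (rep_L2 (u - w) x)))"
      by (intro integrable_mult_right) (simp add: abs_mult)
    show "AE x in lebesgue. norm (F (rep_L2 u x) - F (rep_L2 w x) - f (rep_L2 w x) * rep_L2 (u - w) x)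
        \<le> 2 * growth * (norm (cubic_mult u w (u - w) x) * norm (rep_L2 (u - w) x))"
      using rep_diff[of u w]
    proof eventually_elim
      case (elim x)
      then show ?case using F(3)[of "rep_L2 u x" "rep_L2 w x"]
        by (simp add: cubic_mult_def abs_mult mult.assoc power2_eq_square)
    qed
  qed
  also have "\<dots> = 2 * growth * (to_L2 (\<lambda>x. norm (cubic_mult u w (u - w) x)) \<bullet> to_L2 (\<lambda>x. norm (rep_L2 (u - w) x)))"
  proof -
    have n: "sq_integrable (\<lambda>x. norm (cubic_mult u w (u - w) x))" "sq_integrable (\<lambda>x. norm (rep_L2 (u - w) x))"
      using c(1) sq_integrable_rep[of "u - w"] by (auto simp: sq_integrable_def)
    show ?thesis unfolding inner_to_L2[OF n] inner_real_def by (rule integral_mult_right_zero)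
  qed
  also have "\<dots> \<le> 2 * growth * (norm (to_L2 (cubic_mult u w (u - w))) * norm (u - w))"
  proof (rule mult_left_mono)
    have n: "sq_integrable (\<lambda>x. norm (cubic_mult u w (u - w) x))" "sq_integrable (\<lambda>x. norm (rep_L2 (u - w) x))"
      using c(1) sq_integrable_rep[of "u - w"] by (auto simp: sq_integrable_def)
    have "(norm (to_L2 (\<lambda>x. norm (cubic_mult u w (u - w) x))))\<^sup>2 = (norm (to_L2 (cubic_mult u w (u - w))))\<^sup>2"
      "(norm (to_L2 (\<lambda>x. norm (rep_L2 (u - w) x))))\<^sup>2 = (norm (u - w))\<^sup>2"
      using norm_to_L2[OF n(1)] norm_to_L2[OF n(2)] norm_to_L2[OF c(1)] norm_L2_rep[of "u - w"]
      by (simp_all only: real_norm_def abs_idempotent power2_abs)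
    then have "norm (to_L2 (\<lambda>x. norm (cubic_mult u w (u - w) x))) = norm (to_L2 (cubic_mult u w (u - w)))"
      "norm (to_L2 (\<lambda>x. norm (rep_L2 (u - w) x))) = norm (u - w)" by simp_all
    then show "to_L2 (\<lambda>x. norm (cubic_mult u w (u - w) x)) \<bullet> to_L2 (\<lambda>x. norm (rep_L2 (u - w) x)) \<le> norm (to_L2 (cubic_mult u w (u - w))) * norm (u - w)"
      using norm_cauchy_schwarz[of "to_L2 (\<lambda>x. norm (cubic_mult u w (u - w) x))" "to_L2 (\<lambda>x. norm (rep_L2 (u - w) x))"] by simp
  qed (use growth_nonneg in simp)
  also have "\<dots> \<le> 2 * growth * (cubic_const r * norm (grad \<Omega> (u - w))) * norm (u - w)"
    using c(2) growth_nonneg unfolding mult.assoc[of "2 * growth"] by (intro mult_left_mono mult_right_mono) auto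
  finally show ?thesis .
qed

lemma superpose_inner_ge:
  assumes u: "u \<in> H10 \<Omega>" shows "- K1 * measure lebesgue \<Omega> \<le> superpose f u \<bullet> u"
proof -
  have iO: "integrable lebesgue (indicator \<Omega> :: real^3 \<Rightarrow> real)"
    using emeasure_domain_finite domain_sets by (intro integrable_real_indicator) auto
  have "- K1 * measure lebesgue \<Omega> = (LINT x|lebesgue. - K1 * indicator \<Omega> x)" using domain_sets by simp
  also have "\<dots> \<le> (LINT x|lebesgue. f (rep_L2 u x) * rep_L2 u x)"
  proof (rule integral_mono_AE)
    show "integrable lebesgue (\<lambda>x. f (rep_L2 u x) * rep_L2 u x)"
      using integrable_scaleR_sq[OF sq_integrable_f[OF u] sq_integrable_rep[of u]] by simp
    have "AE x in lebesgue. x \<notin> \<Omega> \<longrightarrow> rep_L2 u x = 0" using H10_L2_on[OF u] by (simp add: L2_on_def)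
    then show "AE x in lebesgue. - K1 * indicator \<Omega> x \<le> f (rep_L2 u x) * rep_L2 u x"
    proof eventually_elim
      case (elim x)
      then show ?case using nonlinearity by (cases "x \<in> \<Omega>") (auto simp: admissible_nonlinearity_def)
    qed
  qed (use iO in simp)
  also have "\<dots> = superpose f u \<bullet> u"
    unfolding superpose_def by (subst inner_to_L2_left[OF sq_integrable_f[OF u]]) simp
  finally show ?thesis .
qed

end

section \<open>The energy identity\<close>

lemma vector_derivative_quotient:
  assumes "(w has_vector_derivative w') (at t within S)"
  shows "((\<lambda>s. (1 / (s - t)) *\<^sub>R (w s - w t)) \<longlongrightarrow> w') (at t within S)"
proof (rule LIM_zero_cancel, rule tendsto_norm_zero_cancel)
  have "((\<lambda>y. (1 / norm (y - t)) *\<^sub>R (w y - (w t + (y - t) *\<^sub>R w'))) \<longlongrightarrow> 0) (at t within S)"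
    using assms by (simp add: has_vector_derivative_def has_derivative_within)
  then have "((\<lambda>y. norm ((1 / norm (y - t)) *\<^sub>R (w y - (w t + (y - t) *\<^sub>R w')))) \<longlongrightarrow> 0) (at t within S)"
    by (rule tendsto_norm_zero)
  then show "((\<lambda>s. norm ((1 / (s - t)) *\<^sub>R (w s - w t) - w')) \<longlongrightarrow> 0) (at t within S)"
  proof (rule Lim_transform_eventually)
    show "\<forall>\<^sub>F y in at t within S. norm ((1 / norm (y - t)) *\<^sub>R (w y - (w t + (y - t) *\<^sub>R w'))) = norm ((1 / (y - t)) *\<^sub>R (w y - w t) - w')"
      unfolding eventually_at_filter
    proof (rule always_eventually, intro allI impI)
      fix y assume y: "y \<noteq> t"
      have "(1 / (y - t)) *\<^sub>R (w y - (w t + (y - t) *\<^sub>R w')) = (1 / (y - t)) *\<^sub>R (w y - w t) - w'"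
        using y by (simp add: scaleR_diff_right scaleR_add_right)
      moreover have "norm ((1 / norm (y - t)) *\<^sub>R (w y - (w t + (y - t) *\<^sub>R w'))) = norm ((1 / (y - t)) *\<^sub>R (w y - (w t + (y - t) *\<^sub>R w')))"
        by simp
      ultimately show "norm ((1 / norm (y - t)) *\<^sub>R (w y - (w t + (y - t) *\<^sub>R w'))) = norm ((1 / (y - t)) *\<^sub>R (w y - w t) - w')"
        by simp
    qed
  qed
qed

text \<open>A product rule in which one factor is only weakly differentiable.\<close>

lemma weak_product_derivative:
  assumes V: "((\<lambda>s. V s \<bullet> w t) has_real_derivative D) (at t within S)" "(V \<longlongrightarrow> V t) (at t within S)"
    and w: "(w has_vector_derivative w') (at t within S)"
  shows "((\<lambda>s. V s \<bullet> w s) has_real_derivative D + V t \<bullet> w') (at t within S)"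
proof -
  have "((\<lambda>s. (V s \<bullet> w t - V t \<bullet> w t) / (s - t) + V s \<bullet> ((1 / (s - t)) *\<^sub>R (w s - w t))) \<longlongrightarrow> D + V t \<bullet> w') (at t within S)"
    using V(1) by (intro tendsto_intros V(2) vector_derivative_quotient[OF w]) (simp add: has_field_derivative_iff)
  then show ?thesis
    by (simp add: has_field_derivative_iff inner_diff_right diff_divide_distrib[symmetric] add_divide_distrib[symmetric])
qed

lemma at_within_initial_segment:
  fixes t :: real assumes "0 \<le> t" "t < T" shows "at t within {0..T} = at t within {0..}"
  using assms by (intro at_within_nhd[of _ "{..<T}"]) auto

lemma primitive_on_halfline:
  fixes g :: "real \<Rightarrow> real"
  assumes g: "continuous_on {0..} g"
  shows "\<exists>G. \<forall>t\<ge>0. (G has_real_derivative g t) (at t within {0..})"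
proof (intro exI allI impI)
  fix t :: real assume t: "0 \<le> t"
  have "((\<lambda>x. integral {0..x} g) has_real_derivative g t) (at t within {0..t + 1})"
    using t by (intro integral_has_real_derivative continuous_on_subset[OF g]) auto
  then show "((\<lambda>x. integral {0..x} g) has_real_derivative g t) (at t within {0..})"
    using at_within_initial_segment[OF t, of "t + 1"] by simp
qed

lemma has_vector_derivative_shift:
  fixes w :: "real \<Rightarrow> 'a::real_normed_vector"
  assumes "(w has_vector_derivative w') (at (t + \<tau>) within {0..})" "0 \<le> \<tau>"
  shows "((\<lambda>s. w (s + \<tau>)) has_vector_derivative w') (at t within {0..})"
proof -
  have "((\<lambda>s. s + \<tau>) has_vector_derivative 1) (at t within {0..})"
    by (auto intro!: derivative_eq_intros)
  moreover have "(w has_vector_derivative w') (at (t + \<tau>) within (\<lambda>s. s + \<tau>) ` {0..})"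
    by (rule has_vector_derivative_within_subset[OF assms(1)]) (use assms(2) in auto)
  ultimately show ?thesis using vector_diff_chain_within by (fastforce simp: o_def)
qed

text \<open>A limit of functions whose derivatives tend to \<open>0\<close> uniformly on bounded intervals is constant.\<close>

lemma small_increments_imp_eq:
  fixes z :: "nat \<Rightarrow> real \<Rightarrow> real"
  assumes T: "0 \<le> T" and lim: "\<And>s. 0 \<le> s \<Longrightarrow> (\<lambda>n. z n s) \<longlonglongrightarrow> l s"
    and der: "\<And>n s. 0 \<le> s \<Longrightarrow> (z n has_real_derivative z' n s) (at s within {0..})"
    and small: "\<And>e. e > 0 \<Longrightarrow> \<forall>\<^sub>F n in sequentially. \<forall>s\<in>{0..T}. \<bar>z' n s\<bar> \<le> e"
  shows "l T = l 0"
proof -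
  have le: "\<bar>l T - l 0\<bar> \<le> e * T" if "e > 0" for e
  proof (rule tendsto_upperbound)
    show "(\<lambda>n. \<bar>z n T - z n 0\<bar>) \<longlonglongrightarrow> \<bar>l T - l 0\<bar>" by (intro tendsto_intros lim T order_refl)
    show "\<forall>\<^sub>F n in sequentially. \<bar>z n T - z n 0\<bar> \<le> e * T"
      using small[OF that]
    proof eventually_elim
      case (elim n)
      have "norm (z n T - z n 0) \<le> e * norm (T - 0)"
      proof (rule field_differentiable_bound[of "{0..T}" "z n" "z' n"])
        fix s assume s: "s \<in> {0..T}"
        show "(z n has_field_derivative z' n s) (at s within {0..T})"
          by (rule DERIV_subset[OF der]) (use s in auto)
        show "norm (z' n s) \<le> e" using elim s by simp
      qed (use T in auto)
      then show ?case using T by simp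
    qed
  qed simp
  have "\<bar>l T - l 0\<bar> \<le> 0 + e" if e: "e > 0" for e
  proof -
    have "\<bar>l T - l 0\<bar> \<le> e / (T + 1) * T" by (rule le) (use e T in simp)
    also have "\<dots> \<le> e" using e T by (simp add: field_simps)
    finally show ?thesis by simp
  qed
  then have "\<bar>l T - l 0\<bar> \<le> 0" by (rule field_le_epsilon)
  then show ?thesis by simp
qed

context damped_wave begin

sublocale A: bounded_linear "coeff_op b" by (rule coeff_op_bounded_linear[OF elliptic])

lemma nu_pos: "\<nu> > 0" using elliptic by (simp add: elliptic_coeff_def)

text \<open>The weak form of the linear wave equation, with velocity \<open>v\<close> and forcing \<open>h\<close>.  It is linear in
  \<open>(u, v, h)\<close>, so differences of solutions of the nonlinear equation and translates in time are covered.\<close>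

definition forced_wave :: "(real \<Rightarrow> real L2) \<Rightarrow> (real \<Rightarrow> real L2) \<Rightarrow> (real \<Rightarrow> real L2) \<Rightarrow> bool" where
  "forced_wave u v h \<longleftrightarrow> (\<forall>t\<ge>0. u t \<in> H10 \<Omega>) \<and> continuous_on {0..} (\<lambda>t. grad \<Omega> (u t)) \<and>
     continuous_on {0..} v \<and> continuous_on {0..} h \<and>
     (\<forall>t\<ge>0. (u has_vector_derivative v t) (at t within {0..})) \<and>
     (\<forall>\<phi>\<in>H10 \<Omega>. \<forall>t\<ge>0. ((\<lambda>s. v s \<bullet> \<phi>) has_real_derivative
        (h t \<bullet> \<phi> - coeff_op b (grad \<Omega> (u t)) \<bullet> grad \<Omega> \<phi>)) (at t within {0..}))"

lemma forced_wave_diff: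
  assumes "forced_wave u1 v1 h1" "forced_wave u2 v2 h2"
  shows "forced_wave (\<lambda>t. u1 t - u2 t) (\<lambda>t. v1 t - v2 t) (\<lambda>t. h1 t - h2 t)"
  unfolding forced_wave_def
proof (intro conjI allI ballI impI)
  show "u1 t - u2 t \<in> H10 \<Omega>" if "0 \<le> t" for t using assms that by (auto simp: forced_wave_def intro: H10_diff)
  have "continuous_on {0..} (\<lambda>t. grad \<Omega> (u1 t) - grad \<Omega> (u2 t))"
    using assms by (auto simp: forced_wave_def intro: continuous_on_diff)
  then show "continuous_on {0..} (\<lambda>t. grad \<Omega> (u1 t - u2 t))"
    by (rule continuous_on_eq) (use assms in \<open>auto simp: forced_wave_def grad_diff\<close>)
  show "continuous_on {0..} (\<lambda>t. v1 t - v2 t)" "continuous_on {0..} (\<lambda>t. h1 t - h2 t)"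
    using assms by (auto simp: forced_wave_def intro: continuous_on_diff)
  show "((\<lambda>t. u1 t - u2 t) has_vector_derivative v1 t - v2 t) (at t within {0..})" if "0 \<le> t" for t
    using assms that by (auto simp: forced_wave_def intro: has_vector_derivative_diff)
  fix \<phi> :: "real L2" and t :: real assume phi: "\<phi> \<in> H10 \<Omega>" and t: "0 \<le> t"
  have "((\<lambda>s. v1 s \<bullet> \<phi> - v2 s \<bullet> \<phi>) has_real_derivative (h1 t \<bullet> \<phi> - coeff_op b (grad \<Omega> (u1 t)) \<bullet> grad \<Omega> \<phi>)
      - (h2 t \<bullet> \<phi> - coeff_op b (grad \<Omega> (u2 t)) \<bullet> grad \<Omega> \<phi>)) (at t within {0..})"
    using assms phi t by (intro DERIV_diff) (auto simp: forced_wave_def)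
  moreover have g: "grad \<Omega> (u1 t - u2 t) = grad \<Omega> (u1 t) - grad \<Omega> (u2 t)"
    using assms t by (auto simp: forced_wave_def grad_diff)
  ultimately show "((\<lambda>s. (v1 s - v2 s) \<bullet> \<phi>) has_real_derivative ((h1 t - h2 t) \<bullet> \<phi> - coeff_op b (grad \<Omega> (u1 t - u2 t)) \<bullet> grad \<Omega> \<phi>)) (at t within {0..})"
    unfolding g A.diff inner_diff_left by (simp add: algebra_simps)
qed

lemma forced_wave_shift:
  assumes "forced_wave u v h" "0 \<le> \<tau>"
  shows "forced_wave (\<lambda>t. u (t + \<tau>)) (\<lambda>t. v (t + \<tau>)) (\<lambda>t. h (t + \<tau>))"
  unfolding forced_wave_def
proof (intro conjI allI ballI impI)
  show "u (t + \<tau>) \<in> H10 \<Omega>" if "0 \<le> t" for t using assms that by (auto simp: forced_wave_def)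
  have c: "continuous_on {0..} (\<lambda>t. w (t + \<tau>))" if "continuous_on {0..} w" for w :: "real \<Rightarrow> 'x::topological_space"
    using assms(2) by (intro continuous_on_compose2[OF that] continuous_intros) auto
  show "continuous_on {0..} (\<lambda>t. grad \<Omega> (u (t + \<tau>)))"
    using c[of "\<lambda>t. grad \<Omega> (u t)"] assms by (simp add: forced_wave_def)
  show "continuous_on {0..} (\<lambda>t. v (t + \<tau>))" "continuous_on {0..} (\<lambda>t. h (t + \<tau>))"
    using c[of v] c[of h] assms by (simp_all add: forced_wave_def)
  show "((\<lambda>t. u (t + \<tau>)) has_vector_derivative v (t + \<tau>)) (at t within {0..})" if "0 \<le> t" for t
    using assms that by (intro has_vector_derivative_shift) (auto simp: forced_wave_def)
  fix \<phi> :: "real L2" and t :: real assume phi: "\<phi> \<in> H10 \<Omega>" and t: "0 \<le> t"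
  have "((\<lambda>s. v s \<bullet> \<phi>) has_real_derivative (h (t + \<tau>) \<bullet> \<phi> - coeff_op b (grad \<Omega> (u (t + \<tau>))) \<bullet> grad \<Omega> \<phi>)) (at (t + \<tau>) within {0..})"
    using assms phi t by (simp add: forced_wave_def)
  then show "((\<lambda>s. v (s + \<tau>) \<bullet> \<phi>) has_real_derivative (h (t + \<tau>) \<bullet> \<phi> - coeff_op b (grad \<Omega> (u (t + \<tau>))) \<bullet> grad \<Omega> \<phi>)) (at t within {0..})"
    unfolding has_real_derivative_iff_has_vector_derivative using assms(2) by (rule has_vector_derivative_shift)
qed

text \<open>In the derivative of \<open>(v1 + v2) \<bullet> (u2 - u1)\<close> the mixed terms cancel by symmetry; this is what
  replaces the multiplication of the equation by the velocity, which is not an admissible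
  test function.\<close>

lemma cross_derivative:
  assumes w1: "forced_wave u1 v1 h1" and w2: "forced_wave u2 v2 h2" and t: "0 \<le> t"
  shows "((\<lambda>s. (v1 s + v2 s) \<bullet> (u2 s - u1 s)) has_real_derivative
     (h1 t + h2 t) \<bullet> (u2 t - u1 t) + (v2 t \<bullet> v2 t - coeff_op b (grad \<Omega> (u2 t)) \<bullet> grad \<Omega> (u2 t))
       - (v1 t \<bullet> v1 t - coeff_op b (grad \<Omega> (u1 t)) \<bullet> grad \<Omega> (u1 t))) (at t within {0..})"
proof -
  let ?\<phi> = "u2 t - u1 t"
  have phi: "?\<phi> \<in> H10 \<Omega>" and g: "grad \<Omega> ?\<phi> = grad \<Omega> (u2 t) - grad \<Omega> (u1 t)"
    using w1 w2 t by (auto simp: forced_wave_def grad_diff intro: H10_diff)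
  have "((\<lambda>s. v1 s \<bullet> ?\<phi> + v2 s \<bullet> ?\<phi>) has_real_derivative (h1 t \<bullet> ?\<phi> - coeff_op b (grad \<Omega> (u1 t)) \<bullet> grad \<Omega> ?\<phi>)
      + (h2 t \<bullet> ?\<phi> - coeff_op b (grad \<Omega> (u2 t)) \<bullet> grad \<Omega> ?\<phi>)) (at t within {0..})" (is "(_ has_real_derivative ?D) _")
    using w1 w2 phi t by (intro DERIV_add) (auto simp: forced_wave_def)
  then have V: "((\<lambda>s. (v1 s + v2 s) \<bullet> ?\<phi>) has_real_derivative ?D) (at t within {0..})" by (simp add: inner_add_left)
  have "continuous_on {0..} (\<lambda>s. v1 s + v2 s)" using w1 w2 by (auto simp: forced_wave_def intro: continuous_on_add)
  then have "((\<lambda>s. v1 s + v2 s) \<longlongrightarrow> v1 t + v2 t) (at t within {0..})" using t by (simp add: continuous_on_def)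
  moreover have "((\<lambda>s. u2 s - u1 s) has_vector_derivative v2 t - v1 t) (at t within {0..})"
    using w1 w2 t by (auto simp: forced_wave_def intro: has_vector_derivative_diff)
  ultimately have "((\<lambda>s. (v1 s + v2 s) \<bullet> (u2 s - u1 s)) has_real_derivative ?D + (v1 t + v2 t) \<bullet> (v2 t - v1 t)) (at t within {0..})"
    using V by (intro weak_product_derivative)
  moreover have "?D + (v1 t + v2 t) \<bullet> (v2 t - v1 t) = (h1 t + h2 t) \<bullet> (u2 t - u1 t) + (v2 t \<bullet> v2 t - coeff_op b (grad \<Omega> (u2 t)) \<bullet> grad \<Omega> (u2 t))
       - (v1 t \<bullet> v1 t - coeff_op b (grad \<Omega> (u1 t)) \<bullet> grad \<Omega> (u1 t))"
    unfolding g using coeff_op_sym[OF elliptic, of "grad \<Omega> (u1 t)" "grad \<Omega> (u2 t)"]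
    by (simp add: inner_add_left inner_diff_left inner_add_right inner_diff_right inner_commute[of "v2 t" "v1 t"])
  ultimately show ?thesis by simp
qed

definition energy :: "(real \<Rightarrow> real L2) \<Rightarrow> (real \<Rightarrow> real L2) \<Rightarrow> real \<Rightarrow> real" where
  "energy u v t = v t \<bullet> v t + coeff_op b (grad \<Omega> (u t)) \<bullet> grad \<Omega> (u t)"

text \<open>Apply \<open>cross_derivative\<close> to the solution and its translate in time by \<open>\<tau>\<close> and divide by \<open>\<tau>\<close>.  The
  difference of the quantity \<open>L\<close> at \<open>s\<close> and \<open>s + \<tau>\<close> that appears is the derivative of a difference of
  its primitive; moved to the left it completes the energy in the limit, and only the forcing is left.\<close>

lemma energy_identity:
  assumes w: "forced_wave u v h" and t: "0 \<le> t"
  shows "(energy u v has_real_derivative 2 * (h t \<bullet> v t)) (at t within {0..})"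
proof -
  define L where "L s = v s \<bullet> v s - coeff_op b (grad \<Omega> (u s)) \<bullet> grad \<Omega> (u s)" for s
  have vc: "continuous_on {0..} v" and hc: "continuous_on {0..} h" and gc: "continuous_on {0..} (\<lambda>t. grad \<Omega> (u t))"
    and ud: "\<And>t. 0 \<le> t \<Longrightarrow> (u has_vector_derivative v t) (at t within {0..})"
    using w by (auto simp: forced_wave_def)
  have Lc: "continuous_on {0..} L" unfolding L_def[abs_def] by (intro continuous_intros vc gc A.continuous_on)
  obtain \<Lambda>' where Lam: "\<And>t. 0 \<le> t \<Longrightarrow> (\<Lambda>' has_real_derivative L t) (at t within {0..})"
    using primitive_on_halfline[OF Lc] by blast
  have "continuous_on {0..} (\<lambda>s. 2 * (h s \<bullet> v s))" by (intro continuous_intros vc hc)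
  then obtain \<Theta> where Th: "\<And>t. 0 \<le> t \<Longrightarrow> (\<Theta> has_real_derivative 2 * (h t \<bullet> v t)) (at t within {0..})"
    using primitive_on_halfline by blast
  define \<tau> where "\<tau> n = 1 / real (Suc n)" for n
  have tp: "\<tau> n > 0" for n by (simp add: \<tau>_def)
  have t0: "\<tau> \<longlonglongrightarrow> 0" unfolding \<tau>_def[abs_def] using LIMSEQ_inverse_real_of_nat by (simp add: inverse_eq_divide)
  define q where "q n s = (1 / \<tau> n) *\<^sub>R (u (s + \<tau> n) - u s)" for n s
  \<comment> \<open>In the limit \<open>z\<close> is \<open>2 * (v s \<bullet> v s) - L s - \<Theta> s\<close>, the energy minus the primitive of the power.\<close>
  define z where "z n s = (v s + v (s + \<tau> n)) \<bullet> (u (s + \<tau> n) - u s) / \<tau> n - (\<Lambda>' (s + \<tau> n) - \<Lambda>' s) / \<tau> n - \<Theta> s" for n s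
  have seq: "filterlim (\<lambda>n. s + \<tau> n) (at s within {0..}) sequentially" if "0 \<le> s" for s
    unfolding filterlim_at using tendsto_add[OF tendsto_const t0, of s] that tp
    by (auto intro!: always_eventually add_nonneg_nonneg simp: less_imp_le less_imp_neq[THEN not_sym])
  have const: "energy u v T - \<Theta> T = energy u v 0 - \<Theta> 0" if T: "0 \<le> T" for T
  proof (rule small_increments_imp_eq[of T z])
    fix s :: real assume s: "0 \<le> s"
    have "(\<lambda>n. q n s) \<longlonglongrightarrow> v s"
      using filterlim_compose[OF vector_derivative_quotient[OF ud[OF s]] seq[OF s]] by (simp add: q_def)
    moreover have "(\<lambda>n. v (s + \<tau> n)) \<longlonglongrightarrow> v s"
      using vc s filterlim_compose[OF _ seq[OF s], of v "nhds (v s)"] by (auto simp: continuous_on_def)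
    moreover have "((\<lambda>y. (\<Lambda>' y - \<Lambda>' s) / (y - s)) \<longlongrightarrow> L s) (at s within {0..})"
      using Lam[OF s] by (simp add: has_field_derivative_iff)
    from filterlim_compose[OF this seq[OF s]] have "(\<lambda>n. (\<Lambda>' (s + \<tau> n) - \<Lambda>' s) / \<tau> n) \<longlonglongrightarrow> L s" by simp
    ultimately have "(\<lambda>n. (v s + v (s + \<tau> n)) \<bullet> q n s - (\<Lambda>' (s + \<tau> n) - \<Lambda>' s) / \<tau> n - \<Theta> s) \<longlonglongrightarrow> (v s + v s) \<bullet> v s - L s - \<Theta> s"
      by (intro tendsto_intros)
    moreover have "(v s + v (s + \<tau> n)) \<bullet> q n s - (\<Lambda>' (s + \<tau> n) - \<Lambda>' s) / \<tau> n - \<Theta> s = z n s" for n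
      by (simp add: z_def q_def)
    moreover have "(v s + v s) \<bullet> v s - L s - \<Theta> s = energy u v s - \<Theta> s" by (simp add: L_def energy_def inner_add_left)
    ultimately show "(\<lambda>n. z n s) \<longlonglongrightarrow> energy u v s - \<Theta> s" by simp
  next
    fix n and s :: real assume s: "0 \<le> s"
    let ?\<tau> = "\<tau> n"
    have s2: "0 \<le> s + ?\<tau>" using s tp[of n] by simp
    have "((\<lambda>s. (v s + v (s + ?\<tau>)) \<bullet> (u (s + ?\<tau>) - u s)) has_real_derivative (h s + h (s + ?\<tau>)) \<bullet> (u (s + ?\<tau>) - u s) + L (s + ?\<tau>) - L s) (at s within {0..})"
      using cross_derivative[OF w forced_wave_shift[OF w, of ?\<tau>] s] tp[of n] by (simp add: L_def less_imp_le)
    moreover have "((\<lambda>s. \<Lambda>' (s + ?\<tau>)) has_real_derivative L (s + ?\<tau>)) (at s within {0..})"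
      using has_vector_derivative_shift[of \<Lambda>' "L (s + ?\<tau>)" s ?\<tau>] Lam[OF s2] tp[of n]
      by (simp add: has_real_derivative_iff_has_vector_derivative less_imp_le)
    ultimately have "(z n has_real_derivative ((h s + h (s + ?\<tau>)) \<bullet> (u (s + ?\<tau>) - u s) + L (s + ?\<tau>) - L s) / ?\<tau> - (L (s + ?\<tau>) - L s) / ?\<tau> - 2 * (h s \<bullet> v s)) (at s within {0..})"
      unfolding z_def[abs_def] by (intro DERIV_diff DERIV_cdivide Lam[OF s] Th[OF s])
    moreover have "((h s + h (s + ?\<tau>)) \<bullet> (u (s + ?\<tau>) - u s) + L (s + ?\<tau>) - L s) / ?\<tau> - (L (s + ?\<tau>) - L s) / ?\<tau> - 2 * (h s \<bullet> v s)
        = (h s + h (s + ?\<tau>)) \<bullet> q n s - 2 * (h s \<bullet> v s)"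
      by (simp add: q_def add_divide_distrib diff_divide_distrib)
    ultimately show "(z n has_real_derivative (h s + h (s + ?\<tau>)) \<bullet> q n s - 2 * (h s \<bullet> v s)) (at s within {0..})" by simp
  next
    fix e :: real assume e: "e > 0"
    let ?S = "{0..T + 1}"
    have vS: "continuous_on ?S v" and hS: "continuous_on ?S h" using vc hc by (auto elim: continuous_on_subset)
    obtain M where M: "\<And>s. s \<in> ?S \<Longrightarrow> norm (v s) \<le> M" "\<And>s. s \<in> ?S \<Longrightarrow> norm (h s) \<le> M" "M > 0"
    proof -
      have "bounded (v ` ?S)" "bounded (h ` ?S)"
        using vS hS by (auto intro!: compact_imp_bounded compact_continuous_image)
      then obtain a b where ab: "a > 0" "b > 0" "\<And>s. s \<in> ?S \<Longrightarrow> norm (v s) \<le> a" "\<And>s. s \<in> ?S \<Longrightarrow> norm (h s) \<le> b"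
        by (auto simp: bounded_pos)
      show ?thesis by (rule that[of "max a b"]) (use ab in \<open>auto intro: max.coboundedI1 max.coboundedI2\<close>)
    qed
    define \<epsilon> where "\<epsilon> = min 1 (e / (3 * M + 1))"
    have eps: "0 < \<epsilon>" "\<epsilon> \<le> 1" "\<epsilon> * (3 * M + 1) \<le> e"
    proof -
      show "0 < \<epsilon>" "\<epsilon> \<le> 1" using e M(3) by (auto simp: \<epsilon>_def)
      have "\<epsilon> * (3 * M + 1) \<le> e / (3 * M + 1) * (3 * M + 1)" using M(3) by (intro mult_right_mono) (auto simp: \<epsilon>_def)
      then show "\<epsilon> * (3 * M + 1) \<le> e" using M(3) by simp
    qed
    have "uniformly_continuous_on ?S v" "uniformly_continuous_on ?S h"
      using vS hS by (auto intro: compact_uniformly_continuous)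
    then obtain d1 d2 where d: "d1 > 0" "d2 > 0"
      "\<And>x y. x \<in> ?S \<Longrightarrow> y \<in> ?S \<Longrightarrow> dist y x < d1 \<Longrightarrow> dist (v y) (v x) < \<epsilon>"
      "\<And>x y. x \<in> ?S \<Longrightarrow> y \<in> ?S \<Longrightarrow> dist y x < d2 \<Longrightarrow> dist (h y) (h x) < \<epsilon>"
      using eps(1) unfolding uniformly_continuous_on_def by metis
    have "\<forall>\<^sub>F n in sequentially. \<tau> n < min d1 (min d2 1)" using t0 d(1,2) by (intro order_tendstoD) auto
    then show "\<forall>\<^sub>F n in sequentially. \<forall>s\<in>{0..T}. \<bar>(h s + h (s + \<tau> n)) \<bullet> q n s - 2 * (h s \<bullet> v s)\<bar> \<le> e"
    proof eventually_elim
      case (elim n)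
      show ?case
      proof
        fix s assume s: "s \<in> {0..T}"
        have sS: "s \<in> ?S" "s + \<tau> n \<in> ?S" using s elim tp[of n] by auto
        have vb: "norm (v y - v s) \<le> \<epsilon>" if "y \<in> {s..s + \<tau> n}" for y
        proof -
          have "y \<in> ?S" "dist y s < d1" using that s elim by (auto simp: dist_real_def)
          then show ?thesis using d(3)[OF sS(1)] by (simp add: dist_norm less_imp_le)
        qed
        have "norm (u (s + \<tau> n) - u s - ((s + \<tau> n) - s) *\<^sub>R v s) \<le> norm ((s + \<tau> n) - s) * \<epsilon>"
        proof (rule vector_differentiable_bound_linearization[of "{s..s + \<tau> n}" u v s "s + \<tau> n" s])
          show "(u has_vector_derivative v x) (at x within {s..s + \<tau> n})" if "x \<in> {s..s + \<tau> n}" for x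
            by (rule has_vector_derivative_within_subset[OF ud]) (use that s in auto)
          show "closed_segment s (s + \<tau> n) \<subseteq> {s..s + \<tau> n}" using tp[of n] by (simp add: closed_segment_eq_real_ivl)
        qed (use vb tp[of n] in auto)
        then have "norm (u (s + \<tau> n) - u s - \<tau> n *\<^sub>R v s) \<le> \<tau> n * \<epsilon>" using tp[of n] by simp
        moreover have "q n s - v s = (1 / \<tau> n) *\<^sub>R (u (s + \<tau> n) - u s - \<tau> n *\<^sub>R v s)"
          using tp[of n] by (simp add: q_def scaleR_diff_right)
        ultimately have qv: "norm (q n s - v s) \<le> \<epsilon>" using tp[of n] by (simp add: divide_le_eq mult.commute)
        have hh: "norm (h (s + \<tau> n) - h s) \<le> \<epsilon>"
          using d(4)[OF sS(1) sS(2)] elim tp[of n] by (simp add: dist_norm less_imp_le)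
        have nq: "norm (q n s) \<le> M + \<epsilon>" using norm_triangle_ineq[of "v s" "q n s - v s"] qv M(1)[OF sS(1)] by simp
        have "(h s + h (s + \<tau> n)) \<bullet> q n s - 2 * (h s \<bullet> v s) = (h (s + \<tau> n) - h s) \<bullet> q n s + 2 * (h s \<bullet> (q n s - v s))"
          by (simp add: inner_add_left inner_diff_left inner_diff_right)
        also have "\<bar>\<dots>\<bar> \<le> \<bar>(h (s + \<tau> n) - h s) \<bullet> q n s\<bar> + 2 * \<bar>h s \<bullet> (q n s - v s)\<bar>" by simp
        also have "\<dots> \<le> \<epsilon> * (M + \<epsilon>) + 2 * (M * \<epsilon>)"
        proof (intro add_mono mult_left_mono)
          show "\<bar>(h (s + \<tau> n) - h s) \<bullet> q n s\<bar> \<le> \<epsilon> * (M + \<epsilon>)"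
            using Cauchy_Schwarz_ineq2[of "h (s + \<tau> n) - h s" "q n s"] mult_mono[OF hh nq] eps(1) by simp
          show "\<bar>h s \<bullet> (q n s - v s)\<bar> \<le> M * \<epsilon>"
            using Cauchy_Schwarz_ineq2[of "h s" "q n s - v s"] mult_mono[OF M(2)[OF sS(1)] qv] M(3) by simp
        qed simp
        also have "\<dots> \<le> \<epsilon> * (3 * M + 1)"
          using eps mult_left_mono[OF eps(2), of \<epsilon>] by (simp add: algebra_simps)
        also have "\<dots> \<le> e" by (rule eps(3))
        finally show "\<bar>(h s + h (s + \<tau> n)) \<bullet> q n s - 2 * (h s \<bullet> v s)\<bar> \<le> e" .
      qed
    qed
  qed (rule T)
  have d: "((\<lambda>s. \<Theta> s + (energy u v 0 - \<Theta> 0)) has_real_derivative 2 * (h t \<bullet> v t)) (at t within {0..})"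
    using DERIV_add[OF Th[OF t] DERIV_const] by simp
  show ?thesis
  proof (rule has_field_derivative_transform_within[OF d zero_less_one])
    show "t \<in> {0..}" using t by simp
    fix s :: real assume "s \<in> {0..}"
    then have "0 \<le> s" by simp
    from const[OF this] show "\<Theta> s + (energy u v 0 - \<Theta> 0) = energy u v s" by linarith
  qed
qed

end

section \<open>Energy solutions of the damped wave equation\<close>

lemma at_within_halfline_nontrivial:
  fixes t :: real assumes "0 \<le> t" shows "at t within {0..} \<noteq> bot"
proof
  assume "at t within {0..} = bot"
  moreover have "at_right t \<le> at t within {0..}" by (rule at_le) (use assms in auto)
  ultimately show False by (simp add: bot_unique)
qed

lemma derivative_of_constant_on_halfline:
  fixes e :: "real \<Rightarrow> real"
  assumes e: "(e has_real_derivative D) (at t within {0..})" and t: "0 \<le> t" and const: "\<And>s. 0 \<le> s \<Longrightarrow> e s = c"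
  shows "D = 0"
proof -
  have "(e has_real_derivative 0) (at t within {0..})"
    by (rule has_field_derivative_transform_within[of "\<lambda>_. c" 0 t "{0..}" 1]) (use t const in auto)
  then show ?thesis
    using e at_within_halfline_nontrivial[OF t] unfolding has_real_derivative_iff_has_vector_derivative
    by (blast intro: vector_derivative_unique_within)
qed

lemma nonpos_derivative_imp_le_initial:
  fixes e :: "real \<Rightarrow> real"
  assumes T: "0 \<le> T" and e: "\<And>t. 0 \<le> t \<Longrightarrow> t \<le> T \<Longrightarrow> (e has_real_derivative e' t) (at t within {0..})"
    and le: "\<And>t. 0 \<le> t \<Longrightarrow> t \<le> T \<Longrightarrow> e' t \<le> 0"
  shows "e T \<le> e 0"
proof -
  have "(e has_derivative (\<lambda>h. h * e' t)) (at t within {0..T})" if "0 \<le> t" "t \<le> T" for t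
    using DERIV_subset[OF e[OF that], of "{0..T}"] by (simp add: has_field_derivative_def mult.commute[of _ "e' t"])
  from mvt_very_simple[OF T this] obtain t where t: "t \<in> {0..T}" "e T - e 0 = (T - 0) * e' t" by blast
  moreover have "(T - 0) * e' t \<le> 0" using T t le[of t] by (intro mult_nonneg_nonpos) auto
  ultimately show ?thesis by linarith
qed

context damped_wave begin

text \<open>One local constant for both estimates, along an arbitrary filter: this serves limits in time and
  limits of sequences of states.\<close>

lemma eventually_superpose_bounds:
  assumes w: "w \<in> H10 \<Omega>" and u: "\<forall>\<^sub>F s in Q. u s \<in> H10 \<Omega>" and lim: "((\<lambda>s. grad \<Omega> (u s)) \<longlongrightarrow> grad \<Omega> w) Q"
  shows "\<exists>C. \<forall>\<^sub>F s in Q. norm (superpose f (u s) - superpose f w) \<le> C * norm (grad \<Omega> (u s) - grad \<Omega> w) \<and>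
     \<bar>potential (u s) - potential w - superpose f w \<bullet> (u s - w)\<bar> \<le> C * norm (grad \<Omega> (u s) - grad \<Omega> w) * norm (u s - w)"
proof -
  define r where "r = norm (grad \<Omega> w) + 1"
  define C where "C = growth * cubic_const r"
  have C0: "0 \<le> C" by (simp add: C_def growth_nonneg cubic_const_def)
  have "\<forall>\<^sub>F s in Q. norm (grad \<Omega> (u s)) < r"
    using tendsto_norm[OF lim] by (rule order_tendstoD) (simp add: r_def)
  then have "\<forall>\<^sub>F s in Q. norm (superpose f (u s) - superpose f w) \<le> (2 * C) * norm (grad \<Omega> (u s) - grad \<Omega> w) \<and>
     \<bar>potential (u s) - potential w - superpose f w \<bullet> (u s - w)\<bar> \<le> (2 * C) * norm (grad \<Omega> (u s) - grad \<Omega> w) * norm (u s - w)"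
    using u
  proof eventually_elim
    case (elim s)
    have us: "norm (grad \<Omega> (u s)) \<le> r" and ws: "norm (grad \<Omega> w) \<le> r" using elim by (auto simp: r_def)
    have g: "grad \<Omega> (u s - w) = grad \<Omega> (u s) - grad \<Omega> w" using elim w by (simp add: grad_diff)
    have "norm (superpose f (u s) - superpose f w) \<le> C * norm (grad \<Omega> (u s) - grad \<Omega> w)"
      using superpose_Lipschitz[OF elim(2) us w ws] by (simp only: g C_def mult.assoc)
    also have "\<dots> \<le> (2 * C) * norm (grad \<Omega> (u s) - grad \<Omega> w)"
      using C0 by (intro mult_right_mono) auto
    finally show ?case
      using potential_expansion[OF elim(2) us w ws] by (simp only: g C_def mult.assoc)
  qed
  then show ?thesis by blast
qed

lemma superpose_tendsto:
  assumes "w \<in> H10 \<Omega>" "\<forall>\<^sub>F s in Q. u s \<in> H10 \<Omega>" "((\<lambda>s. grad \<Omega> (u s)) \<longlongrightarrow> grad \<Omega> w) Q"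
  shows "((\<lambda>s. superpose f (u s)) \<longlongrightarrow> superpose f w) Q"
proof -
  obtain C where C: "\<forall>\<^sub>F s in Q. norm (superpose f (u s) - superpose f w) \<le> C * norm (grad \<Omega> (u s) - grad \<Omega> w) \<and>
     \<bar>potential (u s) - potential w - superpose f w \<bullet> (u s - w)\<bar> \<le> C * norm (grad \<Omega> (u s) - grad \<Omega> w) * norm (u s - w)"
    using eventually_superpose_bounds[OF assms] by blast
  have "((\<lambda>s. C * norm (grad \<Omega> (u s) - grad \<Omega> w)) \<longlongrightarrow> C * norm (grad \<Omega> w - grad \<Omega> w)) Q"
    by (intro tendsto_intros assms(3))
  then have lim0: "((\<lambda>s. C * norm (grad \<Omega> (u s) - grad \<Omega> w)) \<longlongrightarrow> 0) Q" by simp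
  have "\<forall>\<^sub>F s in Q. norm (superpose f (u s) - superpose f w) \<le> C * norm (grad \<Omega> (u s) - grad \<Omega> w)"
    using C by (rule eventually_mono) blast
  then have "((\<lambda>s. superpose f (u s) - superpose f w) \<longlongrightarrow> 0) Q" by (rule Lim_null_comparison) (rule lim0)
  then show ?thesis by (rule LIM_zero_cancel)
qed

lemma potential_tendsto:
  assumes "w \<in> H10 \<Omega>" "\<forall>\<^sub>F s in Q. u s \<in> H10 \<Omega>" "((\<lambda>s. grad \<Omega> (u s)) \<longlongrightarrow> grad \<Omega> w) Q" and uw: "(u \<longlongrightarrow> w) Q"
  shows "((\<lambda>s. potential (u s)) \<longlongrightarrow> potential w) Q"
proof -
  obtain C where C: "\<forall>\<^sub>F s in Q. norm (superpose f (u s) - superpose f w) \<le> C * norm (grad \<Omega> (u s) - grad \<Omega> w) \<and>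
     \<bar>potential (u s) - potential w - superpose f w \<bullet> (u s - w)\<bar> \<le> C * norm (grad \<Omega> (u s) - grad \<Omega> w) * norm (u s - w)"
    using eventually_superpose_bounds[OF assms(1-3)] by blast
  have "((\<lambda>s. C * norm (grad \<Omega> (u s) - grad \<Omega> w) * norm (u s - w)) \<longlongrightarrow> C * norm (grad \<Omega> w - grad \<Omega> w) * norm (w - w)) Q"
    by (intro tendsto_intros assms(3) uw)
  then have lim0: "((\<lambda>s. C * norm (grad \<Omega> (u s) - grad \<Omega> w) * norm (u s - w)) \<longlongrightarrow> 0) Q" by simp
  have "\<forall>\<^sub>F s in Q. norm (potential (u s) - potential w - superpose f w \<bullet> (u s - w)) \<le> C * norm (grad \<Omega> (u s) - grad \<Omega> w) * norm (u s - w)"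
    using C by (rule eventually_mono) simp
  then have "((\<lambda>s. potential (u s) - potential w - superpose f w \<bullet> (u s - w)) \<longlongrightarrow> 0) Q" by (rule Lim_null_comparison) (rule lim0)
  moreover have "((\<lambda>s. superpose f w \<bullet> (u s - w)) \<longlongrightarrow> superpose f w \<bullet> (w - w)) Q" by (intro tendsto_intros uw)
  ultimately have "((\<lambda>s. (potential (u s) - potential w - superpose f w \<bullet> (u s - w)) + superpose f w \<bullet> (u s - w)) \<longlongrightarrow> 0 + superpose f w \<bullet> (w - w)) Q"
    by (rule tendsto_add)
  then have "((\<lambda>s. potential (u s) - potential w) \<longlongrightarrow> 0) Q" by simp
  then show ?thesis by (rule LIM_zero_cancel)
qed

text \<open>The remainder of the expansion of the potential is a product of the increment in
  \<open>H\<^sup>1\<^sub>0\<close>, which tends to \<open>0\<close>, and of the increment in \<open>L\<^sup>2\<close>, which is of the order of the time step.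
  Hence differentiability in \<open>L\<^sup>2\<close> together with continuity in \<open>H\<^sup>1\<^sub>0\<close> suffices.\<close>

lemma potential_derivative:
  assumes u: "\<And>s. 0 \<le> s \<Longrightarrow> u s \<in> H10 \<Omega>" and gc: "continuous_on {0..} (\<lambda>s. grad \<Omega> (u s))"
    and d: "(u has_vector_derivative v) (at t within {0..})" and t: "0 \<le> t"
  shows "((\<lambda>s. potential (u s)) has_real_derivative superpose f (u t) \<bullet> v) (at t within {0..})"
proof -
  let ?Q = "at t within {0..}"
  define q where "q s = (1 / (s - t)) *\<^sub>R (u s - u t)" for s
  have q: "(q \<longlongrightarrow> v) ?Q" unfolding q_def[abs_def] by (rule vector_derivative_quotient[OF d])
  have ev: "\<forall>\<^sub>F s in ?Q. u s \<in> H10 \<Omega>" unfolding eventually_at_filter by (rule always_eventually) (use u in auto)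
  have lim: "((\<lambda>s. grad \<Omega> (u s)) \<longlongrightarrow> grad \<Omega> (u t)) ?Q" using gc t by (simp add: continuous_on_def)
  obtain C where C: "\<forall>\<^sub>F s in ?Q. norm (superpose f (u s) - superpose f (u t)) \<le> C * norm (grad \<Omega> (u s) - grad \<Omega> (u t)) \<and>
     \<bar>potential (u s) - potential (u t) - superpose f (u t) \<bullet> (u s - u t)\<bar> \<le> C * norm (grad \<Omega> (u s) - grad \<Omega> (u t)) * norm (u s - u t)"
    using eventually_superpose_bounds[OF u[OF t] ev lim] by blast
  let ?rem = "\<lambda>s. (potential (u s) - potential (u t) - superpose f (u t) \<bullet> (u s - u t)) / (s - t)"
  have "((\<lambda>s. C * norm (grad \<Omega> (u s) - grad \<Omega> (u t)) * norm (q s)) \<longlongrightarrow> C * norm (grad \<Omega> (u t) - grad \<Omega> (u t)) * norm v) ?Q"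
    by (intro tendsto_intros lim q)
  then have lim0: "((\<lambda>s. C * norm (grad \<Omega> (u s) - grad \<Omega> (u t)) * norm (q s)) \<longlongrightarrow> 0) ?Q" by simp
  have "\<forall>\<^sub>F s in ?Q. norm (?rem s) \<le> C * norm (grad \<Omega> (u s) - grad \<Omega> (u t)) * norm (q s)"
    using C
  proof (rule eventually_mono, elim conjE)
    fix s assume "\<bar>potential (u s) - potential (u t) - superpose f (u t) \<bullet> (u s - u t)\<bar> \<le> C * norm (grad \<Omega> (u s) - grad \<Omega> (u t)) * norm (u s - u t)"
    from divide_right_mono[OF this, of "\<bar>s - t\<bar>"]
    show "norm (?rem s) \<le> C * norm (grad \<Omega> (u s) - grad \<Omega> (u t)) * norm (q s)"
      by (simp add: q_def abs_divide)
  qed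
  then have "(?rem \<longlongrightarrow> 0) ?Q" by (rule Lim_null_comparison) (rule lim0)
  moreover have "((\<lambda>s. superpose f (u t) \<bullet> q s) \<longlongrightarrow> superpose f (u t) \<bullet> v) ?Q" by (intro tendsto_intros q)
  ultimately have "((\<lambda>s. ?rem s + superpose f (u t) \<bullet> q s) \<longlongrightarrow> 0 + superpose f (u t) \<bullet> v) ?Q" by (rule tendsto_add)
  moreover have "?rem s + superpose f (u t) \<bullet> q s = (potential (u s) - potential (u t)) / (s - t)" for s
    by (simp add: q_def diff_divide_distrib)
  ultimately show ?thesis by (simp add: has_field_derivative_iff)
qed

abbreviation "forcing g u v \<equiv> \<lambda>t. g - \<gamma> *\<^sub>R v t - superpose f (u t)"

text \<open>Continuity in the energy space makes the nonlinear term a continuous forcing in \<open>L\<^sup>2\<close>, so it may be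
  treated as a given right hand side.\<close>

lemma energy_solution_forced_wave:
  assumes sol: "energy_solution \<Omega> b \<gamma> f g \<xi> U"
  shows "0 \<le> t \<Longrightarrow> U t \<in> E \<Omega>" "forced_wave (\<lambda>t. fst (U t)) (\<lambda>t. snd (U t)) (forcing g (\<lambda>t. fst (U t)) (\<lambda>t. snd (U t)))"
proof -
  interpret ES: Metric_space "E \<Omega>" "E_dist \<Omega>" by (rule E_metric)
  have cm: "continuous_map (top_of_set {0..}) ES.mtopology U" using sol by (simp add: energy_solution_def)
  have UE: "U t \<in> E \<Omega>" if "0 \<le> t" for t
    using continuous_map_image_subset_topspace[OF cm] that by (auto simp: image_subset_iff)
  then show "0 \<le> t \<Longrightarrow> U t \<in> E \<Omega>" .
  have H: "fst (U t) \<in> H10 \<Omega>" if "0 \<le> t" for t using UE[OF that] by (auto simp: E_def)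
  let ?W = "\<lambda>t. (grad \<Omega> (fst (U t)), snd (U t))"
  have W: "continuous_on {0..} ?W"
    unfolding continuous_on_iff
  proof (intro ballI allI impI)
    fix t e :: real assume t: "t \<in> {0..}" and e: "0 < e"
    have "t \<in> topspace (top_of_set {0..})" using t by simp
    from cm[unfolded ES.continuous_map_to_metric, rule_format, OF this e]
    obtain V where V: "openin (top_of_set {0..}) V" "t \<in> V" "\<And>s. s \<in> V \<Longrightarrow> U s \<in> ES.mball (U t) e"
      by blast
    obtain d where d: "d > 0" "\<And>s. s \<in> {0..} \<Longrightarrow> dist s t < d \<Longrightarrow> s \<in> V"
      using V(1)[unfolded openin_euclidean_subtopology_iff] V(2) by (elim conjE) blast
    show "\<exists>d>0. \<forall>s\<in>{0..}. dist s t < d \<longrightarrow> dist (?W s) (?W t) < e"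
    proof (intro exI[of _ d] conjI ballI impI d(1))
      fix s assume "s \<in> {0..}" "dist s t < d"
      then have "U s \<in> ES.mball (U t) e" by (intro V(3) d(2))
      then have "E_dist \<Omega> (U t) (U s) < e" "U t \<in> E \<Omega>" "U s \<in> E \<Omega>" by (auto simp: ES.mball_def)
      then show "dist (?W s) (?W t) < e" using E_dist_eq[of "U t" "U s"] unfolding dist_norm norm_minus_commute[of "?W s" "?W t"] by simp
    qed
  qed
  have gc: "continuous_on {0..} (\<lambda>t. grad \<Omega> (fst (U t)))" and vc: "continuous_on {0..} (\<lambda>t. snd (U t))"
    using continuous_on_fst[OF W] continuous_on_snd[OF W] by simp_all
  have "continuous_on {0..} (\<lambda>t. superpose f (fst (U t)))"
    unfolding continuous_on_def
  proof
    fix t :: real assume t: "t \<in> {0..}"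
    show "((\<lambda>t. superpose f (fst (U t))) \<longlongrightarrow> superpose f (fst (U t))) (at t within {0..})"
    proof (rule superpose_tendsto)
      show "\<forall>\<^sub>F s in at t within {0..}. fst (U s) \<in> H10 \<Omega>"
        unfolding eventually_at_filter by (rule always_eventually) (use H in auto)
    qed (use H t gc in \<open>auto simp: continuous_on_def\<close>)
  qed
  then have fc: "continuous_on {0..} (forcing g (\<lambda>t. fst (U t)) (\<lambda>t. snd (U t)))"
    by (intro continuous_intros vc)
  show "forced_wave (\<lambda>t. fst (U t)) (\<lambda>t. snd (U t)) (forcing g (\<lambda>t. fst (U t)) (\<lambda>t. snd (U t)))"
    unfolding forced_wave_def
  proof (intro conjI allI ballI impI gc vc fc H)
    show "((\<lambda>t. fst (U t)) has_vector_derivative snd (U t)) (at t within {0..})" if "0 \<le> t" for t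
      using sol that by (simp add: energy_solution_def)
    fix \<phi> :: "real L2" and t :: real assume "\<phi> \<in> H10 \<Omega>" "0 \<le> t"
    then have "((\<lambda>s. snd (U s) \<bullet> \<phi>) has_real_derivative
           (g \<bullet> \<phi> - \<gamma> * (snd (U t) \<bullet> \<phi>) - flux \<Omega> b (fst (U t)) \<bullet> grad \<Omega> \<phi> - superpose f (fst (U t)) \<bullet> \<phi>)) (at t within {0..})"
      using sol by (simp add: energy_solution_def)
    then show "((\<lambda>s. snd (U s) \<bullet> \<phi>) has_real_derivative
        (forcing g (\<lambda>t. fst (U t)) (\<lambda>t. snd (U t)) t \<bullet> \<phi> - coeff_op b (grad \<Omega> (fst (U t))) \<bullet> grad \<Omega> \<phi>)) (at t within {0..})"
      by (simp add: flux_eq inner_diff_left algebra_simps)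
  qed
qed

text \<open>The energy of the difference of two solutions satisfies a Gronwall inequality, because the
  nonlinearity is Lipschitz continuous from bounded subsets of \<open>H\<^sup>1\<^sub>0\<close> to \<open>L\<^sup>2\<close>.\<close>

lemma energy_solution_unique:
  assumes solU: "energy_solution \<Omega> b \<gamma> f g \<xi> U" and solV: "energy_solution \<Omega> b \<gamma> f g \<xi> V" and T: "0 \<le> T"
  shows "U T = V T"
proof -
  let ?u1 = "\<lambda>t. fst (U t)" and ?v1 = "\<lambda>t. snd (U t)" and ?u2 = "\<lambda>t. fst (V t)" and ?v2 = "\<lambda>t. snd (V t)"
  define u v where "u t = ?u1 t - ?u2 t" and "v t = ?v1 t - ?v2 t" for t
  define h where "h t = forcing g ?u1 ?v1 t - forcing g ?u2 ?v2 t" for t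
  note w1 = energy_solution_forced_wave(2)[OF solU] and w2 = energy_solution_forced_wave(2)[OF solV]
  have w: "forced_wave u v h" unfolding u_def[abs_def] v_def[abs_def] h_def[abs_def] by (rule forced_wave_diff[OF w1 w2])
  have H: "?u1 t \<in> H10 \<Omega>" "?u2 t \<in> H10 \<Omega>" if "0 \<le> t" for t using w1 w2 that by (auto simp: forced_wave_def)
  have "continuous_on {0..T} (\<lambda>t. grad \<Omega> (?u1 t))" "continuous_on {0..T} (\<lambda>t. grad \<Omega> (?u2 t))"
    using w1 w2 by (auto simp: forced_wave_def elim: continuous_on_subset)
  then have "bounded ((\<lambda>t. grad \<Omega> (?u1 t)) ` {0..T} \<union> (\<lambda>t. grad \<Omega> (?u2 t)) ` {0..T})"
    by (auto intro!: compact_imp_bounded compact_continuous_image)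
  then obtain r where r: "\<And>t. 0 \<le> t \<Longrightarrow> t \<le> T \<Longrightarrow> norm (grad \<Omega> (?u1 t)) \<le> r \<and> norm (grad \<Omega> (?u2 t)) \<le> r"
    unfolding bounded_iff by fastforce
  define L where "L = growth * cubic_const r"
  have L0: "0 \<le> L" by (simp add: L_def growth_nonneg cubic_const_def)
  define c where "c = L / \<nu> + L"
  have lower: "(norm (v t))\<^sup>2 + \<nu> * (norm (grad \<Omega> (u t)))\<^sup>2 \<le> energy u v t" for t
    using coeff_op_coercive[OF elliptic, of "grad \<Omega> (u t)"] by (simp add: energy_def power2_norm_eq_inner)
  have growth_bound: "2 * (h t \<bullet> v t) \<le> c * energy u v t" if t: "0 \<le> t" "t \<le> T" for t
  proof -
    let ?n = "norm (grad \<Omega> (u t))" and ?m = "norm (v t)"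
    let ?d = "superpose f (?u1 t) - superpose f (?u2 t)"
    have "norm ?d \<le> L * ?n"
      using superpose_Lipschitz[of "?u1 t" r "?u2 t"] H[OF t(1)] r[OF t] by (simp add: L_def u_def mult.assoc)
    then have "norm ?d * ?m \<le> L * ?n * ?m" by (rule mult_right_mono) simp
    moreover have "- (?d \<bullet> v t) \<le> norm ?d * ?m" using Cauchy_Schwarz_ineq2[of ?d "v t"] by linarith
    moreover have "h t \<bullet> v t = - \<gamma> * (v t \<bullet> v t) - ?d \<bullet> v t"
      by (simp add: h_def v_def algebra_simps inner_diff_left inner_diff_right)
    moreover have "0 \<le> \<gamma> * (v t \<bullet> v t)" using damping by simp
    ultimately have "h t \<bullet> v t \<le> L * ?n * ?m" by linarith
    moreover have "L * (2 * ?n * ?m) \<le> L * (?n\<^sup>2 + ?m\<^sup>2)" using L0 by (intro mult_left_mono sum_squares_bound)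
    ultimately have "2 * (h t \<bullet> v t) \<le> L * ?n\<^sup>2 + L * ?m\<^sup>2" by (simp add: algebra_simps)
    moreover have "L / \<nu> * (\<nu> * ?n\<^sup>2) \<le> L / \<nu> * energy u v t"
      using lower[of t] L0 nu_pos zero_le_power2[of ?m] by (intro mult_left_mono) (linarith, simp)
    moreover have "L * ?m\<^sup>2 \<le> L * energy u v t"
    proof (rule mult_left_mono[OF _ L0])
      have "0 \<le> \<nu> * ?n\<^sup>2" using nu_pos by simp
      then show "?m\<^sup>2 \<le> energy u v t" using lower[of t] by linarith
    qed
    ultimately show ?thesis using nu_pos by (simp add: c_def distrib_right)
  qed
  have "exp (- c * T) * energy u v T \<le> exp (- c * 0) * energy u v 0"
  proof (rule nonpos_derivative_imp_le_initial[OF T, where e = "\<lambda>t. exp (- c * t) * energy u v t"])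
    fix t assume t: "0 \<le> t" "t \<le> T"
    show "((\<lambda>t. exp (- c * t) * energy u v t) has_real_derivative exp (- c * t) * (2 * (h t \<bullet> v t) - c * energy u v t)) (at t within {0..})"
      by (rule derivative_eq_intros energy_identity[OF w t(1)] refl | simp add: algebra_simps)+
    show "exp (- c * t) * (2 * (h t \<bullet> v t) - c * energy u v t) \<le> 0"
      using growth_bound[OF t] by (intro mult_nonneg_nonpos) auto
  qed
  moreover have "energy u v 0 = 0"
  proof -
    have "U 0 = V 0" using solU solV by (simp add: energy_solution_def)
    then show ?thesis by (simp add: energy_def u_def v_def grad_zero)
  qed
  ultimately have "exp (- c * T) * energy u v T \<le> 0" by simp
  then have "energy u v T \<le> 0" by (simp add: mult_le_0_iff)
  then have "(norm (v T))\<^sup>2 + \<nu> * (norm (grad \<Omega> (u T)))\<^sup>2 \<le> 0" using lower[of T] by linarith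
  moreover have "0 \<le> (norm (v T))\<^sup>2" "0 \<le> \<nu> * (norm (grad \<Omega> (u T)))\<^sup>2" using nu_pos by auto
  ultimately have "(norm (v T))\<^sup>2 = 0" "\<nu> * (norm (grad \<Omega> (u T)))\<^sup>2 = 0" by linarith+
  then have "v T = 0" "norm (grad \<Omega> (u T)) = 0" using nu_pos by auto
  moreover have "norm (u T) \<le> pc * norm (grad \<Omega> (u T))" by (rule poincare) (use w T in \<open>simp add: forced_wave_def\<close>)
  ultimately show ?thesis by (simp add: u_def v_def prod_eq_iff)
qed

text \<open>The value of the solution operator at points without an energy solution: the description has the
  same empty predicate at all times and all such points.\<close>

definition no_state :: state where "no_state = (THE \<zeta>. False)"

lemma sol_op_eq:
  assumes "energy_solution \<Omega> b \<gamma> f g \<xi> U" "0 \<le> t" shows "sol_op \<Omega> b \<gamma> f g t \<xi> = U t"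
  unfolding sol_op_def using assms energy_solution_unique by (intro the_equality) blast+

lemma sol_op_none:
  assumes "\<nexists>U. energy_solution \<Omega> b \<gamma> f g \<xi> U" shows "sol_op \<Omega> b \<gamma> f g t \<xi> = no_state"
proof -
  have "(\<lambda>\<zeta>. \<exists>U. energy_solution \<Omega> b \<gamma> f g \<xi> U \<and> U t = \<zeta>) = (\<lambda>_. False)" using assms by auto
  then show ?thesis by (simp only: sol_op_def no_state_def)
qed

end

section \<open>An equilibrium on the attractor\<close>

context damped_wave begin

text \<open>Twice the mechanical energy; along solutions it decreases at the rate \<open>2 * \<gamma> * (norm v)\<^sup>2\<close>.\<close>

definition lyapunov :: "real L2 \<Rightarrow> state \<Rightarrow> real" where
  "lyapunov g \<xi> = snd \<xi> \<bullet> snd \<xi> + coeff_op b (grad \<Omega> (fst \<xi>)) \<bullet> grad \<Omega> (fst \<xi>)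
     + 2 * potential (fst \<xi>) - 2 * (g \<bullet> fst \<xi>)"

lemma lyapunov_derivative:
  assumes sol: "energy_solution \<Omega> b \<gamma> f g \<xi> U" and t: "0 \<le> t"
  shows "((\<lambda>s. lyapunov g (U s)) has_real_derivative - 2 * \<gamma> * (snd (U t) \<bullet> snd (U t))) (at t within {0..})"
proof -
  let ?u = "\<lambda>t. fst (U t)" and ?v = "\<lambda>t. snd (U t)"
  note w = energy_solution_forced_wave(2)[OF sol]
  have ud: "(?u has_vector_derivative ?v t) (at t within {0..})" using w t by (simp add: forced_wave_def)
  have P: "((\<lambda>s. potential (?u s)) has_real_derivative superpose f (?u t) \<bullet> ?v t) (at t within {0..})"
    by (rule potential_derivative) (use w t in \<open>auto simp: forced_wave_def\<close>)
  have G: "((\<lambda>s. g \<bullet> ?u s) has_real_derivative g \<bullet> ?v t) (at t within {0..})"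
    unfolding has_real_derivative_iff_has_vector_derivative
    by (rule bounded_linear.has_vector_derivative[OF bounded_linear_inner_right ud])
  have "((\<lambda>s. energy ?u ?v s + 2 * potential (?u s) - 2 * (g \<bullet> ?u s)) has_real_derivative
      2 * (forcing g ?u ?v t \<bullet> ?v t) + 2 * (superpose f (?u t) \<bullet> ?v t) - 2 * (g \<bullet> ?v t)) (at t within {0..})"
    by (intro DERIV_diff DERIV_add DERIV_cmult energy_identity[OF w t] P G)
  moreover have "2 * (forcing g ?u ?v t \<bullet> ?v t) + 2 * (superpose f (?u t) \<bullet> ?v t) - 2 * (g \<bullet> ?v t) = - 2 * \<gamma> * (?v t \<bullet> ?v t)"
    by (simp add: inner_diff_left)
  ultimately show ?thesis by (simp only: lyapunov_def energy_def)
qed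

lemma lyapunov_tendsto:
  assumes x: "\<And>n. x n \<in> E \<Omega>" and l: "l \<in> E \<Omega>" and lim: "(\<lambda>n. E_dist \<Omega> (x n) l) \<longlonglongrightarrow> 0"
  shows "(\<lambda>n. lyapunov g (x n)) \<longlonglongrightarrow> lyapunov g l"
proof -
  have H: "fst (x n) \<in> H10 \<Omega>" "fst l \<in> H10 \<Omega>" for n using x[of n] l by (auto simp: E_def)
  have "(\<lambda>n. norm ((grad \<Omega> (fst (x n)), snd (x n)) - (grad \<Omega> (fst l), snd l))) \<longlonglongrightarrow> 0"
    using lim by (simp only: E_dist_eq[OF x l])
  then have W: "(\<lambda>n. (grad \<Omega> (fst (x n)), snd (x n))) \<longlonglongrightarrow> (grad \<Omega> (fst l), snd l)"
    by (rule LIM_zero_cancel[OF tendsto_norm_zero_cancel])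
  have gl: "(\<lambda>n. grad \<Omega> (fst (x n))) \<longlonglongrightarrow> grad \<Omega> (fst l)" and vl: "(\<lambda>n. snd (x n)) \<longlonglongrightarrow> snd l"
    using tendsto_fst[OF W] tendsto_snd[OF W] by simp_all
  have "(\<lambda>n. pc * norm (grad \<Omega> (fst (x n)) - grad \<Omega> (fst l))) \<longlonglongrightarrow> pc * norm (grad \<Omega> (fst l) - grad \<Omega> (fst l))"
    by (intro tendsto_intros gl)
  then have lim0: "(\<lambda>n. pc * norm (grad \<Omega> (fst (x n)) - grad \<Omega> (fst l))) \<longlonglongrightarrow> 0" by simp
  have "\<forall>\<^sub>F n in sequentially. norm (fst (x n) - fst l) \<le> pc * norm (grad \<Omega> (fst (x n)) - grad \<Omega> (fst l))"
  proof (rule always_eventually, rule allI)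
    fix n show "norm (fst (x n) - fst l) \<le> pc * norm (grad \<Omega> (fst (x n)) - grad \<Omega> (fst l))"
      using poincare[OF H10_diff[OF H(1) H(2)], of n] by (simp only: grad_diff[OF H])
  qed
  then have "(\<lambda>n. fst (x n) - fst l) \<longlonglongrightarrow> 0" by (rule Lim_null_comparison) (rule lim0)
  then have ul: "(\<lambda>n. fst (x n)) \<longlonglongrightarrow> fst l" by (rule LIM_zero_cancel)
  have "(\<lambda>n. potential (fst (x n))) \<longlonglongrightarrow> potential (fst l)"
    by (rule potential_tendsto[OF H(2) _ gl ul]) (simp add: H)
  then show ?thesis unfolding lyapunov_def by (intro tendsto_intros vl gl ul A.tendsto)
qed

lemma lyapunov_attains_min:
  assumes A: "compactin (E_topology \<Omega>) A" "A \<noteq> {}"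
  shows "\<exists>y\<in>A. \<forall>x\<in>A. lyapunov g y \<le> lyapunov g x"
proof -
  interpret ES: Metric_space "E \<Omega>" "E_dist \<Omega>" by (rule E_metric)
  have AE: "A \<subseteq> E \<Omega>" using compactin_subset_topspace[OF A(1)] by simp
  have "compact (lyapunov g ` A)"
    unfolding compact_def
  proof (intro allI impI)
    fix z :: "nat \<Rightarrow> real" assume "\<forall>n. z n \<in> lyapunov g ` A"
    then have "\<forall>n. \<exists>x. x \<in> A \<and> z n = lyapunov g x" by blast
    from choice[OF this] obtain x where x: "\<And>n. x n \<in> A" "\<And>n. z n = lyapunov g (x n)" by blast
    have "range x \<subseteq> A" using x(1) by blast
    then obtain l r where l: "l \<in> A" "strict_mono (r :: nat \<Rightarrow> nat)" "limitin ES.mtopology (x \<circ> r) l sequentially"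
      using A(1)[unfolded ES.compactin_sequentially] by blast
    have "(\<lambda>n. E_dist \<Omega> ((x \<circ> r) n) l) \<longlonglongrightarrow> 0" using l(3) by (simp add: ES.limitin_metric_dist_null)
    then have "(\<lambda>n. lyapunov g ((x \<circ> r) n)) \<longlonglongrightarrow> lyapunov g l"
      using x(1) l(1) AE by (intro lyapunov_tendsto) auto
    moreover have "z \<circ> r = (\<lambda>n. lyapunov g ((x \<circ> r) n))" using x(2) by (simp add: fun_eq_iff)
    ultimately have "(z \<circ> r) \<longlonglongrightarrow> lyapunov g l" by (simp only:)
    then show "\<exists>l\<in>lyapunov g ` A. \<exists>r. strict_mono r \<and> (z \<circ> r) \<longlonglongrightarrow> l" using l(1,2) by blast
  qed
  from compact_attains_inf[OF this] A(2) show ?thesis by auto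
qed

definition "equilibrium_bound s = 1 + (pc * s + K1 * measure lebesgue \<Omega>) / \<nu>"

text \<open>A trajectory that starts at a minimiser of the Lyapunov function and stays in the attractor
  cannot lower it, so its velocity vanishes identically.  The minimiser then solves the stationary
  equation; tested with itself, this bounds it through the coercivity of the elliptic operator and
  the lower bound on \<open>f s * s\<close>.  The condition on \<open>no_state\<close> ensures that every point of the attractor
  has a trajectory.\<close>

lemma attractor_contains_equilibrium:
  assumes att: "compactin (E_topology \<Omega>) A" "A \<noteq> {}" "\<And>t. 0 \<le> t \<Longrightarrow> sol_op \<Omega> b \<gamma> f g t ` A = A"
    and none: "fst no_state \<notin> H10 \<Omega>"
  shows "\<exists>y\<in>A. E_norm \<Omega> y \<le> equilibrium_bound (norm g)"
proof -
  interpret ES: Metric_space "E \<Omega>" "E_dist \<Omega>" by (rule E_metric)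
  have AE: "A \<subseteq> E \<Omega>" using compactin_subset_topspace[OF att(1)] by simp
  obtain y where y: "y \<in> A" "\<And>x. x \<in> A \<Longrightarrow> lyapunov g y \<le> lyapunov g x"
    using lyapunov_attains_min[OF att(1,2)] by blast
  obtain U where U: "energy_solution \<Omega> b \<gamma> f g y U"
  proof (rule ccontr)
    assume "\<not> thesis"
    then have "sol_op \<Omega> b \<gamma> f g 0 y = no_state" using that by (intro sol_op_none) blast
    then have "no_state \<in> A" using att(3)[of 0] y(1) by force
    then show False using subsetD[OF AE] none by (auto simp: E_def mem_Times_iff)
  qed
  have U0: "U 0 = y" using U by (simp add: energy_solution_def)
  have UA: "U t \<in> A" if "0 \<le> t" for t using sol_op_eq[OF U that] att(3)[OF that] y(1) by force
  have const: "lyapunov g (U t) = lyapunov g y" if t: "0 \<le> t" for t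
  proof (rule antisym)
    have "lyapunov g (U t) \<le> lyapunov g (U 0)"
    proof (rule nonpos_derivative_imp_le_initial[OF t])
      fix s assume s: "0 \<le> s" "s \<le> t"
      show "((\<lambda>s. lyapunov g (U s)) has_real_derivative - 2 * \<gamma> * (snd (U s) \<bullet> snd (U s))) (at s within {0..})"
        by (rule lyapunov_derivative[OF U s(1)])
      show "- 2 * \<gamma> * (snd (U s) \<bullet> snd (U s)) \<le> 0" using damping by simp
    qed
    then show "lyapunov g (U t) \<le> lyapunov g y" by (simp add: U0)
  qed (rule y(2)[OF UA[OF t]])
  have v0: "snd (U t) = 0" if t: "0 \<le> t" for t
    using derivative_of_constant_on_halfline[OF lyapunov_derivative[OF U t] t const] damping by simp
  let ?u = "fst y"
  have uH: "?u \<in> H10 \<Omega>" using y(1) AE by (auto simp: E_def)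
  have "((\<lambda>s. snd (U s) \<bullet> ?u) has_real_derivative
      (g \<bullet> ?u - \<gamma> * (snd (U 0) \<bullet> ?u) - flux \<Omega> b (fst (U 0)) \<bullet> grad \<Omega> ?u - superpose f (fst (U 0)) \<bullet> ?u)) (at 0 within {0..})"
    by (rule U[unfolded energy_solution_def, THEN conjunct2, THEN conjunct2, THEN conjunct2, rule_format, OF uH order_refl])
  from derivative_of_constant_on_halfline[OF this order_refl, of 0]
  have "coeff_op b (grad \<Omega> ?u) \<bullet> grad \<Omega> ?u = g \<bullet> ?u - superpose f ?u \<bullet> ?u"
    using v0[OF order_refl] v0 U0 by (simp add: flux_eq)
  moreover have "\<nu> * (norm (grad \<Omega> ?u))\<^sup>2 \<le> coeff_op b (grad \<Omega> ?u) \<bullet> grad \<Omega> ?u" by (rule coeff_op_coercive[OF elliptic])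
  moreover have "- K1 * measure lebesgue \<Omega> \<le> superpose f ?u \<bullet> ?u" by (rule superpose_inner_ge[OF uH])
  moreover have "g \<bullet> ?u \<le> norm g * (pc * norm (grad \<Omega> ?u))"
    using norm_cauchy_schwarz[of g ?u] mult_left_mono[OF poincare[OF uH], of "norm g"] by simp
  ultimately have est: "\<nu> * (norm (grad \<Omega> ?u))\<^sup>2 \<le> norm g * (pc * norm (grad \<Omega> ?u)) + K1 * measure lebesgue \<Omega>" by linarith
  define n where "n = norm (grad \<Omega> ?u)"
  define c where "c = pc * norm g + K1 * measure lebesgue \<Omega>"
  have K: "0 \<le> K1 * measure lebesgue \<Omega>" using nonlinearity by (simp add: admissible_nonlinearity_def)
  have c0: "0 \<le> c" using K pc_pos by (simp add: c_def)
  \<comment> \<open>The summand \<open>1\<close> in the bound avoids solving the quadratic inequality.\<close>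
  have "n \<le> 1 + c / \<nu>"
  proof (cases "n \<le> 1")
    case True
    then show ?thesis using c0 nu_pos by (simp add: add_increasing2)
  next
    case False
    have "\<nu> * n * n \<le> pc * norm g * n + K1 * measure lebesgue \<Omega> * 1" using est by (simp add: n_def power2_eq_square algebra_simps)
    also have "\<dots> \<le> c * n" using False K unfolding c_def distrib_right by (intro add_left_mono mult_left_mono) auto
    finally have "\<nu> * n \<le> c" using False by simp
    then have "n \<le> c / \<nu>" using nu_pos by (simp add: field_simps)
    then show ?thesis by simp
  qed
  moreover have "E_norm \<Omega> y = n" using v0[of 0] U0 by (simp add: E_norm_def n_def)
  ultimately show ?thesis using y(1) by (auto simp: equilibrium_bound_def c_def)
qed

end

section \<open>The distance between the attractors\<close>

context bounded_domain begin

lemma Em1_norm_minus: "Em1_norm \<Omega> (- \<xi>) = Em1_norm \<Omega> \<xi>"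
  by (simp add: Em1_norm_def Hm1_norm_def)

lemma E_norm_eq: "E_norm \<Omega> \<xi> = norm (grad \<Omega> (fst \<xi>), snd \<xi>)"
  by (simp add: E_norm_def norm_Pair)

lemma Em1_diff_le_E_norm:
  assumes "\<xi> \<in> E \<Omega>" "\<eta> \<in> E \<Omega>"
  shows "Em1_norm \<Omega> (\<xi> - \<eta>) \<le> pc * (E_norm \<Omega> \<xi> + E_norm \<Omega> \<eta>)"
proof -
  have "Em1_norm \<Omega> (\<xi> - \<eta>) \<le> pc * E_norm \<Omega> (\<xi> - \<eta>)"
    using assms by (intro Em1_le_E_norm) (auto simp: E_def intro: H10_diff)
  also have "\<dots> \<le> pc * (E_norm \<Omega> \<xi> + E_norm \<Omega> \<eta>)"
    using E_dist_eq[OF assms] norm_triangle_ineq4[of "(grad \<Omega> (fst \<xi>), snd \<xi>)" "(grad \<Omega> (fst \<eta>), snd \<eta>)"] pc_pos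
    unfolding E_norm_eq[of \<xi>] E_norm_eq[of \<eta>] E_dist_def[symmetric] by (intro mult_left_mono) auto
  finally show ?thesis .
qed

text \<open>Attraction applied to a single point.  The infimum need not be attained, hence the slack \<open>e\<close>, and the
  bound may be negative, hence the maximum.\<close>

lemma exp_attracting_point:
  assumes att: "exp_attracting \<Omega> S A \<sigma> m" and \<xi>: "\<xi> \<in> E \<Omega>" and t: "0 \<le> t" and e: "0 < e"
  shows "\<exists>y\<in>A. E_dist \<Omega> (S t \<xi>) y < max 0 (m (E_norm \<Omega> \<xi>)) * exp (- \<sigma> * t) + e"
proof -
  interpret ES: Metric_space "E \<Omega>" "E_dist \<Omega>" by (rule E_metric)
  let ?r = "max 0 (m (E_norm \<Omega> \<xi>)) * exp (- \<sigma> * t)"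
  have "ES.mbounded {\<xi>}" using \<xi> by (simp add: ES.mbounded_insert ES.mbounded_empty)
  then have "semidist (E_dist \<Omega>) (S t ` {\<xi>}) A \<le> ennreal (m (E_set_norm \<Omega> {\<xi>}) * exp (- \<sigma> * t))"
    using att t by (simp only: exp_attracting_def)
  then have "(INF y\<in>A. ennreal (E_dist \<Omega> (S t \<xi>) y)) \<le> ennreal (m (E_norm \<Omega> \<xi>) * exp (- \<sigma> * t))"
    by (simp add: semidist_def E_set_norm_def)
  also have "\<dots> \<le> ennreal ?r" by (intro ennreal_leI mult_right_mono) auto
  also have "\<dots> < ennreal (?r + e)" using e by (intro ennreal_lessI) (auto intro: add_nonneg_pos)
  finally obtain y where "y \<in> A" "ennreal (E_dist \<Omega> (S t \<xi>) y) < ennreal (?r + e)" by (auto simp: INF_less_iff)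
  then show ?thesis by (auto simp: ennreal_less_iff)
qed

end

context damped_wave begin

definition "H10_gap r = infdist (fst no_state) {u \<in> H10 \<Omega>. norm (grad \<Omega> u) \<le> r}"

lemma zero_in_H10_ball: "0 \<le> r \<Longrightarrow> 0 \<in> {u \<in> H10 \<Omega>. norm (grad \<Omega> u) \<le> r}"
  by (simp add: H10_zero grad_zero)

text \<open>A limit in \<open>L\<^sup>2\<close> of a sequence bounded in \<open>H\<^sup>1\<^sub>0\<close> stays in \<open>H\<^sup>1\<^sub>0\<close>, so the ball cannot approach a
  point outside.\<close>

lemma H10_gap_pos:
  assumes "fst no_state \<notin> H10 \<Omega>" "0 \<le> r" shows "0 < H10_gap r"
proof -
  have c: "fst no_state \<notin> closure {u \<in> H10 \<Omega>. norm (grad \<Omega> u) \<le> r}"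
  proof
    assume "fst no_state \<in> closure {u \<in> H10 \<Omega>. norm (grad \<Omega> u) \<le> r}"
    then have "\<exists>u. (\<forall>n. u n \<in> {u \<in> H10 \<Omega>. norm (grad \<Omega> u) \<le> r}) \<and> u \<longlonglongrightarrow> fst no_state"
      by (simp only: closure_sequential)
    then obtain u where u: "\<forall>n. u n \<in> {u \<in> H10 \<Omega>. norm (grad \<Omega> u) \<le> r}" "u \<longlonglongrightarrow> fst no_state" by (elim exE conjE)
    have "fst no_state \<in> H10 \<Omega>" by (rule H10_ball_closed[OF _ _ u(2), of r]) (use u(1) in simp_all)
    then show False using assms(1) by simp
  qed
  have ne: "{u \<in> H10 \<Omega>. norm (grad \<Omega> u) \<le> r} \<noteq> {}" using zero_in_H10_ball[OF assms(2)] by blast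
  have "infdist (fst no_state) {u \<in> H10 \<Omega>. norm (grad \<Omega> u) \<le> r} \<noteq> 0"
    using c unfolding in_closure_iff_infdist_zero[OF ne] .
  then show ?thesis using infdist_nonneg[of "fst no_state" "{u \<in> H10 \<Omega>. norm (grad \<Omega> u) \<le> r}"] unfolding H10_gap_def by linarith
qed

text \<open>If \<open>fst no_state\<close> is outside \<open>H10 \<Omega>\<close>, the trajectory estimate at time \<open>0\<close>, applied to a point without
  a solution, bounds \<open>H10_gap r\<close> by \<open>m1 * \<delta>\<close>.  So \<open>gap_ratio m1 r * \<delta> \<ge> 1\<close>, and constants may be replaced by multiples of \<open>\<delta>\<close>.\<close>

definition "gap_ratio m1 r = (if fst no_state \<in> H10 \<Omega> then 0 else max 0 m1 / H10_gap r)"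

text \<open>The four summands serve, in this order, the trajectory error, the attraction, the case
  \<open>\<delta> \<ge> 1\<close>, and points without a solution.\<close>

definition "attractor_const s m0 m1 r = max 0 m1 + pc * max 0 m0 + (2 * (pc * r) + Em1_norm \<Omega> no_state)
  + pc * (r + equilibrium_bound s) * (1 + gap_ratio m1 r)"

lemma gap_ratio_mono:
  assumes "m1 \<le> m1'" "r \<le> r'" "0 \<le> r" shows "gap_ratio m1 r \<le> gap_ratio m1' r'"
proof (cases "fst no_state \<in> H10 \<Omega>")
  case False
  have "H10_gap r' \<le> H10_gap r"
    unfolding H10_gap_def by (rule infdist_mono) (use assms zero_in_H10_ball[of r] in auto)
  then show ?thesis using False H10_gap_pos[OF False, of r'] assms by (auto simp: gap_ratio_def intro!: frac_le)
qed (simp add: gap_ratio_def)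

lemma gap_ratio_nonneg: "0 \<le> gap_ratio m1 r"
  by (simp add: gap_ratio_def H10_gap_def infdist_nonneg)

lemma equilibrium_bound_mono: "s \<le> s' \<Longrightarrow> equilibrium_bound s \<le> equilibrium_bound s'"
  using pc_pos nu_pos by (simp add: equilibrium_bound_def divide_right_mono mult_left_mono)

lemma equilibrium_bound_nonneg: "0 \<le> s \<Longrightarrow> 0 \<le> equilibrium_bound s"
  using pc_pos nu_pos nonlinearity by (simp add: equilibrium_bound_def admissible_nonlinearity_def)

lemma attractor_const_mono:
  assumes "s \<le> s'" "m0 \<le> m0'" "m1 \<le> m1'" "r \<le> r'" "0 \<le> s" "0 \<le> r"
  shows "attractor_const s m0 m1 r \<le> attractor_const s' m0' m1' r'"
  unfolding attractor_const_def
proof (intro add_mono mult_mono order_refl gap_ratio_mono equilibrium_bound_mono max.mono assms)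
  show "0 \<le> pc * (r' + equilibrium_bound s')"
    using pc_pos equilibrium_bound_nonneg[of s'] assms by simp
  show "0 \<le> r + equilibrium_bound s" using equilibrium_bound_nonneg[of s] assms by simp
  show "0 \<le> 1 + gap_ratio m1 r" using gap_ratio_nonneg[of m1 r] by simp
qed (use pc_pos assms in auto)

end

context damped_wave begin

text \<open>The case distinction is whether the limit flow takes values in the phase space.  If it does
  not, the point has no trajectory, and the gap estimate applies.\<close>

lemma attractor_point_dichotomy:
  assumes exp: "exp_attracting \<Omega> (sol_op \<Omega> b \<gamma> f g) A0 \<sigma> m" and m: "mono_on {0..} m"
    and A0: "A0 \<subseteq> E \<Omega>"
    and A: "\<And>\<xi>. \<xi> \<in> A \<Longrightarrow> \<xi> \<in> E \<Omega> \<and> norm (grad \<Omega> (fst \<xi>)) \<le> \<rho> \<and> E_norm \<Omega> \<xi> \<le> \<rho>"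
    and inv: "\<And>\<xi> t. \<xi> \<in> A \<Longrightarrow> 0 \<le> t \<Longrightarrow> S t \<xi> \<in> A"
    and traj: "\<And>\<xi> t. \<xi> \<in> A \<Longrightarrow> 0 \<le> t \<Longrightarrow> Em1_norm \<Omega> (S t \<xi> - sol_op \<Omega> b \<gamma> f g t \<xi>) \<le> m1 * exp (K * t) * \<delta>"
    and \<xi>: "\<xi> \<in> A" and t: "0 \<le> t" and e: "0 < e"
  obtains y where "y \<in> A0" "Em1_norm \<Omega> (sol_op \<Omega> b \<gamma> f g t \<xi> - y) \<le> pc * (max 0 (m \<rho>) * exp (- \<sigma> * t)) + e"
  | "fst no_state \<notin> H10 \<Omega>" "H10_gap \<rho> \<le> m1 * \<delta>"
proof (cases "fst (sol_op \<Omega> b \<gamma> f g t \<xi>) \<in> H10 \<Omega>")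
  case True
  have xi: "\<xi> \<in> E \<Omega>" "E_norm \<Omega> \<xi> \<le> \<rho>" using A[OF \<xi>] by auto
  have n0: "0 \<le> E_norm \<Omega> \<xi>" by (simp add: E_norm_def)
  have "0 < e / pc" using e pc_pos by simp
  from exp_attracting_point[OF exp xi(1) t this] obtain y where y: "y \<in> A0"
    "E_dist \<Omega> (sol_op \<Omega> b \<gamma> f g t \<xi>) y < max 0 (m (E_norm \<Omega> \<xi>)) * exp (- \<sigma> * t) + e / pc" by blast
  have "m (E_norm \<Omega> \<xi>) \<le> m \<rho>" using n0 xi(2) by (intro mono_onD[OF m]) auto
  then have "max 0 (m (E_norm \<Omega> \<xi>)) * exp (- \<sigma> * t) \<le> max 0 (m \<rho>) * exp (- \<sigma> * t)"
    by (intro mult_right_mono max.mono) auto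
  then have le: "E_norm \<Omega> (sol_op \<Omega> b \<gamma> f g t \<xi> - y) \<le> max 0 (m \<rho>) * exp (- \<sigma> * t) + e / pc"
    using y(2) unfolding E_dist_def by linarith
  have "fst (sol_op \<Omega> b \<gamma> f g t \<xi> - y) \<in> H10 \<Omega>"
    using True subsetD[OF A0 y(1)] by (auto simp: E_def mem_Times_iff intro: H10_diff)
  then have "Em1_norm \<Omega> (sol_op \<Omega> b \<gamma> f g t \<xi> - y) \<le> pc * E_norm \<Omega> (sol_op \<Omega> b \<gamma> f g t \<xi> - y)" by (rule Em1_le_E_norm)
  also have "\<dots> \<le> pc * (max 0 (m \<rho>) * exp (- \<sigma> * t) + e / pc)" using le pc_pos by (intro mult_left_mono) auto
  also have "\<dots> = pc * (max 0 (m \<rho>) * exp (- \<sigma> * t)) + e" using pc_pos by (simp add: distrib_left)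
  finally show ?thesis by (rule that(1)[OF y(1)])
next
  case False
  have none: "\<nexists>U. energy_solution \<Omega> b \<gamma> f g \<xi> U"
  proof
    assume "\<exists>U. energy_solution \<Omega> b \<gamma> f g \<xi> U"
    then obtain U where U: "energy_solution \<Omega> b \<gamma> f g \<xi> U" by blast
    have "U t \<in> E \<Omega>" by (rule energy_solution_forced_wave(1)[OF U t])
    then show False using False sol_op_eq[OF U t] by (auto simp: E_def mem_Times_iff)
  qed
  note S0 = sol_op_none[OF none]
  have ns: "fst no_state \<notin> H10 \<Omega>" using False S0[of t] by simp
  have z: "S 0 \<xi> \<in> A" by (rule inv[OF \<xi> order_refl])
  have "H10_gap \<rho> \<le> dist (fst no_state) (fst (S 0 \<xi>))"
    unfolding H10_gap_def by (rule infdist_le) (use A[OF z] in \<open>auto simp: E_def mem_Times_iff\<close>)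
  also have "\<dots> = norm (fst (S 0 \<xi> - no_state))" by (simp add: dist_norm norm_minus_commute)
  also have "\<dots> \<le> Em1_norm \<Omega> (S 0 \<xi> - no_state)" by (rule norm_fst_le_Em1)
  also have "\<dots> \<le> m1 * \<delta>" using traj[OF \<xi> order_refl] S0[of 0] by simp
  finally show ?thesis by (rule that(2)[OF ns])
qed

lemma exists_small_exponential:
  assumes "0 < \<sigma>" "0 < e" shows "\<exists>t\<ge>0. c * exp (- \<sigma> * t) \<le> (e::real)"
proof -
  obtain n where n: "exp (- \<sigma>) ^ n < e / (\<bar>c\<bar> + 1)"
    using real_arch_pow_inv[of "e / (\<bar>c\<bar> + 1)" "exp (- \<sigma>)"] assms by auto
  have "exp (- \<sigma> * real n) = exp (- \<sigma>) ^ n" by (simp add: exp_of_nat_mult[symmetric] mult.commute)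
  then have "(\<bar>c\<bar> + 1) * exp (- \<sigma> * real n) \<le> e" using n by (simp add: pos_less_divide_eq mult.commute less_imp_le)
  moreover have "c * exp (- \<sigma> * real n) \<le> (\<bar>c\<bar> + 1) * exp (- \<sigma> * real n)" by (intro mult_right_mono) auto
  ultimately have "c * exp (- \<sigma> * real n) \<le> e" by linarith
  then show ?thesis by (intro exI[of _ "real n"]) auto
qed

text \<open>The growing trajectory error and the decaying distance to the attractor balance at the time
  \<open>t\<close> with \<open>exp (K * t) * \<delta> = exp (- \<sigma> * t)\<close>; both are then \<open>\<delta> powr (\<sigma> / (K + \<sigma>))\<close>.\<close>

lemma attractor_point_distance:
  assumes exp: "exp_attracting \<Omega> (sol_op \<Omega> b \<gamma> f g) A0 \<sigma> m" and m: "mono_on {0..} m"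
    and att: "global_attractor \<Omega> (sol_op \<Omega> b \<gamma> f g) A0"
    and A: "\<And>\<xi>. \<xi> \<in> A \<Longrightarrow> \<xi> \<in> E \<Omega> \<and> norm (grad \<Omega> (fst \<xi>)) \<le> \<rho> \<and> E_norm \<Omega> \<xi> \<le> \<rho>"
    and inv: "\<And>t. 0 \<le> t \<Longrightarrow> S t ` A = A"
    and traj: "\<And>\<xi> t. \<xi> \<in> A \<Longrightarrow> 0 \<le> t \<Longrightarrow> Em1_norm \<Omega> (S t \<xi> - sol_op \<Omega> b \<gamma> f g t \<xi>) \<le> m1 * exp (K * t) * \<delta>"
    and \<sigma>: "0 < \<sigma>" and K: "0 < K" and \<delta>: "0 \<le> \<delta>" and \<rho>: "0 \<le> \<rho>" and x: "x \<in> A" and e: "0 < e"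
  shows "\<exists>y\<in>A0. Em1_norm \<Omega> (x - y) \<le> attractor_const (norm g) (m \<rho>) m1 \<rho> * \<delta> powr (\<sigma> / (K + \<sigma>)) + e"
proof -
  interpret ES: Metric_space "E \<Omega>" "E_dist \<Omega>" by (rule E_metric)
  let ?S0 = "sol_op \<Omega> b \<gamma> f g" and ?\<kappa> = "\<sigma> / (K + \<sigma>)"
  let ?M = "attractor_const (norm g) (m \<rho>) m1 \<rho>"
  have comp: "compactin (E_topology \<Omega>) A0" and inv0: "\<And>t. 0 \<le> t \<Longrightarrow> ?S0 t ` A0 = A0"
    using att by (auto simp: global_attractor_def)
  have A0: "A0 \<subseteq> E \<Omega>" using compactin_subset_topspace[OF comp] by simp
  have xE: "x \<in> E \<Omega>" "E_norm \<Omega> x \<le> \<rho>" using A[OF x] by auto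
  have ne: "A0 \<noteq> {}" using exp_attracting_point[OF exp xE(1) order_refl zero_less_one] by blast
  have inv': "S t \<xi> \<in> A" if "\<xi> \<in> A" "0 \<le> t" for \<xi> t using inv[OF that(2)] that(1) by blast
  have kap: "0 < ?\<kappa>" "?\<kappa> \<le> 1" using \<sigma> K by auto
  define C where "C = pc * (\<rho> + equilibrium_bound (norm g))"
  have pos: "0 \<le> max 0 m1" "0 \<le> pc * max 0 (m \<rho>)" "0 \<le> 2 * (pc * \<rho>)" "0 \<le> Em1_norm \<Omega> no_state"
    "0 \<le> C" "0 \<le> C * gap_ratio m1 \<rho>"
    using pc_pos \<rho> Em1_norm_nonneg equilibrium_bound_nonneg[OF norm_ge_zero, of g] gap_ratio_nonneg by (auto simp: C_def)
  have M_eq: "?M = max 0 m1 + pc * max 0 (m \<rho>) + 2 * (pc * \<rho>) + Em1_norm \<Omega> no_state + C + C * gap_ratio m1 \<rho>"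
    by (simp add: attractor_const_def C_def distrib_left)
  have dichotomy: "(\<exists>y\<in>A0. Em1_norm \<Omega> (?S0 t \<xi> - y) \<le> pc * (max 0 (m \<rho>) * exp (- \<sigma> * t)) + e) \<or>
      (fst no_state \<notin> H10 \<Omega> \<and> H10_gap \<rho> \<le> m1 * \<delta>)" if "\<xi> \<in> A" "0 \<le> t" "0 < e" for \<xi> t e
    by (rule attractor_point_dichotomy[where S = S and A = A and \<rho> = \<rho> and \<xi> = \<xi> and t = t and e = e
          and K = K and ?m1.0 = m1 and \<delta> = \<delta>, OF exp m A0 A inv' traj that]) blast+
  have shift: "Em1_norm \<Omega> (x - y) \<le> Em1_norm \<Omega> (x - z) + Em1_norm \<Omega> (z - y)" for y z
    using Em1_norm_triangle[of "x - z" "z - y"] by simp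
  \<comment> \<open>The alternative of a positive gap: the equilibrium is close enough.\<close>
  have gap: ?thesis if ns: "fst no_state \<notin> H10 \<Omega>" and le: "H10_gap \<rho> \<le> m1 * \<delta>"
  proof -
    have gp: "0 < H10_gap \<rho>" by (rule H10_gap_pos[OF ns \<rho>])
    have dpos: "0 < \<delta>" using le gp \<delta> by (cases "\<delta> = 0") auto
    obtain y where y: "y \<in> A0" "E_norm \<Omega> y \<le> equilibrium_bound (norm g)"
      using attractor_contains_equilibrium[OF comp ne inv0 ns] by blast
    have "Em1_norm \<Omega> (x - y) \<le> pc * (E_norm \<Omega> x + E_norm \<Omega> y)" using xE(1) y(1) A0 by (intro Em1_diff_le_E_norm) auto
    also have "\<dots> \<le> C" unfolding C_def using xE(2) y(2) pc_pos by (intro mult_left_mono add_mono) auto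
    also have "C \<le> (C + C * gap_ratio m1 \<rho>) * \<delta> powr ?\<kappa>"
    proof (cases "1 \<le> \<delta>")
      case True
      then have "1 \<le> \<delta> powr ?\<kappa>" using kap by (intro ge_one_powr_ge_zero) auto
      then have "(C + C * gap_ratio m1 \<rho>) * 1 \<le> (C + C * gap_ratio m1 \<rho>) * \<delta> powr ?\<kappa>" using pos by (intro mult_left_mono) auto
      then have "C + C * gap_ratio m1 \<rho> \<le> (C + C * gap_ratio m1 \<rho>) * \<delta> powr ?\<kappa>" by (simp only: mult_1_right)
      moreover have "C \<le> C + C * gap_ratio m1 \<rho>" using pos(6) by simp
      ultimately show ?thesis by (rule order_trans[rotated])
    next
      case False
      have "\<delta> powr 1 \<le> \<delta> powr ?\<kappa>" using False dpos kap by (intro powr_mono') auto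
      then have dk: "\<delta> \<le> \<delta> powr ?\<kappa>" using dpos by simp
      have "m1 * \<delta> \<le> max 0 m1 * \<delta>" using dpos by (intro mult_right_mono) auto
      then have "H10_gap \<rho> \<le> max 0 m1 * \<delta>" using le by linarith
      then have "1 \<le> gap_ratio m1 \<rho> * \<delta>" using gp ns by (simp add: gap_ratio_def pos_le_divide_eq)
      also have "\<dots> \<le> gap_ratio m1 \<rho> * \<delta> powr ?\<kappa>" by (intro mult_left_mono dk gap_ratio_nonneg)
      finally have "C * 1 \<le> C * (gap_ratio m1 \<rho> * \<delta> powr ?\<kappa>)" using pos(5) by (rule mult_left_mono)
      moreover have "0 \<le> C * \<delta> powr ?\<kappa>" using pos(5) by simp
      ultimately show ?thesis by (simp add: distrib_right mult.assoc)
    qed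
    also have "\<dots> \<le> ?M * \<delta> powr ?\<kappa>" using pos by (intro mult_right_mono) (auto simp: M_eq)
    finally show ?thesis using y(1) e by (intro bexI[of _ y]) auto
  qed
  consider "\<delta> = 0" | "1 \<le> \<delta>" | "0 < \<delta>" "\<delta> < 1" using \<delta> by linarith
  then show ?thesis
  proof cases
    case 1
    obtain t where t: "0 \<le> t" "(pc * max 0 (m \<rho>)) * exp (- \<sigma> * t) \<le> e / 2"
      using exists_small_exponential[OF \<sigma>, of "e / 2"] e by auto
    obtain \<xi> where xi: "\<xi> \<in> A" "x = S t \<xi>" using inv[OF t(1)] x by blast
    have "0 < e / 2" using e by simp
    from dichotomy[OF xi(1) t(1) this] show ?thesis
    proof (elim disjE bexE conjE)
      fix y assume y: "y \<in> A0" "Em1_norm \<Omega> (?S0 t \<xi> - y) \<le> pc * (max 0 (m \<rho>) * exp (- \<sigma> * t)) + e / 2"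
      have "Em1_norm \<Omega> (x - ?S0 t \<xi>) \<le> 0" using traj[OF xi(1) t(1)] 1 xi(2) by simp
      then have "Em1_norm \<Omega> (x - y) \<le> e" using shift[of y "?S0 t \<xi>"] y(2) t(2) by (simp add: mult.assoc)
      then show ?thesis using y(1) 1 by auto
    qed (rule gap)
  next
    case 2
    obtain \<xi> where xi: "\<xi> \<in> A" "x = S 0 \<xi>" using inv[OF order_refl] x by blast
    from dichotomy[OF xi(1) order_refl e] show ?thesis
    proof (elim disjE bexE conjE)
      fix y assume y: "y \<in> A0" "Em1_norm \<Omega> (?S0 0 \<xi> - y) \<le> pc * (max 0 (m \<rho>) * exp (- \<sigma> * 0)) + e"
      have bound: "Em1_norm \<Omega> z \<le> pc * \<rho>" if "z \<in> A" for z
      proof -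
        have "Em1_norm \<Omega> z \<le> pc * E_norm \<Omega> z" using A[OF that] by (intro Em1_le_E_norm) (auto simp: E_def mem_Times_iff)
        also have "\<dots> \<le> pc * \<rho>" using A[OF that] pc_pos by (intro mult_left_mono) auto
        finally show ?thesis .
      qed
      have "Em1_norm \<Omega> (?S0 0 \<xi>) \<le> pc * \<rho> + Em1_norm \<Omega> no_state"
      proof (cases "\<exists>U. energy_solution \<Omega> b \<gamma> f g \<xi> U")
        case True
        then obtain U where U: "energy_solution \<Omega> b \<gamma> f g \<xi> U" by blast
        then have "?S0 0 \<xi> = \<xi>" using sol_op_eq[OF U order_refl] by (simp add: energy_solution_def)
        then show ?thesis using bound[OF xi(1)] pos by simp
      next
        case False
        have "0 \<le> pc * \<rho>" using pc_pos \<rho> by simp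
        then show ?thesis unfolding sol_op_none[OF False] by simp
      qed
      moreover have "Em1_norm \<Omega> (x - ?S0 0 \<xi>) \<le> Em1_norm \<Omega> x + Em1_norm \<Omega> (?S0 0 \<xi>)"
        using Em1_norm_triangle[of x "- ?S0 0 \<xi>"] by (simp add: Em1_norm_minus)
      ultimately have "Em1_norm \<Omega> (x - y) \<le> 2 * (pc * \<rho>) + Em1_norm \<Omega> no_state + pc * max 0 (m \<rho>) + e"
        using shift[of y "?S0 0 \<xi>"] y(2) bound[OF x] by simp
      also have "\<dots> \<le> ?M * 1 + e" unfolding M_eq mult_1_right using pos by linarith
      also have "\<dots> \<le> ?M * \<delta> powr ?\<kappa> + e"
        using 2 kap pos by (intro add_right_mono mult_left_mono ge_one_powr_ge_zero) (auto simp: M_eq)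
      finally show ?thesis using y(1) by blast
    qed (rule gap)
  next
    case 3
    define t where "t = - ln \<delta> / (K + \<sigma>)"
    have "0 \<le> - ln \<delta>" using 3 by simp
    then have t0: "0 \<le> t" unfolding t_def using K \<sigma> by (intro divide_nonneg_nonneg) auto
    have pw: "\<delta> powr ?\<kappa> = exp (?\<kappa> * ln \<delta>)" using 3 by (simp add: powr_def)
    have e1: "exp (- \<sigma> * t) = \<delta> powr ?\<kappa>" unfolding pw t_def by simp
    have "exp (K * t) * \<delta> = exp (K * t + ln \<delta>)" using 3 by (simp add: exp_add)
    also have "K * t + ln \<delta> = ?\<kappa> * ln \<delta>" using K \<sigma> by (simp add: t_def field_simps)
    finally have e2: "exp (K * t) * \<delta> = \<delta> powr ?\<kappa>" using pw by simp
    obtain \<xi> where xi: "\<xi> \<in> A" "x = S t \<xi>" using inv[OF t0] x by blast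
    from dichotomy[OF xi(1) t0 e] show ?thesis
    proof (elim disjE bexE conjE)
      fix y assume y: "y \<in> A0" "Em1_norm \<Omega> (?S0 t \<xi> - y) \<le> pc * (max 0 (m \<rho>) * exp (- \<sigma> * t)) + e"
      have "Em1_norm \<Omega> (x - ?S0 t \<xi>) \<le> m1 * \<delta> powr ?\<kappa>"
        using traj[OF xi(1) t0] unfolding xi(2) mult.assoc e2 .
      also have "\<dots> \<le> max 0 m1 * \<delta> powr ?\<kappa>" by (intro mult_right_mono) auto
      finally have "Em1_norm \<Omega> (x - y) \<le> (max 0 m1 + pc * max 0 (m \<rho>)) * \<delta> powr ?\<kappa> + e"
        using shift[of y "?S0 t \<xi>"] y(2) unfolding e1 by (simp add: distrib_right mult.assoc)
      also have "\<dots> \<le> ?M * \<delta> powr ?\<kappa> + e" using pos by (intro add_right_mono mult_right_mono) (auto simp: M_eq)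
      finally show ?thesis using y(1) by blast
    qed (rule gap)
  qed
qed

lemma attractor_semidist:
  assumes "exp_attracting \<Omega> (sol_op \<Omega> b \<gamma> f g) A0 \<sigma> m" "mono_on {0..} m"
    "global_attractor \<Omega> (sol_op \<Omega> b \<gamma> f g) A0"
    "\<And>\<xi>. \<xi> \<in> A \<Longrightarrow> \<xi> \<in> E \<Omega> \<and> norm (grad \<Omega> (fst \<xi>)) \<le> \<rho> \<and> E_norm \<Omega> \<xi> \<le> \<rho>"
    "\<And>t. 0 \<le> t \<Longrightarrow> S t ` A = A"
    "\<And>\<xi> t. \<xi> \<in> A \<Longrightarrow> 0 \<le> t \<Longrightarrow> Em1_norm \<Omega> (S t \<xi> - sol_op \<Omega> b \<gamma> f g t \<xi>) \<le> m1 * exp (K * t) * \<delta>"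
    "0 < \<sigma>" "0 < K" "0 \<le> \<delta>" "0 \<le> \<rho>"
  shows "semidist (Em1_dist \<Omega>) A A0 \<le> ennreal (attractor_const (norm g) (m \<rho>) m1 \<rho> * \<delta> powr (\<sigma> / (K + \<sigma>)))"
  unfolding semidist_def
proof (rule SUP_least, rule ennreal_le_epsilon)
  fix x and e :: real assume x: "x \<in> A" and e: "0 < e"
  let ?B = "attractor_const (norm g) (m \<rho>) m1 \<rho> * \<delta> powr (\<sigma> / (K + \<sigma>))"
  have M0: "0 \<le> attractor_const (norm g) (m \<rho>) m1 \<rho>"
    unfolding attractor_const_def using pc_pos assms(10) Em1_norm_nonneg equilibrium_bound_nonneg[OF norm_ge_zero, of g] gap_ratio_nonneg
    by (intro add_nonneg_nonneg mult_nonneg_nonneg) auto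
  then have B0: "0 \<le> ?B" by simp
  from attractor_point_distance[OF assms x e] obtain y where y: "y \<in> A0" "Em1_norm \<Omega> (x - y) \<le> ?B + e" by blast
  have "(INF y\<in>A0. ennreal (Em1_dist \<Omega> x y)) \<le> ennreal (Em1_dist \<Omega> x y)" by (rule INF_lower[OF y(1)])
  also have "\<dots> \<le> ennreal (?B + e)" using y(2) by (intro ennreal_leI) (simp add: Em1_dist_def)
  also have "\<dots> = ennreal ?B + ennreal e" using B0 e by (intro ennreal_plus) auto
  finally show "(INF y\<in>A0. ennreal (Em1_dist \<Omega> x y)) \<le> ennreal ?B + ennreal e" .
qed

end

text \<open>The radius \<open>\<rho> s\<close> is the bound in the energy norm that the ball of radius \<open>R s\<close> in the regular phase
  space provides.  It is independent of \<open>\<epsilon>\<close>, since rescaling the coefficients preserves their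
  ellipticity constants.\<close>

theorem theorem4p3:
  fixes \<Omega> :: "(real^3) set" and a :: "real^3 \<Rightarrow> real^3^3" and f :: "real \<Rightarrow> real"
    and \<gamma> \<nu> K1 K2 K3 :: real
    and M0 :: "real \<Rightarrow> real \<Rightarrow> real" and M1 R :: "real \<Rightarrow> real"
  assumes "smooth_domain \<Omega>" and "bounded \<Omega>"
    and "\<gamma> > 0"
    and "admissible_coeff \<nu> a"
    and "admissible_nonlinearity K1 K2 K3 f"
    and "\<And>s. s \<ge> 0 \<Longrightarrow> mono_on {0..} (M0 s)"
    and "\<And>r. r \<ge> 0 \<Longrightarrow> mono_on {0..} (\<lambda>s. M0 s r)"
    and "mono_on {0..} M1" and "mono_on {0..} R"
  shows "\<exists>M. mono_on {0..} M \<and>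
    (\<forall>g \<in> L2_on \<Omega>. \<forall>\<sigma> K. \<forall>\<A>\<epsilon> :: real \<Rightarrow> state set. \<forall>\<A>0 :: state set.
      let S\<epsilon> = (\<lambda>\<epsilon>. sol_op \<Omega> (osc_coeff a \<epsilon>) \<gamma> f g);
          S0 = sol_op \<Omega> (hom_coeff a) \<gamma> f g;
          \<delta> = (\<lambda>\<epsilon>. L2_opnorm \<Omega> (\<lambda>w. A_inv \<Omega> (osc_coeff a \<epsilon>) w - A_inv \<Omega> (hom_coeff a) w))
      in
        (\<forall>\<epsilon>>0. global_attractor \<Omega> (S\<epsilon> \<epsilon>) (\<A>\<epsilon> \<epsilon>)) \<longrightarrow>
        global_attractor \<Omega> S0 \<A>0 \<longrightarrow>
        \<sigma> > 0 \<longrightarrow> exp_attracting \<Omega> S0 \<A>0 \<sigma> (M0 (norm g)) \<longrightarrow>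
        (\<forall>\<epsilon>>0. \<A>\<epsilon> \<epsilon> \<subseteq> E2_ball \<Omega> (osc_coeff a \<epsilon>) g (R (norm g))) \<longrightarrow>
        K > 0 \<longrightarrow>
        (\<forall>\<epsilon>>0. \<forall>t\<ge>0. \<forall>\<xi> \<in> E2_ball \<Omega> (osc_coeff a \<epsilon>) g (R (norm g)).
           Em1_norm \<Omega> (S\<epsilon> \<epsilon> t \<xi> - S0 t \<xi>) \<le> M1 (norm g) * exp (K * t) * \<delta> \<epsilon>) \<longrightarrow>
        (\<forall>\<epsilon>>0. semidist (Em1_dist \<Omega>) (\<A>\<epsilon> \<epsilon>) \<A>0
                 \<le> ennreal (M (norm g) * \<delta> \<epsilon> powr (\<sigma> / (K + \<sigma>)))))"
proof -
  obtain \<Lambda> where ell: "elliptic_coeff \<nu> \<Lambda> a" using admissible_coeff_elliptic[OF assms(4)] by blast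
  obtain \<nu>' \<Lambda>' where hom: "elliptic_coeff \<nu>' \<Lambda>' (hom_coeff a)" using elliptic_hom_coeff[OF ell] by blast
  interpret damped_wave \<Omega> f K1 K2 K3 "hom_coeff a" \<nu>' \<Lambda>' \<gamma>
    by unfold_locales (use assms(1,2,3,5) hom in \<open>auto simp: smooth_domain_def\<close>)
  have \<nu>: "0 < \<nu>" using ell by (simp add: elliptic_coeff_def)
  have Ec: "0 \<le> E2_const \<nu>" using \<nu> pc_pos by (simp add: E2_const_def)
  define \<rho> where "\<rho> s = E2_const \<nu> * max 0 (R s)" for s
  have \<rho>0: "0 \<le> \<rho> s" for s using Ec by (simp add: \<rho>_def)
  have \<rho>_mono: "\<rho> s \<le> \<rho> s'" if "0 \<le> s" "s \<le> s'" for s s'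
    unfolding \<rho>_def using Ec mono_onD[OF assms(9), of s s'] that by (intro mult_left_mono max.mono) auto
  define M where "M s = attractor_const s (M0 s (\<rho> s)) (M1 s) (\<rho> s)" for s
  have "mono_on {0..} M"
  proof (rule mono_onI)
    fix s s' :: real assume s: "s \<in> {0..}" "s' \<in> {0..}" "s \<le> s'"
    have "M0 s (\<rho> s) \<le> M0 s (\<rho> s')" using s \<rho>0 \<rho>_mono[of s s'] by (intro mono_onD[OF assms(6)]) auto
    also have "\<dots> \<le> M0 s' (\<rho> s')" using mono_onD[OF assms(7)[OF \<rho>0], of s s'] s by simp
    finally show "M s \<le> M s'"
      unfolding M_def using s \<rho>0 \<rho>_mono[of s s'] mono_onD[OF assms(8), of s s'] by (intro attractor_const_mono) auto
  qed
  moreover have "semidist (Em1_dist \<Omega>) (\<A>\<epsilon> \<epsilon>) \<A>0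
      \<le> ennreal (M (norm g) * L2_opnorm \<Omega> (\<lambda>w. A_inv \<Omega> (osc_coeff a \<epsilon>) w - A_inv \<Omega> (hom_coeff a) w) powr (\<sigma> / (K + \<sigma>)))"
    if att: "\<forall>\<epsilon>>0. global_attractor \<Omega> (sol_op \<Omega> (osc_coeff a \<epsilon>) \<gamma> f g) (\<A>\<epsilon> \<epsilon>)"
      and att0: "global_attractor \<Omega> (sol_op \<Omega> (hom_coeff a) \<gamma> f g) \<A>0"
      and \<sigma>: "\<sigma> > 0" and exp: "exp_attracting \<Omega> (sol_op \<Omega> (hom_coeff a) \<gamma> f g) \<A>0 \<sigma> (M0 (norm g))"
      and ball: "\<forall>\<epsilon>>0. \<A>\<epsilon> \<epsilon> \<subseteq> E2_ball \<Omega> (osc_coeff a \<epsilon>) g (R (norm g))" and K: "K > 0"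
      and traj: "\<forall>\<epsilon>>0. \<forall>t\<ge>0. \<forall>\<xi> \<in> E2_ball \<Omega> (osc_coeff a \<epsilon>) g (R (norm g)).
           Em1_norm \<Omega> (sol_op \<Omega> (osc_coeff a \<epsilon>) \<gamma> f g t \<xi> - sol_op \<Omega> (hom_coeff a) \<gamma> f g t \<xi>) \<le> M1 (norm g) * exp (K * t) *
             L2_opnorm \<Omega> (\<lambda>w. A_inv \<Omega> (osc_coeff a \<epsilon>) w - A_inv \<Omega> (hom_coeff a) w)"
      and \<epsilon>: "\<epsilon> > 0"
    for g \<sigma> K \<A>\<epsilon> \<A>0 \<epsilon>
  proof -
    have osc: "elliptic_coeff \<nu> \<Lambda> (osc_coeff a \<epsilon>)" using elliptic_osc_coeff[OF ell] \<epsilon> by simp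
    have inball: "\<xi> \<in> E2_ball \<Omega> (osc_coeff a \<epsilon>) g (R (norm g))" if "\<xi> \<in> \<A>\<epsilon> \<epsilon>" for \<xi>
      using ball[rule_format, OF \<epsilon>] that by blast
    show ?thesis
      unfolding M_def
    proof (rule attractor_semidist[OF exp assms(6)[OF norm_ge_zero] att0 _ _ _ \<sigma> K L2_opnorm_diff_nonneg[OF osc hom] \<rho>0])
      fix \<xi> assume xi: "\<xi> \<in> \<A>\<epsilon> \<epsilon>"
      note E2 = E2_ball_bounded[OF osc inball[OF xi]]
      show "\<xi> \<in> E \<Omega> \<and> norm (grad \<Omega> (fst \<xi>)) \<le> \<rho> (norm g) \<and> E_norm \<Omega> \<xi> \<le> \<rho> (norm g)"
        using E2 by (simp add: \<rho>_def)
    next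
      fix t :: real assume "0 \<le> t"
      then show "sol_op \<Omega> (osc_coeff a \<epsilon>) \<gamma> f g t ` \<A>\<epsilon> \<epsilon> = \<A>\<epsilon> \<epsilon>"
        using att[rule_format, OF \<epsilon>] by (simp add: global_attractor_def)
    next
      fix \<xi> and t :: real assume "\<xi> \<in> \<A>\<epsilon> \<epsilon>" "0 \<le> t"
      then show "Em1_norm \<Omega> (sol_op \<Omega> (osc_coeff a \<epsilon>) \<gamma> f g t \<xi> - sol_op \<Omega> (hom_coeff a) \<gamma> f g t \<xi>)
          \<le> M1 (norm g) * exp (K * t) * L2_opnorm \<Omega> (\<lambda>w. A_inv \<Omega> (osc_coeff a \<epsilon>) w - A_inv \<Omega> (hom_coeff a) w)"
        using traj[rule_format, OF \<epsilon>] inball by blast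
    qed
  qed
  ultimately show ?thesis unfolding Let_def by (intro exI[of _ M] conjI ballI allI impI) blast+
qed

end
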